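(* Let $k\ge2$ be an integer, $N\ge1$, $\mathcal{G}$ a congruence subgroup of $\mathrm{SL}_2(\mathbb{Z})$ containing $\Gamma(N)$, and $\mathbb{k}$ a subring of $\mathbb{C}$. Let $x_0$ be a cusp of $\mathcal{G}$ such that $\mathrm{amp}(x_0,\mathcal{G})$ divides $\mathrm{amp}(x,\mathcal{G})$ for every $x\in\mathcal{C}(\mathcal{G})$. Then the collection of functions \[\mathcal{B}_{\mathcal{G},k}=\begin{cases}\{E_{k,x}\mid x\in\mathcal{C}(\mathcal{G})\},&\text{if }k\text{ is even and }k\ge4;\\ \{E_{k,x}\mid x\in\mathcal{C}_\infty(\mathcal{G})\},&\text{if }k\text{ is odd and }-\mathrm{Id}\notin\mathcal{G};\\ \Big\{E_{k,x}-\dfrac{|\mathrm{or}_{\mathcal{G},N}(x)|}{|\mathrm{or}_{\mathcal{G},N}(x_0)|}E_{k,x_0}\ \Big|\ x\in\mathcal{C}(\mathcal{G})-\{x_0\}\Big\},&\text{if }k=2;\\ \emptyset,&\text{otherwise}\end{cases}\] forms a $\mathbb{k}$-basis of $\mathcal{E}_k(\mathcal{G},\mathbb{k})$. Here, in the second case, the series are written for a fixed choice of scaling matrix for each regular cusp.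
   Context: Notation: $\Gamma=\mathrm{SL}_2(\mathbb{Z})$ acts on the upper half plane $\mathbb{H}$; $(f|_{k,\gamma})(\tau)=(c\tau+d)^{-k}f(\frac{a\tau+b}{c\tau+d})$ for $\gamma=\begin{pmatrix}a&b\\c&d\end{pmatrix}\in\Gamma$; $\mathrm{Hol}(\mathbb{H})$ is the space of holomorphic functions on $\mathbb{H}$; $\Gamma(N)$ is the principal congruence subgroup of level $N$. Eisenstein series on $\Gamma(N)$: let $\Lambda_N$ be the set of elements of additive order $N$ in $\mathbb{Z}^2/N\mathbb{Z}^2$ (row vectors). Put $\epsilon_N=1$ if $N\ge3$ and $\epsilon_N=\frac12$ if $N\in\{1,2\}$. For $\bar\lambda\in\Lambda_N$ with lift $\lambda\in\mathbb{Z}^2$, \[E_k(\tau,\bar\lambda,N;s)=\epsilon_N\sum_{(c,d)\equiv\lambda\,(N),\ \gcd(c,d)=1}\frac{\mathrm{Im}(\tau)^s}{(c\tau+d)^k|c\tau+d|^{2s}}\qquad(\mathrm{Re}(k+2s)>2),\] which continues analytically in $s$ to $\mathrm{Re}(k+2s)>1$; $E_k(\tau,\bar\lambda,N)$ is its value at $s=0$. Spaces: $\mathcal{E}^*_k(\Gamma(N),\mathbb{k})$ is the $\mathbb{k}$-submodule generated by $\{E_k(\cdot,\bar\lambda,N):\bar\lambda\in\Lambda_N\}$ in the space of real analytic functions on $\mathbb{H}$; $\mathcal{E}^*_k(\mathcal{G},\mathbb{k})$ is its submodule of $|_k$-invariants under $\mathcal{G}$; and $\mathcal{E}_k(\mathcal{G},\mathbb{k})=\mathcal{E}^*_k(\mathcal{G},\mathbb{k})\cap\mathrm{Hol}(\mathbb{H})$.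 Cusps: a cusp of $\mathcal{G}$ is a $\mathcal{G}$-orbit in $\mathbb{P}^1(\mathbb{Q})$, denoted by a fixed representative $x$; $\mathcal{C}(\mathcal{G})$ is the set of cusps; $\mathcal{G}_x$ is the stabilizer of $x$ in $\mathcal{G}$. With $T=\begin{pmatrix}1&1\\0&1\end{pmatrix}$ and $\gamma\in\Gamma$ with $\gamma\infty=x$, the cusp $x$ is irregular if $\gamma^{-1}\mathcal{G}_x\gamma=\langle -T^h\rangle$ for some $h\ge1$ and regular otherwise; $\mathcal{C}_\infty(\mathcal{G})$ is the set of regular cusps. $\mathrm{or}_{\mathcal{G},N}(x)$ denotes the set of cusps of $\Gamma(N)$ contained in $\mathcal{G}x$. $\mathrm{amp}(x,\mathcal{G})=[\Gamma_x:\mathcal{G}_x^{\pm}]$, where $\mathcal{G}_x^\pm$ is generated by $\mathcal{G}_x$ and $-\mathrm{Id}$. (A cusp $x_0$ as in the claim always exists, by a theorem of Larcher.) Spectral Eisenstein series: choose a scaling matrix $\sigma_x\in\Gamma$ with $\sigma_x\infty=x$ and set \[E_{k,x}(\tau;s)=\sum_{\gamma\in\mathcal{G}_x\backslash\mathcal{G}}\mathbf{j}(\sigma_x^{-1}\gamma,\tau)^{-k}\,(\mathrm{Im}\,\sigma_x^{-1}\gamma\tau)^s\quad(\mathrm{Re}(k+2s)>2),\] where $\mathbf{j}\big(\begin{pmatrix}a&b\\c&d\end{pmatrix},\tau\big)=c\tau+d$. This is well defined if $k$ is even (and then independent of $\sigma_x$), or if $k$ is odd, $-\mathrm{Id}\notin\mathcal{G}$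 and $x$ is regular. It continues analytically in $s$ to $\mathrm{Re}(k+2s)>1$, and $E_{k,x}=E_{k,x}(\tau)$ denotes its value at $s=0$. *)

theory Defs
  imports
    "HOL-Complex_Analysis.Complex_Analysis"
    "HOL-Algebra.Algebra"
    "HOL-Algebra.Algebraic_Closure_Type"
    "HOL-Number_Theory.Cong"
begin

unbundle no fps_syntax

section \<open>The modular group and its congruence subgroups\<close>

definition SL2Z :: "(int ^ 2 ^ 2) monoid" where
  "SL2Z = \<lparr>carrier = {A. det A = 1}, monoid.mult = (**), one = mat 1\<rparr>"

text \<open>A subgroup \<open>\<G>\<close> of \<open>SL2Z\<close> is given by its underlying set of matrices; this is
  \<open>\<G>\<close> as a group in its own right.\<close>

abbreviation SL2Z_sub :: "(int ^ 2 ^ 2) set \<Rightarrow> (int ^ 2 ^ 2) monoid" where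
  "SL2Z_sub \<G> \<equiv> SL2Z\<lparr>carrier := \<G>\<rparr>"

definition principal_congruence_subgroup :: "nat \<Rightarrow> (int ^ 2 ^ 2) set" where
  "principal_congruence_subgroup N =
     {\<gamma> \<in> carrier SL2Z. \<forall>i j. [\<gamma> $ i $ j = mat 1 $ i $ j] (mod int N)}"

definition congruence_subgroup :: "(int ^ 2 ^ 2) set \<Rightarrow> bool" where
  "congruence_subgroup \<G> \<longleftrightarrow>
     subgroup \<G> SL2Z \<and> (\<exists>M\<ge>1. principal_congruence_subgroup M \<subseteq> \<G>)"

definition T_mat :: "int ^ 2 ^ 2" where
  "T_mat = vector [vector [1, 1], vector [0, 1]]"


section \<open>Functions on the upper half plane\<close>

text \<open>Functions on the upper half plane are modelled as functions on the complex plane; the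
  Eisenstein series below are set to \<open>0\<close> off the upper half plane, so that equality of their
  linear combinations is equality on the upper half plane.\<close>

definition upper_half_plane :: "complex set" where
  "upper_half_plane = {\<tau>. Im \<tau> > 0}"

definition automorphy_factor :: "int ^ 2 ^ 2 \<Rightarrow> complex \<Rightarrow> complex" where
  "automorphy_factor \<gamma> \<tau> = of_int (\<gamma> $ 2 $ 1) * \<tau> + of_int (\<gamma> $ 2 $ 2)"

definition moebius :: "int ^ 2 ^ 2 \<Rightarrow> complex \<Rightarrow> complex" where
  "moebius \<gamma> \<tau> = (of_int (\<gamma> $ 1 $ 1) * \<tau> + of_int (\<gamma> $ 1 $ 2)) / automorphy_factor \<gamma> \<tau>"

definition slash :: "nat \<Rightarrow> int ^ 2 ^ 2 \<Rightarrow> (complex \<Rightarrow> complex) \<Rightarrow> complex \<Rightarrow> complex" where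
  "slash k \<gamma> f \<tau> = automorphy_factor \<gamma> \<tau> powi (- int k) * f (moebius \<gamma> \<tau>)"

text \<open>For a function \<open>\<phi>\<close> given on \<open>Re (k + 2s) > 2\<close>, the value at \<open>s = 0\<close> of its analytic
  continuation to the half plane \<open>Re (k + 2s) > 1\<close>.  By the identity theorem the value is unique
  when a continuation exists.\<close>

definition continued_value_at_0 :: "nat \<Rightarrow> (complex \<Rightarrow> complex) \<Rightarrow> complex" where
  "continued_value_at_0 k \<phi> =
     (THE v. \<exists>F. F holomorphic_on {s. Re (of_nat k + 2 * s) > 1} \<and>
                 (\<forall>s. Re (of_nat k + 2 * s) > 2 \<longrightarrow> F s = \<phi> s) \<and> v = F 0)"


section \<open>Linear combinations over a subring of the complex numbers\<close>

definition span_over :: "complex set \<Rightarrow> 'i set \<Rightarrow> ('i \<Rightarrow> complex \<Rightarrow> complex) \<Rightarrow> (complex \<Rightarrow> complex) set"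
  where
  "span_over R I b =
     {\<lambda>\<tau>. \<Sum>i\<in>J. c i * b i \<tau> | J c. finite J \<and> J \<subseteq> I \<and> (\<forall>i\<in>J. c i \<in> R)}"

definition independent_over :: "complex set \<Rightarrow> 'i set \<Rightarrow> ('i \<Rightarrow> complex \<Rightarrow> complex) \<Rightarrow> bool" where
  "independent_over R I b \<longleftrightarrow>
     (\<forall>J c. finite J \<and> J \<subseteq> I \<and> (\<forall>i\<in>J. c i \<in> R) \<and> (\<lambda>\<tau>. \<Sum>i\<in>J. c i * b i \<tau>) = (\<lambda>\<tau>. 0)
        \<longrightarrow> (\<forall>i\<in>J. c i = 0))"

definition basis_over ::
  "complex set \<Rightarrow> 'i set \<Rightarrow> ('i \<Rightarrow> complex \<Rightarrow> complex) \<Rightarrow> (complex \<Rightarrow> complex) set \<Rightarrow> bool" where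
  "basis_over R I b M \<longleftrightarrow> independent_over R I b \<and> span_over R I b = M"


section \<open>Eisenstein series on the principal congruence subgroups\<close>

definition Z2 :: "(int \<times> int) monoid" where
  "Z2 = integer_group \<times>\<times> integer_group"

definition NZ2 :: "nat \<Rightarrow> (int \<times> int) set" where
  "NZ2 N = {(int N * a, int N * b) | a b. True}"

text \<open>Elements of the quotient are cosets, so \<open>(c, d)\<close> reduces to \<open>L\<close> iff \<open>(c, d) \<in> L\<close>.\<close>

definition Lambda_N :: "nat \<Rightarrow> (int \<times> int) set set" where
  "Lambda_N N = {L \<in> carrier (Z2 Mod NZ2 N). group.ord (Z2 Mod NZ2 N) L = N}"

definition eps_N :: "nat \<Rightarrow> complex" where
  "eps_N N = (if N \<ge> 3 then 1 else 1 / 2)"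

definition eisenstein_series :: "nat \<Rightarrow> (int \<times> int) set \<Rightarrow> nat \<Rightarrow> complex \<Rightarrow> complex \<Rightarrow> complex" where
  "eisenstein_series k L N s \<tau> =
     eps_N N * (\<Sum>\<^sub>\<infinity>(c, d)\<in>{(c, d). (c, d) \<in> L \<and> gcd c d = 1}.
        of_real (Im \<tau>) powr s /
          ((of_int c * \<tau> + of_int d) ^ k * of_real (cmod (of_int c * \<tau> + of_int d)) powr (2 * s)))"

definition eisenstein :: "nat \<Rightarrow> nat \<Rightarrow> (int \<times> int) set \<Rightarrow> complex \<Rightarrow> complex" where
  "eisenstein k N L \<tau> =
     (if \<tau> \<in> upper_half_plane
      then continued_value_at_0 k (\<lambda>s. eisenstein_series k L N s \<tau>) else 0)"

definition Eis_star_N :: "nat \<Rightarrow> nat \<Rightarrow> complex set \<Rightarrow> (complex \<Rightarrow> complex) set" where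
  "Eis_star_N k N R = span_over R (Lambda_N N) (eisenstein k N)"

definition Eis_star ::
  "nat \<Rightarrow> nat \<Rightarrow> (int ^ 2 ^ 2) set \<Rightarrow> complex set \<Rightarrow> (complex \<Rightarrow> complex) set" where
  "Eis_star k N \<G> R =
     {f \<in> Eis_star_N k N R. \<forall>\<gamma>\<in>\<G>. \<forall>\<tau>\<in>upper_half_plane. slash k \<gamma> f \<tau> = f \<tau>}"

definition Eis ::
  "nat \<Rightarrow> nat \<Rightarrow> (int ^ 2 ^ 2) set \<Rightarrow> complex set \<Rightarrow> (complex \<Rightarrow> complex) set" where
  "Eis k N \<G> R = Eis_star k N \<G> R \<inter> {f. f holomorphic_on upper_half_plane}"


section \<open>Cusps\<close>

datatype P1Q = Fin rat | Infty

fun moebius_P1Q :: "int ^ 2 ^ 2 \<Rightarrow> P1Q \<Rightarrow> P1Q" where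
  "moebius_P1Q \<gamma> Infty =
     (if \<gamma> $ 2 $ 1 = 0 then Infty else Fin (of_int (\<gamma> $ 1 $ 1) / of_int (\<gamma> $ 2 $ 1)))"
| "moebius_P1Q \<gamma> (Fin q) =
     (if of_int (\<gamma> $ 2 $ 1) * q + of_int (\<gamma> $ 2 $ 2) = 0 then Infty
      else Fin ((of_int (\<gamma> $ 1 $ 1) * q + of_int (\<gamma> $ 1 $ 2)) /
                (of_int (\<gamma> $ 2 $ 1) * q + of_int (\<gamma> $ 2 $ 2))))"

definition cusps :: "(int ^ 2 ^ 2) set \<Rightarrow> P1Q set set" where
  "cusps \<G> = orbits (SL2Z_sub \<G>) UNIV moebius_P1Q"

definition cusp_stabilizer :: "(int ^ 2 ^ 2) set \<Rightarrow> P1Q \<Rightarrow> (int ^ 2 ^ 2) set" where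
  "cusp_stabilizer \<G> x = stabilizer (SL2Z_sub \<G>) moebius_P1Q x"

definition irregular :: "(int ^ 2 ^ 2) set \<Rightarrow> P1Q \<Rightarrow> bool" where
  "irregular \<G> x \<longleftrightarrow>
     (\<exists>\<gamma>\<in>carrier SL2Z. moebius_P1Q \<gamma> Infty = x \<and>
        (\<exists>h::nat. h \<ge> 1 \<and>
           inv\<^bsub>SL2Z\<^esub> \<gamma> <#\<^bsub>SL2Z\<^esub> cusp_stabilizer \<G> x #>\<^bsub>SL2Z\<^esub> \<gamma>
             = generate SL2Z {- (T_mat [^]\<^bsub>SL2Z\<^esub> h)}))"

definition amp :: "P1Q \<Rightarrow> (int ^ 2 ^ 2) set \<Rightarrow> nat" where
  "amp x \<G> =
     card (rcosets\<^bsub>SL2Z_sub (cusp_stabilizer (carrier SL2Z) x)\<^esub>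
             generate SL2Z (cusp_stabilizer \<G> x \<union> {- mat 1}))"

definition or_set :: "(int ^ 2 ^ 2) set \<Rightarrow> nat \<Rightarrow> P1Q \<Rightarrow> P1Q set set" where
  "or_set \<G> N x =
     {D \<in> cusps (principal_congruence_subgroup N).
        D \<subseteq> Group_Action.orbit (SL2Z_sub \<G>) moebius_P1Q x}"


section \<open>Spectral Eisenstein series\<close>

text \<open>The summand is evaluated at an arbitrary representative of each right coset; it does not
  depend on that choice when \<open>k\<close> is even, or when \<open>k\<close> is odd, \<open>-1 \<notin> \<G>\<close> and \<open>x\<close> is regular.\<close>

definition spectral_series ::
  "(int ^ 2 ^ 2) set \<Rightarrow> nat \<Rightarrow> P1Q \<Rightarrow> int ^ 2 ^ 2 \<Rightarrow> complex \<Rightarrow> complex \<Rightarrow> complex" where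
  "spectral_series \<G> k x \<sigma> s \<tau> =
     (\<Sum>\<^sub>\<infinity>C\<in>rcosets\<^bsub>SL2Z_sub \<G>\<^esub> cusp_stabilizer \<G> x.
        let \<delta> = inv\<^bsub>SL2Z\<^esub> \<sigma> \<otimes>\<^bsub>SL2Z\<^esub> (SOME \<gamma>. \<gamma> \<in> C) in
          automorphy_factor \<delta> \<tau> powi (- int k) * of_real (Im (moebius \<delta> \<tau>)) powr s)"

definition spectral_eisenstein ::
  "(int ^ 2 ^ 2) set \<Rightarrow> nat \<Rightarrow> P1Q \<Rightarrow> int ^ 2 ^ 2 \<Rightarrow> complex \<Rightarrow> complex" where
  "spectral_eisenstein \<G> k x \<sigma> \<tau> =
     (if \<tau> \<in> upper_half_plane
      then continued_value_at_0 k (\<lambda>s. spectral_series \<G> k x \<sigma> s \<tau>) else 0)"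

text \<open>The collection \<open>\<B>\<close>, as a family indexed by cusps (that is, by \<open>\<G>\<close>-orbits).  Here \<open>rep\<close>
  and \<open>\<sigma>\<close> choose a representative and a scaling matrix for each cusp, and \<open>C0\<close> is the
  distinguished cusp.\<close>

definition B_index ::
  "(int ^ 2 ^ 2) set \<Rightarrow> nat \<Rightarrow> (P1Q set \<Rightarrow> P1Q) \<Rightarrow> P1Q set \<Rightarrow> P1Q set set" where
  "B_index \<G> k rep C0 =
     (if even k \<and> k \<ge> 4 then cusps \<G>
      else if odd k \<and> - mat 1 \<notin> \<G> then {C \<in> cusps \<G>. \<not> irregular \<G> (rep C)}
      else if k = 2 then cusps \<G> - {C0}
      else {})"

definition B_family ::
  "(int ^ 2 ^ 2) set \<Rightarrow> nat \<Rightarrow> nat \<Rightarrow> (P1Q set \<Rightarrow> P1Q) \<Rightarrow> (P1Q set \<Rightarrow> int ^ 2 ^ 2) \<Rightarrow> P1Q set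
     \<Rightarrow> P1Q set \<Rightarrow> complex \<Rightarrow> complex" where
  "B_family \<G> N k rep \<sigma> C0 C =
     (if k = 2
      then (\<lambda>\<tau>. spectral_eisenstein \<G> k (rep C) (\<sigma> C) \<tau>
              - of_nat (card (or_set \<G> N (rep C))) / of_nat (card (or_set \<G> N (rep C0)))
                * spectral_eisenstein \<G> k (rep C0) (\<sigma> C0) \<tau>)
      else spectral_eisenstein \<G> k (rep C) (\<sigma> C))"

end

theory Submission
  imports Defs
begin

text \<open>
  Every Eisenstein series in the statement is a sum over primitive row vectors. For a function \<open>b\<close> on
  primitive vectors that depends only on the residue class modulo \<open>N\<close>, let \<open>F b\<close> be the value at
  \<open>s = 0\<close> of the continuation of half the sum of
  \<open>b v * Im \<tau> powr s / ((c\<tau> + d) ^ k * |c\<tau> + d| powr 2s)\<close> over all primitive \<open>v = (c, d)\<close>. Since \<open>v\<close> and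
  \<open>-v\<close> give terms differing by \<open>(-1) ^ k\<close>, one may take \<open>b (-v) = (-1) ^ k * b v\<close>. Up to
  normalization, the series attached to \<open>\<Lambda>\<^sub>N\<close> are the \<open>F b\<close> for symmetrized indicator functions of
  residue classes, and \<open>E_{k,x}\<close> is \<open>F b\<close> for the (signed) indicator function \<open>beta\<close> of the vectors that represent a point of the cusp
  (\<open>spectral_eisenstein_eq\<close>).

  The slash action of \<open>\<gamma>\<close> replaces \<open>b v\<close> by \<open>b (v \<gamma>\<^sup>-\<^sup>1)\<close>, and \<open>F b\<close> tends to \<open>b (0, 1)\<close> at \<open>\<i>\<infinity>\<close>. As
  \<open>SL2(Z)\<close> is transitive on primitive vectors, all values of \<open>b\<close> are boundary values of translates of \<open>F b\<close>,
  so \<open>F\<close> is injective. It follows that \<open>Eis\<close> is the image under \<open>F\<close> of the \<open>R\<close>-valued, \<open>\<G>\<close>-invariant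
  \<open>b\<close>, subject in weight 2 to the condition that the values of \<open>b\<close> on the residue classes sum to 0: in that
  weight \<open>F b\<close> is a holomorphic function plus a nonzero multiple of this sum divided by \<open>Im \<tau>\<close>
  (\<open>Eis_imp_admissible\<close>, \<open>admissible_imp_Eis\<close>).

  The rest is linear algebra. A \<open>\<G>\<close>-invariant \<open>b\<close> is determined by one value for each cusp, this value is 0
  if \<open>k\<close> is odd and the orbit of the vector is stable under \<open>-1\<close>, and the functions \<open>beta\<close> of the other
  cusps form the dual basis (\<open>spectral_basis\<close>). For odd \<open>k\<close> with \<open>-1 \<notin> \<G>\<close> those other cusps are the regular
  ones (\<open>irregular_iff_not_separated\<close>). In weight 2 one cusp \<open>x\<^sub>0\<close> serves to enforce the linear
  condition, and the correction terms have coefficients in every subring because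
  \<open>|or x| / |or x\<^sub>0|\<close> is an integer: if \<open>n\<^sub>x\<close> is the number of residue classes of vectors belonging to \<open>x\<close>,
  then \<open>n\<^sub>x\<close> is \<open>|or x|\<close> times 1 or 2 depending only on \<open>N\<close>, and counting the reductions of
  \<open>\<plusminus>\<G>\<close> modulo \<open>N\<close> by their action on a vector of \<open>x\<close> gives \<open>|\<plusminus>\<G> mod N| = n\<^sub>x * N / amp x\<close>, so
  \<open>n\<^sub>x\<close> is proportional to \<open>amp x\<close> (\<open>card_Gpm_mod\<close>, \<open>or_set_ratio\<close>).

  The analytic input is obtained without Fourier expansions or Hurwitz zeta functions. With
  \<open>\<psi> z = z ^ -(k-1) * |z| powr -2s\<close>, the term \<open>z ^ -k * |z| powr -2s\<close> is a linear combination of the derivatives of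
  \<open>\<psi>\<close> in the two directions \<open>N\<tau>\<close> and \<open>N\<close>. The differences \<open>\<psi> (z + u) - \<psi> z\<close> for \<open>u = N\<tau>\<close> and \<open>u = N\<close>
  telescope to 0 over a residue class of the lattice; subtracting them from the derivatives leaves a remainder
  of second order, whose sum converges for \<open>Re (k + 2s) > 1\<close> (\<open>lattice_sum_eq\<close>,
  \<open>lattice_sum_holomorphic\<close>). Moebius inversion passes to primitive vectors. In weight 2
  at \<open>s = 0\<close> the differences can only be summed row by row. The shift by \<open>N\<close> still contributes 0, but the
  shift by \<open>N\<tau>\<close> does not: by the partial fraction expansion of the cotangent it produces the defect
  \<open>2\<pi>\<i> / N\<close>, which is the source of the term with \<open>1 / Im \<tau>\<close> (\<open>weight_2_defect\<close>).
\<close>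

unbundle no Formal_Power_Series.fps_syntax

section \<open>Infinite sums depending on a parameter\<close>

text \<open>The Weierstrass test with a summable majorant near each point. Finitely many terms may
  violate the majorant, since the estimates for lattice sums below hold only for large lattice
  vectors.\<close>
lemma holomorphic_on_infsum:
  fixes f :: "'i \<Rightarrow> complex \<Rightarrow> complex"
  assumes S: "open S" and hol: "\<And>i. i \<in> I \<Longrightarrow> f i holomorphic_on S"
    and bound: "\<And>x. x \<in> S \<Longrightarrow> \<exists>d>0. \<exists>F M. finite F \<and> M summable_on I \<and>
                  (\<forall>i\<in>I - F. \<forall>y\<in>ball x d \<inter> S. norm (f i y) \<le> M i)"
  shows "(\<lambda>x. \<Sum>\<^sub>\<infinity>i\<in>I. f i x) holomorphic_on S"
    and "\<And>x. x \<in> S \<Longrightarrow> (\<lambda>i. f i x) summable_on I"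
proof -
  have *: "(\<exists>r>0. (\<lambda>x. \<Sum>\<^sub>\<infinity>i\<in>I. f i x) holomorphic_on ball x r) \<and> (\<lambda>i. f i x) summable_on I"
    if x: "x \<in> S" for x
  proof -
    obtain d F M where d: "d > 0" "finite F" "M summable_on I"
      and le: "\<And>i y. i \<in> I - F \<Longrightarrow> y \<in> ball x d \<inter> S \<Longrightarrow> norm (f i y) \<le> M i"
      using bound[OF x] by metis
    obtain e where e: "e > 0" "ball x e \<subseteq> S" using S x openE by blast
    define r where "r = min d e / 2"
    have r: "r > 0" "cball x r \<subseteq> ball x d \<inter> S"
      using d e by (auto simp: r_def)
    have M': "M summable_on (I - F)" using d(3) summable_on_subset_banach by blast
    have "uniform_limit (cball x r) (\<lambda>Y y. \<Sum>i\<in>Y. f i y) (\<lambda>y. \<Sum>\<^sub>\<infinity>i\<in>I - F. f i y)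
            (finite_subsets_at_top (I - F))"
      by (rule Weierstrass_m_test_general[OF _ M']) (use le r in blast)
    moreover have "\<forall>\<^sub>F Y in finite_subsets_at_top (I - F).
        continuous_on (cball x r) (\<lambda>y. \<Sum>i\<in>Y. f i y) \<and> (\<lambda>y. \<Sum>i\<in>Y. f i y) holomorphic_on ball x r"
    proof (rule eventually_finite_subsets_at_top_weakI)
      fix Y assume Y: "finite Y" "Y \<subseteq> I - F"
      have "(\<lambda>y. \<Sum>i\<in>Y. f i y) holomorphic_on S"
        by (intro holomorphic_on_sum hol) (use Y in auto)
      then have "(\<lambda>y. \<Sum>i\<in>Y. f i y) holomorphic_on cball x r"
        by (rule holomorphic_on_subset) (use r in auto)
      then show "continuous_on (cball x r) (\<lambda>y. \<Sum>i\<in>Y. f i y) \<and>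
          (\<lambda>y. \<Sum>i\<in>Y. f i y) holomorphic_on ball x r"
        by (intro conjI holomorphic_on_imp_continuous_on holomorphic_on_subset[OF _ ball_subset_cball])
    qed
    ultimately have h1: "(\<lambda>y. \<Sum>\<^sub>\<infinity>i\<in>I - F. f i y) holomorphic_on ball x r"
      using holomorphic_uniform_limit[of x r "\<lambda>Y y. \<Sum>i\<in>Y. f i y" "finite_subsets_at_top (I - F)"
          "\<lambda>y. \<Sum>\<^sub>\<infinity>i\<in>I - F. f i y"] by simp
    have sm: "(\<lambda>i. f i y) summable_on (I - F)" if "y \<in> cball x r" for y
      by (rule abs_summable_summable[OF Infinite_Sum.abs_summable_on_comparison_test'[OF M' le]])
         (use r that in auto)
    have eq: "(\<Sum>\<^sub>\<infinity>i\<in>I. f i y) = (\<Sum>i\<in>I \<inter> F. f i y) + (\<Sum>\<^sub>\<infinity>i\<in>I - F. f i y)"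
      and sm': "(\<lambda>i. f i y) summable_on I" if y: "y \<in> cball x r" for y
    proof -
      have I: "I = (I \<inter> F) \<union> (I - F)" by auto
      have f: "finite (I \<inter> F)" using d by auto
      show "(\<Sum>\<^sub>\<infinity>i\<in>I. f i y) = (\<Sum>i\<in>I \<inter> F. f i y) + (\<Sum>\<^sub>\<infinity>i\<in>I - F. f i y)"
        using infsum_Un_disjoint[of "\<lambda>i. f i y" "I \<inter> F" "I - F"] f sm[OF y] I by auto
      show "(\<lambda>i. f i y) summable_on I"
        using summable_on_Un_disjoint[of "\<lambda>i. f i y" "I \<inter> F" "I - F"] f sm[OF y] I by auto
    qed
    have "(\<lambda>y. (\<Sum>i\<in>I \<inter> F. f i y) + (\<Sum>\<^sub>\<infinity>i\<in>I - F. f i y)) holomorphic_on ball x r"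
      by (intro holomorphic_on_add h1 holomorphic_on_sum holomorphic_on_subset[OF hol])
         (use r ball_subset_cball[of x r] in auto)
    then have "(\<lambda>x. \<Sum>\<^sub>\<infinity>i\<in>I. f i x) holomorphic_on ball x r"
      by (rule holomorphic_transform) (use eq ball_subset_cball[of x r] in auto)
    moreover have "(\<lambda>i. f i x) summable_on I" using r(1) by (intro sm') auto
    ultimately show ?thesis using r(1) by blast
  qed
  then show "\<And>x. x \<in> S \<Longrightarrow> (\<lambda>i. f i x) summable_on I" by blast
  show "(\<lambda>x. \<Sum>\<^sub>\<infinity>i\<in>I. f i x) holomorphic_on S"
    unfolding holomorphic_on_def
  proof
    fix x assume "x \<in> S"
    then obtain r where "r > 0" "(\<lambda>x. \<Sum>\<^sub>\<infinity>i\<in>I. f i x) holomorphic_on ball x r" using * by blast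
    then show "(\<lambda>x. \<Sum>\<^sub>\<infinity>i\<in>I. f i x) field_differentiable at x within S"
      by (intro field_differentiable_at_within[OF holomorphic_on_imp_differentiable_at]) auto
  qed
qed

lemma tendsto_infsum:
  fixes f :: "'i \<Rightarrow> 'a \<Rightarrow> complex"
  assumes lim: "\<And>i. i \<in> I \<Longrightarrow> ((f i) \<longlongrightarrow> l i) F"
    and le: "\<And>i x. i \<in> I \<Longrightarrow> x \<in> A \<Longrightarrow> norm (f i x) \<le> M i"
    and M: "M summable_on I" and A: "\<forall>\<^sub>F x in F. x \<in> A" and F: "F \<noteq> bot"
  shows "((\<lambda>x. \<Sum>\<^sub>\<infinity>i\<in>I. f i x) \<longlongrightarrow> (\<Sum>\<^sub>\<infinity>i\<in>I. l i)) F"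
proof (rule swap_uniform_limit')
  show "uniform_limit A (\<lambda>Y x. \<Sum>i\<in>Y. f i x) (\<lambda>x. \<Sum>\<^sub>\<infinity>i\<in>I. f i x) (finite_subsets_at_top I)"
    by (rule Weierstrass_m_test_general[OF le M])
  show "\<forall>\<^sub>F Y in finite_subsets_at_top I. ((\<lambda>x. \<Sum>i\<in>Y. f i x) \<longlongrightarrow> (\<Sum>i\<in>Y. l i)) F"
    by (rule eventually_finite_subsets_at_top_weakI) (auto intro!: tendsto_sum lim)
  have "norm (l i) \<le> M i" if "i \<in> I" for i
    by (rule tendsto_upperbound[OF tendsto_norm[OF lim[OF that]] _ F])
       (use eventually_mono[OF A le] that in auto)
  then have "l summable_on I"
    using Infinite_Sum.abs_summable_on_comparison_test'[OF M] abs_summable_summable by blast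
  then show "(sum l \<longlongrightarrow> (\<Sum>\<^sub>\<infinity>i\<in>I. l i)) (finite_subsets_at_top I)"
    using infsum_tendsto by blast
qed (use A in auto)

lemma tendsto_infsum_cofinite:
  fixes f :: "'i \<Rightarrow> 'a \<Rightarrow> complex"
  assumes lim: "\<And>i. i \<in> I \<Longrightarrow> ((f i) \<longlongrightarrow> l i) F"
    and E: "finite E"
    and le: "\<And>i x. i \<in> I - E \<Longrightarrow> x \<in> A \<Longrightarrow> norm (f i x) \<le> M i"
    and M: "M summable_on I" and A: "\<forall>\<^sub>F x in F. x \<in> A" and F: "F \<noteq> bot"
  shows "((\<lambda>x. \<Sum>\<^sub>\<infinity>i\<in>I. f i x) \<longlongrightarrow> (\<Sum>\<^sub>\<infinity>i\<in>I. l i)) F"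
proof -
  have M': "M summable_on (I - E)" using M summable_on_subset_banach by blast
  have f: "finite (I \<inter> E)" using E by auto
  have I: "(I \<inter> E) \<union> (I - E) = I" by auto
  have split: "infsum g I = (\<Sum>i\<in>I \<inter> E. g i) + infsum g (I - E)"
    if "g summable_on (I - E)" for g :: "'i \<Rightarrow> complex"
    using infsum_Un_disjoint[of g "I \<inter> E" "I - E"] f that I by auto
  have sl: "l summable_on (I - E)"
  proof (rule abs_summable_summable[OF Infinite_Sum.abs_summable_on_comparison_test'[OF M']])
    show "norm (l i) \<le> M i" if "i \<in> I - E" for i
      by (rule tendsto_upperbound[OF tendsto_norm[OF lim] _ F])
         (use eventually_mono[OF A le] that in auto)
  qed
  have "((\<lambda>x. (\<Sum>i\<in>I \<inter> E. f i x) + (\<Sum>\<^sub>\<infinity>i\<in>I - E. f i x)) \<longlongrightarrow> (\<Sum>i\<in>I \<inter> E. l i) + (\<Sum>\<^sub>\<infinity>i\<in>I - E. l i)) F"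
    by (intro tendsto_add tendsto_sum tendsto_infsum[OF _ le M' A F] lim) auto
  moreover have "\<forall>\<^sub>F x in F. (\<Sum>i\<in>I \<inter> E. f i x) + (\<Sum>\<^sub>\<infinity>i\<in>I - E. f i x) = (\<Sum>\<^sub>\<infinity>i\<in>I. f i x)"
    using A
  proof eventually_elim
    case (elim x)
    have "(\<lambda>i. f i x) summable_on (I - E)"
      by (rule abs_summable_summable[OF Infinite_Sum.abs_summable_on_comparison_test'[OF M' le[OF _ elim]]])
    then show ?case by (simp add: split)
  qed
  ultimately show ?thesis unfolding split[OF sl] by (rule Lim_transform_eventually)
qed

text \<open>The unordered sum is the limit of its partial sums over the intervals \<open>{-m..<m}\<close>, which
  telescope.\<close>
lemma infsum_telescope_int:
  fixes h :: "int \<Rightarrow> complex"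
  assumes "(h \<longlongrightarrow> a) at_top" "(h \<longlongrightarrow> b) at_bot" "(\<lambda>n. h (n + 1) - h n) summable_on UNIV"
  shows "(\<Sum>\<^sub>\<infinity>n. h (n + 1) - h n) = a - b"
proof -
  let ?D = "\<lambda>n. h (n + 1) - h n"
  have "(sum ?D \<longlongrightarrow> (\<Sum>\<^sub>\<infinity>n. ?D n)) (finite_subsets_at_top UNIV)"
    using assms(3) infsum_tendsto by blast
  moreover have "filterlim (\<lambda>m::nat. {- int m..<int m}) (finite_subsets_at_top UNIV) sequentially"
    unfolding filterlim_finite_subsets_at_top
  proof (intro allI impI)
    fix Y :: "int set" assume "finite Y \<and> Y \<subseteq> UNIV"
    then have "\<bar>x\<bar> \<le> (\<Sum>x\<in>Y. \<bar>x\<bar>)" if "x \<in> Y" for x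
      using member_le_sum[of x Y abs] that by auto
    then obtain B :: int where B: "\<And>x. x \<in> Y \<Longrightarrow> \<bar>x\<bar> \<le> B" by metis
    show "\<forall>\<^sub>F m in sequentially. finite {- int m..<int m} \<and> Y \<subseteq> {- int m..<int m} \<and> {- int m..<int m} \<subseteq> UNIV"
      using eventually_gt_at_top[of "nat \<bar>B\<bar>"]
    proof eventually_elim
      case (elim m)
      have "x \<in> {- int m..<int m}" if "x \<in> Y" for x
        using B[OF that] elim by auto
      then show ?case by auto
    qed
  qed
  ultimately have lim: "(\<lambda>m. sum ?D {- int m..<int m}) \<longlonglongrightarrow> (\<Sum>\<^sub>\<infinity>n. ?D n)"
    by (rule filterlim_compose)
  have eq: "sum ?D {- int m..<int m} = h (int m) - h (- int m)" for m :: nat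
  proof (induction m)
    case (Suc m)
    have "{- int (Suc m)..<int (Suc m)} = insert (- 1 - int m) (insert (int m) {- int m..<int m})"
      by auto
    then show ?case using Suc by (simp add: algebra_simps)
  qed simp
  have "(\<lambda>m. h (int m) - h (- int m)) \<longlonglongrightarrow> a - b"
  proof (intro tendsto_diff filterlim_compose[OF assms(1)] filterlim_compose[OF assms(2)]
      filterlim_int_sequentially)
    show "filterlim (\<lambda>m. - int m) at_bot sequentially"
      unfolding filterlim_at_bot
    proof
      fix Z show "\<forall>\<^sub>F m in sequentially. - int m \<le> Z"
        using eventually_ge_at_top[of "nat \<bar>Z\<bar>"] by eventually_elim auto
    qed
  qed
  then show ?thesis using lim unfolding eq by (rule LIMSEQ_unique[rotated])
qed

definition residue_class :: "nat \<Rightarrow> int \<Rightarrow> int set" where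
  "residue_class N a = {c. [c = a] (mod int N)}"

lemma residue_class_eq_range: "residue_class N a = range (\<lambda>m. a + int N * m)"
proof -
  have "c \<in> residue_class N a \<longleftrightarrow> (\<exists>m. c - a = int N * m)" for c
    by (simp add: residue_class_def cong_iff_dvd_diff dvd_def)
  moreover have "c - a = int N * m \<longleftrightarrow> c = a + int N * m" for c m by auto
  ultimately show ?thesis by (auto simp: image_iff)
qed

lemma infsum_telescope_residue_class:
  fixes h :: "int \<Rightarrow> complex"
  assumes N: "N \<ge> 1" and lim: "(h \<longlongrightarrow> a) at_top" "(h \<longlongrightarrow> b) at_bot"
    and sm: "(\<lambda>n. h (n + int N) - h n) summable_on residue_class N r"
  shows "(\<Sum>\<^sub>\<infinity>n\<in>residue_class N r. h (n + int N) - h n) = a - b"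
proof -
  let ?g = "\<lambda>m. r + int N * m"
  have inj: "inj ?g" using N by (auto simp: inj_on_def)
  have "((\<lambda>n. h (n + int N) - h n) \<circ> ?g) summable_on UNIV"
    using sm unfolding residue_class_eq_range by (subst summable_on_reindex[OF inj, symmetric])
  then have s: "(\<lambda>m. (h \<circ> ?g) (m + 1) - (h \<circ> ?g) m) summable_on UNIV"
    by (simp add: o_def algebra_simps)
  have ge: "m \<le> int N * m" if "m \<ge> 0" for m using N that mult_right_mono[of 1 "int N" m] by simp
  have le: "int N * m \<le> m" if "m \<le> 0" for m using N that mult_right_mono_neg[of 1 "int N" m] by simp
  have t: "filterlim ?g at_top at_top"
    unfolding filterlim_at_top
  proof
    fix Z show "\<forall>\<^sub>F m in at_top. Z \<le> ?g m"
      using eventually_ge_at_top[of "\<bar>Z\<bar> + \<bar>r\<bar>"] 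
    proof eventually_elim
      case (elim m) then show ?case using ge[of m] by linarith
    qed
  qed
  have b: "filterlim ?g at_bot at_bot"
    unfolding filterlim_at_bot
  proof
    fix Z show "\<forall>\<^sub>F m in at_bot. ?g m \<le> Z"
      using eventually_le_at_bot[of "- \<bar>Z\<bar> - \<bar>r\<bar>"] 
    proof eventually_elim
      case (elim m) then show ?case using le[of m] by linarith
    qed
  qed
  have "(\<Sum>\<^sub>\<infinity>m. (h \<circ> ?g) (m + 1) - (h \<circ> ?g) m) = a - b"
    by (rule infsum_telescope_int[OF _ _ s])
       (auto simp: o_def intro: filterlim_compose[OF lim(1) t] filterlim_compose[OF lim(2) b])
  then show ?thesis
    unfolding residue_class_eq_range by (subst infsum_reindex[OF inj]) (simp add: o_def algebra_simps)
qed

lemma eventually_le_abs_int: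
  "\<forall>\<^sub>F d::int in at_top. B \<le> real_of_int \<bar>d\<bar>" "\<forall>\<^sub>F d::int in at_bot. B \<le> real_of_int \<bar>d\<bar>"
proof -
  show "\<forall>\<^sub>F d::int in at_top. B \<le> real_of_int \<bar>d\<bar>"
    using eventually_ge_at_top[of "\<bar>\<lceil>B\<rceil>\<bar>"]
  proof eventually_elim
    case (elim d)
    then have "\<lceil>B\<rceil> \<le> \<bar>d\<bar>" by linarith
    then show ?case by (simp only: ceiling_le_iff)
  qed
  show "\<forall>\<^sub>F d::int in at_bot. B \<le> real_of_int \<bar>d\<bar>"
    using eventually_le_at_bot[of "- \<bar>\<lceil>B\<rceil>\<bar>"]
  proof eventually_elim
    case (elim d)
    then have "\<lceil>B\<rceil> \<le> \<bar>d\<bar>" by linarith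
    then show ?case by (simp only: ceiling_le_iff)
  qed
qed

section \<open>The lattice spanned by \<open>\<tau>\<close> and 1\<close>

definition lin :: "complex \<Rightarrow> int \<times> int \<Rightarrow> complex" where
  "lin \<tau> v = of_int (fst v) * \<tau> + of_int (snd v)"

text \<open>The product weight makes \<open>wt v powr -t\<close> summable for \<open>t > 1\<close> as a product of two
  one-dimensional series. As \<open>|c\<tau> + d|\<close> is at least a multiple of the square root of
  \<open>wt (c, d)\<close>, this gives the convergence of \<open>|c\<tau> + d| powr -r\<close> for \<open>r > 2\<close> without counting
  lattice points in discs.\<close>
definition wt :: "int \<times> int \<Rightarrow> real" where
  "wt v = (1 + \<bar>of_int (fst v)\<bar>) * (1 + \<bar>of_int (snd v)\<bar>)"

lemma wt_ge_1: "wt v \<ge> 1"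
  unfolding wt_def by (rule order_trans[OF _ mult_mono[of 1 _ 1]]) auto

lemma finite_wt_less: "finite {v. wt v < C}"
proof (rule finite_subset)
  show "{v. wt v < C} \<subseteq> {- \<lceil>C\<rceil>..\<lceil>C\<rceil>} \<times> {- \<lceil>C\<rceil>..\<lceil>C\<rceil>}"
  proof
    fix v assume "v \<in> {v. wt v < C}"
    then have lt: "wt v < C" by simp
    let ?x = "\<bar>of_int (fst v)\<bar> :: real" and ?y = "\<bar>of_int (snd v)\<bar> :: real"
    have "wt v = 1 + ?x + ?y + ?x * ?y" by (simp add: wt_def algebra_simps)
    moreover have "?x * ?y \<ge> 0" by simp
    moreover have "?x \<ge> 0" "?y \<ge> 0" by simp_all
    ultimately have "?x < C" "?y < C" using lt by linarith+
    then have "of_int \<bar>fst v\<bar> < C" "of_int \<bar>snd v\<bar> < C" by simp_all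
    then have "\<bar>fst v\<bar> \<le> \<lceil>C\<rceil>" "\<bar>snd v\<bar> \<le> \<lceil>C\<rceil>" by (simp_all add: le_ceiling_iff)
    then show "v \<in> {- \<lceil>C\<rceil>..\<lceil>C\<rceil>} \<times> {- \<lceil>C\<rceil>..\<lceil>C\<rceil>}"
      by (cases v) auto
  qed
qed simp

lemma summable_on_int_powr:
  assumes "t > 1"
  shows "(\<lambda>n::int. (1 + \<bar>of_int n\<bar> :: real) powr (- t)) summable_on UNIV"
proof -
  have "summable (\<lambda>n. real (Suc n) powr (- t))"
    using assms by (subst summable_Suc_iff) (simp add: summable_real_powr_iff)
  then have n: "(\<lambda>n. (1 + real n) powr (- t)) summable_on UNIV"
    by (simp add: summable_on_UNIV_nonneg_real_iff)
  have "(\<lambda>n::int. (1 + \<bar>of_int n\<bar> :: real) powr (- t)) summable_on range int"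
    "(\<lambda>n::int. (1 + \<bar>of_int n\<bar> :: real) powr (- t)) summable_on range (\<lambda>n. - int n)"
    by (subst summable_on_reindex; use n in \<open>simp add: o_def inj_on_def\<close>)+
  then have "(\<lambda>n::int. (1 + \<bar>of_int n\<bar> :: real) powr (- t)) summable_on (range int \<union> range (\<lambda>n. - int n))"
    by (rule summable_on_union)
  moreover have "range int \<union> range (\<lambda>n. - int n) = UNIV"
    by (auto simp: image_iff) (metis int_cases2)
  ultimately show ?thesis by simp
qed

lemma summable_on_wt_powr:
  assumes "t > 1"
  shows "(\<lambda>v. wt v powr (- t)) summable_on A"
proof -
  let ?f = "\<lambda>n::int. (1 + \<bar>of_int n\<bar> :: real) powr (- t)"
  have f: "(?f has_sum infsum ?f UNIV) UNIV"
    using summable_on_int_powr[OF assms] by simp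
  have "(\<lambda>(c, d). ?f c * ?f d) summable_on (SIGMA c:UNIV. UNIV)"
    by (rule summable_on_SigmaI[where g = "\<lambda>c. ?f c * infsum ?f UNIV"])
       (auto intro!: has_sum_cmult_right f summable_on_cmult_left summable_on_int_powr assms)
  also have "(\<lambda>(c, d). ?f c * ?f d) = (\<lambda>v. wt v powr (- t))"
    by (auto simp: wt_def powr_mult fun_eq_iff)
  finally show ?thesis
    using summable_on_subset_banach by auto
qed

text \<open>The imaginary part of \<open>c\<tau> + d\<close> controls \<open>c\<close>, and then \<open>d\<close> is controlled by the triangle
  inequality. The constant is uniform in \<open>\<tau>\<close> on sets bounded away from the real axis and from
  infinity.\<close>
lemma lin_lower_bound_linear:
  assumes "\<delta> > 0"
  obtains \<kappa> where "\<kappa> > 0" "\<kappa> \<le> 1"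
    "\<And>\<tau> v. Im \<tau> \<ge> \<delta> \<Longrightarrow> cmod \<tau> \<le> M \<Longrightarrow> v \<noteq> (0, 0) \<Longrightarrow>
      \<kappa> * (1 + \<bar>of_int (fst v)\<bar> + \<bar>of_int (snd v)\<bar>) \<le> cmod (lin \<tau> v)"
proof
  define K where "K = 1 / \<delta> + 1 + \<bar>M\<bar> / \<delta>"
  have K: "K > 0" using assms by (auto simp: K_def intro!: add_nonneg_pos add_pos_nonneg)
  show "1 / (2 * K) > 0" using K by simp
  have "K \<ge> 1" using assms by (simp add: K_def)
  then show "1 / (2 * K) \<le> 1" by simp
  fix \<tau> :: complex and v :: "int \<times> int" assume \<tau>: "Im \<tau> \<ge> \<delta>" "cmod \<tau> \<le> M" and v: "v \<noteq> (0, 0)"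
  obtain c d where cd: "v = (c, d)" by force
  let ?z = "lin \<tau> v" let ?x = "\<bar>of_int c\<bar> :: real" and ?y = "\<bar>of_int d\<bar> :: real"
  have "?x * \<delta> \<le> ?x * Im \<tau>" using \<tau> by (intro mult_left_mono) auto
  also have "\<dots> = \<bar>Im ?z\<bar>" using \<tau> assms by (simp add: lin_def cd abs_mult)
  also have "\<dots> \<le> cmod ?z" by (rule abs_Im_le_cmod)
  finally have x: "?x \<le> cmod ?z / \<delta>" using assms by (simp add: field_simps)
  have "?y = cmod (?z - of_int c * \<tau>)" by (simp add: lin_def cd)
  also have "\<dots> \<le> cmod ?z + ?x * cmod \<tau>"
    by (rule order_trans[OF norm_triangle_ineq4]) (simp add: norm_mult)
  also have "\<dots> \<le> cmod ?z + cmod ?z / \<delta> * \<bar>M\<bar>" 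
    using x \<tau> by (intro add_left_mono mult_mono) auto
  finally have s: "?x + ?y \<le> K * cmod ?z" using x by (simp add: K_def algebra_simps)
  have "?x \<ge> 1 \<or> ?y \<ge> 1" using v cd by auto
  then have "1 + ?x + ?y \<le> 2 * (?x + ?y)" by auto
  with s have "1 + ?x + ?y \<le> 2 * K * cmod ?z" by simp
  then have "1 / (2 * K) * (1 + ?x + ?y) \<le> cmod ?z" using K by (simp add: field_simps)
  then show "1 / (2 * K) * (1 + \<bar>of_int (fst v)\<bar> + \<bar>of_int (snd v)\<bar>) \<le> cmod ?z" by (simp add: cd)
qed

lemma wt_le_square: "wt v \<le> (1 + \<bar>of_int (fst v)\<bar> + \<bar>of_int (snd v)\<bar>)\<^sup>2"
proof -
  have *: "(1 + x) * (1 + y) \<le> (1 + x + y)\<^sup>2" if "x \<ge> 0" "y \<ge> 0" for x y :: real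
  proof -
    have "(1 + x + y)\<^sup>2 = (1 + x) * (1 + y) + (x + y + x\<^sup>2 + y\<^sup>2 + x * y)"
      by (simp add: power2_eq_square algebra_simps)
    moreover have "x + y + x\<^sup>2 + y\<^sup>2 + x * y \<ge> 0" using that by simp
    ultimately show ?thesis by linarith
  qed
  show ?thesis unfolding wt_def by (rule *) simp_all
qed

lemma lin_lower_bound:
  assumes "\<delta> > 0"
  obtains \<kappa> where "\<kappa> > 0" "\<kappa> \<le> 1"
    "\<And>\<tau> v. Im \<tau> \<ge> \<delta> \<Longrightarrow> cmod \<tau> \<le> M \<Longrightarrow> v \<noteq> (0, 0) \<Longrightarrow> \<kappa> * wt v powr (1/2) \<le> cmod (lin \<tau> v)"
proof -
  from lin_lower_bound_linear[OF assms] obtain \<kappa> where \<kappa>: "\<kappa> > 0" "\<kappa> \<le> 1"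
    "\<And>\<tau> v. Im \<tau> \<ge> \<delta> \<Longrightarrow> cmod \<tau> \<le> M \<Longrightarrow> v \<noteq> (0, 0) \<Longrightarrow>
      \<kappa> * (1 + \<bar>of_int (fst v)\<bar> + \<bar>of_int (snd v)\<bar>) \<le> cmod (lin \<tau> v)" by blast
  have "wt v powr (1/2) \<le> 1 + \<bar>of_int (fst v)\<bar> + \<bar>of_int (snd v)\<bar>" for v
  proof -
    have "sqrt (wt v) \<le> 1 + \<bar>of_int (fst v)\<bar> + \<bar>of_int (snd v)\<bar>"
      by (rule real_le_lsqrt[OF _ wt_le_square]) simp
    then show ?thesis using wt_ge_1[of v] by (simp add: powr_half_sqrt)
  qed
  then have le: "\<kappa> * wt v powr (1/2) \<le> \<kappa> * (1 + \<bar>of_int (fst v)\<bar> + \<bar>of_int (snd v)\<bar>)" for v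
    using \<kappa>(1) by (intro mult_left_mono) auto
  show ?thesis by (rule that[OF \<kappa>(1,2)]) (rule order_trans[OF le \<kappa>(3)])
qed

lemma large_wt:
  assumes "\<kappa> > 0" "wt v \<ge> (2 * x / \<kappa>)\<^sup>2"
  shows "2 * x \<le> \<kappa> * wt v powr (1/2)"
proof -
  have "sqrt (wt v) \<ge> 2 * x / \<kappa>" using assms(2) by (rule real_le_rsqrt)
  then show ?thesis using assms(1) wt_ge_1[of v] by (simp add: powr_half_sqrt field_simps)
qed

section \<open>Analytic continuation of lattice sums\<close>

lemma summable_on_diff_complex:
  fixes f g :: "'a \<Rightarrow> complex"
  assumes "f summable_on A" "g summable_on A"
  shows "(\<lambda>x. f x - g x) summable_on A"
  using summable_on_add[OF assms(1) summable_on_uminus[THEN iffD2, OF assms(2)]] by simp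

lemma infsum_diff_complex:
  fixes f g :: "'a \<Rightarrow> complex"
  assumes "f summable_on A" "g summable_on A"
  shows "(\<Sum>\<^sub>\<infinity>x\<in>A. f x - g x) = infsum f A - infsum g A"
  using infsum_add[OF assms(1) summable_on_uminus[THEN iffD2, OF assms(2)]] by (simp add: infsum_uminus)

text \<open>The function \<open>z ^ -a * (cnj z) ^ -b * |z| powr -2s\<close>, with value 0 at \<open>z = 0\<close>. Allowing a
  power of \<open>cnj z\<close> makes the family closed under differentiation in real directions.\<close>
definition psi :: "nat \<Rightarrow> nat \<Rightarrow> complex \<Rightarrow> complex \<Rightarrow> complex" where
  "psi a b s z = 1 / (z ^ a * cnj z ^ b * of_real (cmod z) powr (2 * s))"

text \<open>The derivative of \<open>psi\<close> at \<open>z\<close> in the direction \<open>u\<close>, see \<open>psi_vector_derivative\<close>.\<close>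
definition dpsi :: "nat \<Rightarrow> nat \<Rightarrow> complex \<Rightarrow> complex \<Rightarrow> complex \<Rightarrow> complex" where
  "dpsi a b s u z = - (of_nat a + s) * u * psi (Suc a) b s z - (of_nat b + s) * cnj u * psi a (Suc b) s z"

lemma psi_0 [simp]: "psi a b s 0 = 0"
  by (simp add: psi_def)

lemma norm_psi:
  assumes "z \<noteq> 0"
  shows "norm (psi a b s z) = cmod z powr (- (real a + real b + 2 * Re s))"
proof -
  have "cmod z powr (real a + real b + 2 * Re s) = cmod z ^ a * cmod z ^ b * cmod z powr (2 * Re s)"
    using assms by (simp add: powr_add powr_realpow)
  then have "cmod z powr (- (real a + real b + 2 * Re s)) = 1 / (cmod z ^ a * cmod z ^ b * cmod z powr (2 * Re s))"
    unfolding powr_minus_divide by simp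
  then show ?thesis
    using assms by (simp add: psi_def norm_divide norm_mult norm_power norm_powr_real_powr)
qed

lemma psi_holomorphic [holomorphic_intros]: "(\<lambda>s. psi a b s z) holomorphic_on S"
proof (cases "z = 0")
  case False
  then show ?thesis unfolding psi_def
    by (auto intro!: holomorphic_intros)
qed simp

lemma psi_vector_derivative:
  assumes nz: "z + of_real t * u \<noteq> 0"
  shows "((\<lambda>t. psi a b s (z + of_real t * u)) has_vector_derivative dpsi a b s u (z + of_real t * u)) (at t within S)"
proof -
  define y where "y = (\<lambda>t::real. z + of_real t * u)"
  have y: "(y has_vector_derivative u) (at t)"
    unfolding y_def by (auto intro!: derivative_eq_intros simp: has_vector_derivative_def scaleR_conv_of_real)
  have cy: "((\<lambda>t. cnj (y t)) has_vector_derivative cnj u) (at t)"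
    using y by (simp add: has_vector_derivative_cnj)
  have nz': "y t \<noteq> 0" using nz by (simp add: y_def)
  \<comment> \<open>\<open>|y t| powr -2s\<close> is \<open>exp (-s * ln (q t))\<close> with the real polynomial \<open>q = |y|\<^sup>2\<close>, which
    avoids differentiating the absolute value.\<close>
  define q where "q = (\<lambda>t. (Re z + t * Re u)\<^sup>2 + (Im z + t * Im u)\<^sup>2)"
  have q_eq: "q t = (cmod (y t))\<^sup>2" for t by (simp add: q_def y_def cmod_power2)
  then have q_pos: "q t > 0" using nz' by simp
  define q' where "q' = 2 * (Re u * (Re z + t * Re u) + Im u * (Im z + t * Im u))"
  have "(q has_real_derivative q') (at t)"
    unfolding q_def q'_def by (auto intro!: derivative_eq_intros simp: algebra_simps)
  then have "((\<lambda>t. ln (q t)) has_real_derivative (q' / q t)) (at t)"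
    using q_pos by (auto intro!: derivative_eq_intros simp: divide_simps)
  then have lq: "((\<lambda>t. of_real (ln (q t)) :: complex) has_vector_derivative of_real (q' / q t)) (at t)"
    unfolding has_real_derivative_iff_has_vector_derivative
    by (rule bounded_linear.has_vector_derivative[OF bounded_linear_of_real])
  have q'q: "of_real (q' / q t) = u / y t + cnj u / cnj (y t)"
  proof -
    have "of_real (q t) = y t * cnj (y t)" unfolding q_eq by (rule complex_norm_square)
    moreover have "of_real q' = u * cnj (y t) + cnj u * y t"
      by (simp add: q'_def y_def complex_eq_iff algebra_simps)
    ultimately have "of_real (q' / q t) = (u * cnj (y t) + cnj u * y t) / (y t * cnj (y t))"
      by (simp only: of_real_divide)
    also have "\<dots> = u / y t + cnj u / cnj (y t)" using nz' by (simp add: add_divide_distrib)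
    finally show ?thesis .
  qed
  let ?e = "\<lambda>t. exp (- s * of_real (ln (q t)))"
  have e: "(?e has_vector_derivative (of_real (q' / q t) * (- s * ?e t))) (at t)"
  proof -
    have "((\<lambda>x. exp (- s * x)) has_field_derivative - s * ?e t) (at (of_real (ln (q t))))"
      by (auto intro!: derivative_eq_intros)
    from field_vector_diff_chain_at[OF lq this] show ?thesis by (simp only: o_def)
  qed
  have inv_power: "((\<lambda>x. 1 / x ^ n) has_field_derivative (- of_nat n / w ^ Suc n)) (at w)"
    if "w \<noteq> 0" for n and w :: complex
  proof (cases n)
    case (Suc m)
    have "((\<lambda>x. x ^ Suc m) has_field_derivative of_nat (Suc m) * w ^ m) (at w)"
      by (rule DERIV_cong[OF DERIV_power[OF DERIV_ident]]) simp
    then have "((\<lambda>x. inverse (x ^ Suc m)) has_field_derivative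
        - (inverse (w ^ Suc m) * (of_nat (Suc m) * w ^ m) * inverse (w ^ Suc m))) (at w)"
      by (rule DERIV_inverse') (use that in simp)
    moreover have "- (inverse (w ^ Suc m) * (of_nat (Suc m) * w ^ m) * inverse (w ^ Suc m)) = - of_nat n / w ^ Suc n"
      using that by (simp add: Suc divide_simps)
    ultimately show ?thesis unfolding Suc inverse_eq_divide by (simp only:)
  qed simp
  have p: "((\<lambda>t. 1 / y t ^ a) has_vector_derivative (u * (- of_nat a / y t ^ Suc a))) (at t)"
    using field_vector_diff_chain_at[OF y inv_power[OF nz']] by (simp only: o_def)
  have "cnj (y t) \<noteq> 0" using nz' by simp
  from field_vector_diff_chain_at[OF cy inv_power[OF this]]
  have cp: "((\<lambda>t. 1 / cnj (y t) ^ b) has_vector_derivative (cnj u * (- of_nat b / cnj (y t) ^ Suc b))) (at t)"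
    by (simp only: o_def)
  have eq: "psi i j s (y t) = 1 / y t ^ i * (1 / cnj (y t) ^ j) * ?e t" if "y t \<noteq> 0" for i j t
  proof -
    have "of_real (cmod (y t)) powr (2 * s) = exp (s * of_real (ln (q t)))"
      using that by (simp add: powr_def q_eq ln_realpow Ln_of_real mult_ac)
    then show ?thesis by (simp add: psi_def exp_minus field_simps)
  qed
  let ?D = "1 / y t ^ a * (1 / cnj (y t) ^ b) * (of_real (q' / q t) * (- s * ?e t)) +
     (1 / y t ^ a * (cnj u * (- of_nat b / cnj (y t) ^ Suc b)) + u * (- of_nat a / y t ^ Suc a) * (1 / cnj (y t) ^ b)) * ?e t"
  have D: "((\<lambda>t. 1 / y t ^ a * (1 / cnj (y t) ^ b) * ?e t) has_vector_derivative ?D) (at t)"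
    by (intro has_vector_derivative_mult p cp e)
  have Deq: "?D = dpsi a b s u (y t)"
    unfolding dpsi_def eq[OF nz'] q'q unfolding power_Suc divide_inverse inverse_mult_distrib
    by (simp add: algebra_simps)
  have D': "((\<lambda>t. 1 / y t ^ a * (1 / cnj (y t) ^ b) * ?e t) has_vector_derivative dpsi a b s u (y t)) (at t within S)"
    using D unfolding Deq by (rule has_vector_derivative_at_within)
  have "\<forall>\<^sub>F t in nhds t. y t \<noteq> 0"
  proof -
    have "open {t. y t \<noteq> 0}" unfolding y_def by (intro open_Collect_neq continuous_intros)
    from eventually_nhds_in_open[OF this] nz' show ?thesis by simp
  qed
  then have ev: "\<forall>\<^sub>F t in nhds t. t \<in> S \<longrightarrow> psi a b s (y t) = 1 / y t ^ a * (1 / cnj (y t) ^ b) * ?e t"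
    by (rule eventually_mono) (use eq in blast)
  have "((\<lambda>t. psi a b s (y t)) has_vector_derivative dpsi a b s u (y t)) (at t within S)"
    using D' unfolding has_vector_derivative_cong_ev[OF ev eq[OF nz']] .
  then show ?thesis by (simp add: y_def)
qed

text \<open>Taylor's formula with the second derivative bounded along the segment from \<open>z\<close> to \<open>z + u\<close>,
  which stays at distance at least \<open>|z| / 2\<close> from 0.\<close>
lemma psi_second_order_bound:
  assumes big: "cmod z \<ge> 2 * cmod u" and z: "z \<noteq> 0"
    and r: "r = real a + real b + 2 + 2 * Re s" "r \<ge> 0"
  shows "norm (psi a b s (z + u) - psi a b s z - dpsi a b s u z)
           \<le> 4 * (real a + real b + 1 + cmod s)\<^sup>2 * (cmod u)\<^sup>2 * 2 powr r * cmod z powr (- r)"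
proof -
  define K where "K = 4 * (real a + real b + 1 + cmod s)\<^sup>2 * (cmod u)\<^sup>2 * 2 powr r * cmod z powr (- r)"
  define y where "y = (\<lambda>t::real. z + of_real t * u)"
  have y_ge: "cmod (y t) \<ge> cmod z / 2" if "t \<in> {0..1}" for t
  proof -
    have "cmod (of_real t * u) \<le> cmod u" using that by (simp add: norm_mult mult_left_le_one_le)
    moreover have "cmod z \<le> cmod (y t) + cmod (of_real t * u)"
      unfolding y_def by (metis add_diff_cancel_right' norm_triangle_ineq4)
    ultimately show ?thesis using big by simp
  qed
  have y_nz: "y t \<noteq> 0" if "t \<in> {0..1}" for t
    using y_ge[OF that] z by auto
  define D where "D = (\<lambda>t. dpsi a b s u (y t))"
  define D2 where "D2 = (\<lambda>t. - (of_nat a + s) * u * dpsi (Suc a) b s u (y t) - (of_nat b + s) * cnj u * dpsi a (Suc b) s u (y t))"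
  have d1: "((\<lambda>t. psi a b s (y t)) has_vector_derivative D t) (at t within {0..1})" if "t \<in> {0..1}" for t
    using psi_vector_derivative[of z t u a b s] y_nz[OF that] by (simp add: y_def D_def)
  have d2: "(D has_vector_derivative D2 t) (at t within {0..1})" if "t \<in> {0..1}" for t
    unfolding D_def D2_def dpsi_def[of a b]
    using y_nz[OF that] unfolding y_def
    by (intro derivative_intros has_vector_derivative_mult_right psi_vector_derivative)
  let ?C = "real a + real b + 1 + cmod s"
  have D2_le: "norm (D2 t) \<le> K" if t: "t \<in> {0..1}" for t
  proof -
    have p: "norm (psi i j s (y t)) \<le> 2 powr r * cmod z powr (- r)" if "i + j = a + b + 2" for i j
    proof -
      have "real i + real j = real a + real b + 2" using that by linarith
      then have "norm (psi i j s (y t)) = cmod (y t) powr (- r)"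
        using y_nz[OF t] by (simp add: norm_psi r algebra_simps)
      also have "\<dots> \<le> (cmod z / 2) powr (- r)"
        using y_ge[OF t] z r by (intro powr_mono2') auto
      also have "\<dots> = 2 powr r * cmod z powr (- r)"
        using z by (simp add: powr_divide powr_minus_divide)
      finally show ?thesis .
    qed
    have c: "cmod (of_nat i + s) \<le> ?C" if "i \<le> a + b + 1" for i
    proof -
      have "cmod (of_nat i + s) \<le> real i + cmod s" using norm_triangle_ineq[of "of_nat i" s] by simp
      also have "\<dots> \<le> ?C" using that by (simp flip: of_nat_add of_nat_Suc)
      finally show ?thesis .
    qed
    have dp: "norm (dpsi i j s u (y t)) \<le> 2 * (?C * cmod u * (2 powr r * cmod z powr (- r)))" if "i + j = a + b + 1" for i j
    proof -
      have "norm (dpsi i j s u (y t)) \<le> norm (- (of_nat i + s) * u * psi (Suc i) j s (y t)) + norm ((of_nat j + s) * cnj u * psi i (Suc j) s (y t))"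
        unfolding dpsi_def by (rule norm_triangle_ineq4)
      also have "\<dots> = cmod (of_nat i + s) * cmod u * norm (psi (Suc i) j s (y t)) + cmod (of_nat j + s) * cmod u * norm (psi i (Suc j) s (y t))"
        by (simp only: norm_mult norm_minus_cancel complex_mod_cnj)
      also have "\<dots> \<le> ?C * cmod u * (2 powr r * cmod z powr (- r)) + ?C * cmod u * (2 powr r * cmod z powr (- r))"
        by (intro add_mono mult_mono c p mult_nonneg_nonneg add_nonneg_nonneg) (use that in auto)
      finally show ?thesis by (simp only: mult_2)
    qed
    have "norm (D2 t) \<le> norm (- (of_nat a + s) * u * dpsi (Suc a) b s u (y t)) + norm ((of_nat b + s) * cnj u * dpsi a (Suc b) s u (y t))"
      unfolding D2_def by (rule norm_triangle_ineq4)
    also have "\<dots> = cmod (of_nat a + s) * cmod u * norm (dpsi (Suc a) b s u (y t)) + cmod (of_nat b + s) * cmod u * norm (dpsi a (Suc b) s u (y t))"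
      by (simp only: norm_mult norm_minus_cancel complex_mod_cnj)
    also have "\<dots> \<le> ?C * cmod u * (2 * (?C * cmod u * (2 powr r * cmod z powr (- r)))) + ?C * cmod u * (2 * (?C * cmod u * (2 powr r * cmod z powr (- r))))"
      by (intro add_mono mult_mono c dp mult_nonneg_nonneg add_nonneg_nonneg) auto
    also have "\<dots> = K" by (simp add: K_def power2_eq_square)
    finally show ?thesis .
  qed
  have "norm (D x - D 0) \<le> K" if x: "x \<in> {0..1}" for x
  proof -
    have "norm (D x - D 0) \<le> K * norm (x - 0)"
    proof (rule differentiable_bound[where S = "{0..1}" and f' = "\<lambda>t h. h *\<^sub>R D2 t"])
      show "(D has_derivative (\<lambda>h. h *\<^sub>R D2 t)) (at t within {0..1})" if "t \<in> {0..1}" for t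
        using d2[OF that] by (simp add: has_vector_derivative_def)
      show "onorm (\<lambda>h. h *\<^sub>R D2 t) \<le> K" if "t \<in> {0..1}" for t
      proof (rule onorm_le)
        fix h show "norm (h *\<^sub>R D2 t) \<le> K * norm h"
          using mult_right_mono[OF D2_le[OF that], of "norm h"] by (simp add: mult.commute)
      qed
    qed (use x in auto)
    also have "\<dots> \<le> K"
      using x by (simp add: K_def mult_left_le)
    finally show ?thesis .
  qed
  then have "norm (psi a b s (y 1) - psi a b s (y 0) - (1 - 0) *\<^sub>R D 0) \<le> norm (1 - 0 :: real) * K"
    by (intro vector_differentiable_bound_linearization[where S = "{0..1}"])
       (auto intro!: d1 simp: closed_segment_eq_real_ivl)
  then show ?thesis by (simp add: y_def D_def K_def)
qed

text \<open>The first-order Taylor remainder of \<open>psi\<close>, up to sign. It decays faster than \<open>dpsi\<close> by a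
  factor \<open>1 / |z|\<close>, and differs from it by a difference whose lattice sum telescopes.\<close>
definition psi_rem :: "nat \<Rightarrow> nat \<Rightarrow> complex \<Rightarrow> complex \<Rightarrow> complex \<Rightarrow> complex" where
  "psi_rem a b s u z = dpsi a b s u z - (psi a b s (z + u) - psi a b s z)"

lemma psi_rem_holomorphic [holomorphic_intros]: "(\<lambda>s. psi_rem a b s u z) holomorphic_on S"
  unfolding psi_rem_def dpsi_def by (intro holomorphic_intros)

lemma norm_psi_lin_le:
  assumes \<kappa>: "\<kappa> > 0" "\<kappa> * wt v powr (1/2) \<le> cmod (lin \<tau> v)"
    and r: "r = real a + real b + 2 * Re s" "r \<ge> 0"
  shows "norm (psi a b s (lin \<tau> v)) \<le> \<kappa> powr (- r) * wt v powr (- (r / 2))"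
proof -
  have pos: "\<kappa> * wt v powr (1/2) > 0" using \<kappa> wt_ge_1[of v] by simp
  then have "lin \<tau> v \<noteq> 0" using \<kappa> by auto
  then have "norm (psi a b s (lin \<tau> v)) = cmod (lin \<tau> v) powr (- r)"
    by (simp add: norm_psi r)
  also have "\<dots> \<le> (\<kappa> * wt v powr (1/2)) powr (- r)"
    using pos \<kappa> r by (intro powr_mono2') auto
  also have "\<dots> = \<kappa> powr (- r) * wt v powr (- (r / 2))"
    using \<kappa> by (simp add: powr_mult powr_powr)
  finally show ?thesis .
qed

lemma summable_on_psi_lin:
  assumes \<tau>: "Im \<tau> > 0" and r: "real a + real b + 2 * Re s > 2"
  shows "(\<lambda>v. norm (psi a b s (lin \<tau> v))) summable_on A" "(\<lambda>v. psi a b s (lin \<tau> v)) summable_on A"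
proof -
  define r where "r = real a + real b + 2 * Re s"
  obtain \<kappa> where \<kappa>: "\<kappa> > 0" "\<And>v. v \<noteq> (0, 0) \<Longrightarrow> \<kappa> * wt v powr (1/2) \<le> cmod (lin \<tau> v)"
    using lin_lower_bound[OF \<tau>, of "cmod \<tau>"] by (metis order_refl)
  have "(\<lambda>v. \<kappa> powr (- r) * wt v powr (- (r / 2))) summable_on A"
    by (intro summable_on_cmult_right summable_on_wt_powr) (use r in \<open>simp add: r_def field_simps\<close>)
  then show "(\<lambda>v. norm (psi a b s (lin \<tau> v))) summable_on A"
  proof (rule Infinite_Sum.abs_summable_on_comparison_test')
    fix v
    show "norm (psi a b s (lin \<tau> v)) \<le> \<kappa> powr (- r) * wt v powr (- (r / 2))"
    proof (cases "v = (0, 0)")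
      case False
      then show ?thesis
        using r by (intro norm_psi_lin_le \<kappa>) (auto simp: r_def)
    qed (simp add: lin_def)
  qed
  then show "(\<lambda>v. psi a b s (lin \<tau> v)) summable_on A" by (rule abs_summable_summable)
qed

text \<open>The remainder is \<open>O(|z| powr -(2 + w))\<close> for \<open>w = a + b + 2 Re s\<close>, hence its sum over the
  lattice converges as soon as \<open>w > 0\<close>, whereas the sum of \<open>dpsi\<close> needs \<open>w > 1\<close>.\<close>
lemma psi_rem_sum_holomorphic:
  fixes a b :: nat
  assumes \<tau>: "Im \<tau> > 0" and u: "u \<noteq> 0"
  defines "S \<equiv> {s::complex. real a + real b + 2 * Re s > 0}"
  shows "(\<lambda>s. \<Sum>\<^sub>\<infinity>v\<in>A. psi_rem a b s u (lin \<tau> v)) holomorphic_on S"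
    and "\<And>s. s \<in> S \<Longrightarrow> (\<lambda>v. psi_rem a b s u (lin \<tau> v)) summable_on A"
proof -
  have S: "open S" unfolding S_def by (intro open_Collect_less continuous_intros)
  obtain \<kappa> where \<kappa>: "\<kappa> > 0" "\<kappa> \<le> 1" "\<And>v. v \<noteq> (0, 0) \<Longrightarrow> \<kappa> * wt v powr (1/2) \<le> cmod (lin \<tau> v)"
    using lin_lower_bound[OF \<tau>, of "cmod \<tau>"] by (metis order_refl)
  have bound: "\<exists>d>0. \<exists>F M. finite F \<and> M summable_on A \<and>
      (\<forall>v\<in>A - F. \<forall>s\<in>ball s0 d \<inter> S. norm (psi_rem a b s u (lin \<tau> v)) \<le> M v)"
    if s0: "s0 \<in> S" for s0
  proof -
    \<comment> \<open>On the disc of radius \<open>\<eta> / 2\<close> about \<open>s0\<close> the decay exponent stays between \<open>2 + \<eta>\<close> and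
      \<open>2 + 3\<eta>\<close>.\<close>
    define \<eta> where "\<eta> = (real a + real b + 2 * Re s0) / 2"
    have \<eta>: "\<eta> > 0" unfolding \<eta>_def by (rule divide_pos_pos) (use s0 in \<open>simp_all add: S_def\<close>)
    define d where "d = \<eta> / 2"
    define C where "C = real a + real b + 1 + cmod s0 + d"
    define F where "F = {v. wt v < (2 * cmod u / \<kappa>)\<^sup>2} \<union> {(0, 0)}"
    define M where "M = (\<lambda>v. 4 * C\<^sup>2 * (cmod u)\<^sup>2 * 2 powr (2 + 3 * \<eta>) * \<kappa> powr (- (2 + 3 * \<eta>)) * wt v powr (- ((2 + \<eta>) / 2)))"
    have "finite F" by (simp add: F_def finite_wt_less)
    moreover have "M summable_on A"
      unfolding M_def by (intro summable_on_cmult_right summable_on_wt_powr) (use \<eta> in simp)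
    moreover have "norm (psi_rem a b s u (lin \<tau> v)) \<le> M v" if v: "v \<in> A - F" and s: "s \<in> ball s0 d \<inter> S" for v s
    proof -
      have v0: "v \<noteq> (0, 0)" and wt: "wt v \<ge> (2 * cmod u / \<kappa>)\<^sup>2" using v by (auto simp: F_def)
      note lb = \<kappa>(3)[OF v0]
      have "2 * cmod u \<le> \<kappa> * wt v powr (1/2)" by (rule large_wt[OF \<kappa>(1) wt])
      then have big: "2 * cmod u \<le> cmod (lin \<tau> v)" using lb by linarith
      then have nz: "lin \<tau> v \<noteq> 0" using u by auto
      have ds: "cmod (s - s0) < d" using s by (simp add: dist_norm norm_minus_commute)
      then have "\<bar>Re s - Re s0\<bar> < d" using abs_Re_le_cmod[of "s - s0"] by simp
      define r where "r = real a + real b + 2 + 2 * Re s"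
      have r: "2 + \<eta> \<le> r" "r \<le> 2 + 3 * \<eta>"
        using \<open>\<bar>Re s - Re s0\<bar> < d\<close>[unfolded abs_less_iff] by (auto simp: r_def \<eta>_def d_def field_simps)
      have Cs: "real a + real b + 1 + cmod s \<le> C"
        using ds norm_triangle_sub[of s s0] by (simp add: C_def)
      have pw: "cmod (lin \<tau> v) powr (- r) \<le> \<kappa> powr (- (2 + 3 * \<eta>)) * wt v powr (- ((2 + \<eta>) / 2))"
      proof -
        have "cmod (lin \<tau> v) powr (- r) \<le> (\<kappa> * wt v powr (1/2)) powr (- r)"
          using lb \<kappa>(1) wt_ge_1[of v] r \<eta> by (intro powr_mono2') auto
        also have "\<dots> = \<kappa> powr (- r) * wt v powr (- (r / 2))"
          using \<kappa>(1) by (simp add: powr_mult powr_powr)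
        also have "\<dots> \<le> \<kappa> powr (- (2 + 3 * \<eta>)) * wt v powr (- ((2 + \<eta>) / 2))"
          using r \<eta> \<kappa> wt_ge_1[of v] by (intro mult_mono powr_mono powr_mono') auto
        finally show ?thesis .
      qed
      have "norm (psi_rem a b s u (lin \<tau> v)) = norm (psi a b s (lin \<tau> v + u) - psi a b s (lin \<tau> v) - dpsi a b s u (lin \<tau> v))"
        unfolding psi_rem_def by (rule norm_minus_commute)
      also have "\<dots> \<le> 4 * (real a + real b + 1 + cmod s)\<^sup>2 * (cmod u)\<^sup>2 * 2 powr r * cmod (lin \<tau> v) powr (- r)"
        by (rule psi_second_order_bound) (use big nz r \<eta> in \<open>auto simp: r_def\<close>)
      also have "\<dots> \<le> 4 * C\<^sup>2 * (cmod u)\<^sup>2 * 2 powr (2 + 3 * \<eta>) * (\<kappa> powr (- (2 + 3 * \<eta>)) * wt v powr (- ((2 + \<eta>) / 2)))"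
        using r Cs by (intro mult_mono pw power_mono powr_mono mult_nonneg_nonneg) auto
      finally show ?thesis by (simp add: M_def)
    qed
    moreover have "d > 0" using \<eta> by (simp add: d_def)
    ultimately show ?thesis by blast
  qed
  show "(\<lambda>s. \<Sum>\<^sub>\<infinity>v\<in>A. psi_rem a b s u (lin \<tau> v)) holomorphic_on S"
    by (rule holomorphic_on_infsum(1)[OF S psi_rem_holomorphic bound])
  show "(\<lambda>v. psi_rem a b s u (lin \<tau> v)) summable_on A" if "s \<in> S" for s
    by (rule holomorphic_on_infsum(2)[OF S psi_rem_holomorphic bound that])
qed

lemma psi_tendsto_0:
  assumes r: "real a + real b + 2 * Re s > 0" and lim: "filterlim (\<lambda>x. cmod (f x)) at_top F"
  shows "((\<lambda>x. psi a b s (f x)) \<longlongrightarrow> 0) F"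
proof (rule Lim_null_comparison)
  show "\<forall>\<^sub>F x in F. norm (psi a b s (f x)) \<le> cmod (f x) powr (- (real a + real b + 2 * Re s))"
    using filterlim_at_top_dense[THEN iffD1, rule_format, OF lim, of 0]
    by eventually_elim (auto simp: norm_psi)
  show "((\<lambda>x. cmod (f x) powr (- (real a + real b + 2 * Re s))) \<longlongrightarrow> 0) F"
    by (rule tendsto_neg_powr[OF _ lim]) (use r in simp)
qed

lemma filterlim_cmod_lin:
  assumes \<tau>: "Im \<tau> > 0"
  shows "filterlim (\<lambda>d. cmod (lin \<tau> (c, d))) at_top at_top" "filterlim (\<lambda>d. cmod (lin \<tau> (c, d))) at_top at_bot"
    "filterlim (\<lambda>c. cmod (lin \<tau> (c, d))) at_top at_top" "filterlim (\<lambda>c. cmod (lin \<tau> (c, d))) at_top at_bot"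
proof -
  obtain \<kappa> where \<kappa>: "\<kappa> > 0" "\<And>v. v \<noteq> (0, 0) \<Longrightarrow> \<kappa> * wt v powr (1/2) \<le> cmod (lin \<tau> v)"
    using lin_lower_bound[OF \<tau>, of "cmod \<tau>"] by (metis order_refl)
  have key: "Z \<le> cmod (lin \<tau> v)" if "(Z / \<kappa>)\<^sup>2 + 1 \<le> real_of_int \<bar>fst v\<bar> \<or> (Z / \<kappa>)\<^sup>2 + 1 \<le> real_of_int \<bar>snd v\<bar>" for Z v
  proof -
    have v: "v \<noteq> (0, 0)"
    proof
      assume "v = (0, 0)"
      with that have "(Z / \<kappa>)\<^sup>2 + 1 \<le> 0" by auto
      moreover have "(Z / \<kappa>)\<^sup>2 \<ge> 0" by simp
      ultimately show False by linarith
    qed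
    have w: "wt v = 1 + real_of_int \<bar>fst v\<bar> + real_of_int \<bar>snd v\<bar> + real_of_int \<bar>fst v\<bar> * real_of_int \<bar>snd v\<bar>"
      by (simp add: wt_def algebra_simps)
    moreover have "real_of_int \<bar>fst v\<bar> * real_of_int \<bar>snd v\<bar> \<ge> 0" "real_of_int \<bar>fst v\<bar> \<ge> 0" "real_of_int \<bar>snd v\<bar> \<ge> 0" by simp_all
    ultimately have "(Z / \<kappa>)\<^sup>2 \<le> wt v" using that by linarith
    then have "Z / \<kappa> \<le> sqrt (wt v)" by (rule real_le_rsqrt)
    then have "Z \<le> \<kappa> * wt v powr (1/2)"
      using \<kappa>(1) wt_ge_1[of v] by (simp add: powr_half_sqrt field_simps)
    then show ?thesis using \<kappa>(2)[OF v] by linarith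
  qed
  have *: "filterlim (\<lambda>x. cmod (lin \<tau> (g x))) at_top F"
    if ev: "\<And>B. \<forall>\<^sub>F x in F. B \<le> real_of_int \<bar>x\<bar>" and g: "\<And>x. fst (g x) = x \<or> snd (g x) = x"
    for g :: "int \<Rightarrow> int \<times> int" and F
    unfolding filterlim_at_top
  proof
    fix Z show "\<forall>\<^sub>F x in F. Z \<le> cmod (lin \<tau> (g x))"
      using ev[of "(Z / \<kappa>)\<^sup>2 + 1"]
    proof eventually_elim
      case (elim x)
      then show ?case using g[of x] by (intro key) auto
    qed
  qed
  show "filterlim (\<lambda>d. cmod (lin \<tau> (c, d))) at_top at_top" "filterlim (\<lambda>c. cmod (lin \<tau> (c, d))) at_top at_top"
    by (rule *[OF eventually_le_abs_int(1)], simp)+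
  show "filterlim (\<lambda>d. cmod (lin \<tau> (c, d))) at_top at_bot" "filterlim (\<lambda>c. cmod (lin \<tau> (c, d))) at_top at_bot"
    by (rule *[OF eventually_le_abs_int(2)], simp)+
qed

abbreviation vclass :: "nat \<Rightarrow> int \<times> int \<Rightarrow> (int \<times> int) set" where
  "vclass N v \<equiv> residue_class N (fst v) \<times> residue_class N (snd v)"

text \<open>The shift by \<open>u = N\<close> or \<open>u = N\<tau>\<close> is a step of \<open>N\<close> in one coordinate, so the sum telescopes
  along each row or each column. Both boundary terms vanish because \<open>psi\<close> tends to 0 at
  infinity.\<close>
lemma infsum_psi_difference_0:
  assumes \<tau>: "Im \<tau> > 0" and N: "N \<ge> 1" and r: "real a + real b + 2 * Re s > 0"
    and u: "u = of_nat N \<or> u = of_nat N * \<tau>"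
    and sm: "(\<lambda>v. psi a b s (lin \<tau> v + u) - psi a b s (lin \<tau> v)) summable_on vclass N v0"
  shows "(\<Sum>\<^sub>\<infinity>v\<in>vclass N v0. psi a b s (lin \<tau> v + u) - psi a b s (lin \<tau> v)) = 0"
proof -
  let ?A = "residue_class N (fst v0)" and ?B = "residue_class N (snd v0)"
  let ?f = "\<lambda>c d. psi a b s (lin \<tau> (c, d) + u) - psi a b s (lin \<tau> (c, d))"
  have sm': "(\<lambda>(c, d). ?f c d) summable_on ?A \<times> ?B"
    using sm by (simp add: case_prod_unfold)
  have sm'': "(\<lambda>(d, c). ?f c d) summable_on ?B \<times> ?A"
    using sm' by (subst (asm) summable_on_swap) (simp add: case_prod_unfold)
  from u show ?thesis
  proof
    assume u: "u = of_nat N"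
    have eq: "lin \<tau> (c, d) + u = lin \<tau> (c, d + int N)" for c d by (simp add: lin_def u)
    have "(\<Sum>\<^sub>\<infinity>d\<in>?B. ?f c d) = 0 - 0" if "c \<in> ?A" for c
      unfolding eq
      by (rule infsum_telescope_residue_class[where h = "\<lambda>d. psi a b s (lin \<tau> (c, d))", OF N])
         (use summable_on_SigmaD1[OF sm' that] in \<open>auto intro!: psi_tendsto_0[OF r] filterlim_cmod_lin[OF \<tau>] simp: eq\<close>)
    then have "(\<Sum>\<^sub>\<infinity>c\<in>?A. \<Sum>\<^sub>\<infinity>d\<in>?B. ?f c d) = 0" by (simp cong: infsum_cong)
    then show ?thesis
      by (subst (asm) infsum_Sigma'_banach[OF sm']) (simp add: case_prod_unfold)
  next
    assume u: "u = of_nat N * \<tau>"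
    have eq: "lin \<tau> (c, d) + u = lin \<tau> (c + int N, d)" for c d by (simp add: lin_def u algebra_simps)
    have "(\<Sum>\<^sub>\<infinity>c\<in>?A. ?f c d) = 0 - 0" if "d \<in> ?B" for d
      unfolding eq
      by (rule infsum_telescope_residue_class[where h = "\<lambda>c. psi a b s (lin \<tau> (c, d))", OF N])
         (use summable_on_SigmaD1[OF sm'' that] in \<open>auto intro!: psi_tendsto_0[OF r] filterlim_cmod_lin[OF \<tau>] simp: eq\<close>)
    then have "(\<Sum>\<^sub>\<infinity>d\<in>?B. \<Sum>\<^sub>\<infinity>c\<in>?A. ?f c d) = 0" by (simp cong: infsum_cong)
    then have "(\<Sum>\<^sub>\<infinity>c\<in>?A. \<Sum>\<^sub>\<infinity>d\<in>?B. ?f c d) = 0"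
      by (subst infsum_swap_banach[OF sm'])
    then show ?thesis
      by (subst (asm) infsum_Sigma'_banach[OF sm']) (simp add: case_prod_unfold)
  qed
qed

text \<open>For \<open>\<psi> = psi (k - 1) 0 s\<close> with derivative \<open>\<partial>\<^sub>u \<psi>\<close> in direction \<open>u\<close>, the combination
  \<open>\<partial>\<^sub>u \<psi>\<close> at \<open>u = N\<tau>\<close> minus \<open>cnj \<tau>\<close> times \<open>\<partial>\<^sub>u \<psi>\<close> at \<open>u = N\<close> eliminates the antiholomorphic
  derivative and is a multiple of \<open>psi k 0 s\<close>. The definition has the remainders \<open>psi_rem\<close> in
  place of the derivatives: this does not change the sum where everything converges, and extends
  it to \<open>Re (k + 2s) > 1\<close>.\<close>
definition lattice_sum :: "nat \<Rightarrow> nat \<Rightarrow> complex \<Rightarrow> int \<times> int \<Rightarrow> complex \<Rightarrow> complex" where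
  "lattice_sum k N \<tau> v0 s =
     - ((\<Sum>\<^sub>\<infinity>v\<in>vclass N v0. psi_rem (k - 1) 0 s (of_nat N * \<tau>) (lin \<tau> v)) -
        cnj \<tau> * (\<Sum>\<^sub>\<infinity>v\<in>vclass N v0. psi_rem (k - 1) 0 s (of_nat N) (lin \<tau> v)))
     / ((of_nat k - 1 + s) * of_nat N * (\<tau> - cnj \<tau>))"

lemma lattice_sum_holomorphic:
  assumes \<tau>: "Im \<tau> > 0" and N: "N \<ge> 1" and k: "k \<ge> 2"
  shows "lattice_sum k N \<tau> v0 holomorphic_on {s. Re (of_nat k + 2 * s) > 1}"
proof -
  let ?S = "{s. Re (of_nat k + 2 * s) > 1}"
  have S: "?S = {s. real (k - 1) + real 0 + 2 * Re s > 0}" using k by (auto simp: of_nat_diff)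
  have u: "of_nat N \<noteq> (0::complex)" "of_nat N * \<tau> \<noteq> 0" using N \<tau> by auto
  have nz: "of_nat k - 1 + s \<noteq> 0" if "s \<in> ?S" for s
  proof
    assume "of_nat k - 1 + s = 0"
    then have "Re (of_nat k - 1 + s) = 0" by simp
    then show False using that k by simp
  qed
  have nz': "\<tau> - cnj \<tau> \<noteq> 0" using \<tau> by (auto simp: complex_eq_iff)
  show ?thesis
    unfolding lattice_sum_def[abs_def]
    by (intro holomorphic_intros psi_rem_sum_holomorphic(1)[OF \<tau> u(1), of "k - 1" 0, folded S]
         psi_rem_sum_holomorphic(1)[OF \<tau> u(2), of "k - 1" 0, folded S])
       (use nz nz' N in auto)
qed

lemma lattice_sum_eq:
  assumes \<tau>: "Im \<tau> > 0" and N: "N \<ge> 1" and k: "k \<ge> 2" and s: "Re (of_nat k + 2 * s) > 2"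
  shows "lattice_sum k N \<tau> v0 s = (\<Sum>\<^sub>\<infinity>v\<in>vclass N v0. psi k 0 s (lin \<tau> v))"
proof -
  let ?L = "vclass N v0"
  have k': "Suc (k - 1) = k" using k by simp
  have sm: "(\<lambda>v. psi k 0 s (lin \<tau> v)) summable_on ?L" "(\<lambda>v. psi (k - 1) 1 s (lin \<tau> v)) summable_on ?L"
    by (rule summable_on_psi_lin(2)[OF \<tau>]; use s k in \<open>simp add: of_nat_diff\<close>)+
  have dsm: "(\<lambda>v. dpsi (k - 1) 0 s u (lin \<tau> v)) summable_on ?L" for u
    unfolding dpsi_def k' diff_conv_add_uminus One_nat_def[symmetric]
    by (intro summable_on_add summable_on_uminus[THEN iffD2] summable_on_cmult_right sm)
  have R: "(\<Sum>\<^sub>\<infinity>v\<in>?L. psi_rem (k - 1) 0 s u (lin \<tau> v)) = (\<Sum>\<^sub>\<infinity>v\<in>?L. dpsi (k - 1) 0 s u (lin \<tau> v))"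
    if u: "u = of_nat N \<or> u = of_nat N * \<tau>" for u
  proof -
    have "u \<noteq> 0" using u N \<tau> by auto
    then have rsm: "(\<lambda>v. psi_rem (k - 1) 0 s u (lin \<tau> v)) summable_on ?L"
      by (rule psi_rem_sum_holomorphic(2)[OF \<tau>]) (use s k in \<open>simp add: of_nat_diff\<close>)
    have eq: "psi (k - 1) 0 s (lin \<tau> v + u) - psi (k - 1) 0 s (lin \<tau> v) =
        dpsi (k - 1) 0 s u (lin \<tau> v) - psi_rem (k - 1) 0 s u (lin \<tau> v)" for v
      by (simp add: psi_rem_def)
    have dif: "(\<lambda>v. psi (k - 1) 0 s (lin \<tau> v + u) - psi (k - 1) 0 s (lin \<tau> v)) summable_on ?L"
      unfolding eq by (rule summable_on_diff_complex[OF dsm rsm])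
    have "(\<Sum>\<^sub>\<infinity>v\<in>?L. psi (k - 1) 0 s (lin \<tau> v + u) - psi (k - 1) 0 s (lin \<tau> v)) = 0"
      by (rule infsum_psi_difference_0[OF \<tau> N _ u dif]) (use s k in \<open>simp add: of_nat_diff\<close>)
    then show ?thesis
      unfolding eq by (subst (asm) infsum_diff_complex[OF dsm rsm]) simp
  qed
  have nz: "of_nat k - 1 + s \<noteq> 0"
  proof
    assume "of_nat k - 1 + s = 0"
    then have "Re (of_nat k - 1 + s) = 0" by simp
    then show False using s k by simp
  qed
  have nz': "\<tau> - cnj \<tau> \<noteq> 0" using \<tau> by (auto simp: complex_eq_iff)
  \<comment> \<open>The coefficient of \<open>psi (k - 1) 1 s\<close> cancels because \<open>cnj (N\<tau>) = cnj \<tau> * cnj N\<close>.\<close>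
  have id: "dpsi (k - 1) 0 s (of_nat N * \<tau>) z - cnj \<tau> * dpsi (k - 1) 0 s (of_nat N) z =
      - ((of_nat k - 1 + s) * of_nat N * (\<tau> - cnj \<tau>)) * psi k 0 s z" for z
    using k by (simp add: dpsi_def k' of_nat_diff algebra_simps)
  have "(\<Sum>\<^sub>\<infinity>v\<in>?L. psi_rem (k - 1) 0 s (of_nat N * \<tau>) (lin \<tau> v)) -
        cnj \<tau> * (\<Sum>\<^sub>\<infinity>v\<in>?L. psi_rem (k - 1) 0 s (of_nat N) (lin \<tau> v))
      = (\<Sum>\<^sub>\<infinity>v\<in>?L. dpsi (k - 1) 0 s (of_nat N * \<tau>) (lin \<tau> v) - cnj \<tau> * dpsi (k - 1) 0 s (of_nat N) (lin \<tau> v))"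
    by (subst infsum_diff_complex[OF dsm summable_on_cmult_right[OF dsm]])
       (simp_all only: R[OF disjI1[OF refl]] R[OF disjI2[OF refl]] infsum_cmult_right')
  also have "\<dots> = - ((of_nat k - 1 + s) * of_nat N * (\<tau> - cnj \<tau>)) * (\<Sum>\<^sub>\<infinity>v\<in>?L. psi k 0 s (lin \<tau> v))"
    unfolding id by (rule infsum_cmult_right')
  finally have E: "(\<Sum>\<^sub>\<infinity>v\<in>?L. psi_rem (k - 1) 0 s (of_nat N * \<tau>) (lin \<tau> v)) -
        cnj \<tau> * (\<Sum>\<^sub>\<infinity>v\<in>?L. psi_rem (k - 1) 0 s (of_nat N) (lin \<tau> v))
      = - ((of_nat k - 1 + s) * of_nat N * (\<tau> - cnj \<tau>)) * (\<Sum>\<^sub>\<infinity>v\<in>?L. psi k 0 s (lin \<tau> v))" .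
  have "(of_nat k - 1 + s) * of_nat N * (\<tau> - cnj \<tau>) \<noteq> 0" using nz nz' N by simp
  then show ?thesis unfolding lattice_sum_def E by simp
qed

section \<open>Moebius inversion and primitive vectors\<close>

text \<open>The Moebius function.\<close>
definition mu :: "nat \<Rightarrow> int" where
  "mu n = (if squarefree n then (- 1) ^ card (prime_factors n) else 0)"

lemma abs_mu_le_1: "\<bar>mu n\<bar> \<le> 1"
  by (simp add: mu_def power_abs)

lemma mu_1 [simp]: "mu (Suc 0) = 1" by (simp add: mu_def)

lemma mu_prime_mult:
  assumes p: "Factorial_Ring.prime p" and e: "\<not> p dvd e" "e > 0"
  shows "mu (p * e) = - mu e"
proof -
  have cop: "coprime p e" using p e by (simp add: prime_imp_coprime)
  have "squarefree (p * e) \<longleftrightarrow> squarefree e"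
    using cop p by (auto simp: squarefree_mult_coprime squarefree_prime dest: squarefree_multD)
  moreover have "prime_factors (p * e) = insert p (prime_factors e)"
    using p e by (subst prime_factors_product) (auto simp: prime_prime_factors)
  moreover have "p \<notin> prime_factors e" using e by auto
  ultimately show ?thesis by (simp add: mu_def)
qed

lemma sum_mu_divisors:
  assumes n: "n > 0"
  shows "(\<Sum>d | d dvd n. mu d) = (if n = 1 then 1 else 0)"
proof (cases "n = 1")
  case False
  then obtain p where p: "Factorial_Ring.prime p" "p dvd n" using prime_factor_nat by blast
  have p0: "p > 0" using p prime_gt_0_nat by blast
  \<comment> \<open>For a prime \<open>p\<close> dividing \<open>n\<close>, the squarefree divisors come in pairs \<open>d\<close>, \<open>p * d\<close> with
    opposite signs.\<close>
  let ?A = "{d. d dvd n \<and> \<not> p dvd d}"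
  have fin: "finite {d. d dvd n}" using n by simp
  have A: "finite ?A" by (rule finite_subset[OF _ fin]) auto
  have "(\<Sum>d | d dvd n. mu d) = (\<Sum>d\<in>?A \<union> (*) p ` ?A. mu d)"
  proof (rule sum.mono_neutral_right[OF fin])
    show "?A \<union> (*) p ` ?A \<subseteq> {d. d dvd n}"
    proof -
      have "p * d dvd n" if "d \<in> ?A" for d
        using that p by (auto intro!: divides_mult simp: prime_imp_coprime)
      then show ?thesis by auto
    qed
    show "\<forall>d\<in>{d. d dvd n} - (?A \<union> (*) p ` ?A). mu d = 0"
    proof
      fix d assume d: "d \<in> {d. d dvd n} - (?A \<union> (*) p ` ?A)"
      then obtain e where e: "d = p * e" by auto
      have "e dvd n" using d e dvd_mult_right by blast
      then have "p dvd e" using d e by auto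
      then have "p\<^sup>2 dvd d" by (auto simp: e power2_eq_square)
      then have "\<not> squarefree d" using p by (metis not_prime_unit squarefreeD)
      then show "mu d = 0" by (simp add: mu_def)
    qed
  qed
  also have "\<dots> = (\<Sum>d\<in>?A. mu d) + (\<Sum>d\<in>(*) p ` ?A. mu d)"
    using A by (intro sum.union_disjoint) auto
  also have "(\<Sum>d\<in>(*) p ` ?A. mu d) = (\<Sum>d\<in>?A. mu (p * d))"
    using p0 by (subst sum.reindex) (auto simp: inj_on_def)
  also have "\<dots> = (\<Sum>d\<in>?A. - mu d)"
    using n by (intro sum.cong refl mu_prime_mult p) (auto intro: dvd_pos_nat)
  finally show ?thesis using False by (simp add: sum_negf)
qed simp

definition prim :: "(int \<times> int) set" where
  "prim = {v. gcd (fst v) (snd v) = 1}"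

definition svec :: "int \<Rightarrow> int \<times> int \<Rightarrow> int \<times> int" where
  "svec n v = (n * fst v, n * snd v)"

text \<open>The sum of \<open>mu n\<close> over the divisors \<open>n\<close> of \<open>gcd c d\<close> is the indicator of \<open>(c, d)\<close> being
  primitive; exchange the two sums. Homogeneity of \<open>f\<close> turns the multiples of \<open>n\<close> in \<open>L\<close> into
  the factor \<open>h n\<close> and the sum over the vectors that \<open>n\<close> maps into \<open>L\<close>.\<close>
lemma primitive_sum_moebius:
  fixes f :: "int \<times> int \<Rightarrow> complex"
  assumes f0: "f (0, 0) = 0" and hom: "\<And>n v. n > 0 \<Longrightarrow> f (svec (int n) v) = h n * f v"
    and f: "(\<lambda>v. norm (f v)) summable_on UNIV" and h: "(\<lambda>n. norm (h n)) summable_on {0<..}"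
  shows "(\<Sum>\<^sub>\<infinity>v\<in>L \<inter> prim. f v) = (\<Sum>\<^sub>\<infinity>n\<in>{0<..}. of_int (mu n) * h n * (\<Sum>\<^sub>\<infinity>v\<in>{v. svec (int n) v \<in> L}. f v))"
proof -
  let ?B = "\<lambda>n. {v. svec (int n) v \<in> L \<and> v \<noteq> (0, 0)}"
  let ?D = "\<lambda>v::int \<times> int. {n. n dvd nat (gcd (fst v) (snd v))}"
  let ?F = "\<lambda>(n, v). of_int (mu n) * (h n * f v)"
  have "(\<lambda>(n, v). norm (h n) * norm (f v)) summable_on (SIGMA n:{0<..}. UNIV)"
    by (rule summable_on_SigmaI[where g = "\<lambda>n. norm (h n) * (\<Sum>\<^sub>\<infinity>v. norm (f v))"])
       (auto intro!: has_sum_cmult_right has_sum_infsum[OF f] summable_on_cmult_left h)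
  then have "(\<lambda>(n, v). norm (h n) * norm (f v)) summable_on (SIGMA n:{0<..}. ?B n)"
    by (rule summable_on_subset_banach) auto
  then have "(\<lambda>x. norm (?F x)) summable_on (SIGMA n:{0<..}. ?B n)"
    by (rule Infinite_Sum.abs_summable_on_comparison_test')
       (use abs_mu_le_1 in \<open>auto simp: norm_mult mult_left_le_one_le simp flip: of_int_abs\<close>)
  then have F: "?F summable_on (SIGMA n:{0<..}. ?B n)" by (rule abs_summable_summable)
  have gcd0: "nat (gcd (fst v) (snd v)) > 0" if "v \<noteq> (0, 0)" for v :: "int \<times> int"
    using that by (cases v) auto
  let ?G = "\<lambda>(v, n). of_int (mu n) * f v"
  have bij: "?G (svec (int n) v, n) = ?F (n, v)" if "n > 0" for n v
    using hom[OF that] by simp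
  have S: "(?F has_sum infsum ?F (SIGMA n:{0<..}. ?B n)) (SIGMA n:{0<..}. ?B n) \<longleftrightarrow>
        (?G has_sum infsum ?F (SIGMA n:{0<..}. ?B n)) (SIGMA v:L - {(0, 0)}. ?D v)"
  proof (rule has_sum_reindex_bij_witness[where j = "\<lambda>(n, v). (svec (int n) v, n)" and
      i = "\<lambda>(v, n). (n, (fst v div int n, snd v div int n))"])
    fix b assume b: "b \<in> (SIGMA v:L - {(0, 0)}. ?D v)"
    obtain c d n where bb: "b = ((c, d), n)" by (metis surj_pair)
    have n: "n dvd nat (gcd c d)" and cd: "(c, d) \<in> L" "(c, d) \<noteq> (0, 0)" using b bb by auto
    have n0: "n > 0" using dvd_pos_nat[OF gcd0[OF cd(2)]] n by simp
    have "int n dvd gcd c d" using n int_dvd_int_iff[of n "nat (gcd c d)"] by simp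
    then have dv: "int n dvd c" "int n dvd d" by auto
    then show "(\<lambda>(n, v). (svec (int n) v, n)) ((\<lambda>(v, n). (n, (fst v div int n, snd v div int n))) b) = b"
      by (simp add: bb svec_def)
    show "(\<lambda>(v, n). (n, (fst v div int n, snd v div int n))) b \<in> (SIGMA n:{0<..}. ?B n)"
      using n0 dv cd by (auto simp: bb svec_def)
  next
    fix a assume a: "a \<in> (SIGMA n:{0<..}. ?B n)"
    obtain c d n where aa: "a = (n, (c, d))" by (metis surj_pair)
    have n: "n > 0" and L: "svec (int n) (c, d) \<in> L" and cd: "(c, d) \<noteq> (0, 0)" using a aa by auto
    have nz: "svec (int n) (c, d) \<noteq> (0, 0)" using cd n by (auto simp: svec_def)
    have "int n dvd int (nat (gcd (int n * c) (int n * d)))" by simp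
    then have "n dvd nat (gcd (int n * c) (int n * d))" by (simp only: int_dvd_int_iff)
    then show "(\<lambda>(n, v). (svec (int n) v, n)) a \<in> (SIGMA v:L - {(0, 0)}. ?D v)"
      using L nz by (auto simp: aa svec_def)
    show "(\<lambda>(v, n). (n, (fst v div int n, snd v div int n))) ((\<lambda>(n, v). (svec (int n) v, n)) a) = a"
      using n by (simp add: aa svec_def)
    show "?G ((\<lambda>(n, v). (svec (int n) v, n)) a) = ?F a"
      using bij[OF n] by (simp add: aa)
  qed (rule refl)
  then have G: "(?G has_sum infsum ?F (SIGMA n:{0<..}. ?B n)) (SIGMA v:L - {(0, 0)}. ?D v)"
    using F by (simp only: has_sum_infsum)
  have inner: "((\<lambda>n. ?G (v, n)) has_sum (if v \<in> prim then f v else 0)) (?D v)" if v: "v \<in> L - {(0, 0)}" for v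
  proof -
    have g: "nat (gcd (fst v) (snd v)) > 0" using gcd0 v by auto
    have "(\<Sum>n\<in>?D v. ?G (v, n)) = of_int (\<Sum>n\<in>?D v. mu n) * f v"
      by (simp add: sum_distrib_right)
    also have "\<dots> = (if v \<in> prim then f v else 0)"
      unfolding sum_mu_divisors[OF g] by (auto simp: prim_def nat_eq_iff)
    finally show ?thesis using g by (intro has_sum_finiteI) auto
  qed
  have "((\<lambda>v. if v \<in> prim then f v else 0) has_sum infsum ?F (SIGMA n:{0<..}. ?B n)) (L - {(0, 0)})"
    by (rule has_sum_SigmaD[OF G]) (use inner in auto)
  then have "(f has_sum infsum ?F (SIGMA n:{0<..}. ?B n)) (L \<inter> prim)"
    by (subst (asm) has_sum_cong_neutral[where T = "L \<inter> prim" and g = f]) (auto simp: prim_def)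
  then have "(\<Sum>\<^sub>\<infinity>v\<in>L \<inter> prim. f v) = infsum ?F (SIGMA n:{0<..}. ?B n)" by (rule infsumI)
  also have "\<dots> = (\<Sum>\<^sub>\<infinity>n\<in>{0<..}. \<Sum>\<^sub>\<infinity>v\<in>?B n. ?F (n, v))"
    by (rule infsum_Sigma_banach[OF F, symmetric])
  also have "\<dots> = (\<Sum>\<^sub>\<infinity>n\<in>{0<..}. of_int (mu n) * h n * (\<Sum>\<^sub>\<infinity>v\<in>{v. svec (int n) v \<in> L}. f v))"
  proof (rule infsum_cong)
    fix n :: nat
    have "(\<Sum>\<^sub>\<infinity>v\<in>?B n. f v) = (\<Sum>\<^sub>\<infinity>v\<in>{v. svec (int n) v \<in> L}. f v)"
      by (rule infsum_cong_neutral) (auto simp: f0)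
    then show "(\<Sum>\<^sub>\<infinity>v\<in>?B n. ?F (n, v)) = of_int (mu n) * h n * (\<Sum>\<^sub>\<infinity>v\<in>{v. svec (int n) v \<in> L}. f v)"
      by (simp add: infsum_cmult_right' mult.assoc)
  qed
  finally show ?thesis .
qed

definition inv_mod :: "nat \<Rightarrow> nat \<Rightarrow> int" where
  "inv_mod N n = (SOME u. u \<in> {0..<int N} \<and> [int n * u = 1] (mod int N))"

lemma inv_mod:
  assumes "N \<ge> 1" "coprime n N"
  shows "inv_mod N n \<in> {0..<int N}" "[int n * inv_mod N n = 1] (mod int N)"
proof -
  obtain u where u: "[int n * u = 1] (mod int N)"
    using assms cong_solve_coprime_int[of "int n" "int N"] by auto
  have "[int n * (u mod int N) = int n * u] (mod int N)"
    by (intro cong_scalar_left) (simp add: cong_def)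
  then have "[int n * (u mod int N) = 1] (mod int N)" using u cong_trans by blast
  moreover have "u mod int N \<in> {0..<int N}" using assms by simp
  ultimately have "\<exists>u. u \<in> {0..<int N} \<and> [int n * u = 1] (mod int N)" by blast
  from someI_ex[OF this] show "inv_mod N n \<in> {0..<int N}" "[int n * inv_mod N n = 1] (mod int N)"
    by (simp_all add: inv_mod_def)
qed

text \<open>A common factor of \<open>n\<close> and \<open>N\<close> divides both coordinates of every vector in a class that
  contains a multiple of \<open>n\<close>; the class of a primitive vector allows this for no factor but 1.\<close>
lemma svec_in_vclass:
  assumes N: "N \<ge> 1" and v0: "v0 \<in> prim"
  shows "{v. svec (int n) v \<in> vclass N v0} = (if coprime n N then vclass N (svec (inv_mod N n) v0) else {})"
proof (cases "coprime n N")
  case True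
  let ?u = "inv_mod N n"
  have nu: "[int n * ?u = 1] (mod int N)" by (rule inv_mod(2)[OF N True])
  have "[int n * x = a] (mod int N) \<longleftrightarrow> [x = ?u * a] (mod int N)" for x a
  proof
    assume "[int n * x = a] (mod int N)"
    then have "[?u * (int n * x) = ?u * a] (mod int N)" by (rule cong_scalar_left)
    moreover have "[int n * ?u * x = 1 * x] (mod int N)" by (rule cong_scalar_right[OF nu])
    ultimately show "[x = ?u * a] (mod int N)" by (simp add: cong_def mult_ac)
  next
    assume "[x = ?u * a] (mod int N)"
    then have "[int n * x = int n * (?u * a)] (mod int N)" by (rule cong_scalar_left)
    moreover have "[int n * ?u * a = 1 * a] (mod int N)" by (rule cong_scalar_right[OF nu])
    ultimately show "[int n * x = a] (mod int N)" by (simp add: cong_def mult_ac)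
  qed
  then show ?thesis using True by (auto simp: svec_def residue_class_def)
next
  case False
  have "svec (int n) v \<notin> vclass N v0" for v
  proof
    assume "svec (int n) v \<in> vclass N v0"
    then have c: "[int n * fst v = fst v0] (mod int N)" "[int n * snd v = snd v0] (mod int N)"
      by (auto simp: svec_def residue_class_def)
    let ?g = "int (gcd n N)"
    have g: "?g dvd int n" "?g dvd int N" by (simp_all only: int_dvd_int_iff gcd_dvd1 gcd_dvd2)
    have "?g dvd fst v0" "?g dvd snd v0"
      using c g by (meson cong_dvd_iff cong_dvd_modulus dvd_mult2)+
    then have "?g dvd gcd (fst v0) (snd v0)" by (rule gcd_greatest)
    moreover have "gcd (fst v0) (snd v0) = 1" using v0 by (simp add: prim_def)
    ultimately have "?g dvd int 1" by (simp only: of_nat_1)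
    then have "gcd n N dvd 1" by (simp only: int_dvd_int_iff)
    then show False using False by (simp add: coprime_iff_gcd_eq_1)
  qed
  then show ?thesis using False by auto
qed

lemma psi_mult_of_nat: 
  shows "psi a b s (of_nat n * z) = psi a b s (of_nat n) * psi a b s z"
proof -
  have "complex_of_real (real n * cmod z) powr (2 * s) = of_real (real n) powr (2 * s) * of_real (cmod z) powr (2 * s)"
    by (simp add: powr_times_real)
  then show ?thesis
    by (simp add: psi_def norm_mult power_mult_distrib)
qed

lemma lin_svec: "lin \<tau> (svec n v) = of_int n * lin \<tau> v"
  by (simp add: lin_def svec_def algebra_simps)

lemma summable_on_psi_of_nat:
  assumes "real a + real b + 2 * Re s > 1"
  shows "(\<lambda>n. norm (psi a b s (of_nat n))) summable_on {0<..}"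
proof -
  have "summable (\<lambda>n. real n powr (- (real a + real b + 2 * Re s)))"
    using assms by (simp add: summable_real_powr_iff)
  then have "(\<lambda>n. real n powr (- (real a + real b + 2 * Re s))) summable_on UNIV"
    by (simp add: summable_on_UNIV_nonneg_real_iff)
  then have "(\<lambda>n. real n powr (- (real a + real b + 2 * Re s))) summable_on {0<..}"
    by (rule summable_on_subset_banach) simp
  then show ?thesis
    by (rule summable_on_cong[THEN iffD1, rotated]) (simp add: norm_psi)
qed

text \<open>The continuation of the sum of \<open>eis_term\<close> over the primitive vectors in the class of \<open>v0\<close>.
  For each \<open>n\<close> coprime to \<open>N\<close>, the vectors that \<open>n\<close> maps into the class of \<open>v0\<close> form the class
  of \<open>v0 / n\<close>.\<close>
definition eis_cont :: "nat \<Rightarrow> nat \<Rightarrow> complex \<Rightarrow> int \<times> int \<Rightarrow> complex \<Rightarrow> complex" where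
  "eis_cont k N \<tau> v0 s = of_real (Im \<tau>) powr s *
     (\<Sum>\<^sub>\<infinity>n\<in>{n. 0 < n \<and> coprime n N}. of_int (mu n) * psi k 0 s (of_nat n) * lattice_sum k N \<tau> (svec (inv_mod N n) v0) s)"

lemma eis_cont_holomorphic:
  assumes \<tau>: "Im \<tau> > 0" and N: "N \<ge> 1" and k: "k \<ge> 2"
  shows "eis_cont k N \<tau> v0 holomorphic_on {s. Re (of_nat k + 2 * s) > 1}"
proof -
  let ?S = "{s. Re (of_nat k + 2 * s) > 1}"
  let ?f = "\<lambda>n s. of_int (mu n) * psi k 0 s (of_nat n) * lattice_sum k N \<tau> (svec (inv_mod N n) v0) s"
  have S: "open ?S" by (intro open_Collect_less continuous_intros)
  note hol = lattice_sum_holomorphic[OF \<tau> N k]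
  have "(\<lambda>s. \<Sum>\<^sub>\<infinity>n\<in>{n. 0 < n \<and> coprime n N}. ?f n s) holomorphic_on ?S"
  proof (rule holomorphic_on_infsum(1)[OF S])
    show "?f n holomorphic_on ?S" for n
      by (intro holomorphic_intros hol)
    fix s0 assume s0: "s0 \<in> ?S"
    obtain e where e: "e > 0" "cball s0 e \<subseteq> ?S" using S s0 open_contains_cball by blast
    \<comment> \<open>Only finitely many lattice sums occur, as \<open>inv_mod\<close> takes values below \<open>N\<close>; so a bound on
      each of them near \<open>s0\<close> suffices.\<close>
    have bd: "\<exists>B. \<forall>s\<in>cball s0 e. norm (lattice_sum k N \<tau> (svec u v0) s) \<le> B" for u
    proof -
      have "continuous_on (cball s0 e) (lattice_sum k N \<tau> (svec u v0))"
        using holomorphic_on_imp_continuous_on[OF hol] continuous_on_subset e(2) by blast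
      then have "compact (lattice_sum k N \<tau> (svec u v0) ` cball s0 e)"
        by (intro compact_continuous_image) auto
      then show ?thesis using compact_imp_bounded bounded_iff by (metis imageI)
    qed
    then obtain B where B: "\<And>u s. s \<in> cball s0 e \<Longrightarrow> norm (lattice_sum k N \<tau> (svec u v0) s) \<le> B u" by metis
    define BB where "BB = (\<Sum>u\<in>{0..<int N}. \<bar>B u\<bar>)"
    define \<eta> where "\<eta> = (Re (of_nat k + 2 * s0) - 1) / 2"
    have \<eta>: "\<eta> > 0" unfolding \<eta>_def by (rule divide_pos_pos) (use s0 in simp_all)
    define d where "d = min e (\<eta> / 2)"
    define M where "M = (\<lambda>n::nat. real n powr (- (1 + \<eta>)) * BB)"
    have "M summable_on {n. 0 < n \<and> coprime n N}"
    proof -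
      have "summable (\<lambda>n. real n powr (- (1 + \<eta>)))" using \<eta> by (simp add: summable_real_powr_iff)
      then have "(\<lambda>n. real n powr (- (1 + \<eta>))) summable_on UNIV" by (simp add: summable_on_UNIV_nonneg_real_iff)
      then have "M summable_on UNIV" unfolding M_def by (rule summable_on_cmult_left)
      then show ?thesis by (rule summable_on_subset_banach) simp
    qed
    moreover have "norm (?f n s) \<le> M n" if n: "n \<in> {n. 0 < n \<and> coprime n N}" and s: "s \<in> ball s0 d \<inter> ?S" for n s
    proof -
      have se: "s \<in> cball s0 e" using s by (simp add: d_def)
      have "cmod (s0 - s) < \<eta> / 2" using s by (simp add: d_def dist_norm)
      then have "Re s0 - Re s < \<eta> / 2" using abs_Re_le_cmod[of "s0 - s"] by simp
      then have r: "real k + 2 * Re s \<ge> 1 + \<eta>" by (simp add: \<eta>_def field_simps)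
      have "norm (psi k 0 s (of_nat n)) = real n powr (- (real k + 2 * Re s))"
        using n by (simp add: norm_psi)
      also have "\<dots> \<le> real n powr (- (1 + \<eta>))"
        using n r by (intro powr_mono) auto
      finally have p: "norm (psi k 0 s (of_nat n)) \<le> real n powr (- (1 + \<eta>))" .
      have "norm (lattice_sum k N \<tau> (svec (inv_mod N n) v0) s) \<le> \<bar>B (inv_mod N n)\<bar>"
        using B[OF se, of "inv_mod N n"] by linarith
      also have "\<dots> \<le> BB" unfolding BB_def
        by (rule member_le_sum) (use inv_mod(1)[OF N, of n] n in auto)
      finally have l: "norm (lattice_sum k N \<tau> (svec (inv_mod N n) v0) s) \<le> BB" .
      have m: "norm (of_int (mu n) :: complex) \<le> 1"
        using abs_mu_le_1[of n] by (simp flip: of_int_abs)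
      have "norm (?f n s) \<le> 1 * real n powr (- (1 + \<eta>)) * BB"
        unfolding norm_mult by (intro mult_mono m p l mult_nonneg_nonneg) auto
      then show ?thesis by (simp add: M_def)
    qed
    moreover have "d > 0" using e \<eta> by (simp add: d_def)
    ultimately show "\<exists>d>0. \<exists>F M. finite F \<and> M summable_on {n. 0 < n \<and> coprime n N} \<and>
       (\<forall>n\<in>{n. 0 < n \<and> coprime n N} - F. \<forall>s\<in>ball s0 d \<inter> ?S. norm (?f n s) \<le> M n)"
      by (intro exI[of _ d] conjI exI[of _ "{}"] exI[of _ M]) auto
  qed
  then show ?thesis unfolding eis_cont_def[abs_def] using \<tau>
    by (intro holomorphic_intros) auto
qed

definition eis_term :: "nat \<Rightarrow> complex \<Rightarrow> complex \<Rightarrow> int \<times> int \<Rightarrow> complex" where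
  "eis_term k s \<tau> v = of_real (Im \<tau>) powr s / (lin \<tau> v ^ k * of_real (cmod (lin \<tau> v)) powr (2 * s))"

lemma eis_term_eq_psi: "eis_term k s \<tau> v = of_real (Im \<tau>) powr s * psi k 0 s (lin \<tau> v)"
  by (simp add: eis_term_def psi_def)

lemma summable_on_eis_term:
  assumes \<tau>: "Im \<tau> > 0" and s: "Re (of_nat k + 2 * s) > 2"
  shows "(\<lambda>v. eis_term k s \<tau> v) summable_on A"
  unfolding eis_term_eq_psi
  by (intro summable_on_cmult_right summable_on_psi_lin(2)[OF \<tau>]) (use s in simp)

lemma eis_cont_eq:
  assumes \<tau>: "Im \<tau> > 0" and N: "N \<ge> 1" and k: "k \<ge> 2" and v0: "v0 \<in> prim" and s: "Re (of_nat k + 2 * s) > 2"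
  shows "eis_cont k N \<tau> v0 s = (\<Sum>\<^sub>\<infinity>v\<in>vclass N v0 \<inter> prim. eis_term k s \<tau> v)"
proof -
  let ?f = "\<lambda>v. psi k 0 s (lin \<tau> v)"
  have "(\<Sum>\<^sub>\<infinity>v\<in>vclass N v0 \<inter> prim. ?f v) =
      (\<Sum>\<^sub>\<infinity>n\<in>{0<..}. of_int (mu n) * psi k 0 s (of_nat n) * (\<Sum>\<^sub>\<infinity>v\<in>{v. svec (int n) v \<in> vclass N v0}. ?f v))"
  proof (rule primitive_sum_moebius)
    show "(\<lambda>v. norm (?f v)) summable_on UNIV" by (rule summable_on_psi_lin(1)[OF \<tau>]) (use s in simp)
    show "(\<lambda>n. norm (psi k 0 s (of_nat n))) summable_on {0<..}"
      by (rule summable_on_psi_of_nat) (use s in simp)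
    show "?f (svec (int n) v) = psi k 0 s (of_nat n) * ?f v" for n v
      by (simp add: lin_svec psi_mult_of_nat)
  qed (simp add: lin_def)
  also have "\<dots> = (\<Sum>\<^sub>\<infinity>n\<in>{n. 0 < n \<and> coprime n N}. of_int (mu n) * psi k 0 s (of_nat n) * lattice_sum k N \<tau> (svec (inv_mod N n) v0) s)"
    by (rule infsum_cong_neutral) (auto simp: svec_in_vclass[OF N v0] lattice_sum_eq[OF \<tau> N k s])
  finally show ?thesis
    unfolding eis_cont_def eis_term_eq_psi infsum_cmult_right' by simp
qed

section \<open>Values of continuations\<close>

text \<open>The relation underlying the definite description in \<open>continued_value_at_0\<close>. It composes
  with sums and scalars before uniqueness is known.\<close>
definition continuation_value :: "nat \<Rightarrow> (complex \<Rightarrow> complex) \<Rightarrow> complex \<Rightarrow> bool" where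
  "continuation_value k \<phi> x \<longleftrightarrow>
     (\<exists>F. F holomorphic_on {s. Re (of_nat k + 2 * s) > 1} \<and>
          (\<forall>s. Re (of_nat k + 2 * s) > 2 \<longrightarrow> F s = \<phi> s) \<and> x = F 0)"

lemma continuation_value_unique:
  assumes k: "k \<ge> 2" and x: "continuation_value k \<phi> x" and y: "continuation_value k \<phi> y"
  shows "x = y"
proof -
  let ?S = "{s::complex. Re (of_nat k + 2 * s) > 1}" and ?U = "{s::complex. Re (of_nat k + 2 * s) > 2}"
  obtain F G where F: "F holomorphic_on ?S" "\<And>s. s \<in> ?U \<Longrightarrow> F s = \<phi> s" "x = F 0"
    and G: "G holomorphic_on ?S" "\<And>s. s \<in> ?U \<Longrightarrow> G s = \<phi> s" "y = G 0"
    using x y unfolding continuation_value_def by blast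
  have S: "?S = {s. Re s > (1 - real k) / 2}" by (auto simp: field_simps)
  have "F 0 = G 0"
  proof (rule analytic_continuation_open[of ?U ?S F G 0])
    show "open ?U" by (intro open_Collect_less continuous_intros)
    show "open ?S" by (intro open_Collect_less continuous_intros)
    show "connected ?S" unfolding S by (intro convex_connected convex_halfspace_Re_gt)
    have "(2 :: complex) \<in> ?U" by simp
    then show "?U \<noteq> {}" by blast
    show "0 \<in> ?S" using k by simp
  qed (use F G in auto)
  then show ?thesis using F G by simp
qed

lemma continued_value_at_0_eqI:
  assumes k: "k \<ge> 2" and x: "continuation_value k \<phi> x"
  shows "continued_value_at_0 k \<phi> = x"
proof -
  have "continued_value_at_0 k \<phi> = (THE v. continuation_value k \<phi> v)"
    unfolding continued_value_at_0_def continuation_value_def ..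
  also have "\<dots> = x" by (rule the_equality[of "continuation_value k \<phi>", OF x]) (rule continuation_value_unique[OF k _ x])
  finally show ?thesis .
qed

lemma continuation_value_sum:
  assumes "\<And>i. i \<in> I \<Longrightarrow> continuation_value k (\<phi> i) (x i)"
  shows "continuation_value k (\<lambda>s. \<Sum>i\<in>I. c i * \<phi> i s) (\<Sum>i\<in>I. c i * x i)"
proof -
  obtain F where F: "\<And>i. i \<in> I \<Longrightarrow> F i holomorphic_on {s. Re (of_nat k + 2 * s) > 1}"
    "\<And>i s. i \<in> I \<Longrightarrow> Re (of_nat k + 2 * s) > 2 \<Longrightarrow> F i s = \<phi> i s" "\<And>i. i \<in> I \<Longrightarrow> x i = F i 0"
    using assms unfolding continuation_value_def by metis
  show ?thesis unfolding continuation_value_def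
    by (rule exI[of _ "\<lambda>s. \<Sum>i\<in>I. c i * F i s"]) (intro conjI holomorphic_on_sum holomorphic_on_mult holomorphic_on_const F(1), simp_all add: F(3), simp add: F(2))
qed

lemma continuation_value_cmult:
  assumes "continuation_value k \<phi> x"
  shows "continuation_value k (\<lambda>s. c * \<phi> s) (c * x)"
  using continuation_value_sum[of "{()}" k "\<lambda>_. \<phi>" "\<lambda>_. x" "\<lambda>_. c"] assms by simp

lemma continuation_value_cong:
  assumes "\<And>s. Re (of_nat k + 2 * s) > 2 \<Longrightarrow> \<phi> s = \<phi>' s"
  shows "continuation_value k \<phi> x \<longleftrightarrow> continuation_value k \<phi>' x"
  using assms unfolding continuation_value_def by simp

lemma continuation_value_class:
  assumes \<tau>: "Im \<tau> > 0" and N: "N \<ge> 1" and k: "k \<ge> 2" and v0: "v0 \<in> prim"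
  shows "continuation_value k (\<lambda>s. \<Sum>\<^sub>\<infinity>v\<in>vclass N v0 \<inter> prim. eis_term k s \<tau> v) (eis_cont k N \<tau> v0 0)"
  unfolding continuation_value_def
  using eis_cont_holomorphic[OF \<tau> N k] eis_cont_eq[OF \<tau> N k v0] by blast

section \<open>Weight at least three\<close>

lemma lin_nonzero: "Im \<tau> > 0 \<Longrightarrow> v \<noteq> (0, 0) \<Longrightarrow> lin \<tau> v \<noteq> 0"
  by (cases v) (auto simp: lin_def complex_eq_iff)

lemma lin_0 [simp]: "lin \<tau> (0, 0) = 0" by (simp add: lin_def)

lemma psi_at_0: "psi a 0 0 z = 1 / z ^ a" if "a \<noteq> 0"
  using that by (cases "z = 0") (auto simp: psi_def)

lemma open_uhp: "open {\<tau>. Im \<tau> > 0}"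
  by (intro open_Collect_less continuous_intros)

lemma lin_holomorphic [holomorphic_intros]: "(\<lambda>\<tau>. lin \<tau> v) holomorphic_on A"
  unfolding lin_def by (intro holomorphic_intros)

lemma inverse_lin_holomorphic [holomorphic_intros]:
  "(\<lambda>\<tau>. 1 / lin \<tau> v ^ k) holomorphic_on {\<tau>. Im \<tau> > 0}"
proof (cases "v = (0, 0)")
  case False
  then show ?thesis using lin_nonzero by (intro holomorphic_intros) auto
qed simp

lemma lin_lower_bound_local:
  assumes \<tau>0: "Im \<tau>0 > 0"
  obtains d \<kappa> where "d > 0" "\<kappa> > 0"
    "\<forall>\<tau>\<in>ball \<tau>0 d. Im \<tau> > 0 \<and> (\<forall>v. v \<noteq> (0, 0) \<longrightarrow> \<kappa> * wt v powr (1/2) \<le> cmod (lin \<tau> v))"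
proof -
  define d where "d = Im \<tau>0 / 2"
  have d: "d > 0" using \<tau>0 by (simp add: d_def)
  have near: "Im \<tau> \<ge> d" "cmod \<tau> \<le> cmod \<tau>0 + d" if "\<tau> \<in> ball \<tau>0 d" for \<tau>
  proof -
    have n: "cmod (\<tau> - \<tau>0) < d" using that by (simp add: dist_norm norm_minus_commute)
    then have "\<bar>Im \<tau> - Im \<tau>0\<bar> < d" using abs_Im_le_cmod[of "\<tau> - \<tau>0"] by simp
    then show "Im \<tau> \<ge> d" unfolding d_def by linarith
    show "cmod \<tau> \<le> cmod \<tau>0 + d" using n norm_triangle_sub[of \<tau> \<tau>0] by simp
  qed
  from lin_lower_bound[OF d, of "cmod \<tau>0 + d"] obtain \<kappa> where \<kappa>: "\<kappa> > 0"
    "\<And>\<tau> v. Im \<tau> \<ge> d \<Longrightarrow> cmod \<tau> \<le> cmod \<tau>0 + d \<Longrightarrow> v \<noteq> (0, 0) \<Longrightarrow> \<kappa> * wt v powr (1/2) \<le> cmod (lin \<tau> v)"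
    by metis
  show ?thesis
  proof (rule that[OF d \<kappa>(1)], intro ballI conjI allI impI)
    show "Im \<tau> > 0" if "\<tau> \<in> ball \<tau>0 d" for \<tau> using near(1)[OF that] d by simp
    show "\<kappa> * wt v powr (1/2) \<le> cmod (lin \<tau> v)" if "\<tau> \<in> ball \<tau>0 d" "v \<noteq> (0, 0)" for \<tau> v
      by (rule \<kappa>(2)[OF near[OF that(1)] that(2)])
  qed
qed

text \<open>For \<open>k \<ge> 3\<close> the point \<open>s = 0\<close> lies in the half plane of absolute convergence.\<close>
lemma eis_cont_0_eq:
  assumes \<tau>: "Im \<tau> > 0" and N: "N \<ge> 1" and k: "k \<ge> 3" and v0: "v0 \<in> prim"
  shows "eis_cont k N \<tau> v0 0 = (\<Sum>\<^sub>\<infinity>v\<in>vclass N v0 \<inter> prim. 1 / lin \<tau> v ^ k)"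
proof -
  have "eis_cont k N \<tau> v0 0 = (\<Sum>\<^sub>\<infinity>v\<in>vclass N v0 \<inter> prim. eis_term k 0 \<tau> v)"
    by (rule eis_cont_eq[OF \<tau> N _ v0]) (use k in simp_all)
  also have "\<dots> = (\<Sum>\<^sub>\<infinity>v\<in>vclass N v0 \<inter> prim. 1 / lin \<tau> v ^ k)"
    using \<tau> k by (intro infsum_cong) (auto simp: eis_term_eq_psi psi_at_0)
  finally show ?thesis .
qed

lemma eis_cont_0_holomorphic:
  assumes N: "N \<ge> 1" and k: "k \<ge> 3" and v0: "v0 \<in> prim"
  shows "(\<lambda>\<tau>. eis_cont k N \<tau> v0 0) holomorphic_on {\<tau>. Im \<tau> > 0}"
proof -
  have "(\<lambda>\<tau>. \<Sum>\<^sub>\<infinity>v\<in>vclass N v0 \<inter> prim. 1 / lin \<tau> v ^ k) holomorphic_on {\<tau>. Im \<tau> > 0}"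
  proof (rule holomorphic_on_infsum(1)[OF open_uhp inverse_lin_holomorphic])
    fix \<tau>0 :: complex assume "\<tau>0 \<in> {\<tau>. Im \<tau> > 0}"
    then have "Im \<tau>0 > 0" by simp
    then obtain d \<kappa> where d: "d > 0" "\<kappa> > 0"
      and \<kappa>: "\<forall>\<tau>\<in>ball \<tau>0 d. Im \<tau> > 0 \<and> (\<forall>v. v \<noteq> (0, 0) \<longrightarrow> \<kappa> * wt v powr (1/2) \<le> cmod (lin \<tau> v))"
      by (rule lin_lower_bound_local)
    define M where "M = (\<lambda>v. \<kappa> powr (- real k) * wt v powr (- (real k / 2)))"
    have "M summable_on vclass N v0 \<inter> prim"
      unfolding M_def by (intro summable_on_cmult_right summable_on_wt_powr) (use k in simp)
    moreover have "norm (1 / lin \<tau> v ^ k) \<le> M v"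
      if v: "v \<in> vclass N v0 \<inter> prim - {(0, 0)}" and \<tau>: "\<tau> \<in> ball \<tau>0 d \<inter> {\<tau>. Im \<tau> > 0}" for v \<tau>
    proof -
      have lb: "\<kappa> * wt v powr (1/2) \<le> cmod (lin \<tau> v)" using \<kappa> v \<tau> by blast
      have "norm (psi k 0 0 (lin \<tau> v)) \<le> \<kappa> powr (- real k) * wt v powr (- (real k / 2))"
        by (rule norm_psi_lin_le[OF d(2) lb]) auto
      then show ?thesis using k by (simp add: psi_at_0 M_def)
    qed
    ultimately show "\<exists>d>0. \<exists>F M. finite F \<and> M summable_on vclass N v0 \<inter> prim \<and>
        (\<forall>v\<in>vclass N v0 \<inter> prim - F. \<forall>\<tau>\<in>ball \<tau>0 d \<inter> {\<tau>. Im \<tau> > 0}. norm (1 / lin \<tau> v ^ k) \<le> M v)"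
      using d(1) by (intro exI[of _ d] conjI exI[of _ "{(0, 0)}"] exI[of _ M]) auto
  qed
  then show ?thesis
    by (rule holomorphic_transform) (use eis_cont_0_eq[OF _ N k v0] in simp)
qed

text \<open>The boundary value at \<open>\<i>\<infinity>\<close> of the series of the class of \<open>v0\<close>: only the terms of \<open>(0, 1)\<close>
  and \<open>(0, -1)\<close> survive, the second with the sign \<open>(-1) ^ k\<close>.\<close>
definition vlimit :: "nat \<Rightarrow> nat \<Rightarrow> int \<times> int \<Rightarrow> complex" where
  "vlimit k N v0 = of_bool ((0, 1) \<in> vclass N v0) + (- 1) ^ k * of_bool ((0, - 1) \<in> vclass N v0)"

text \<open>The limit of \<open>(c\<tau> + d) ^ -k\<close> as \<open>\<tau>\<close> tends to \<open>\<i>\<infinity>\<close> along the imaginary axis; at \<open>(0, 0)\<close> it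
  is 0, as division by zero gives 0.\<close>
definition cusp_term :: "nat \<Rightarrow> int \<times> int \<Rightarrow> complex" where
  "cusp_term k v = (if fst v = 0 then 1 / of_int (snd v) ^ k else 0)"

lemma infsum_cusp_term_prim: "(\<Sum>\<^sub>\<infinity>v\<in>vclass N v0 \<inter> prim. cusp_term k v) = vlimit k N v0"
proof -
  have "(\<Sum>\<^sub>\<infinity>v\<in>vclass N v0 \<inter> prim. cusp_term k v) = (\<Sum>\<^sub>\<infinity>v\<in>vclass N v0 \<inter> {(0, 1), (0, - 1)}. cusp_term k v)"
  proof (rule infsum_cong_neutral)
    fix v assume v: "v \<in> vclass N v0 \<inter> prim - vclass N v0 \<inter> {(0, 1), (0, - 1)}"
    have "fst v \<noteq> 0"
    proof
      assume "fst v = 0"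
      with v have "\<bar>snd v\<bar> = 1" by (auto simp: prim_def)
      with v \<open>fst v = 0\<close> show False by (cases v) (auto simp: abs_if split: if_splits)
    qed
    then show "cusp_term k v = 0" by (simp add: cusp_term_def)
  qed (auto simp: prim_def)
  also have "\<dots> = (\<Sum>v\<in>{(0, 1), (0, - 1)}. if v \<in> vclass N v0 then cusp_term k v else 0)"
    by (subst infsum_finite) (auto simp: sum.inter_restrict[symmetric] Int_commute)
  also have "\<dots> = vlimit k N v0"
    by (simp add: vlimit_def cusp_term_def of_bool_def power_divide divide_inverse flip: power_inverse)
  finally show ?thesis .
qed

lemma norm_lin_imaginary_ge:
  assumes "y \<ge> 1"
  shows "cmod (lin (\<i> * of_real y) v) \<ge> cmod (lin \<i> v)"
proof -
  have "1\<^sup>2 \<le> y\<^sup>2" using assms by (intro power_mono) auto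
  then have "(of_int (fst v))\<^sup>2 * 1 \<le> (of_int (fst v))\<^sup>2 * y\<^sup>2" by (intro mult_left_mono) auto
  then show ?thesis
    by (simp add: lin_def cmod_def power_mult_distrib)
qed

lemma tendsto_inverse_lin:
  assumes k: "k \<noteq> 0"
  shows "((\<lambda>y. 1 / lin (\<i> * of_real y) v ^ k) \<longlongrightarrow> cusp_term k v) at_top"
proof (cases "fst v = 0")
  case True
  then show ?thesis by (simp add: lin_def cusp_term_def)
next
  case False
  have "filterlim (\<lambda>y::real. \<bar>of_int (fst v)\<bar> * y) at_top at_top"
    by (rule filterlim_tendsto_pos_mult_at_top[where f = "\<lambda>_. \<bar>real_of_int (fst v)\<bar>" and g = "\<lambda>y. y" and c = "\<bar>real_of_int (fst v)\<bar>"])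
       (use False in \<open>auto intro: filterlim_ident\<close>)
  moreover have "\<forall>\<^sub>F y in at_top. \<bar>of_int (fst v)\<bar> * y \<le> cmod (lin (\<i> * of_real y) v)"
    using eventually_ge_at_top[of 0]
  proof eventually_elim
    case (elim y)
    have "\<bar>of_int (fst v)\<bar> * y = \<bar>Im (lin (\<i> * of_real y) v)\<bar>" using elim by (simp add: lin_def abs_mult)
    then show ?case using abs_Im_le_cmod by metis
  qed
  ultimately have "filterlim (\<lambda>y. cmod (lin (\<i> * of_real y) v)) at_top at_top"
    by (rule filterlim_at_top_mono)
  then have "((\<lambda>y. psi k 0 0 (lin (\<i> * of_real y) v)) \<longlongrightarrow> 0) at_top"
    by (rule psi_tendsto_0[rotated]) (use k in simp)
  then show ?thesis using False k by (simp add: psi_at_0 cusp_term_def)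
qed

text \<open>On the imaginary axis above \<open>\<i>\<close> the terms are dominated by their values at \<open>\<i>\<close>, so the
  limit may be taken termwise.\<close>
lemma eis_cont_0_limit:
  assumes N: "N \<ge> 1" and k: "k \<ge> 3" and v0: "v0 \<in> prim"
  shows "((\<lambda>y. eis_cont k N (\<i> * of_real y) v0 0) \<longlongrightarrow> vlimit k N v0) at_top"
proof -
  have "((\<lambda>y. \<Sum>\<^sub>\<infinity>v\<in>vclass N v0 \<inter> prim. 1 / lin (\<i> * of_real y) v ^ k) \<longlongrightarrow> (\<Sum>\<^sub>\<infinity>v\<in>vclass N v0 \<inter> prim. cusp_term k v)) at_top"
  proof (rule tendsto_infsum)
    show "((\<lambda>y. 1 / lin (\<i> * of_real y) v ^ k) \<longlongrightarrow> cusp_term k v) at_top" for v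
      by (rule tendsto_inverse_lin) (use k in simp)
    show "(\<lambda>v. norm (psi k 0 0 (lin \<i> v))) summable_on vclass N v0 \<inter> prim"
      by (rule summable_on_psi_lin(1)) (use k in simp_all)
    fix v y assume v: "v \<in> vclass N v0 \<inter> prim" and y: "y \<in> {1::real..}"
    have "v \<noteq> (0, 0)" using v by (auto simp: prim_def)
    then have "lin \<i> v \<noteq> 0" by (intro lin_nonzero) simp_all
    then have "1 / cmod (lin (\<i> * of_real y) v) ^ k \<le> 1 / cmod (lin \<i> v) ^ k"
      using norm_lin_imaginary_ge[of y v] y by (intro divide_left_mono power_mono mult_pos_pos zero_less_power) (auto intro: less_le_trans)
    then show "norm (1 / lin (\<i> * of_real y) v ^ k) \<le> norm (psi k 0 0 (lin \<i> v))"
      using k by (simp add: psi_at_0 norm_divide norm_power)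
  qed (use eventually_ge_at_top[of "1::real"] in auto)
  then have "((\<lambda>y. \<Sum>\<^sub>\<infinity>v\<in>vclass N v0 \<inter> prim. 1 / lin (\<i> * of_real y) v ^ k) \<longlongrightarrow> vlimit k N v0) at_top"
    by (simp only: infsum_cusp_term_prim)
  then show ?thesis
  proof (rule Lim_transform_eventually)
    show "\<forall>\<^sub>F y in at_top. (\<Sum>\<^sub>\<infinity>v\<in>vclass N v0 \<inter> prim. 1 / lin (\<i> * of_real y) v ^ k) = eis_cont k N (\<i> * of_real y) v0 0"
      using eventually_gt_at_top[of "0::real"]
      by eventually_elim (subst eis_cont_0_eq[OF _ N k v0]; simp)
  qed
qed

section \<open>Weight two\<close>

lemma cot_tendsto:
  assumes "filterlim (\<lambda>x. Im (f x)) at_top F"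
  shows "((\<lambda>x. cot (f x)) \<longlongrightarrow> - \<i>) F"
proof -
  \<comment> \<open>Euler's formulas give the cotangent as a rational function of \<open>exp (2\<i>w)\<close>, which tends to
    0.\<close>
  have cot: "cot w = \<i> * (exp (2 * \<i> * w) + 1) / (exp (2 * \<i> * w) - 1)" for w
  proof -
    define e where "e = exp (\<i> * w)"
    have e: "e \<noteq> 0" by (simp add: e_def)
    have sq: "exp (2 * \<i> * w) = e * e" by (simp add: e_def exp_add[symmetric] algebra_simps)
    have m: "exp (- (\<i> * w)) = inverse e" by (simp only: e_def exp_minus)
    have inv: "e + inverse e = (e * e + 1) / e" "e - inverse e = (e * e - 1) / e"
      using e by (simp_all add: divide_inverse distrib_right left_diff_distrib mult.assoc)
    have "cos w = (e + inverse e) / 2" unfolding cos_exp_eq m e_def ..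
    then have c: "cos w = (e * e + 1) / (2 * e)" unfolding inv by (simp only: divide_divide_eq_left mult.commute)
    have "sin w = (e - inverse e) / (2 * \<i>)" unfolding sin_exp_eq m e_def ..
    then have s: "sin w = (e * e - 1) / (2 * \<i> * e)" unfolding inv by (simp only: divide_divide_eq_left mult.commute)
    have "cot w = ((e * e + 1) / (2 * e)) / ((e * e - 1) / (2 * \<i> * e))" by (simp only: cot_def c s)
    also have "\<dots> = ((2 * e) * (\<i> * (e * e + 1))) / ((2 * e) * (e * e - 1))" by (simp add: mult_ac)
    also have "\<dots> = \<i> * (e * e + 1) / (e * e - 1)" using e by (intro mult_divide_mult_cancel_left) simp
    finally show ?thesis by (simp only: sq)
  qed
  have "((\<lambda>x. exp (2 * \<i> * f x)) \<longlongrightarrow> 0) F"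
  proof (rule Lim_null_comparison)
    show "\<forall>\<^sub>F x in F. norm (exp (2 * \<i> * f x)) \<le> exp (- (2 * Im (f x)))"
      by (simp add: norm_exp_eq_Re)
    have "filterlim (\<lambda>x. 2 * Im (f x)) at_top F"
      by (rule filterlim_tendsto_pos_mult_at_top[OF tendsto_const _ assms]) simp
    then have "filterlim (\<lambda>x. - (2 * Im (f x))) at_bot F" by (simp add: filterlim_uminus_at_bot)
    then show "((\<lambda>x. exp (- (2 * Im (f x)))) \<longlongrightarrow> 0) F" by (rule filterlim_compose[OF exp_at_bot])
  qed
  then have "((\<lambda>x. \<i> * (exp (2 * \<i> * f x) + 1) / (exp (2 * \<i> * f x) - 1)) \<longlongrightarrow> \<i> * (0 + 1) / (0 - 1)) F"
    by (intro tendsto_intros) auto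
  then show ?thesis unfolding cot by simp
qed

text \<open>Logarithmic derivative of the reflection formula for the Gamma function.\<close>
lemma Digamma_reflection:
  fixes x :: complex
  assumes x: "x \<notin> \<int>"
  shows "Digamma (1 - x) - Digamma x = of_real pi * cot (of_real pi * x)"
proof -
  have x': "x \<notin> \<int>\<^sub>\<le>\<^sub>0" "1 - x \<notin> \<int>\<^sub>\<le>\<^sub>0"
    using x nonpos_Ints_Int[of x] nonpos_Ints_Int[of "1 - x"] by (auto simp: minus_in_Ints_iff dest: Ints_diff[OF Ints_1])
  have s: "sin (of_real pi * x) \<noteq> 0"
  proof
    assume "sin (of_real pi * x) = 0"
    then obtain n :: int where "of_real pi * x = of_real (of_int n * pi)" unfolding sin_eq_0 by auto
    then have "x = of_int n" by simp
    then show False using x by simp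
  qed
  let ?G = "Gamma x * Gamma (1 - x)"
  have G0: "?G \<noteq> 0" using x' by (simp add: Gamma_eq_zero_iff)
  have "((\<lambda>z. Gamma z * Gamma (1 - z)) has_field_derivative ?G * (Digamma x - Digamma (1 - x))) (at x)"
    using x' by (auto intro!: derivative_eq_intros simp: algebra_simps)
  moreover have "((\<lambda>z. of_real pi / sin (of_real pi * z)) has_field_derivative
      - (of_real pi / sin (of_real pi * x)) * (of_real pi * cot (of_real pi * x))) (at x)"
    using s by (auto intro!: derivative_eq_intros simp: cot_def field_simps)
  ultimately have "?G * (Digamma x - Digamma (1 - x)) = - (of_real pi / sin (of_real pi * x)) * (of_real pi * cot (of_real pi * x))"
    unfolding Gamma_reflection_complex by (rule DERIV_unique)
  then have "?G * (Digamma x - Digamma (1 - x)) = ?G * (- (of_real pi * cot (of_real pi * x)))"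
    unfolding Gamma_reflection_complex[of x, symmetric] by simp
  then have "Digamma x - Digamma (1 - x) = - (of_real pi * cot (of_real pi * x))"
    using G0 by (simp only: mult_cancel_left simp_thms)
  then show ?thesis by (simp add: algebra_simps)
qed

lemma sums_Digamma_diff:
  fixes x y :: complex
  assumes "x \<noteq> 0" "y \<noteq> 0"
  shows "(\<lambda>n. 1 / (x + of_nat n) - 1 / (y + of_nat n)) sums (Digamma y - Digamma x)"
proof -
  have *: "(\<lambda>n. inverse (of_nat (n + 1)) - inverse (z + of_nat n)) sums (Digamma z + euler_mascheroni)"
    if "z \<noteq> 0" for z :: complex
    using summable_Digamma[OF that] by (simp add: Digamma_def summable_sums)
  from sums_diff[OF *[OF assms(2)] *[OF assms(1)]] show ?thesis by (simp add: inverse_eq_divide)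
qed

text \<open>The partial fraction expansion of the cotangent, in a form where the unordered sum
  converges: the half-sums over \<open>n \<ge> 0\<close> and \<open>n < 0\<close> are differences of Digamma values, combined
  by the reflection formula.\<close>
lemma infsum_cot:
  fixes x y :: complex
  assumes x: "Im x \<noteq> 0" and y: "Im y \<noteq> 0"
    and sm: "(\<lambda>n::int. 1 / (x + of_int n) - 1 / (y + of_int n)) summable_on UNIV"
  shows "(\<Sum>\<^sub>\<infinity>n::int. 1 / (x + of_int n) - 1 / (y + of_int n)) = of_real pi * (cot (of_real pi * x) - cot (of_real pi * y))"
proof -
  let ?f = "\<lambda>n::int. 1 / (x + of_int n) - 1 / (y + of_int n)"
  have nI: "z \<notin> \<int>" "z \<noteq> 0" "1 - z \<noteq> 0" if "Im z \<noteq> 0" for z :: complex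
    using that by (auto elim!: Ints_cases simp: complex_eq_iff)
  have inj1: "inj int" and inj2: "inj (\<lambda>n. - int n - 1)" by (auto simp: inj_on_def)
  have U: "(UNIV :: int set) = range int \<union> range (\<lambda>n. - int n - 1)"
  proof (rule UNIV_eq_I)
    fix z :: int
    show "z \<in> range int \<union> range (\<lambda>n. - int n - 1)"
    proof (cases "z \<ge> 0")
      case True then show ?thesis by (intro UnI1 image_eqI[of _ _ "nat z"]) auto
    next
      case False then show ?thesis by (intro UnI2 image_eqI[of _ _ "nat (- z - 1)"]) auto
    qed
  qed
  have sm1: "?f summable_on range int" and sm2: "?f summable_on range (\<lambda>n. - int n - 1)"
    using sm summable_on_subset_banach by blast+
  have "(\<Sum>\<^sub>\<infinity>n::int. ?f n) = infsum ?f (range int) + infsum ?f (range (\<lambda>n. - int n - 1))"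
    by (subst U, rule infsum_Un_disjoint[OF sm1 sm2]) auto
  also have "infsum ?f (range int) = Digamma y - Digamma x"
  proof -
    have "infsum ?f (range int) = infsum (?f \<circ> int) UNIV" by (rule infsum_reindex[OF inj1])
    moreover have "((?f \<circ> int) has_sum infsum (?f \<circ> int) UNIV) UNIV"
      using sm1 by (intro has_sum_infsum) (simp only: summable_on_reindex[OF inj1])
    from has_sum_imp_sums[OF this] have "(\<lambda>n. 1 / (x + of_nat n) - 1 / (y + of_nat n)) sums infsum (?f \<circ> int) UNIV"
      by (simp add: o_def)
    ultimately show ?thesis using sums_unique2[OF sums_Digamma_diff[OF nI(2)[OF x] nI(2)[OF y]]] by simp
  qed
  also have "infsum ?f (range (\<lambda>n. - int n - 1)) = - (Digamma (1 - y) - Digamma (1 - x))"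
  proof -
    let ?g = "\<lambda>n. - int n - 1"
    obtain I where I: "I = infsum (?f \<circ> ?g) UNIV" by simp
    have "infsum ?f (range ?g) = I" unfolding I by (rule infsum_reindex[OF inj2])
    moreover have "((?f \<circ> ?g) has_sum I) UNIV"
      unfolding I using sm2 by (intro has_sum_infsum) (simp only: summable_on_reindex[OF inj2])
    from has_sum_imp_sums[OF this] have sA: "(?f \<circ> ?g) sums I" .
    have eq: "(?f \<circ> ?g) = (\<lambda>n. - (1 / ((1 - x) + of_nat n) - 1 / ((1 - y) + of_nat n)))"
    proof
      fix n
      have neg: "1 / (z + of_int (- int n - 1)) = - (1 / ((1 - z) + of_nat n))" for z :: complex
      proof -
        have "z + of_int (- int n - 1) = - ((1 - z) + of_nat n)" by simp
        then show ?thesis by (simp only: divide_minus_right)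
      qed
      show "(?f \<circ> ?g) n = - (1 / ((1 - x) + of_nat n) - 1 / ((1 - y) + of_nat n))"
        unfolding o_def neg by simp
    qed
    have "(\<lambda>n. - (1 / ((1 - x) + of_nat n) - 1 / ((1 - y) + of_nat n))) sums - (Digamma (1 - y) - Digamma (1 - x))"
      by (intro sums_minus sums_Digamma_diff nI x y)
    with sA[unfolded eq] have "I = - (Digamma (1 - y) - Digamma (1 - x))" by (rule sums_unique2)
    ultimately show ?thesis by (rule trans)
  qed
  finally show ?thesis
    using Digamma_reflection[OF nI(1)[OF x]] Digamma_reflection[OF nI(1)[OF y]] by (simp add: algebra_simps)
qed

lemma psi_rem_weight_2: "psi_rem 1 0 0 u z = - u / z\<^sup>2 - (1 / (z + u) - 1 / z)"
proof -
  have "psi (Suc 1) 0 0 z = 1 / z\<^sup>2" by (subst psi_at_0) (simp_all add: power2_eq_square)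
  moreover have "psi 1 0 0 w = 1 / w" for w by (subst psi_at_0) simp_all
  ultimately show ?thesis by (simp add: psi_rem_def dpsi_def)
qed

lemma filterlim_abs_int:
  "filterlim (\<lambda>d::int. cmod (of_int d)) at_top at_top" "filterlim (\<lambda>d::int. cmod (of_int d)) at_top at_bot"
  unfolding filterlim_at_top using eventually_le_abs_int by simp_all

lemma inverse_lin_tendsto_0:
  assumes "filterlim (\<lambda>x. cmod (f x)) at_top F"
  shows "((\<lambda>x. 1 / f x :: complex) \<longlongrightarrow> 0) F"
  using psi_tendsto_0[of 1 0 0 f F, OF _ assms] by (simp add: psi_at_0)

lemma summable_on_inverse_lin_diff:
  assumes \<tau>: "Im \<tau> > 0"
  shows "(\<lambda>d. 1 / lin \<tau> (c, d) - 1 / lin \<tau> (c', d)) summable_on A"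
proof -
  let ?f = "\<lambda>d. 1 / lin \<tau> (c, d) - 1 / lin \<tau> (c', d)"
  from lin_lower_bound_linear[OF \<tau>, of "cmod \<tau>"] obtain \<kappa> where \<kappa>: "\<kappa> > 0"
    "\<And>v. v \<noteq> (0, 0) \<Longrightarrow> \<kappa> * (1 + \<bar>of_int (fst v)\<bar> + \<bar>of_int (snd v)\<bar>) \<le> cmod (lin \<tau> v)"
    by (metis order_refl)
  have lb: "\<kappa> * (1 + \<bar>of_int d\<bar>) \<le> cmod (lin \<tau> (c, d))" if "d \<noteq> 0" for c d
  proof -
    have "\<kappa> * (1 + \<bar>of_int d\<bar>) \<le> \<kappa> * (1 + \<bar>of_int c\<bar> + \<bar>of_int d\<bar>)"
      using \<kappa>(1) by (intro mult_left_mono) auto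
    also have "\<dots> \<le> cmod (lin \<tau> (c, d))" using \<kappa>(2)[of "(c, d)"] that by simp
    finally show ?thesis .
  qed
  define M where "M = (\<lambda>d::int. cmod (of_int (c' - c) * \<tau>) / \<kappa>\<^sup>2 * (1 + \<bar>of_int d\<bar>) powr (- 2))"
  have "(\<lambda>d. norm (?f d)) summable_on (A - {0})"
  proof (rule Infinite_Sum.abs_summable_on_comparison_test')
    have "M summable_on UNIV" unfolding M_def by (intro summable_on_cmult_right summable_on_int_powr) simp
    then show "M summable_on (A - {0})" by (rule summable_on_subset_banach) simp
    fix d assume d: "d \<in> A - {0}"
    have nz: "lin \<tau> (c, d) \<noteq> 0" "lin \<tau> (c', d) \<noteq> 0" using d by (auto intro!: lin_nonzero[OF \<tau>])
    have pos: "\<kappa> * (1 + \<bar>of_int d\<bar>) > 0" using \<kappa>(1) by (intro mult_pos_pos) auto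
    have "?f d = (lin \<tau> (c', d) - lin \<tau> (c, d)) / (lin \<tau> (c, d) * lin \<tau> (c', d))"
      using nz by (simp add: diff_frac_eq)
    also have "\<dots> = (of_int (c' - c) * \<tau>) / (lin \<tau> (c, d) * lin \<tau> (c', d))"
      by (simp add: lin_def algebra_simps)
    finally have "norm (?f d) = cmod (of_int (c' - c) * \<tau>) / (cmod (lin \<tau> (c, d)) * cmod (lin \<tau> (c', d)))"
      by (simp only: norm_divide norm_mult)
    also have "\<dots> \<le> cmod (of_int (c' - c) * \<tau>) / ((\<kappa> * (1 + \<bar>of_int d\<bar>)) * (\<kappa> * (1 + \<bar>of_int d\<bar>)))"
      using lb[of d c] lb[of d c'] d pos nz \<kappa>(1) by (intro divide_left_mono mult_mono mult_pos_pos) auto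
    also have "\<dots> = M d"
    proof -
      have "(1 + \<bar>real_of_int d\<bar>) powr (- 2) = 1 / (1 + \<bar>real_of_int d\<bar>)\<^sup>2"
        by (simp add: powr_minus_divide)
      then show ?thesis by (simp add: M_def power2_eq_square)
    qed
    finally show "norm (?f d) \<le> M d" .
  qed
  then have "?f summable_on insert 0 (A - {0})"
    by (simp only: summable_on_insert_iff) (rule abs_summable_summable)
  then show ?thesis by (rule summable_on_subset_banach) auto
qed

lemma infsum_inverse_lin_diff:
  assumes \<tau>: "Im \<tau> > 0" and N: "N \<ge> 1" and c: "c \<noteq> 0" "c' \<noteq> 0"
  shows "(\<Sum>\<^sub>\<infinity>d\<in>residue_class N b. 1 / lin \<tau> (c, d) - 1 / lin \<tau> (c', d)) =
     of_real pi / of_nat N * (cot (of_real pi * (lin \<tau> (c, b) / of_nat N)) - cot (of_real pi * (lin \<tau> (c', b) / of_nat N)))"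
proof -
  let ?g = "\<lambda>m. b + int N * m" and ?f = "\<lambda>d. 1 / lin \<tau> (c, d) - 1 / lin \<tau> (c', d)"
  let ?x = "lin \<tau> (c, b) / of_nat N" and ?y = "lin \<tau> (c', b) / of_nat N"
  have inj: "inj ?g" using N by (auto simp: inj_on_def)
  have g: "1 / lin \<tau> (e, ?g n) = 1 / of_nat N * (1 / (lin \<tau> (e, b) / of_nat N + of_int n))" for e n
  proof -
    have "lin \<tau> (e, ?g n) = of_nat N * (lin \<tau> (e, b) / of_nat N + of_int n)"
      using N by (simp add: lin_def field_simps)
    then show ?thesis by simp
  qed
  have fg: "(?f \<circ> ?g) n = 1 / of_nat N * (1 / (?x + of_int n) - 1 / (?y + of_int n))" for n
    unfolding o_def g by (simp only: right_diff_distrib)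
  have "?f summable_on range ?g" by (rule summable_on_inverse_lin_diff[OF \<tau>])
  then have "(?f \<circ> ?g) summable_on UNIV" by (simp only: summable_on_reindex[OF inj])
  then have "(\<lambda>n. of_nat N * ((?f \<circ> ?g) n)) summable_on UNIV" by (rule summable_on_cmult_right)
  moreover have "of_nat N * ((?f \<circ> ?g) n) = 1 / (?x + of_int n) - 1 / (?y + of_int n)" for n
    unfolding fg using N by simp
  ultimately have sm: "(\<lambda>n. 1 / (?x + of_int n) - 1 / (?y + of_int n)) summable_on UNIV" by (simp only:)
  have im: "Im (lin \<tau> (e, b) / of_nat N) \<noteq> 0" if "e \<noteq> 0" for e
    using that \<tau> N by (simp add: lin_def)
  have "infsum ?f (residue_class N b) = infsum (?f \<circ> ?g) UNIV"
    unfolding residue_class_eq_range by (rule infsum_reindex[OF inj])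
  also have "\<dots> = 1 / of_nat N * (\<Sum>\<^sub>\<infinity>n. 1 / (?x + of_int n) - 1 / (?y + of_int n))"
    unfolding fg by (rule infsum_cmult_right')
  also have "\<dots> = 1 / of_nat N * (of_real pi * (cot (of_real pi * ?x) - cot (of_real pi * ?y)))"
    by (simp only: infsum_cot[OF im[OF c(1)] im[OF c(2)] sm])
  finally show ?thesis by simp
qed

text \<open>Since \<open>-N\<tau> / z\<^sup>2\<close> is \<open>\<tau>\<close> times \<open>-N / z\<^sup>2\<close>, the derivatives contained in \<open>psi_rem\<close> cancel
  and only differences of \<open>1 / (c\<tau> + d)\<close> remain. Summed over \<open>d\<close> first, the differences in \<open>d\<close>
  telescope to 0. The differences in \<open>c\<close> lead to the function \<open>hc\<close> of \<open>c\<close>, which is \<open>\<pi> / N\<close>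
  times a cotangent, up to a constant, and so has the different limits \<open>\<mp>\<i>\<pi> / N\<close> for \<open>c \<rightarrow> \<plusminus>\<infinity>\<close>;
  up to sign, the defect is their difference.\<close>
lemma weight_2_defect:
  assumes \<tau>: "Im \<tau> > 0" and N: "N \<ge> 1"
  shows "(\<Sum>\<^sub>\<infinity>v\<in>vclass N v0. psi_rem 1 0 0 (of_nat N * \<tau>) (lin \<tau> v)) -
         \<tau> * (\<Sum>\<^sub>\<infinity>v\<in>vclass N v0. psi_rem 1 0 0 (of_nat N) (lin \<tau> v)) = 2 * of_real pi * \<i> / of_nat N"
proof -
  define A where "A = residue_class N (fst v0)"
  define B where "B = residue_class N (snd v0)"
  define g where "g = (\<lambda>c d. 1 / lin \<tau> (c, d))"
  define T where "T = (\<lambda>c d. - (g (c + int N) d - g c d) + \<tau> * (g c (d + int N) - g c d))"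
  \<comment> \<open>The sum of \<open>1 / (c\<tau> + d)\<close> over \<open>d\<close> diverges; subtracting the row \<open>c = 1\<close> makes it converge
    and does not affect differences in \<open>c\<close>. The formula \<open>hc_eq\<close> is restricted to \<open>c \<noteq> 0\<close>, where
    the argument of the cotangent is not real.\<close>
  define hc where "hc = (\<lambda>c. \<Sum>\<^sub>\<infinity>d\<in>B. g c d - g 1 d)"
  have u: "of_nat N * \<tau> \<noteq> 0" "of_nat N \<noteq> (0::complex)" using N \<tau> by auto
  have \<tau>0: "\<tau> \<noteq> 0" using \<tau> by auto
  have smP: "(\<lambda>v. psi_rem 1 0 0 (of_nat N * \<tau>) (lin \<tau> v)) summable_on A \<times> B"
    by (rule psi_rem_sum_holomorphic(2)[OF \<tau> u(1)]) simp
  have smQ: "(\<lambda>v. psi_rem 1 0 0 (of_nat N) (lin \<tau> v)) summable_on A \<times> B"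
    by (rule psi_rem_sum_holomorphic(2)[OF \<tau> u(2)]) simp
  have T_eq: "psi_rem 1 0 0 (of_nat N * \<tau>) (lin \<tau> v) - \<tau> * psi_rem 1 0 0 (of_nat N) (lin \<tau> v) = (\<lambda>(c, d). T c d) v" for v
  proof -
    obtain c d where v: "v = (c, d)" by force
    have s: "lin \<tau> (c, d) + of_nat N * \<tau> = lin \<tau> (c + int N, d)" "lin \<tau> (c, d) + of_nat N = lin \<tau> (c, d + int N)"
      by (simp_all add: lin_def algebra_simps)
    show ?thesis unfolding v psi_rem_weight_2 s T_def g_def by (simp add: algebra_simps)
  qed
  have smT: "(\<lambda>(c, d). T c d) summable_on A \<times> B"
    using summable_on_diff_complex[OF smP summable_on_cmult_right[OF smQ, of \<tau>]] unfolding T_eq by simp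
  have dif: "(\<lambda>d. g c d - g c' d) summable_on B" for c c'
    unfolding g_def by (rule summable_on_inverse_lin_diff[OF \<tau>])
  have hdif: "(\<Sum>\<^sub>\<infinity>d\<in>B. g (c + int N) d - g c d) = hc (c + int N) - hc c" for c
    using infsum_diff_complex[OF dif[of "c + int N" 1] dif[of c 1]] by (simp add: hc_def)
  have g0: "(g c \<longlongrightarrow> 0) at_top" "(g c \<longlongrightarrow> 0) at_bot" for c
    unfolding g_def by (intro inverse_lin_tendsto_0 filterlim_cmod_lin[OF \<tau>])+
  have row: "(\<Sum>\<^sub>\<infinity>d\<in>B. T c d) = - (hc (c + int N) - hc c)" if c: "c \<in> A" for c
  proof -
    have smTc: "T c summable_on B" by (rule summable_on_SigmaD1[OF smT c])
    have "(\<lambda>d. inverse \<tau> * (T c d + (g (c + int N) d - g c d))) summable_on B"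
      by (intro summable_on_cmult_right summable_on_add smTc dif)
    moreover have "inverse \<tau> * (T c d + (g (c + int N) d - g c d)) = g c (d + int N) - g c d" for d
      using \<tau>0 by (simp add: T_def)
    ultimately have smb: "(\<lambda>d. g c (d + int N) - g c d) summable_on B" by (simp only:)
    have b0: "(\<Sum>\<^sub>\<infinity>d\<in>B. g c (d + int N) - g c d) = 0 - 0"
      unfolding B_def by (rule infsum_telescope_residue_class[OF N g0 smb[unfolded B_def]])
    have "(\<Sum>\<^sub>\<infinity>d\<in>B. T c d) = (\<Sum>\<^sub>\<infinity>d\<in>B. - (g (c + int N) d - g c d)) + (\<Sum>\<^sub>\<infinity>d\<in>B. \<tau> * (g c (d + int N) - g c d))"
      unfolding T_def
      by (rule infsum_add[OF summable_on_uminus[THEN iffD2, OF dif] summable_on_cmult_right[OF smb]])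
    also have "\<dots> = - (hc (c + int N) - hc c)"
      by (simp only: infsum_uminus infsum_cmult_right' b0 hdif diff_0_right mult_zero_right add_0_right diff_self)
    finally show ?thesis .
  qed
  have "(\<lambda>c. \<Sum>\<^sub>\<infinity>d\<in>B. T c d) summable_on A" by (rule summable_on_Sigma_banach[OF smT])
  then have "(\<lambda>c. - (hc (c + int N) - hc c)) summable_on A"
    by (rule summable_on_cong[THEN iffD1, rotated]) (rule row)
  then have smh: "(\<lambda>c. hc (c + int N) - hc c) summable_on A"
    by (simp only: summable_on_uminus)
  define K where "K = of_real pi / of_nat N * cot (of_real pi * (lin \<tau> (1, snd v0) / of_nat N))"
  have hc_eq: "hc c = of_real pi / of_nat N * cot (of_real pi * (lin \<tau> (c, snd v0) / of_nat N)) - K" if "c \<noteq> 0" for c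
    unfolding hc_def g_def B_def K_def infsum_inverse_lin_diff[OF \<tau> N that one_neq_zero]
    by (rule right_diff_distrib)
  have imc: "Im (of_real pi * (lin \<tau> (c, snd v0) / of_nat N)) = (pi * Im \<tau> / real N) * real_of_int c" for c
    by (simp add: lin_def)
  have pos: "pi * Im \<tau> / real N > 0" using \<tau> N by simp
  have fl: "filterlim (\<lambda>c::int. (pi * Im \<tau> / real N) * real_of_int \<bar>c\<bar>) at_top F"
    if "\<And>B. \<forall>\<^sub>F c::int in F. B \<le> real_of_int \<bar>c\<bar>" for F
    by (rule filterlim_tendsto_pos_mult_at_top[OF tendsto_const pos])
       (use that in \<open>simp add: filterlim_at_top\<close>)
  have top: "(hc \<longlongrightarrow> of_real pi / of_nat N * (- \<i>) - K) at_top"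
  proof -
    have "filterlim (\<lambda>c. Im (of_real pi * (lin \<tau> (c, snd v0) / of_nat N))) at_top at_top"
      unfolding imc
    proof (rule filterlim_cong[THEN iffD1, OF refl refl _ fl[OF eventually_le_abs_int(1)]])
      show "\<forall>\<^sub>F c in at_top. (pi * Im \<tau> / real N) * real_of_int \<bar>c\<bar> = (pi * Im \<tau> / real N) * real_of_int c"
        using eventually_ge_at_top[of "0::int"] by eventually_elim (simp only: abs_of_nonneg)
    qed
    then have "((\<lambda>c. of_real pi / of_nat N * cot (of_real pi * (lin \<tau> (c, snd v0) / of_nat N)) - K) \<longlongrightarrow> of_real pi / of_nat N * (- \<i>) - K) at_top"
      by (intro tendsto_intros cot_tendsto)
    then show ?thesis
    proof (rule Lim_transform_eventually)
      show "\<forall>\<^sub>F c in at_top. of_real pi / of_nat N * cot (of_real pi * (lin \<tau> (c, snd v0) / of_nat N)) - K = hc c"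
        using eventually_gt_at_top[of "0::int"]
      proof eventually_elim
        case (elim c)
        then have "c \<noteq> 0" by simp
        then show ?case by (rule hc_eq[symmetric])
      qed
    qed
  qed
  have bot: "(hc \<longlongrightarrow> of_real pi / of_nat N * (- (- \<i>)) - K) at_bot"
  proof -
    have cot_minus: "cot z = - cot (- z)" for z :: complex by (simp add: cot_def)
    have "filterlim (\<lambda>c. Im (- (of_real pi * (lin \<tau> (c, snd v0) / of_nat N)))) at_top at_bot"
      unfolding uminus_complex.sel imc
    proof (rule filterlim_cong[THEN iffD1, OF refl refl _ fl[OF eventually_le_abs_int(2)]])
      show "\<forall>\<^sub>F c in at_bot. (pi * Im \<tau> / real N) * real_of_int \<bar>c\<bar> = - ((pi * Im \<tau> / real N) * real_of_int c)"
        using eventually_le_at_bot[of "0::int"]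
        by eventually_elim (simp only: abs_of_nonpos of_int_minus mult_minus_right)
    qed
    then have "((\<lambda>c. of_real pi / of_nat N * (- cot (- (of_real pi * (lin \<tau> (c, snd v0) / of_nat N)))) - K) \<longlongrightarrow> of_real pi / of_nat N * (- (- \<i>)) - K) at_bot"
      by (intro tendsto_intros cot_tendsto)
    then have "((\<lambda>c. of_real pi / of_nat N * cot (of_real pi * (lin \<tau> (c, snd v0) / of_nat N)) - K) \<longlongrightarrow> of_real pi / of_nat N * (- (- \<i>)) - K) at_bot"
      by (simp only: cot_minus[symmetric])
    then show ?thesis
    proof (rule Lim_transform_eventually)
      show "\<forall>\<^sub>F c in at_bot. of_real pi / of_nat N * cot (of_real pi * (lin \<tau> (c, snd v0) / of_nat N)) - K = hc c"
        using eventually_le_at_bot[of "-1::int"]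
      proof eventually_elim
        case (elim c)
        then have "c \<noteq> 0" by simp
        then show ?case by (rule hc_eq[symmetric])
      qed
    qed
  qed
  have tel: "(\<Sum>\<^sub>\<infinity>c\<in>A. hc (c + int N) - hc c) = (of_real pi / of_nat N * (- \<i>) - K) - (of_real pi / of_nat N * (- (- \<i>)) - K)"
    unfolding A_def by (rule infsum_telescope_residue_class[OF N top bot smh[unfolded A_def]])
  have "(\<Sum>\<^sub>\<infinity>v\<in>A \<times> B. psi_rem 1 0 0 (of_nat N * \<tau>) (lin \<tau> v)) - \<tau> * (\<Sum>\<^sub>\<infinity>v\<in>A \<times> B. psi_rem 1 0 0 (of_nat N) (lin \<tau> v))
      = (\<Sum>\<^sub>\<infinity>v\<in>A \<times> B. (\<lambda>(c, d). T c d) v)"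
    unfolding T_eq[symmetric] infsum_diff_complex[OF smP summable_on_cmult_right[OF smQ]] infsum_cmult_right' ..
  also have "\<dots> = (\<Sum>\<^sub>\<infinity>c\<in>A. \<Sum>\<^sub>\<infinity>d\<in>B. T c d)"
    by (rule infsum_Sigma'_banach[OF smT, symmetric])
  also have "\<dots> = (\<Sum>\<^sub>\<infinity>c\<in>A. - (hc (c + int N) - hc c))"
    by (rule infsum_cong) (rule row)
  also have "\<dots> = 2 * of_real pi * \<i> / of_nat N"
    unfolding infsum_uminus tel by (simp add: algebra_simps)
  finally show ?thesis unfolding A_def B_def .
qed

text \<open>A holomorphic function of \<open>\<tau>\<close>, since for \<open>k = 2\<close> and \<open>s = 0\<close> the terms
  \<open>-N / z\<^sup>2 - (1 / (z + N) - 1 / z)\<close> are rational in \<open>z = c\<tau> + d\<close>.\<close>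
definition weight_2_corr :: "nat \<Rightarrow> int \<times> int \<Rightarrow> complex \<Rightarrow> complex" where
  "weight_2_corr N v0 \<tau> = (\<Sum>\<^sub>\<infinity>v\<in>vclass N v0. psi_rem 1 0 0 (of_nat N) (lin \<tau> v))"

text \<open>The first sum of remainders in \<open>lattice_sum\<close> is expressed by the second one through
  \<open>weight_2_defect\<close>; after this, \<open>cnj \<tau>\<close> occurs only in the factor \<open>\<tau> - cnj \<tau>\<close>.\<close>
lemma lattice_sum_weight_2:
  assumes \<tau>: "Im \<tau> > 0" and N: "N \<ge> 1"
  shows "lattice_sum 2 N \<tau> v0 0 = - of_real pi / (of_nat N)\<^sup>2 / of_real (Im \<tau>) - weight_2_corr N v0 \<tau> / of_nat N"
proof -
  let ?P = "\<Sum>\<^sub>\<infinity>v\<in>vclass N v0. psi_rem 1 0 0 (of_nat N * \<tau>) (lin \<tau> v)" and ?Q = "weight_2_corr N v0 \<tau>"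
  have t: "\<tau> - cnj \<tau> = 2 * \<i> * of_real (Im \<tau>)" by (simp add: complex_eq_iff)
  then have t0: "\<tau> - cnj \<tau> \<noteq> 0" using \<tau> by simp
  have P: "?P = 2 * of_real pi * \<i> / of_nat N + \<tau> * ?Q"
    using weight_2_defect[OF \<tau> N, of v0] unfolding weight_2_corr_def by (simp add: algebra_simps)
  have k: "(2::nat) - 1 = 1" "of_nat 2 - 1 + 0 = (1::complex)" by simp_all
  have "lattice_sum 2 N \<tau> v0 0 = - (?P - cnj \<tau> * ?Q) / (1 * of_nat N * (\<tau> - cnj \<tau>))"
    unfolding lattice_sum_def k weight_2_corr_def ..
  also have "?P - cnj \<tau> * ?Q = 2 * of_real pi * \<i> / of_nat N + (\<tau> - cnj \<tau>) * ?Q"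
    unfolding P by (simp add: algebra_simps)
  also have "- (2 * of_real pi * \<i> / of_nat N + (\<tau> - cnj \<tau>) * ?Q) / (1 * of_nat N * (\<tau> - cnj \<tau>))
      = - (2 * of_real pi * \<i> / of_nat N) / (of_nat N * (\<tau> - cnj \<tau>)) - ?Q / of_nat N"
    using t0 N by (simp add: field_simps)
  also have "- (2 * of_real pi * \<i> / of_nat N) / (of_nat N * (\<tau> - cnj \<tau>)) = - of_real pi / (of_nat N)\<^sup>2 / of_real (Im \<tau>)"
    unfolding t by (simp add: power2_eq_square)
  finally show ?thesis .
qed

lemma psi_rem_weight_2_bound:
  assumes \<kappa>: "\<kappa> > 0" "\<kappa> * wt v powr (1/2) \<le> cmod z" and u: "2 * cmod u \<le> \<kappa> * wt v powr (1/2)"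
  shows "norm (psi_rem 1 0 0 u z) \<le> 16 * (cmod u)\<^sup>2 * 2 powr 3 * \<kappa> powr (- 3) * wt v powr (- (3 / 2))"
proof -
  have pos: "\<kappa> * wt v powr (1/2) > 0" using \<kappa>(1) wt_ge_1[of v] by simp
  have z: "z \<noteq> 0" using pos \<kappa>(2) by auto
  have "norm (psi_rem 1 0 0 u z) = norm (psi 1 0 0 (z + u) - psi 1 0 0 z - dpsi 1 0 0 u z)"
    unfolding psi_rem_def by (rule norm_minus_commute)
  also have "\<dots> \<le> 4 * (real 1 + real 0 + 1 + cmod 0)\<^sup>2 * (cmod u)\<^sup>2 * 2 powr 3 * cmod z powr (- 3)"
    by (rule psi_second_order_bound) (use z \<kappa> u in auto)
  also have "\<dots> \<le> 4 * (real 1 + real 0 + 1 + cmod 0)\<^sup>2 * (cmod u)\<^sup>2 * 2 powr 3 * (\<kappa> * wt v powr (1/2)) powr (- 3)"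
    by (intro mult_left_mono powr_mono2') (use pos \<kappa> in auto)
  also have "(\<kappa> * wt v powr (1/2)) powr (- 3) = \<kappa> powr (- 3) * wt v powr (- (3 / 2))"
    using \<kappa>(1) by (simp add: powr_mult powr_powr)
  finally show ?thesis by (simp add: mult.assoc)
qed

lemma weight_2_corr_holomorphic:
  assumes N: "N \<ge> 1"
  shows "weight_2_corr N v0 holomorphic_on {\<tau>. Im \<tau> > 0}"
  unfolding weight_2_corr_def[abs_def]
proof (rule holomorphic_on_infsum(1)[OF open_uhp])
  fix v
  have s: "lin \<tau> v + of_nat N = lin \<tau> (fst v, snd v + int N)" for \<tau> by (simp add: lin_def)
  have "(\<lambda>\<tau>. - of_nat N * (1 / lin \<tau> v ^ 2) - (1 / lin \<tau> (fst v, snd v + int N) ^ 1 - 1 / lin \<tau> v ^ 1)) holomorphic_on {\<tau>. Im \<tau> > 0}"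
    by (intro holomorphic_intros)
  then show "(\<lambda>\<tau>. psi_rem 1 0 0 (of_nat N) (lin \<tau> v)) holomorphic_on {\<tau>. Im \<tau> > 0}"
    unfolding psi_rem_weight_2 s by simp
next
  fix \<tau>0 :: complex assume "\<tau>0 \<in> {\<tau>. Im \<tau> > 0}"
  then have "Im \<tau>0 > 0" by simp
  then obtain d \<kappa> where d: "d > 0" "\<kappa> > 0"
    and \<kappa>: "\<forall>\<tau>\<in>ball \<tau>0 d. Im \<tau> > 0 \<and> (\<forall>v. v \<noteq> (0, 0) \<longrightarrow> \<kappa> * wt v powr (1/2) \<le> cmod (lin \<tau> v))"
    by (rule lin_lower_bound_local)
  define F where "F = {v. wt v < (2 * cmod (of_nat N) / \<kappa>)\<^sup>2} \<union> {(0, 0)}"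
  define M where "M = (\<lambda>v. 16 * (cmod (of_nat N))\<^sup>2 * 2 powr 3 * \<kappa> powr (- 3) * wt v powr (- (3 / 2)))"
  have "finite F" by (simp add: F_def finite_wt_less)
  moreover have "M summable_on vclass N v0"
    unfolding M_def by (intro summable_on_cmult_right summable_on_wt_powr) simp
  moreover have "norm (psi_rem 1 0 0 (of_nat N) (lin \<tau> v)) \<le> M v"
    if v: "v \<in> vclass N v0 - F" and \<tau>: "\<tau> \<in> ball \<tau>0 d \<inter> {\<tau>. Im \<tau> > 0}" for v \<tau>
  proof -
    have lb: "\<kappa> * wt v powr (1/2) \<le> cmod (lin \<tau> v)" using \<kappa> v \<tau> unfolding F_def by blast
    have "wt v \<ge> (2 * cmod (of_nat N) / \<kappa>)\<^sup>2" using v unfolding F_def by (auto simp: not_less)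
    then show ?thesis unfolding M_def
      by (intro psi_rem_weight_2_bound lb large_wt d(2))
  qed
  ultimately show "\<exists>d>0. \<exists>F M. finite F \<and> M summable_on vclass N v0 \<and>
      (\<forall>v\<in>vclass N v0 - F. \<forall>\<tau>\<in>ball \<tau>0 d \<inter> {\<tau>. Im \<tau> > 0}. norm (psi_rem 1 0 0 (of_nat N) (lin \<tau> v)) \<le> M v)"
    using d(1) by (intro exI[of _ d] conjI exI[of _ F] exI[of _ M]) auto
qed

lemma summable_on_cusp_term_2: "(\<lambda>v. norm (cusp_term 2 v)) summable_on A"
proof (rule Infinite_Sum.abs_summable_on_comparison_test')
  show "(\<lambda>v. 4 * wt v powr (- 2)) summable_on A"
    by (intro summable_on_cmult_right summable_on_wt_powr) simp
  fix v
  show "norm (cusp_term 2 v) \<le> 4 * wt v powr (- 2)"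
  proof (cases "fst v = 0 \<and> snd v \<noteq> 0")
    case True
    let ?d = "\<bar>real_of_int (snd v)\<bar>"
    have "1 \<le> \<bar>snd v\<bar>" using True by linarith
    then have d: "?d \<ge> 1" by linarith
    have w: "wt v = 1 + ?d" using True by (simp add: wt_def)
    have "norm (cusp_term 2 v) = 1 / ?d\<^sup>2" using True by (simp add: cusp_term_def norm_divide norm_power)
    also have "\<dots> = 4 / (2 * ?d)\<^sup>2" by (simp add: power_mult_distrib)
    also have "\<dots> \<le> 4 / (1 + ?d)\<^sup>2" using d by (intro divide_left_mono power_mono mult_pos_pos) auto
    also have "\<dots> = 4 * wt v powr (- 2)" using d by (simp add: w powr_minus_divide)
    finally show ?thesis .
  qed (auto simp: cusp_term_def)
qed

text \<open>The termwise limit is \<open>-N\<close> times \<open>cusp_term 2\<close> minus a difference of \<open>cusp_term 1\<close>, and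
  the latter telescopes. The terms with \<open>d = 0\<close> or \<open>d + N = 0\<close> in row 0 follow the convention
  \<open>1 / 0 = 0\<close>, under which the difference still telescopes.\<close>
lemma weight_2_corr_limit:
  assumes N: "N \<ge> 1"
  shows "((\<lambda>y. weight_2_corr N v0 (\<i> * of_real y)) \<longlongrightarrow> - of_nat N * (\<Sum>\<^sub>\<infinity>v\<in>vclass N v0. cusp_term 2 v)) at_top"
proof -
  define D where "D = (\<lambda>v. cusp_term 1 (fst v, snd v + int N) - cusp_term 1 v)"
  define l where "l = (\<lambda>v. - of_nat N * cusp_term 2 v - D v)"
  have "Im \<i> > 0" by simp
  from lin_lower_bound[OF this, of "cmod \<i>"] obtain \<kappa> where \<kappa>: "\<kappa> > 0" "\<And>v. v \<noteq> (0, 0) \<Longrightarrow> \<kappa> * wt v powr (1/2) \<le> cmod (lin \<i> v)"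
    by (metis order_refl)
  define F where "F = {v. wt v < (2 * cmod (of_nat N) / \<kappa>)\<^sup>2} \<union> {(0, 0)}"
  define M where "M = (\<lambda>v. 16 * (cmod (of_nat N))\<^sup>2 * 2 powr 3 * \<kappa> powr (- 3) * wt v powr (- (3 / 2)))"
  have "((\<lambda>y. \<Sum>\<^sub>\<infinity>v\<in>vclass N v0. psi_rem 1 0 0 (of_nat N) (lin (\<i> * of_real y) v)) \<longlongrightarrow> (\<Sum>\<^sub>\<infinity>v\<in>vclass N v0. l v)) at_top"
  proof (rule tendsto_infsum_cofinite)
    show "finite F" by (simp add: F_def finite_wt_less)
    show "M summable_on vclass N v0"
      unfolding M_def by (intro summable_on_cmult_right summable_on_wt_powr) simp
    show "norm (psi_rem 1 0 0 (of_nat N) (lin (\<i> * of_real y) v)) \<le> M v"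
      if v: "v \<in> vclass N v0 - F" and y: "y \<in> {1::real..}" for v y
    proof -
      have "v \<noteq> (0, 0)" using v by (auto simp: F_def)
      then have lb: "\<kappa> * wt v powr (1/2) \<le> cmod (lin (\<i> * of_real y) v)"
        using \<kappa>(2)[of v] norm_lin_imaginary_ge[of y v] y by simp
      have "wt v \<ge> (2 * cmod (of_nat N) / \<kappa>)\<^sup>2" using v unfolding F_def by (auto simp: not_less)
      then show ?thesis unfolding M_def
        by (intro psi_rem_weight_2_bound lb large_wt \<kappa>(1))
    qed
    show "\<forall>\<^sub>F y in at_top. y \<in> {1::real..}" using eventually_ge_at_top[of "1::real"] by simp
    fix v
    have s: "lin \<tau> v + of_nat N = lin \<tau> (fst v, snd v + int N)" for \<tau> by (simp add: lin_def)
    have "((\<lambda>y. - of_nat N * (1 / lin (\<i> * of_real y) v ^ 2) - (1 / lin (\<i> * of_real y) (fst v, snd v + int N) ^ 1 - 1 / lin (\<i> * of_real y) v ^ 1))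
        \<longlongrightarrow> - of_nat N * cusp_term 2 v - (cusp_term 1 (fst v, snd v + int N) - cusp_term 1 v)) at_top"
      by (intro tendsto_intros tendsto_inverse_lin) simp_all
    then show "((\<lambda>y. psi_rem 1 0 0 (of_nat N) (lin (\<i> * of_real y) v)) \<longlongrightarrow> l v) at_top"
      unfolding psi_rem_weight_2 s l_def D_def by simp
  qed simp
  moreover have "(\<Sum>\<^sub>\<infinity>v\<in>vclass N v0. l v) = - of_nat N * (\<Sum>\<^sub>\<infinity>v\<in>vclass N v0. cusp_term 2 v)"
  proof -
    have c2: "cusp_term 2 summable_on vclass N v0"
      by (rule abs_summable_summable[OF summable_on_cusp_term_2])
    have smD: "D summable_on S" for S
    proof (rule abs_summable_summable[OF Infinite_Sum.abs_summable_on_comparison_test'])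
      let ?sh = "\<lambda>v::int \<times> int. (fst v, snd v + int N)"
      have inj: "inj_on ?sh S" by (auto simp: inj_on_def prod_eq_iff)
      have "((\<lambda>v. norm (cusp_term 2 v)) \<circ> ?sh) summable_on S"
        unfolding summable_on_reindex[OF inj, symmetric] by (rule summable_on_cusp_term_2)
      then show "(\<lambda>v. real N * (norm (cusp_term 2 v) + norm (cusp_term 2 (?sh v)))) summable_on S"
        by (intro summable_on_cmult_right summable_on_add summable_on_cusp_term_2) (simp only: o_def)
      fix v
      show "norm (D v) \<le> real N * (norm (cusp_term 2 v) + norm (cusp_term 2 (?sh v)))"
      proof (cases "fst v = 0")
        case True
        define x where "x = real_of_int (snd v)"
        \<comment> \<open>If neither denominator is 0, the difference is \<open>N / (x (x + N))\<close> in absolute value,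
          and the product is bounded by a sum of squares. The excluded cases hold by
          \<open>1 / 0 = 0\<close>.\<close>
        have "\<bar>1 / (x + real N) - 1 / x\<bar> \<le> real N * (1 / x\<^sup>2 + 1 / (x + real N)\<^sup>2)"
        proof (cases "x = 0 \<or> x + real N = 0")
          case True
          then show ?thesis using N by (auto simp: power2_eq_square add_eq_0_iff)
        next
          case False
          let ?a = "1 / \<bar>x\<bar>" and ?b = "1 / \<bar>x + real N\<bar>"
          have "1 / (x + real N) - 1 / x = - real N * (1 / x * (1 / (x + real N)))"
            using False by (simp add: field_simps)
          then have "\<bar>1 / (x + real N) - 1 / x\<bar> = real N * (?a * ?b)"
            by (simp add: abs_mult)
          also have "?a * ?b \<le> ?a\<^sup>2 + ?b\<^sup>2"
          proof -
            have "0 \<le> (?a - ?b)\<^sup>2" by simp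
            then have "2 * (?a * ?b) \<le> ?a\<^sup>2 + ?b\<^sup>2" by (simp only: power2_diff)
            moreover have "0 \<le> ?a * ?b" by simp
            ultimately show ?thesis by linarith
          qed
          finally show ?thesis by (simp add: power_one_over mult_left_mono)
        qed
        moreover have "D v = of_real (1 / (x + real N) - 1 / x)"
          using True by (simp add: D_def cusp_term_def x_def)
        moreover have "norm (cusp_term 2 v) = 1 / x\<^sup>2"
          using True by (simp add: cusp_term_def x_def norm_divide norm_power)
        moreover have "norm (cusp_term 2 (?sh v)) = 1 / (x + real N)\<^sup>2"
        proof -
          have "cusp_term 2 (?sh v) = of_real (1 / (x + real N)\<^sup>2)" using True by (simp add: cusp_term_def x_def)
          then show ?thesis by (simp only: norm_of_real) simp
        qed
        ultimately show ?thesis by (simp only: norm_of_real)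
      qed (simp add: D_def cusp_term_def)
    qed
    have smD': "(\<lambda>(c, d). D (c, d)) summable_on residue_class N (fst v0) \<times> residue_class N (snd v0)"
      using smD by simp
    have "(\<Sum>\<^sub>\<infinity>d\<in>residue_class N (snd v0). cusp_term 1 (c, d + int N) - cusp_term 1 (c, d)) = 0 - 0"
      if c: "c \<in> residue_class N (fst v0)" for c
    proof (rule infsum_telescope_residue_class[where h = "\<lambda>d. cusp_term 1 (c, d)", OF N])
      show "((\<lambda>d. cusp_term 1 (c, d)) \<longlongrightarrow> 0) at_top" "((\<lambda>d. cusp_term 1 (c, d)) \<longlongrightarrow> 0) at_bot"
        using inverse_lin_tendsto_0[OF filterlim_abs_int(1)] inverse_lin_tendsto_0[OF filterlim_abs_int(2)]
        by (cases "c = 0"; simp add: cusp_term_def)+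
      show "(\<lambda>d. cusp_term 1 (c, d + int N) - cusp_term 1 (c, d)) summable_on residue_class N (snd v0)"
        using summable_on_SigmaD1[OF smD' c] by (simp add: D_def)
    qed
    then have "(\<Sum>\<^sub>\<infinity>c\<in>residue_class N (fst v0). \<Sum>\<^sub>\<infinity>d\<in>residue_class N (snd v0). D (c, d)) = 0"
      by (simp add: D_def cong: infsum_cong)
    then have D0: "(\<Sum>\<^sub>\<infinity>v\<in>vclass N v0. D v) = 0"
      unfolding infsum_Sigma'_banach[OF smD'] by simp
    show ?thesis unfolding l_def
      by (subst infsum_diff_complex[OF summable_on_cmult_right[OF c2] smD])
         (simp only: D0 infsum_cmult_right' diff_0_right)
  qed
  ultimately show ?thesis by (simp only: weight_2_corr_def)
qed

lemma summable_on_mu: "(\<lambda>n. of_int (mu n) * psi 2 0 0 (of_nat n)) summable_on ({0<..} \<inter> A)"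
proof (rule abs_summable_summable[OF Infinite_Sum.abs_summable_on_comparison_test'])
  have "(\<lambda>n. norm (psi 2 0 0 (of_nat n))) summable_on {0<..}" by (rule summable_on_psi_of_nat) simp
  then show "(\<lambda>n. norm (psi 2 0 0 (of_nat n))) summable_on ({0<..} \<inter> A)"
    by (rule summable_on_subset_banach) simp
  fix n
  have m: "norm (of_int (mu n) :: complex) \<le> 1" using abs_mu_le_1[of n] by (simp flip: of_int_abs)
  show "norm (of_int (mu n) * psi 2 0 0 (of_nat n)) \<le> norm (psi 2 0 0 (of_nat n))"
    unfolding norm_mult using m by (intro mult_left_le_one_le) auto
qed

text \<open>The factors \<open>lattice_sum\<close> in \<open>eis_cont\<close> depend on \<open>n\<close> only through its inverse \<open>u\<close> modulo
  \<open>N\<close>, so the sum over \<open>n\<close> is a finite combination with these coefficients.\<close>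
definition mu_part :: "nat \<Rightarrow> int \<Rightarrow> complex" where
  "mu_part N u = (\<Sum>\<^sub>\<infinity>n\<in>{0<..} \<inter> {n. coprime n N \<and> inv_mod N n = u}. of_int (mu n) * psi 2 0 0 (of_nat n))"

lemma infsum_mu_split:
  assumes N: "N \<ge> 1"
  shows "(\<Sum>\<^sub>\<infinity>n\<in>{n. 0 < n \<and> coprime n N}. of_int (mu n) * psi 2 0 0 (of_nat n) * q (inv_mod N n)) = (\<Sum>u\<in>{0..<int N}. mu_part N u * q u)"
proof -
  let ?B = "\<lambda>u. {0<..} \<inter> {n. coprime n N \<and> inv_mod N n = u}"
  let ?F = "\<lambda>n. of_int (mu n) * psi 2 0 0 (of_nat n) * q (inv_mod N n)"
  have eq: "?F n = of_int (mu n) * psi 2 0 0 (of_nat n) * q u" if "n \<in> ?B u" for n u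
    using that by simp
  have "(\<Sum>u\<in>{0..<int N}. infsum ?F (?B u)) = infsum ?F (\<Union>u\<in>{0..<int N}. ?B u)"
  proof (rule sum_infsum)
    show "?F summable_on ?B u" for u
      by (rule summable_on_cong[THEN iffD1, OF eq[symmetric] summable_on_cmult_left[OF summable_on_mu]])
  qed auto
  also have "(\<Union>u\<in>{0..<int N}. ?B u) = {n. 0 < n \<and> coprime n N}"
    using inv_mod(1)[OF N] by fastforce
  also have "(\<Sum>u\<in>{0..<int N}. infsum ?F (?B u)) = (\<Sum>u\<in>{0..<int N}. mu_part N u * q u)"
  proof (rule sum.cong[OF refl])
    fix u
    have "infsum ?F (?B u) = (\<Sum>\<^sub>\<infinity>n\<in>?B u. of_int (mu n) * psi 2 0 0 (of_nat n) * q u)"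
      by (rule infsum_cong) (rule eq)
    then show "infsum ?F (?B u) = mu_part N u * q u"
      by (simp only: infsum_cmult_left' mu_part_def)
  qed
  finally show ?thesis ..
qed

text \<open>The holomorphic part in the decomposition \<open>eis_cont_weight_2\<close>.\<close>
definition weight_2_hol :: "nat \<Rightarrow> int \<times> int \<Rightarrow> complex \<Rightarrow> complex" where
  "weight_2_hol N v0 \<tau> = - (\<Sum>u\<in>{0..<int N}. mu_part N u * weight_2_corr N (svec u v0) \<tau>) / of_nat N"

text \<open>The coefficient of \<open>1 / Im \<tau>\<close>. It is the same for all residue classes of primitive
  vectors, which is why holomorphy in weight 2 is one linear condition.\<close>
definition weight_2_const :: "nat \<Rightarrow> complex" where
  "weight_2_const N = - of_real pi / (of_nat N)\<^sup>2 * (\<Sum>u\<in>{0..<int N}. mu_part N u)"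

lemma eis_cont_weight_2:
  assumes \<tau>: "Im \<tau> > 0" and N: "N \<ge> 1"
  shows "eis_cont 2 N \<tau> v0 0 = weight_2_hol N v0 \<tau> + weight_2_const N / of_real (Im \<tau>)"
proof -
  have "eis_cont 2 N \<tau> v0 0 = (\<Sum>u\<in>{0..<int N}. mu_part N u * lattice_sum 2 N \<tau> (svec u v0) 0)"
    unfolding eis_cont_def infsum_mu_split[OF N, where q = "\<lambda>u. lattice_sum 2 N \<tau> (svec u v0) 0"]
    using \<tau> by simp
  also have "\<dots> = (\<Sum>u\<in>{0..<int N}. mu_part N u * (- of_real pi / (of_nat N)\<^sup>2 / of_real (Im \<tau>)))
      - (\<Sum>u\<in>{0..<int N}. mu_part N u * weight_2_corr N (svec u v0) \<tau> / of_nat N)"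
    unfolding lattice_sum_weight_2[OF \<tau> N] right_diff_distrib sum_subtractf by simp
  also have "\<dots> = weight_2_hol N v0 \<tau> + weight_2_const N / of_real (Im \<tau>)"
    unfolding weight_2_hol_def weight_2_const_def sum_distrib_right[symmetric] sum_divide_distrib[symmetric]
    by simp
  finally show ?thesis .
qed

lemma weight_2_hol_holomorphic:
  assumes N: "N \<ge> 1"
  shows "weight_2_hol N v0 holomorphic_on {\<tau>. Im \<tau> > 0}"
  unfolding weight_2_hol_def[abs_def] using N
  by (intro holomorphic_intros weight_2_corr_holomorphic) auto

text \<open>The constant is a nonzero multiple of the sum of \<open>mu n / n\<^sup>2\<close> over \<open>n\<close> coprime to \<open>N\<close>.
  That sum is inverse to the sum of \<open>1 / n\<^sup>2\<close> over the same \<open>n\<close>.\<close>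
lemma weight_2_const_nonzero:
  assumes N: "N \<ge> 1"
  shows "weight_2_const N \<noteq> 0"
proof -
  \<comment> \<open>The Dirichlet series identity is the case of \<open>primitive_sum_moebius\<close> for functions
    supported on the vectors \<open>(0, d)\<close>: the only primitive vector among those with \<open>d > 0\<close> is
    \<open>(0, 1)\<close>.\<close>
  define f :: "int \<times> int \<Rightarrow> complex" where "f = (\<lambda>v. if coprime (snd v) (int N) then cusp_term 2 v else 0)"
  define h :: "nat \<Rightarrow> complex" where "h = (\<lambda>n. if coprime n N then psi 2 0 0 (of_nat n) else 0)"
  define L :: "(int \<times> int) set" where "L = {v. snd v > 0}"
  have psi2: "psi 2 0 0 (of_nat n) = 1 / of_nat n ^ 2" for n by (rule psi_at_0) simp
  have "(\<Sum>\<^sub>\<infinity>v\<in>L \<inter> prim. f v) = (\<Sum>\<^sub>\<infinity>n\<in>{0<..}. of_int (mu n) * h n * (\<Sum>\<^sub>\<infinity>v\<in>{v. svec (int n) v \<in> L}. f v))"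
  proof (rule primitive_sum_moebius)
    show "f (0, 0) = 0" by (simp add: f_def cusp_term_def)
    show "(\<lambda>v. norm (f v)) summable_on UNIV"
      by (rule Infinite_Sum.abs_summable_on_comparison_test'[OF summable_on_cusp_term_2]) (simp add: f_def)
    show "(\<lambda>n. norm (h n)) summable_on {0<..}"
      by (rule Infinite_Sum.abs_summable_on_comparison_test'[OF summable_on_psi_of_nat[of 2 0 0]]) (simp_all add: h_def)
    show "f (svec (int n) v) = h n * f v" if "n > 0" for n v
      using that by (auto simp: f_def h_def svec_def cusp_term_def psi2 power_mult_distrib)
  qed
  moreover have "(\<Sum>\<^sub>\<infinity>v\<in>L \<inter> prim. f v) = 1"
  proof -
    have "(\<Sum>\<^sub>\<infinity>v\<in>L \<inter> prim. f v) = (\<Sum>\<^sub>\<infinity>v\<in>{(0, 1)}. f v)"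
    proof (rule infsum_cong_neutral)
      fix v assume v: "v \<in> L \<inter> prim - {(0, 1)}"
      have "fst v \<noteq> 0"
      proof
        assume "fst v = 0"
        with v have "\<bar>snd v\<bar> = 1" "snd v > 0" by (auto simp: prim_def L_def)
        with v \<open>fst v = 0\<close> show False by (cases v) auto
      qed
      then show "f v = 0" by (simp add: f_def cusp_term_def)
    qed (auto simp: prim_def L_def)
    also have "\<dots> = 1" by (simp add: f_def cusp_term_def)
    finally show ?thesis .
  qed
  moreover have "{v. svec (int n) v \<in> L} = L" if "n \<in> {0<..}" for n
    using that by (auto simp: L_def svec_def zero_less_mult_iff)
  then have "(\<Sum>\<^sub>\<infinity>n\<in>{0<..}. of_int (mu n) * h n * (\<Sum>\<^sub>\<infinity>v\<in>{v. svec (int n) v \<in> L}. f v))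
      = (\<Sum>\<^sub>\<infinity>n\<in>{0<..}. of_int (mu n) * h n * (\<Sum>\<^sub>\<infinity>v\<in>L. f v))"
    by (intro infsum_cong) simp
  ultimately have "(\<Sum>\<^sub>\<infinity>n\<in>{0<..}. of_int (mu n) * h n) * (\<Sum>\<^sub>\<infinity>v\<in>L. f v) = 1"
    by (simp only: infsum_cmult_left')
  then have nz: "(\<Sum>\<^sub>\<infinity>n\<in>{0<..}. of_int (mu n) * h n) \<noteq> 0" by auto
  have "(\<Sum>\<^sub>\<infinity>n\<in>{0<..}. of_int (mu n) * h n) = (\<Sum>\<^sub>\<infinity>n\<in>{n. 0 < n \<and> coprime n N}. of_int (mu n) * psi 2 0 0 (of_nat n) * 1)"
    by (rule infsum_cong_neutral) (auto simp: h_def)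
  also have "\<dots> = (\<Sum>u\<in>{0..<int N}. mu_part N u)"
    using infsum_mu_split[OF N, where q = "\<lambda>_. 1"] by simp
  finally show ?thesis using nz N by (simp add: weight_2_const_def)
qed

text \<open>Moebius inversion applied to \<open>cusp_term 2\<close> gives the boundary value of the holomorphic
  part, and the other part tends to 0.\<close>
lemma weight_2_limit:
  assumes N: "N \<ge> 1" and v0: "v0 \<in> prim"
  shows "((\<lambda>y. eis_cont 2 N (\<i> * of_real y) v0 0) \<longlongrightarrow> vlimit 2 N v0) at_top"
proof -
  let ?Z = "\<lambda>u. \<Sum>\<^sub>\<infinity>v\<in>vclass N (svec u v0). cusp_term 2 v"
  have psi2: "psi 2 0 0 (of_nat n) = 1 / of_nat n ^ 2" for n by (rule psi_at_0) simp
  have "vlimit 2 N v0 = (\<Sum>\<^sub>\<infinity>v\<in>vclass N v0 \<inter> prim. cusp_term 2 v)"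
    by (rule infsum_cusp_term_prim[symmetric])
  also have "\<dots> = (\<Sum>\<^sub>\<infinity>n\<in>{0<..}. of_int (mu n) * psi 2 0 0 (of_nat n) * (\<Sum>\<^sub>\<infinity>v\<in>{v. svec (int n) v \<in> vclass N v0}. cusp_term 2 v))"
  proof (rule primitive_sum_moebius)
    show "cusp_term 2 (0, 0) = 0" by (simp add: cusp_term_def)
    show "cusp_term 2 (svec (int n) v) = psi 2 0 0 (of_nat n) * cusp_term 2 v" if "n > 0" for n v
      using that by (simp add: cusp_term_def svec_def psi2 power_mult_distrib)
    show "(\<lambda>v. norm (cusp_term 2 v)) summable_on UNIV" by (rule summable_on_cusp_term_2)
    show "(\<lambda>n. norm (psi 2 0 0 (of_nat n))) summable_on {0<..}" by (rule summable_on_psi_of_nat) simp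
  qed
  also have "\<dots> = (\<Sum>\<^sub>\<infinity>n\<in>{n. 0 < n \<and> coprime n N}. of_int (mu n) * psi 2 0 0 (of_nat n) * ?Z (inv_mod N n))"
    by (rule infsum_cong_neutral) (auto simp: svec_in_vclass[OF N v0])
  also have "\<dots> = (\<Sum>u\<in>{0..<int N}. mu_part N u * ?Z u)"
    by (rule infsum_mu_split[OF N])
  finally have lim: "vlimit 2 N v0 = (\<Sum>u\<in>{0..<int N}. mu_part N u * ?Z u)" .
  have "((\<lambda>y. weight_2_hol N v0 (\<i> * of_real y)) \<longlongrightarrow> - (\<Sum>u\<in>{0..<int N}. mu_part N u * (- of_nat N * ?Z u)) / of_nat N) at_top"
    unfolding weight_2_hol_def by (intro tendsto_intros weight_2_corr_limit N) (use N in auto)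
  moreover have "- (\<Sum>u\<in>{0..<int N}. mu_part N u * (- of_nat N * ?Z u)) / of_nat N = vlimit 2 N v0"
  proof -
    have "(\<Sum>u\<in>{0..<int N}. mu_part N u * (- of_nat N * ?Z u)) = - of_nat N * (\<Sum>u\<in>{0..<int N}. mu_part N u * ?Z u)"
      by (simp only: sum_distrib_left) (rule sum.cong, simp_all)
    then show ?thesis unfolding lim using N by simp
  qed
  moreover have "((\<lambda>y. weight_2_const N / of_real y) \<longlongrightarrow> 0) at_top"
    by (rule tendsto_divide_0[OF tendsto_const filterlim_of_real_at_infinity])
  ultimately have "((\<lambda>y. weight_2_hol N v0 (\<i> * of_real y) + weight_2_const N / of_real y) \<longlongrightarrow> vlimit 2 N v0 + 0) at_top"
    by (intro tendsto_add) simp_all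
  then have "((\<lambda>y. weight_2_hol N v0 (\<i> * of_real y) + weight_2_const N / of_real y) \<longlongrightarrow> vlimit 2 N v0) at_top"
    by simp
  then show ?thesis
  proof (rule Lim_transform_eventually)
    show "\<forall>\<^sub>F y in at_top. weight_2_hol N v0 (\<i> * of_real y) + weight_2_const N / of_real y = eis_cont 2 N (\<i> * of_real y) v0 0"
      using eventually_gt_at_top[of "0::real"]
      by eventually_elim (subst eis_cont_weight_2[OF _ N]; simp)
  qed
qed

section \<open>The action of the modular group on primitive row vectors\<close>

definition act :: "int \<times> int \<Rightarrow> int ^ 2 ^ 2 \<Rightarrow> int \<times> int" where
  "act v g = (fst v * g $ 1 $ 1 + snd v * g $ 2 $ 1, fst v * g $ 1 $ 2 + snd v * g $ 2 $ 2)"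

text \<open>The inverse on \<open>SL2Z\<close>, given by polynomials in the entries.\<close>
definition adj2 :: "int ^ 2 ^ 2 \<Rightarrow> int ^ 2 ^ 2" where
  "adj2 g = vector [vector [g $ 2 $ 2, - g $ 1 $ 2], vector [- g $ 2 $ 1, g $ 1 $ 1]]"

lemma adj2_nth [simp]:
  "adj2 g $ 1 $ 1 = g $ 2 $ 2" "adj2 g $ 1 $ 2 = - g $ 1 $ 2"
  "adj2 g $ 2 $ 1 = - g $ 2 $ 1" "adj2 g $ 2 $ 2 = g $ 1 $ 1"
  by (simp_all add: adj2_def)

lemma mat2_eq_iff:
  "A = B \<longleftrightarrow> A $ 1 $ 1 = B $ 1 $ 1 \<and> A $ 1 $ 2 = B $ 1 $ 2 \<and> A $ 2 $ 1 = B $ 2 $ 1 \<and> A $ 2 $ 2 = B $ 2 $ 2"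
  for A B :: "int ^ 2 ^ 2"
  by (simp only: vec_eq_iff forall_2 conj_assoc)

lemma mat2_mult_nth: "(A ** B) $ i $ j = A $ i $ 1 * B $ 1 $ j + A $ i $ 2 * B $ 2 $ j" for A B :: "int ^ 2 ^ 2"
  by (simp add: matrix_matrix_mult_def sum_2)

lemma mat1_nth [simp]: "(mat 1 :: int ^ 2 ^ 2) $ 1 $ 1 = 1" "(mat 1 :: int ^ 2 ^ 2) $ 1 $ 2 = 0"
  "(mat 1 :: int ^ 2 ^ 2) $ 2 $ 1 = 0" "(mat 1 :: int ^ 2 ^ 2) $ 2 $ 2 = 1"
  by (simp_all add: mat_def)

lemma carrier_SL2Z: "g \<in> carrier SL2Z \<longleftrightarrow> g $ 1 $ 1 * g $ 2 $ 2 - g $ 1 $ 2 * g $ 2 $ 1 = 1"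
  by (simp add: SL2Z_def det_2)

lemma mult_SL2Z [simp]: "A \<otimes>\<^bsub>SL2Z\<^esub> B = A ** B" and one_SL2Z [simp]: "\<one>\<^bsub>SL2Z\<^esub> = mat 1"
  by (simp_all add: SL2Z_def)

lemma adj2_mult:
  assumes "g \<in> carrier SL2Z"
  shows "adj2 g ** g = mat 1" "g ** adj2 g = mat 1" "adj2 g \<in> carrier SL2Z"
  using assms by (auto simp: carrier_SL2Z mat2_eq_iff mat2_mult_nth algebra_simps)

lemma mult_closed_SL2Z: "A \<in> carrier SL2Z \<Longrightarrow> B \<in> carrier SL2Z \<Longrightarrow> A ** B \<in> carrier SL2Z"
  by (simp add: SL2Z_def det_mul)

lemma mat1_SL2Z [simp]: "mat 1 \<in> carrier SL2Z" by (simp add: carrier_SL2Z)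

lemma group_SL2Z: "group SL2Z"
proof (rule groupI)
  show "\<exists>y\<in>carrier SL2Z. y \<otimes>\<^bsub>SL2Z\<^esub> x = \<one>\<^bsub>SL2Z\<^esub>" if "x \<in> carrier SL2Z" for x
    using adj2_mult[OF that] by (intro bexI[of _ "adj2 x"]) simp_all
qed (simp_all add: mult_closed_SL2Z matrix_mul_assoc)

lemma inv_SL2Z: "g \<in> carrier SL2Z \<Longrightarrow> inv\<^bsub>SL2Z\<^esub> g = adj2 g"
  using group.inv_equality[OF group_SL2Z, of "adj2 g" g] adj2_mult[of g] by simp

lemma act_mult: "act v (A ** B) = act (act v A) B"
  by (simp add: act_def mat2_mult_nth algebra_simps)

lemma act_one [simp]: "act v (mat 1) = v"
  by (simp add: act_def)

lemma act_adj2 [simp]: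
  assumes "g \<in> carrier SL2Z"
  shows "act (act v g) (adj2 g) = v" "act (act v (adj2 g)) g = v"
  using adj2_mult[OF assms] by (simp_all flip: act_mult)

lemma svec_neg_svec [simp]: "svec (- 1) (svec (- 1) v) = v" by (simp add: svec_def)

lemma act_svec: "act (svec n v) g = svec n (act v g)"
  by (simp add: act_def svec_def algebra_simps)

lemma prim_svec_neg [simp]: "svec (- 1) v \<in> prim \<longleftrightarrow> v \<in> prim"
  by (simp add: prim_def svec_def)

lemma prim_act:
  assumes g: "g \<in> carrier SL2Z"
  shows "act v g \<in> prim \<longleftrightarrow> v \<in> prim"
proof -
  have dvd: "gcd (fst v) (snd v) dvd gcd (fst (act v g)) (snd (act v g))" for v g
    by (simp add: act_def)
  have imp: "v \<in> prim" if "act v g \<in> prim" for v g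
  proof -
    have "gcd (fst v) (snd v) dvd 1" using dvd[of v g] that by (simp only: prim_def mem_Collect_eq)
    then show ?thesis by (simp only: prim_def mem_Collect_eq is_unit_gcd_iff)
  qed
  show ?thesis
  proof
    assume "v \<in> prim"
    then have "act (act v g) (adj2 g) \<in> prim" using g by simp
    then show "act v g \<in> prim" by (rule imp)
  qed (rule imp)
qed

lemma prim_01: "(0, 1) \<in> prim" by (simp add: prim_def)

lemma prim_nonzero: "v \<in> prim \<Longrightarrow> v \<noteq> (0, 0)" by (auto simp: prim_def)

lemma svec_neg_neq: "v \<in> prim \<Longrightarrow> svec (- 1) v \<noteq> v"
  by (cases v) (auto simp: svec_def dest: prim_nonzero)

text \<open>A matrix with bottom row \<open>v\<close> is completed by Bezout's identity.\<close>
lemma prim_transitive: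
  assumes "v \<in> prim"
  obtains g where "g \<in> carrier SL2Z" "act (0, 1) g = v"
proof -
  obtain a b where ab: "a * fst v + b * snd v = gcd (fst v) (snd v)" using bezout_int by blast
  define g :: "int ^ 2 ^ 2" where "g = vector [vector [b, - a], vector [fst v, snd v]]"
  have "g \<in> carrier SL2Z" using ab assms by (simp add: g_def carrier_SL2Z prim_def algebra_simps)
  moreover have "act (0, 1) g = v" by (simp add: g_def act_def)
  ultimately show ?thesis using that by blast
qed

lemma vclass_sym: "v \<in> vclass N w \<longleftrightarrow> w \<in> vclass N v"
  by (cases v; cases w) (auto simp: residue_class_def cong_sym_eq)

lemma vclass_refl [simp]: "v \<in> vclass N v"
  by (cases v) (auto simp: residue_class_def)

lemma vclass_iff: "v \<in> vclass N w \<longleftrightarrow> [fst v = fst w] (mod int N) \<and> [snd v = snd w] (mod int N)"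
  by (cases v) (auto simp: residue_class_def)

lemma vclass_trans: "u \<in> vclass N v \<Longrightarrow> v \<in> vclass N w \<Longrightarrow> u \<in> vclass N w"
  unfolding vclass_iff by (auto intro: cong_trans)

lemma vclass_symD: "v \<in> vclass N w \<Longrightarrow> w \<in> vclass N v"
  by (rule iffD1[OF vclass_sym])

lemma vclass_common: "u \<in> vclass N v \<Longrightarrow> u \<in> vclass N w \<Longrightarrow> v \<in> vclass N w"
  by (rule vclass_trans[OF vclass_symD])

lemma act_vclass: "v \<in> vclass N w \<Longrightarrow> act v g \<in> vclass N (act w g)"
  unfolding vclass_iff act_def by (auto intro!: cong_add cong_mult)

lemma svec_vclass: "v \<in> vclass N w \<Longrightarrow> svec n v \<in> vclass N (svec n w)"
  unfolding vclass_iff svec_def by (auto intro!: cong_mult)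

definition red :: "nat \<Rightarrow> int \<times> int \<Rightarrow> int \<times> int" where
  "red N v = (fst v mod int N, snd v mod int N)"

lemma red_eq_iff: "red N v = red N w \<longleftrightarrow> v \<in> vclass N w"
  unfolding vclass_iff red_def cong_def by simp

text \<open>A system of primitive representatives of the classes modulo \<open>N\<close> that contain primitive
  vectors.\<close>
definition reps :: "nat \<Rightarrow> (int \<times> int) set" where
  "reps N = (\<lambda>q. SOME v. v \<in> prim \<and> red N v = q) ` (red N ` prim)"

lemma finite_red_prim: "N \<ge> 1 \<Longrightarrow> finite (red N ` S)"
  by (rule finite_subset[of _ "{0..<int N} \<times> {0..<int N}"]) (auto simp: red_def)

lemma finite_reps: "N \<ge> 1 \<Longrightarrow> finite (reps N)"
  unfolding reps_def by (intro finite_imageI finite_red_prim)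

lemma reps_choice: "v \<in> prim \<Longrightarrow> (SOME w. w \<in> prim \<and> red N w = red N v) \<in> prim \<inter> vclass N v"
  by (rule someI2[of _ v]) (auto simp: red_eq_iff)

lemma reps_prim: "reps N \<subseteq> prim"
proof
  fix r assume "r \<in> reps N"
  then obtain v where "v \<in> prim" "r = (SOME w. w \<in> prim \<and> red N w = red N v)"
    unfolding reps_def by blast
  then show "r \<in> prim" using reps_choice[of v N] by blast
qed

lemma reps_exists: "v \<in> prim \<Longrightarrow> \<exists>r\<in>reps N. v \<in> vclass N r"
proof -
  assume v: "v \<in> prim"
  have "(SOME w. w \<in> prim \<and> red N w = red N v) \<in> reps N" using v unfolding reps_def by blast
  moreover have "v \<in> vclass N (SOME w. w \<in> prim \<and> red N w = red N v)"
    by (rule vclass_symD[OF IntD2[OF reps_choice[OF v]]])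
  ultimately show ?thesis by (rule bexI[rotated])
qed

lemma reps_unique: "r \<in> reps N \<Longrightarrow> r' \<in> reps N \<Longrightarrow> r \<in> vclass N r' \<Longrightarrow> r = r'"
proof -
  assume r: "r \<in> reps N" and r': "r' \<in> reps N" and c: "r \<in> vclass N r'"
  from r obtain v where v: "v \<in> prim" "r = (SOME w. w \<in> prim \<and> red N w = red N v)"
    unfolding reps_def by blast
  from r' obtain v' where v': "v' \<in> prim" "r' = (SOME w. w \<in> prim \<and> red N w = red N v')"
    unfolding reps_def by blast
  have "red N r = red N v" "red N r' = red N v'"
    using reps_choice[OF v(1), of N] reps_choice[OF v'(1), of N] v(2) v'(2) by (simp_all only: red_eq_iff Int_iff)
  moreover have "red N r = red N r'" using c by (simp only: red_eq_iff)
  ultimately show "r = r'" using v(2) v'(2) by simp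
qed

lemma sum_reps_of_bool:
  assumes N: "N \<ge> 1" and v: "v \<in> prim" and f: "\<And>r. r \<in> reps N \<Longrightarrow> v \<in> vclass N r \<Longrightarrow> f r = x"
  shows "(\<Sum>r\<in>reps N. f r * of_bool (v \<in> vclass N r)) = (x :: complex)"
proof -
  obtain r where r: "r \<in> reps N" "v \<in> vclass N r" using reps_exists[OF v] by blast
  have "(\<Sum>r\<in>reps N. f r * of_bool (v \<in> vclass N r)) = (\<Sum>r'\<in>{r}. f r' * of_bool (v \<in> vclass N r'))"
  proof (rule sum.mono_neutral_right[OF finite_reps[OF N]])
    show "\<forall>r'\<in>reps N - {r}. f r' * of_bool (v \<in> vclass N r') = 0"
    proof
      fix r' assume r': "r' \<in> reps N - {r}"
      have "v \<notin> vclass N r'"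
      proof
        assume "v \<in> vclass N r'"
        then have "r \<in> vclass N r'" by (rule vclass_common[OF r(2)])
        then show False using reps_unique[OF r(1), of r'] r' by simp
      qed
      then show "f r' * of_bool (v \<in> vclass N r') = 0" by simp
    qed
  qed (use r in simp)
  then show ?thesis using r f[OF r] by simp
qed

section \<open>Eisenstein series of periodic functions\<close>

definition periodic :: "nat \<Rightarrow> (int \<times> int \<Rightarrow> complex) \<Rightarrow> bool" where
  "periodic N a \<longleftrightarrow> (\<forall>v\<in>prim. \<forall>w\<in>prim. v \<in> vclass N w \<longrightarrow> a v = a w)"

lemma periodicD: "periodic N a \<Longrightarrow> v \<in> prim \<Longrightarrow> w \<in> prim \<Longrightarrow> v \<in> vclass N w \<Longrightarrow> a v = a w"
  unfolding periodic_def by blast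

text \<open>Without symmetrization in \<open>v \<mapsto> -v\<close>, so that the series of \<open>\<Lambda>\<^sub>N\<close> are literally of this
  form.\<close>
definition periodic_eis :: "nat \<Rightarrow> (int \<times> int \<Rightarrow> complex) \<Rightarrow> complex \<Rightarrow> complex" where
  "periodic_eis k a \<tau> = (if \<tau> \<in> upper_half_plane
     then continued_value_at_0 k (\<lambda>s. \<Sum>\<^sub>\<infinity>v\<in>prim. a v * eis_term k s \<tau> v) else 0)"

lemma continuation_value_periodic:
  assumes k: "k \<ge> 2" and N: "N \<ge> 1" and a: "periodic N a" and \<tau>: "Im \<tau> > 0"
  shows "continuation_value k (\<lambda>s. \<Sum>\<^sub>\<infinity>v\<in>prim. a v * eis_term k s \<tau> v) (\<Sum>r\<in>reps N. a r * eis_cont k N \<tau> r 0)"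
proof -
  have "continuation_value k (\<lambda>s. \<Sum>r\<in>reps N. a r * (\<Sum>\<^sub>\<infinity>v\<in>vclass N r \<inter> prim. eis_term k s \<tau> v)) (\<Sum>r\<in>reps N. a r * eis_cont k N \<tau> r 0)"
    by (rule continuation_value_sum) (use continuation_value_class[OF \<tau> N k] reps_prim in blast)
  moreover have "(\<Sum>r\<in>reps N. a r * (\<Sum>\<^sub>\<infinity>v\<in>vclass N r \<inter> prim. eis_term k s \<tau> v)) = (\<Sum>\<^sub>\<infinity>v\<in>prim. a v * eis_term k s \<tau> v)"
    if s: "Re (of_nat k + 2 * s) > 2" for s
  proof -
    have eq: "a v * eis_term k s \<tau> v = a r * eis_term k s \<tau> v" if "r \<in> reps N" "v \<in> vclass N r \<inter> prim" for r v
    proof -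
      have "a v = a r" using a that reps_prim unfolding periodic_def by blast
      then show ?thesis by simp
    qed
    have "(\<Sum>r\<in>reps N. \<Sum>\<^sub>\<infinity>v\<in>vclass N r \<inter> prim. a v * eis_term k s \<tau> v) = (\<Sum>\<^sub>\<infinity>v\<in>(\<Union>r\<in>reps N. vclass N r \<inter> prim). a v * eis_term k s \<tau> v)"
    proof (rule sum_infsum[OF finite_reps[OF N]])
      fix r assume r: "r \<in> reps N"
      show "(\<lambda>v. a v * eis_term k s \<tau> v) summable_on (vclass N r \<inter> prim)"
        by (rule summable_on_cong[THEN iffD2, OF eq[OF r] summable_on_cmult_right[OF summable_on_eis_term[OF \<tau> s]]])
    next
      fix r r' assume r: "r \<in> reps N" "r' \<in> reps N" "r \<noteq> r'"
      show "vclass N r \<inter> prim \<inter> (vclass N r' \<inter> prim) = {}"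
      proof (rule ccontr)
        assume "vclass N r \<inter> prim \<inter> (vclass N r' \<inter> prim) \<noteq> {}"
        then obtain v where "v \<in> vclass N r" "v \<in> vclass N r'" by blast
        then have "r \<in> vclass N r'" by (rule vclass_common)
        then show False using reps_unique[OF r(1,2)] r(3) by simp
      qed
    qed
    also have "(\<Union>r\<in>reps N. vclass N r \<inter> prim) = prim" using reps_exists by blast
    also have "(\<Sum>r\<in>reps N. \<Sum>\<^sub>\<infinity>v\<in>vclass N r \<inter> prim. a v * eis_term k s \<tau> v) = (\<Sum>r\<in>reps N. a r * (\<Sum>\<^sub>\<infinity>v\<in>vclass N r \<inter> prim. eis_term k s \<tau> v))"
    proof (rule sum.cong[OF refl])
      fix r assume "r \<in> reps N"
      then have "(\<Sum>\<^sub>\<infinity>v\<in>vclass N r \<inter> prim. a v * eis_term k s \<tau> v) = (\<Sum>\<^sub>\<infinity>v\<in>vclass N r \<inter> prim. a r * eis_term k s \<tau> v)"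
        by (intro infsum_cong eq)
      then show "(\<Sum>\<^sub>\<infinity>v\<in>vclass N r \<inter> prim. a v * eis_term k s \<tau> v) = a r * (\<Sum>\<^sub>\<infinity>v\<in>vclass N r \<inter> prim. eis_term k s \<tau> v)"
        by (simp only: infsum_cmult_right')
    qed
    finally show ?thesis .
  qed
  ultimately show ?thesis by (subst (asm) continuation_value_cong) auto
qed

lemma periodic_eis_eq:
  assumes k: "k \<ge> 2" and N: "N \<ge> 1" and a: "periodic N a" and \<tau>: "Im \<tau> > 0"
  shows "periodic_eis k a \<tau> = (\<Sum>r\<in>reps N. a r * eis_cont k N \<tau> r 0)"
  using continued_value_at_0_eqI[OF k continuation_value_periodic[OF assms]] \<tau>
  by (simp add: periodic_eis_def upper_half_plane_def)

lemma periodic_eis_outside: "\<tau> \<notin> upper_half_plane \<Longrightarrow> periodic_eis k a \<tau> = 0"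
  by (simp add: periodic_eis_def)

lemma periodic_eis_cong:
  assumes "\<And>v. v \<in> prim \<Longrightarrow> a v = b v"
  shows "periodic_eis k a = periodic_eis k b"
proof
  fix \<tau>
  have "(\<Sum>\<^sub>\<infinity>v\<in>prim. a v * eis_term k s \<tau> v) = (\<Sum>\<^sub>\<infinity>v\<in>prim. b v * eis_term k s \<tau> v)" for s
    by (rule infsum_cong) (simp add: assms)
  then show "periodic_eis k a \<tau> = periodic_eis k b \<tau>" by (simp add: periodic_eis_def)
qed

lemma periodic_sum:
  "(\<And>i. i \<in> I \<Longrightarrow> periodic N (a i)) \<Longrightarrow> periodic N (\<lambda>v. \<Sum>i\<in>I. c i * a i v)"
  unfolding periodic_def by (metis (no_types, lifting) sum.cong)

lemma periodic_eis_sum: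
  assumes k: "k \<ge> 2" and N: "N \<ge> 1" and a: "\<And>i. i \<in> I \<Longrightarrow> periodic N (a i)"
  shows "periodic_eis k (\<lambda>v. \<Sum>i\<in>I. c i * a i v) \<tau> = (\<Sum>i\<in>I. c i * periodic_eis k (a i) \<tau>)"
proof (cases "Im \<tau> > 0")
  case True
  have p: "periodic N (\<lambda>v. \<Sum>i\<in>I. c i * a i v)" by (rule periodic_sum[OF a])
  have "periodic_eis k (\<lambda>v. \<Sum>i\<in>I. c i * a i v) \<tau> = (\<Sum>r\<in>reps N. \<Sum>i\<in>I. c i * (a i r * eis_cont k N \<tau> r 0))"
    using periodic_eis_eq[OF k N p True] by (simp add: sum_distrib_right mult.assoc)
  also have "\<dots> = (\<Sum>i\<in>I. c i * (\<Sum>r\<in>reps N. a i r * eis_cont k N \<tau> r 0))"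
    by (subst sum.swap) (simp add: sum_distrib_left)
  also have "\<dots> = (\<Sum>i\<in>I. c i * periodic_eis k (a i) \<tau>)"
    by (intro sum.cong refl) (simp add: periodic_eis_eq[OF k N a True])
  finally show ?thesis .
qed (simp add: periodic_eis_outside upper_half_plane_def)

text \<open>Only the classes of \<open>(0, 1)\<close> and \<open>(0, -1)\<close> contribute to the limit of the finite
  combination \<open>periodic_eis_eq\<close>.\<close>
lemma periodic_eis_limit:
  assumes k: "k \<ge> 2" and N: "N \<ge> 1" and a: "periodic N a"
  shows "((\<lambda>y. periodic_eis k a (\<i> * of_real y)) \<longlongrightarrow> a (0, 1) + (- 1) ^ k * a (0, - 1)) at_top"
proof -
  have lim: "((\<lambda>y. eis_cont k N (\<i> * of_real y) r 0) \<longlongrightarrow> vlimit k N r) at_top" if "r \<in> prim" for r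
  proof (cases "k = 2")
    case True
    then show ?thesis using weight_2_limit[OF N that] by simp
  next
    case False
    then show ?thesis using k by (intro eis_cont_0_limit N that) simp
  qed
  have "((\<lambda>y. \<Sum>r\<in>reps N. a r * eis_cont k N (\<i> * of_real y) r 0) \<longlongrightarrow> (\<Sum>r\<in>reps N. a r * vlimit k N r)) at_top"
    by (intro tendsto_sum tendsto_mult tendsto_const lim) (use reps_prim in blast)
  moreover have "(\<Sum>r\<in>reps N. a r * vlimit k N r) = a (0, 1) + (- 1) ^ k * a (0, - 1)"
  proof -
    have p: "(0, - 1) \<in> prim" by (simp add: prim_def)
    have 1: "(\<Sum>r\<in>reps N. a r * of_bool ((0, 1) \<in> vclass N r)) = a (0, 1)"
      by (rule sum_reps_of_bool[OF N prim_01]) (use periodicD[OF a prim_01, symmetric] reps_prim in blast)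
    have 2: "(\<Sum>r\<in>reps N. a r * of_bool ((0, - 1) \<in> vclass N r)) = a (0, - 1)"
      by (rule sum_reps_of_bool[OF N p]) (use periodicD[OF a p, symmetric] reps_prim in blast)
    have "(\<Sum>r\<in>reps N. a r * vlimit k N r) = (\<Sum>r\<in>reps N. a r * of_bool ((0, 1) \<in> vclass N r))
        + (- 1) ^ k * (\<Sum>r\<in>reps N. a r * of_bool ((0, - 1) \<in> vclass N r))"
      unfolding vlimit_def distrib_left sum.distrib sum_distrib_left by (simp only: mult.left_commute)
    then show ?thesis by (simp only: 1 2)
  qed
  ultimately have "((\<lambda>y. \<Sum>r\<in>reps N. a r * eis_cont k N (\<i> * of_real y) r 0) \<longlongrightarrow> a (0, 1) + (- 1) ^ k * a (0, - 1)) at_top"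
    by (simp only:)
  then show ?thesis
  proof (rule Lim_transform_eventually)
    show "\<forall>\<^sub>F y in at_top. (\<Sum>r\<in>reps N. a r * eis_cont k N (\<i> * of_real y) r 0) = periodic_eis k a (\<i> * of_real y)"
      using eventually_gt_at_top[of "0::real"]
      by eventually_elim (subst periodic_eis_eq[OF k N a]; simp)
  qed
qed

lemma eis_term_neg: "eis_term k s \<tau> (svec (- 1) v) = (- 1) ^ k * eis_term k s \<tau> v"
proof -
  have "((- 1) ^ k :: complex) * (- 1) ^ k = 1" by (simp flip: power_mult_distrib)
  then have inv: "1 / ((- 1) ^ k :: complex) = (- 1) ^ k" by (simp add: nonzero_divide_eq_eq)
  have "lin \<tau> (svec (- 1) v) = - lin \<tau> v" by (simp add: lin_svec)
  then have "eis_term k s \<tau> (svec (- 1) v) = of_real (Im \<tau>) powr s / ((- 1) ^ k * lin \<tau> v ^ k * of_real (cmod (lin \<tau> v)) powr (2 * s))"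
    by (simp only: eis_term_def norm_minus_cancel power_minus[of "lin \<tau> v"])
  also have "\<dots> = 1 / (- 1) ^ k * eis_term k s \<tau> v"
    by (simp only: eis_term_def times_divide_times_eq mult_1 mult.assoc)
  finally have "eis_term k s \<tau> (svec (- 1) v) = 1 / (- 1) ^ k * eis_term k s \<tau> v" .
  then show ?thesis by (simp only: inv)
qed

lemma bij_svec_neg_prim: "bij_betw (svec (- 1)) prim prim"
  by (rule bij_betw_byWitness[where f' = "svec (- 1)"]) auto

lemma periodic_eis_neg: "periodic_eis k (\<lambda>v. (- 1) ^ k * a (svec (- 1) v)) = periodic_eis k a"
proof
  fix \<tau>
  have "(\<Sum>\<^sub>\<infinity>v\<in>prim. (- 1) ^ k * a (svec (- 1) v) * eis_term k s \<tau> v) = (\<Sum>\<^sub>\<infinity>v\<in>prim. a v * eis_term k s \<tau> v)" for s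
    using infsum_reindex_bij_betw[OF bij_svec_neg_prim, of "\<lambda>v. a v * eis_term k s \<tau> v"]
    by (simp add: eis_term_neg mult_ac)
  then show "periodic_eis k (\<lambda>v. (- 1) ^ k * a (svec (- 1) v)) \<tau> = periodic_eis k a \<tau>"
    by (simp add: periodic_eis_def)
qed

lemma periodic_neg: "periodic N a \<Longrightarrow> periodic N (\<lambda>v. a (svec (- 1) v))"
  unfolding periodic_def using svec_vclass by auto

lemma periodic_cmult: "periodic N a \<Longrightarrow> periodic N (\<lambda>v. c * a v)"
  unfolding periodic_def by metis

lemma periodic_add: "periodic N a \<Longrightarrow> periodic N b \<Longrightarrow> periodic N (\<lambda>v. a v + b v)"
  unfolding periodic_def by metis

lemma periodic_eis_cmult:
  assumes "k \<ge> 2" "N \<ge> 1" "periodic N a"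
  shows "periodic_eis k (\<lambda>v. c * a v) \<tau> = c * periodic_eis k a \<tau>"
  using periodic_eis_sum[OF assms(1,2), of "{()}" "\<lambda>_. a" "\<lambda>_. c" \<tau>] assms(3) by simp

lemma periodic_eis_add:
  assumes "k \<ge> 2" "N \<ge> 1" "periodic N a" "periodic N b"
  shows "periodic_eis k (\<lambda>v. a v + b v) \<tau> = periodic_eis k a \<tau> + periodic_eis k b \<tau>"
  using periodic_eis_sum[OF assms(1,2), of "UNIV :: bool set" "\<lambda>i. if i then a else b" "\<lambda>_. 1" \<tau>] assms(3,4)
  by (simp add: UNIV_bool add.commute)

text \<open>The substitution \<open>v \<mapsto> -v\<close> in the series multiplies \<open>eis_term\<close> by \<open>(-1) ^ k\<close>.\<close>
lemma periodic_eis_symmetrize: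
  assumes k: "k \<ge> 2" and N: "N \<ge> 1" and a: "periodic N a"
  shows "periodic_eis k (\<lambda>v. (a v + (- 1) ^ k * a (svec (- 1) v)) / 2) = periodic_eis k a"
proof
  fix \<tau>
  let ?n = "\<lambda>v. (- 1) ^ k * a (svec (- 1) v)"
  have n: "periodic N ?n" by (intro periodic_cmult periodic_neg a)
  have "periodic_eis k (\<lambda>v. (a v + ?n v) / 2) \<tau> = periodic_eis k (\<lambda>v. 1 / 2 * (a v + ?n v)) \<tau>" by simp
  also have "\<dots> = 1 / 2 * (periodic_eis k a \<tau> + periodic_eis k ?n \<tau>)"
    by (simp only: periodic_eis_cmult[OF k N periodic_add[OF a n]] periodic_eis_add[OF k N a n])
  also have "\<dots> = periodic_eis k a \<tau>" by (simp add: periodic_eis_neg)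
  finally show "periodic_eis k (\<lambda>v. (a v + ?n v) / 2) \<tau> = periodic_eis k a \<tau>" .
qed

lemma periodic_act:
  assumes g: "g \<in> carrier SL2Z" and a: "periodic N a"
  shows "periodic N (\<lambda>v. a (act v g))"
  using a act_vclass prim_act[OF g] unfolding periodic_def by blast

lemma automorphy_factor_nonzero:
  assumes g: "g \<in> carrier SL2Z" and \<tau>: "Im \<tau> > 0"
  shows "automorphy_factor g \<tau> \<noteq> 0"
proof -
  have "(g $ 2 $ 1, g $ 2 $ 2) \<noteq> (0, 0)" using g by (auto simp: carrier_SL2Z)
  from lin_nonzero[OF \<tau> this] show ?thesis by (simp add: lin_def automorphy_factor_def)
qed

lemma Im_moebius:
  assumes g: "g \<in> carrier SL2Z" and \<tau>: "Im \<tau> > 0"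
  shows "Im (moebius g \<tau>) = Im \<tau> / (cmod (automorphy_factor g \<tau>))\<^sup>2"
proof -
  define a b c d where abcd: "a = real_of_int (g $ 1 $ 1)" "b = real_of_int (g $ 1 $ 2)" "c = real_of_int (g $ 2 $ 1)" "d = real_of_int (g $ 2 $ 2)"
  have "real_of_int (g $ 1 $ 1 * g $ 2 $ 2 - g $ 1 $ 2 * g $ 2 $ 1) = 1" using g by (simp only: carrier_SL2Z of_int_1)
  then have det: "a * d - b * c = 1" by (simp add: abcd)
  have j: "automorphy_factor g \<tau> = of_real c * \<tau> + of_real d" by (simp add: automorphy_factor_def abcd)
  have "moebius g \<tau> = (of_real a * \<tau> + of_real b) / (of_real c * \<tau> + of_real d)"
    by (simp add: moebius_def j) (simp add: abcd)
  then have "Im (moebius g \<tau>) = ((a * Im \<tau>) * (c * Re \<tau> + d) - (a * Re \<tau> + b) * (c * Im \<tau>)) / ((c * Re \<tau> + d)\<^sup>2 + (c * Im \<tau>)\<^sup>2)"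
    by (simp add: Im_divide)
  also have "(a * Im \<tau>) * (c * Re \<tau> + d) - (a * Re \<tau> + b) * (c * Im \<tau>) = (a * d - b * c) * Im \<tau>"
    by (simp add: algebra_simps)
  also have "(c * Re \<tau> + d)\<^sup>2 + (c * Im \<tau>)\<^sup>2 = (cmod (automorphy_factor g \<tau>))\<^sup>2"
    by (simp add: j cmod_power2)
  finally show ?thesis by (simp add: det)
qed

lemma lin_moebius:
  assumes g: "g \<in> carrier SL2Z" and \<tau>: "Im \<tau> > 0"
  shows "lin (moebius g \<tau>) v = lin \<tau> (act v g) / automorphy_factor g \<tau>"
proof -
  define j where "j = automorphy_factor g \<tau>"
  have j: "j \<noteq> 0" using automorphy_factor_nonzero[OF assms] by (simp add: j_def)
  have "lin (moebius g \<tau>) v = (of_int (fst v) * (of_int (g $ 1 $ 1) * \<tau> + of_int (g $ 1 $ 2)) + of_int (snd v) * j) / j"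
    using j by (simp add: lin_def moebius_def add_divide_distrib distrib_left flip: j_def)
  also have "of_int (fst v) * (of_int (g $ 1 $ 1) * \<tau> + of_int (g $ 1 $ 2)) + of_int (snd v) * j = lin \<tau> (act v g)"
    by (simp add: j_def automorphy_factor_def lin_def act_def algebra_simps)
  finally show ?thesis by (simp add: j_def)
qed

lemma powr_quotient_of_real:
  assumes "x \<ge> 0" "y > 0"
  shows "of_real (x / y) powr s = (of_real x powr s / of_real y powr s :: complex)"
proof -
  have "of_real (x / y * y) powr s = (of_real (x / y) powr s * of_real y powr s :: complex)"
    using assms by (subst of_real_mult) (intro powr_times_real, auto)
  moreover have "x / y * y = x" using assms by simp
  moreover have "of_real y powr s \<noteq> (0::complex)" using assms by simp
  ultimately show ?thesis by simp
qed

lemma powr_square_of_real: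
  assumes "x > 0"
  shows "of_real (x\<^sup>2) powr s = (of_real x powr (2 * s) :: complex)"
  using assms by (simp add: powr_def Ln_of_real ln_realpow mult_ac flip: of_real_power)

lemma eis_term_moebius:
  assumes g: "g \<in> carrier SL2Z" and \<tau>: "Im \<tau> > 0"
  shows "eis_term k s (moebius g \<tau>) v = automorphy_factor g \<tau> ^ k * eis_term k s \<tau> (act v g)"
proof -
  define j where "j = automorphy_factor g \<tau>"
  have j: "j \<noteq> 0" using automorphy_factor_nonzero[OF assms] by (simp add: j_def)
  have 1: "of_real (Im (moebius g \<tau>)) powr s = (of_real (Im \<tau>) powr s / of_real (cmod j) powr (2 * s) :: complex)"
  proof -
    have "of_real (Im \<tau> / (cmod j)\<^sup>2) powr s = (of_real (Im \<tau>) powr s / of_real ((cmod j)\<^sup>2) powr s :: complex)"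
      by (rule powr_quotient_of_real) (use \<tau> j in auto)
    also have "of_real ((cmod j)\<^sup>2) powr s = (of_real (cmod j) powr (2 * s) :: complex)"
      by (rule powr_square_of_real) (use j in simp)
    finally show ?thesis unfolding Im_moebius[OF assms] j_def .
  qed
  have 2: "cmod (lin (moebius g \<tau>) v) = cmod (lin \<tau> (act v g)) / cmod j"
    unfolding lin_moebius[OF assms] j_def by (rule norm_divide)
  have 3: "of_real (cmod (lin (moebius g \<tau>) v)) powr (2 * s) = (of_real (cmod (lin \<tau> (act v g))) powr (2 * s) / of_real (cmod j) powr (2 * s) :: complex)"
    unfolding 2 using j by (intro powr_quotient_of_real) auto
  have p: "of_real (cmod j) powr (2 * s) \<noteq> (0::complex)" using j by simp
  show ?thesis
    unfolding eis_term_def 1 3 unfolding lin_moebius[OF assms] j_def[symmetric] power_divide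
    using p j by simp
qed

text \<open>For fixed \<open>s\<close> the slash operator permutes the terms of the series, by \<open>eis_term_moebius\<close>;
  the identity passes to the continuation by uniqueness.\<close>
lemma slash_periodic_eis:
  assumes k: "k \<ge> 2" and N: "N \<ge> 1" and a: "periodic N a" and g: "g \<in> carrier SL2Z" and \<tau>: "Im \<tau> > 0"
  shows "slash k g (periodic_eis k a) \<tau> = periodic_eis k (\<lambda>v. a (act v (adj2 g))) \<tau>"
proof -
  let ?j = "automorphy_factor g \<tau>"
  have j: "?j \<noteq> 0" by (rule automorphy_factor_nonzero[OF g \<tau>])
  have \<tau>': "Im (moebius g \<tau>) > 0" unfolding Im_moebius[OF g \<tau>] using j \<tau> by simp
  have adj: "adj2 g \<in> carrier SL2Z" by (rule adj2_mult(3)[OF g])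
  have bij: "bij_betw (\<lambda>v. act v (adj2 g)) prim prim"
    by (rule bij_betw_byWitness[where f' = "\<lambda>v. act v g"]) (use g adj prim_act in auto)
  have eq: "(\<Sum>\<^sub>\<infinity>v\<in>prim. a v * eis_term k s (moebius g \<tau>) v) = ?j ^ k * (\<Sum>\<^sub>\<infinity>v\<in>prim. a (act v (adj2 g)) * eis_term k s \<tau> v)" for s
  proof -
    have "(\<Sum>\<^sub>\<infinity>v\<in>prim. a v * eis_term k s (moebius g \<tau>) v) = (\<Sum>\<^sub>\<infinity>v\<in>prim. a (act v (adj2 g)) * eis_term k s (moebius g \<tau>) (act v (adj2 g)))"
      by (rule infsum_reindex_bij_betw[OF bij, symmetric])
    also have "\<dots> = (\<Sum>\<^sub>\<infinity>v\<in>prim. ?j ^ k * (a (act v (adj2 g)) * eis_term k s \<tau> v))"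
      by (simp add: eis_term_moebius[OF g \<tau>] g mult_ac)
    finally show ?thesis by (simp only: infsum_cmult_right')
  qed
  note a' = periodic_act[OF adj a]
  have "continuation_value k (\<lambda>s. \<Sum>\<^sub>\<infinity>v\<in>prim. a v * eis_term k s (moebius g \<tau>) v) (?j ^ k * periodic_eis k (\<lambda>v. a (act v (adj2 g))) \<tau>)"
    unfolding eq periodic_eis_eq[OF k N a' \<tau>] by (rule continuation_value_cmult[OF continuation_value_periodic[OF k N a' \<tau>]])
  then have "periodic_eis k a (moebius g \<tau>) = ?j ^ k * periodic_eis k (\<lambda>v. a (act v (adj2 g))) \<tau>"
    using continued_value_at_0_eqI[OF k] \<tau>' by (simp add: periodic_eis_def upper_half_plane_def)
  then show ?thesis using j by (simp add: slash_def power_int_minus field_simps)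
qed

lemma periodic_eis_holomorphic:
  assumes k: "k \<ge> 3" and N: "N \<ge> 1" and a: "periodic N a"
  shows "periodic_eis k a holomorphic_on upper_half_plane"
proof -
  have "(\<lambda>\<tau>. \<Sum>r\<in>reps N. a r * eis_cont k N \<tau> r 0) holomorphic_on upper_half_plane"
    unfolding upper_half_plane_def
    by (intro holomorphic_intros eis_cont_0_holomorphic N k) (use reps_prim in blast)
  then show ?thesis
    by (rule holomorphic_transform) (use periodic_eis_eq[OF _ N a] k in \<open>simp add: upper_half_plane_def\<close>)
qed

text \<open>Otherwise \<open>Im\<close> would be complex differentiable at \<open>\<i>\<close>, but its derivatives along the real
  and the imaginary direction are 0 and 1.\<close>
lemma inverse_Im_not_holomorphic:
  assumes "c \<noteq> 0"
  shows "\<not> (\<lambda>\<tau>. c / of_real (Im \<tau>)) holomorphic_on upper_half_plane"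
proof
  assume hol: "(\<lambda>\<tau>. c / of_real (Im \<tau>)) holomorphic_on upper_half_plane"
  have "(\<lambda>\<tau>. c / (c / of_real (Im \<tau>))) holomorphic_on upper_half_plane"
    using assms by (intro holomorphic_intros hol) (auto simp: upper_half_plane_def)
  then have I: "(\<lambda>\<tau>. of_real (Im \<tau>)) holomorphic_on upper_half_plane"
    by (rule holomorphic_transform) (use assms in auto)
  have op: "open upper_half_plane" unfolding upper_half_plane_def by (rule open_uhp)
  have i: "\<i> \<in> upper_half_plane" by (simp add: upper_half_plane_def)
  obtain D where D: "((\<lambda>\<tau>. complex_of_real (Im \<tau>)) has_field_derivative D) (at \<i>)"
    using holomorphic_on_imp_differentiable_at[OF I op i] field_differentiable_def by blast
  have 1: "((\<lambda>t::real. \<i> + of_real t) has_vector_derivative 1) (at 0)"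
    by (auto intro!: derivative_eq_intros simp: has_vector_derivative_def scaleR_conv_of_real)
  have 2: "((\<lambda>t::real. \<i> + \<i> * of_real t) has_vector_derivative \<i>) (at 0)"
    by (auto intro!: derivative_eq_intros simp: has_vector_derivative_def scaleR_conv_of_real)
  have "((\<lambda>t::real. 1 :: complex) has_vector_derivative 1 * D) (at 0)"
    using field_vector_diff_chain_at[OF 1, of "\<lambda>\<tau>. of_real (Im \<tau>)" D] D by (simp add: o_def)
  then have D0: "D = 0"
    using vector_derivative_unique_at[OF _ has_vector_derivative_const[of "1::complex"]] by fastforce
  have "((\<lambda>t::real. 1 + of_real t :: complex) has_vector_derivative \<i> * D) (at 0)"
    using field_vector_diff_chain_at[OF 2, of "\<lambda>\<tau>. of_real (Im \<tau>)" D] D by (simp add: o_def)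
  moreover have "((\<lambda>t::real. 1 + of_real t :: complex) has_vector_derivative 1) (at 0)"
    by (auto intro!: derivative_eq_intros simp: has_vector_derivative_def scaleR_conv_of_real)
  ultimately have "\<i> * D = 1" by (rule vector_derivative_unique_at)
  then show False using D0 by simp
qed

lemma periodic_eis_2_holomorphic_iff:
  assumes N: "N \<ge> 1" and a: "periodic N a"
  shows "periodic_eis 2 a holomorphic_on upper_half_plane \<longleftrightarrow> (\<Sum>r\<in>reps N. a r) = 0"
proof -
  let ?h = "\<lambda>\<tau>. \<Sum>r\<in>reps N. a r * weight_2_hol N r \<tau>" and ?c = "(\<Sum>r\<in>reps N. a r) * weight_2_const N"
  have h: "?h holomorphic_on upper_half_plane"
    unfolding upper_half_plane_def by (intro holomorphic_intros weight_2_hol_holomorphic N)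
  have eq: "periodic_eis 2 a \<tau> = ?h \<tau> + ?c / of_real (Im \<tau>)" if "\<tau> \<in> upper_half_plane" for \<tau>
  proof -
    have \<tau>: "Im \<tau> > 0" using that by (simp add: upper_half_plane_def)
    have "periodic_eis 2 a \<tau> = (\<Sum>r\<in>reps N. a r * weight_2_hol N r \<tau> + a r * weight_2_const N / of_real (Im \<tau>))"
      unfolding periodic_eis_eq[OF order_refl N a \<tau>] eis_cont_weight_2[OF \<tau> N] by (simp add: distrib_left)
    then show ?thesis by (simp only: sum.distrib sum_divide_distrib sum_distrib_right)
  qed
  show ?thesis
  proof
    assume "periodic_eis 2 a holomorphic_on upper_half_plane"
    then have "(\<lambda>\<tau>. periodic_eis 2 a \<tau> - ?h \<tau>) holomorphic_on upper_half_plane"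
      by (intro holomorphic_on_diff h)
    then have "(\<lambda>\<tau>. ?c / of_real (Im \<tau>)) holomorphic_on upper_half_plane"
      by (rule holomorphic_transform) (simp add: eq)
    then have "?c = 0" using inverse_Im_not_holomorphic by blast
    then show "(\<Sum>r\<in>reps N. a r) = 0" using weight_2_const_nonzero[OF N] by simp
  next
    assume 0: "(\<Sum>r\<in>reps N. a r) = 0"
    show "periodic_eis 2 a holomorphic_on upper_half_plane"
      by (rule holomorphic_transform[OF h]) (simp add: eq 0)
  qed
qed

section \<open>Recovering a periodic function from its Eisenstein series\<close>

definition parity :: "nat \<Rightarrow> (int \<times> int \<Rightarrow> complex) \<Rightarrow> bool" where
  "parity k b \<longleftrightarrow> (\<forall>v\<in>prim. b (svec (- 1) v) = (- 1) ^ k * b v)"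

text \<open>The factor 1/2 compensates for \<open>v\<close> and \<open>-v\<close> contributing equally when \<open>b\<close> satisfies
  \<open>parity\<close>, so that the value at \<open>\<i>\<infinity>\<close> is \<open>b (0, 1)\<close>.\<close>
definition bdry_eis :: "nat \<Rightarrow> (int \<times> int \<Rightarrow> complex) \<Rightarrow> complex \<Rightarrow> complex" where
  "bdry_eis k b = periodic_eis k (\<lambda>v. b v / 2)"

lemma periodic_half: "periodic N b \<Longrightarrow> periodic N (\<lambda>v. b v / 2)"
  unfolding periodic_def by metis

text \<open>Move \<open>v\<close> to \<open>(0, 1)\<close> by the slash action and compare with \<open>periodic_eis_limit\<close>.\<close>
lemma bdry_eis_zero_imp:
  assumes k: "k \<ge> 2" and N: "N \<ge> 1" and b: "periodic N b" "parity k b"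
    and zero: "\<And>\<tau>. \<tau> \<in> upper_half_plane \<Longrightarrow> bdry_eis k b \<tau> = 0" and v: "v \<in> prim"
  shows "b v = 0"
proof -
  obtain g where g: "g \<in> carrier SL2Z" "act (0, 1) g = v" using prim_transitive[OF v] by blast
  define h where "h = adj2 g"
  have h: "h \<in> carrier SL2Z" "adj2 h = g" using adj2_mult[OF g(1)] by (simp_all add: h_def mat2_eq_iff)
  note b2 = periodic_half[OF b(1)]
  let ?b = "\<lambda>w. b (act w g) / 2"
  have pb: "periodic N ?b" using periodic_act[OF g(1) b2] by simp
  have z: "periodic_eis k ?b \<tau> = 0" if "Im \<tau> > 0" for \<tau>
  proof -
    have "automorphy_factor h \<tau> \<noteq> 0" by (rule automorphy_factor_nonzero[OF h(1) that])
    then have "Im (moebius h \<tau>) > 0" unfolding Im_moebius[OF h(1) that] using that by simp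
    then have "bdry_eis k b (moebius h \<tau>) = 0" by (intro zero) (simp add: upper_half_plane_def)
    then have "slash k h (periodic_eis k (\<lambda>v. b v / 2)) \<tau> = 0" by (simp add: slash_def bdry_eis_def)
    then show ?thesis using slash_periodic_eis[OF k N b2 h(1) that] by (simp add: h(2))
  qed
  have "((\<lambda>y. periodic_eis k ?b (\<i> * of_real y)) \<longlongrightarrow> ?b (0, 1) + (- 1) ^ k * ?b (0, - 1)) at_top"
    by (rule periodic_eis_limit[OF k N pb])
  moreover have "((\<lambda>y. periodic_eis k ?b (\<i> * of_real y)) \<longlongrightarrow> 0) at_top"
  proof (rule Lim_transform_eventually[OF tendsto_const])
    show "\<forall>\<^sub>F y in at_top. 0 = periodic_eis k ?b (\<i> * of_real y)"
      using eventually_gt_at_top[of "0::real"] by eventually_elim (simp add: z)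
  qed
  ultimately have lim: "?b (0, 1) + (- 1) ^ k * ?b (0, - 1) = 0"
    using tendsto_unique trivial_limit_at_top_linorder by blast
  have "act (0, - 1) g = svec (- 1) v" using g(2) by (auto simp: act_def svec_def)
  then have "b (act (0, - 1) g) = (- 1) ^ k * b v" using b(2) v by (simp add: parity_def)
  moreover have "((- 1) ^ k :: complex) * (- 1) ^ k = 1" by (simp flip: power_mult_distrib)
  ultimately show ?thesis using lim g(2) by (simp add: field_simps flip: mult.assoc)
qed

section \<open>The spaces of Eisenstein series\<close>

lemma subring_complex_closed:
  assumes R: "subring R (ring_of_type_algebra :: complex ring)"
  shows "0 \<in> R" "1 \<in> R" "x \<in> R \<Longrightarrow> y \<in> R \<Longrightarrow> x + y \<in> R" "x \<in> R \<Longrightarrow> y \<in> R \<Longrightarrow> x * y \<in> R" "x \<in> R \<Longrightarrow> - x \<in> R"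
proof -
  let ?C = "ring_of_type_algebra :: complex ring"
  have ops: "\<zero>\<^bsub>?C\<^esub> = 0" "\<one>\<^bsub>?C\<^esub> = 1" "a \<oplus>\<^bsub>?C\<^esub> b = a + b" "a \<otimes>\<^bsub>?C\<^esub> b = a * b" "carrier ?C = UNIV" for a b
    by (simp_all add: ring_of_type_algebra_def)
  have ring: "Ring.ring ?C" by (rule ring_from_type_algebra)
  have neg: "\<ominus>\<^bsub>?C\<^esub> a = - a" for a
    by (rule abelian_group.minus_equality[OF ring.is_abelian_group[OF ring]]) (simp_all add: ops)
  show "0 \<in> R" using subringE(2)[OF R] by (simp only: ops)
  show "1 \<in> R" using subringE(3)[OF R] by (simp only: ops)
  show "x \<in> R \<Longrightarrow> y \<in> R \<Longrightarrow> x + y \<in> R" using subringE(7)[OF R, of x y] by (simp only: ops)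
  show "x \<in> R \<Longrightarrow> y \<in> R \<Longrightarrow> x * y \<in> R" using subringE(6)[OF R, of x y] by (simp only: ops)
  show "x \<in> R \<Longrightarrow> - x \<in> R" using subringE(5)[OF R, of x] by (simp only: neg)
qed

lemma subring_complex_sum:
  assumes R: "subring R (ring_of_type_algebra :: complex ring)" and f: "\<And>i. i \<in> I \<Longrightarrow> f i \<in> R"
  shows "sum f I \<in> R"
  using f
proof (induction I rule: infinite_finite_induct)
  case (insert i I)
  then show ?case using subring_complex_closed(3)[OF R] by simp
qed (use subring_complex_closed(1)[OF R] in simp_all)

lemma subring_complex_power_neg:
  assumes R: "subring R (ring_of_type_algebra :: complex ring)"
  shows "(- 1) ^ k \<in> R"
  by (induction k) (use subring_complex_closed[OF R] in simp_all)

lemma carrier_Z2 [simp]: "carrier Z2 = UNIV" by (simp add: Z2_def)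
lemma mult_Z2 [simp]: "v \<otimes>\<^bsub>Z2\<^esub> w = (fst v + fst w, snd v + snd w)" by (simp add: Z2_def mult_DirProd')
lemma one_Z2 [simp]: "\<one>\<^bsub>Z2\<^esub> = (0, 0)" by (simp add: Z2_def)
lemma group_Z2: "group Z2" unfolding Z2_def by (intro DirProd_group group_integer_group)
lemma comm_group_Z2: "comm_group Z2"
  by (rule group.group_comm_groupI[OF group_Z2]) (simp add: add.commute)

lemma NZ2_eq: "NZ2 N = vclass N (0, 0)"
proof -
  have "v \<in> NZ2 N \<longleftrightarrow> v \<in> vclass N (0, 0)" for v
    by (cases v) (auto simp: NZ2_def residue_class_def cong_0_iff dvd_def)
  then show ?thesis by blast
qed

lemma NZ2_coset: "NZ2 N #>\<^bsub>Z2\<^esub> v = vclass N v"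
proof -
  have "w \<in> NZ2 N #>\<^bsub>Z2\<^esub> v \<longleftrightarrow> w \<in> vclass N v" for w
  proof -
    have "w \<in> NZ2 N #>\<^bsub>Z2\<^esub> v \<longleftrightarrow> (fst w - fst v, snd w - snd v) \<in> NZ2 N"
      unfolding r_coset_def by (auto simp: prod_eq_iff intro!: bexI[of _ "(fst w - fst v, snd w - snd v)"])
    also have "\<dots> \<longleftrightarrow> w \<in> vclass N v"
      by (simp add: NZ2_eq mem_Times_iff residue_class_def cong_0_iff cong_iff_dvd_diff)
    finally show ?thesis .
  qed
  then show ?thesis by blast
qed

lemma normal_NZ2: "NZ2 N \<lhd> Z2"
proof -
  have "subgroup (NZ2 N) Z2"
  proof (rule group.subgroupI[OF group_Z2])
    show "NZ2 N \<noteq> {}" unfolding NZ2_eq using vclass_refl by blast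
    fix a assume a: "a \<in> NZ2 N"
    have i: "inv\<^bsub>Z2\<^esub> a = (- fst a, - snd a)"
      by (rule group.inv_equality[OF group_Z2]) simp_all
    show "inv\<^bsub>Z2\<^esub> a \<in> NZ2 N" unfolding i using a by (auto simp: NZ2_eq residue_class_def mem_Times_iff cong_0_iff)
    fix b assume b: "b \<in> NZ2 N"
    show "a \<otimes>\<^bsub>Z2\<^esub> b \<in> NZ2 N" using a b by (auto simp: NZ2_eq residue_class_def mem_Times_iff cong_0_iff)
  qed simp
  then show ?thesis using comm_group.subgroup_imp_normal[OF comm_group_Z2] by blast
qed

lemma carrier_Z2_Mod: "carrier (Z2 Mod NZ2 N) = range (vclass N)"
  by (auto simp: FactGroup_def RCOSETS_def NZ2_coset)

lemma pow_Z2_Mod: "vclass N v [^]\<^bsub>Z2 Mod NZ2 N\<^esub> (n::nat) = vclass N (svec (int n) v)"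
proof (induction n)
  case 0
  then show ?case by (simp add: FactGroup_def nat_pow_def NZ2_eq svec_def)
next
  case (Suc n)
  have "vclass N v [^]\<^bsub>Z2 Mod NZ2 N\<^esub> Suc n = vclass N (svec (int n) v) \<otimes>\<^bsub>Z2 Mod NZ2 N\<^esub> vclass N v"
    using Suc by (simp add: nat_pow_def)
  also have "\<dots> = (NZ2 N #>\<^bsub>Z2\<^esub> svec (int n) v) <#>\<^bsub>Z2\<^esub> (NZ2 N #>\<^bsub>Z2\<^esub> v)"
    unfolding NZ2_coset by (simp add: FactGroup_def)
  also have "\<dots> = NZ2 N #>\<^bsub>Z2\<^esub> (svec (int n) v \<otimes>\<^bsub>Z2\<^esub> v)"
    by (rule normal.rcos_sum[OF normal_NZ2]) simp_all
  also have "\<dots> = vclass N (svec (int (Suc n)) v)"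
    unfolding NZ2_coset by (simp add: svec_def algebra_simps)
  finally show ?case .
qed

lemma Lambda_N_class: "L \<in> Lambda_N N \<Longrightarrow> \<exists>v. L = vclass N v"
  unfolding Lambda_N_def carrier_Z2_Mod by blast

lemma vclass_eq_iff: "vclass N v = vclass N w \<longleftrightarrow> v \<in> vclass N w"
proof
  assume "vclass N v = vclass N w"
  then show "v \<in> vclass N w" using vclass_refl[of v N] by blast
next
  assume v: "v \<in> vclass N w"
  have "u \<in> vclass N v \<longleftrightarrow> u \<in> vclass N w" for u
    using vclass_trans[OF _ v] vclass_trans[OF _ vclass_symD[OF v]] by blast
  then show "vclass N v = vclass N w" by blast
qed

lemma prim_dvd_cancel:
  assumes "v \<in> prim" "m dvd n * fst v" "m dvd n * snd v"
  shows "m dvd (n::int)"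
proof -
  have "m dvd gcd (n * fst v) (n * snd v)" using assms by simp
  then have "m dvd \<bar>n\<bar> * gcd (fst v) (snd v)" by (simp only: gcd_mult_distrib_int)
  then show ?thesis using assms(1) by (simp add: prim_def)
qed

text \<open>A multiple \<open>n v\<close> of a primitive vector vanishes modulo \<open>N\<close> only if \<open>N\<close> divides \<open>n\<close>.\<close>
lemma Lambda_N_prim: "v \<in> prim \<Longrightarrow> vclass N v \<in> Lambda_N N"
proof -
  assume v: "v \<in> prim"
  let ?Q = "Z2 Mod NZ2 N"
  have Q: "group ?Q" by (rule normal.factorgroup_is_group[OF normal_NZ2])
  have c: "vclass N v \<in> carrier ?Q" by (auto simp: carrier_Z2_Mod)
  have "group.ord ?Q (vclass N v) = N \<longleftrightarrow> (\<forall>n::nat. vclass N v [^]\<^bsub>?Q\<^esub> n = \<one>\<^bsub>?Q\<^esub> \<longleftrightarrow> N dvd n)"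
    by (rule group.ord_unique[OF Q c])
  moreover have "vclass N v [^]\<^bsub>?Q\<^esub> n = \<one>\<^bsub>?Q\<^esub> \<longleftrightarrow> N dvd n" for n :: nat
  proof -
    have "vclass N v [^]\<^bsub>?Q\<^esub> n = \<one>\<^bsub>?Q\<^esub> \<longleftrightarrow> svec (int n) v \<in> vclass N (0, 0)"
    proof -
      have "\<one>\<^bsub>?Q\<^esub> = vclass N (0, 0)" by (simp add: FactGroup_def NZ2_eq)
      then show ?thesis unfolding pow_Z2_Mod by (simp only: vclass_eq_iff)
    qed
    also have "\<dots> \<longleftrightarrow> int N dvd int n * fst v \<and> int N dvd int n * snd v"
      by (simp add: residue_class_def svec_def cong_0_iff)
    also have "\<dots> \<longleftrightarrow> int N dvd int n" using prim_dvd_cancel[OF v, of "int N" "int n"] by auto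
    finally show ?thesis by (simp only: int_dvd_int_iff)
  qed
  ultimately show ?thesis using c by (simp add: Lambda_N_def)
qed

definition class_ind :: "(int \<times> int) set \<Rightarrow> int \<times> int \<Rightarrow> complex" where
  "class_ind L v = of_bool (v \<in> L)"

lemma periodic_class_ind: "periodic N (class_ind (vclass N w))"
  unfolding periodic_def class_ind_def
proof (intro ballI impI)
  fix u v assume uv: "u \<in> vclass N v"
  have "u \<in> vclass N w \<longleftrightarrow> v \<in> vclass N w"
    by (rule iffI[OF vclass_common[OF uv] vclass_trans[OF uv]])
  then show "of_bool (u \<in> vclass N w) = (of_bool (v \<in> vclass N w) :: complex)" by (simp only:)
qed

text \<open>The pairs with \<open>gcd c d = 1\<close> in the class \<open>L\<close> are its primitive vectors; the coefficient
  function is a multiple of the indicator function of \<open>L\<close>.\<close>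
lemma eisenstein_eq_periodic_eis: "eisenstein k N L = periodic_eis k (\<lambda>v. eps_N N * class_ind L v)"
proof
  fix \<tau>
  have "eisenstein_series k L N s \<tau> = (\<Sum>\<^sub>\<infinity>v\<in>prim. eps_N N * class_ind L v * eis_term k s \<tau> v)" for s
  proof -
    have S: "{(c, d). (c, d) \<in> L \<and> gcd c d = 1} = L \<inter> prim" by (auto simp: prim_def)
    have "eisenstein_series k L N s \<tau> = eps_N N * (\<Sum>\<^sub>\<infinity>v\<in>L \<inter> prim. eis_term k s \<tau> v)"
      unfolding eisenstein_series_def S by (simp add: case_prod_unfold eis_term_def lin_def)
    also have "(\<Sum>\<^sub>\<infinity>v\<in>L \<inter> prim. eis_term k s \<tau> v) = (\<Sum>\<^sub>\<infinity>v\<in>prim. class_ind L v * eis_term k s \<tau> v)"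
      by (rule infsum_cong_neutral) (auto simp: class_ind_def)
    finally show ?thesis by (simp only: infsum_cmult_right'[symmetric] mult.assoc)
  qed
  then show "eisenstein k N L \<tau> = periodic_eis k (\<lambda>v. eps_N N * class_ind L v) \<tau>"
    by (simp add: eisenstein_def periodic_eis_def)
qed

lemma vclass_neg_small:
  assumes "N < 3" "N \<ge> 1"
  shows "svec (- 1) v \<in> vclass N v"
proof -
  have "N = 1 \<or> N = 2" using assms by auto
  then show ?thesis
    by (cases v) (auto simp: residue_class_def svec_def cong_iff_dvd_diff)
qed

lemma vclass_neg_large:
  assumes "N \<ge> 3" "v \<in> prim"
  shows "svec (- 1) v \<notin> vclass N v"
proof
  assume "svec (- 1) v \<in> vclass N v"
  then have "int N dvd - fst v - fst v" "int N dvd - snd v - snd v"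
    by (simp_all add: residue_class_def svec_def cong_iff_dvd_diff)
  moreover have "- fst v - fst v = (- 2) * fst v" "- snd v - snd v = (- 2) * snd v" by simp_all
  ultimately have "int N dvd - 2" using prim_dvd_cancel[OF assms(2), of "int N" "- 2"] by simp
  then have "int N dvd 2" by simp
  then show False using assms(1) zdvd_imp_le[of "int N" 2] by simp
qed

text \<open>The functions on primitive vectors that correspond to the elements of \<open>Eis k N G R\<close> under
  \<open>bdry_eis k\<close>. In weight 2 the last condition expresses holomorphy.\<close>
definition admissible :: "nat \<Rightarrow> nat \<Rightarrow> (int ^ 2 ^ 2) set \<Rightarrow> complex set \<Rightarrow> (int \<times> int \<Rightarrow> complex) \<Rightarrow> bool" where
  "admissible k N G R b \<longleftrightarrow> periodic N b \<and> parity k b \<and> (\<forall>v\<in>prim. b v \<in> R) \<and>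
     (\<forall>g\<in>G. \<forall>v\<in>prim. b (act v g) = b v) \<and> (k = 2 \<longrightarrow> (\<Sum>r\<in>reps N. b r) = 0)"

lemma bdry_eis_diff:
  assumes "k \<ge> 2" "N \<ge> 1" "periodic N a" "periodic N b"
  shows "bdry_eis k (\<lambda>v. a v - b v) \<tau> = bdry_eis k a \<tau> - bdry_eis k b \<tau>"
proof -
  have m: "periodic N (\<lambda>v. (- 1) * (b v / 2))" by (intro periodic_cmult periodic_half assms)
  have "bdry_eis k (\<lambda>v. a v - b v) \<tau> = periodic_eis k (\<lambda>v. a v / 2 + (- 1) * (b v / 2)) \<tau>"
    by (simp add: bdry_eis_def diff_divide_distrib)
  also have "\<dots> = periodic_eis k (\<lambda>v. a v / 2) \<tau> + (- 1) * periodic_eis k (\<lambda>v. b v / 2) \<tau>"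
    by (simp only: periodic_eis_add[OF assms(1,2) periodic_half[OF assms(3)] m]
        periodic_eis_cmult[OF assms(1,2) periodic_half[OF assms(4)]])
  finally show ?thesis by (simp add: bdry_eis_def)
qed

lemma bdry_eis_sum:
  assumes "k \<ge> 2" "N \<ge> 1" "\<And>i. i \<in> I \<Longrightarrow> periodic N (b i)"
  shows "bdry_eis k (\<lambda>v. \<Sum>i\<in>I. c i * b i v) \<tau> = (\<Sum>i\<in>I. c i * bdry_eis k (b i) \<tau>)"
proof -
  have "bdry_eis k (\<lambda>v. \<Sum>i\<in>I. c i * b i v) \<tau> = periodic_eis k (\<lambda>v. \<Sum>i\<in>I. c i * (b i v / 2)) \<tau>"
    by (simp add: bdry_eis_def sum_divide_distrib)
  also have "\<dots> = (\<Sum>i\<in>I. c i * periodic_eis k (\<lambda>v. b i v / 2) \<tau>)"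
    by (rule periodic_eis_sum[OF assms(1,2)]) (rule periodic_half[OF assms(3)])
  finally show ?thesis by (simp add: bdry_eis_def)
qed

lemma bdry_eis_cong: "(\<And>v. v \<in> prim \<Longrightarrow> a v = b v) \<Longrightarrow> bdry_eis k a = bdry_eis k b"
  unfolding bdry_eis_def by (rule periodic_eis_cong) simp

lemma slash_bdry_eis:
  assumes k: "k \<ge> 2" and N: "N \<ge> 1" and b: "periodic N b" and g: "g \<in> carrier SL2Z" and \<tau>: "\<tau> \<in> upper_half_plane"
  shows "slash k g (bdry_eis k b) \<tau> = bdry_eis k (\<lambda>v. b (act v (adj2 g))) \<tau>"
  using slash_periodic_eis[OF k N periodic_half[OF b] g, of \<tau>] \<tau>
  by (simp add: bdry_eis_def upper_half_plane_def)

lemma sum_half_reps: "(\<Sum>r\<in>reps N. b r / 2 :: complex) = 0 \<longleftrightarrow> (\<Sum>r\<in>reps N. b r) = 0"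
  by (simp flip: sum_divide_distrib)

text \<open>Symmetrizing the coefficients of \<open>f\<close> gives \<open>b\<close>. Its values lie in \<open>R\<close> although \<open>eps_N\<close> may
  be 1/2, because then \<open>v\<close> and \<open>-v\<close> are congruent and the two equal summands add up to twice
  that half, or cancel. The invariance of \<open>b\<close> follows from that of \<open>f\<close> by injectivity.\<close>
lemma Eis_imp_admissible:
  assumes k: "k \<ge> 2" and N: "N \<ge> 1" and R: "subring R (ring_of_type_algebra :: complex ring)"
    and G: "G \<subseteq> carrier SL2Z" and f: "f \<in> Eis k N G R"
  obtains b where "admissible k N G R b" "f = bdry_eis k b"
proof -
  from f have fs: "f \<in> Eis_star_N k N R" and inv: "\<And>g \<tau>. g \<in> G \<Longrightarrow> \<tau> \<in> upper_half_plane \<Longrightarrow> slash k g f \<tau> = f \<tau>"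
    and hol: "f holomorphic_on upper_half_plane"
    by (auto simp: Eis_def Eis_star_def)
  from fs obtain J c where J: "finite J" "J \<subseteq> Lambda_N N" "\<forall>L\<in>J. c L \<in> R"
    and f_eq: "f = (\<lambda>\<tau>. \<Sum>L\<in>J. c L * eisenstein k N L \<tau>)"
    unfolding Eis_star_N_def span_over_def by blast
  define S where "S = (\<lambda>v. \<Sum>L\<in>J. c L * class_ind L v)"
  define b where "b = (\<lambda>v. eps_N N * (S v + (- 1) ^ k * S (svec (- 1) v)))"
  have perL: "periodic N (class_ind L)" if "L \<in> J" for L
    using Lambda_N_class[of L N] J(2) that periodic_class_ind by blast
  have perS: "periodic N S" unfolding S_def by (rule periodic_sum[OF perL])
  have perS': "periodic N (\<lambda>v. eps_N N * S v)" by (rule periodic_cmult[OF perS])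
  have per: "periodic N b"
    unfolding b_def by (intro periodic_cmult periodic_add perS periodic_neg)
  have par: "parity k b"
    unfolding parity_def b_def by (simp add: algebra_simps)
  have SR: "S v \<in> R" for v
    unfolding S_def
    by (intro subring_complex_sum[OF R] subring_complex_closed(4)[OF R])
       (use J(3) subring_complex_closed(1,2)[OF R] in \<open>auto simp: class_ind_def\<close>)
  have bR: "b v \<in> R" if v: "v \<in> prim" for v
  proof (cases "N \<ge> 3")
    case True
    then show ?thesis
      unfolding b_def eps_N_def
      using subring_complex_closed(3)[OF R SR subring_complex_closed(4)[OF R subring_complex_power_neg[OF R] SR]]
      by simp
  next
    case False
    then have "svec (- 1) v \<in> vclass N v" using N by (intro vclass_neg_small) auto
    then have "S (svec (- 1) v) = S v" using v by (intro periodicD[OF perS]) auto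
    then have "b v = S v \<or> b v = 0"
      using False by (cases "even k") (auto simp: b_def eps_N_def)
    then show ?thesis using SR[of v] subring_complex_closed(1)[OF R] by auto
  qed
  have f_b: "f = bdry_eis k b"
  proof
    fix \<tau>
    have "f \<tau> = (\<Sum>L\<in>J. c L * periodic_eis k (\<lambda>v. eps_N N * class_ind L v) \<tau>)"
      by (simp add: f_eq eisenstein_eq_periodic_eis)
    also have "\<dots> = periodic_eis k (\<lambda>v. \<Sum>L\<in>J. c L * (eps_N N * class_ind L v)) \<tau>"
      by (rule periodic_eis_sum[OF k N, symmetric]) (intro periodic_cmult perL)
    also have "(\<lambda>v. \<Sum>L\<in>J. c L * (eps_N N * class_ind L v)) = (\<lambda>v. eps_N N * S v)"
      unfolding S_def sum_distrib_left by (simp add: mult.left_commute)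
    also have "periodic_eis k (\<lambda>v. eps_N N * S v) = periodic_eis k (\<lambda>v. (eps_N N * S v + (- 1) ^ k * (eps_N N * S (svec (- 1) v))) / 2)"
      by (rule periodic_eis_symmetrize[OF k N perS', symmetric])
    also have "(\<lambda>v. (eps_N N * S v + (- 1) ^ k * (eps_N N * S (svec (- 1) v))) / 2) = (\<lambda>v. b v / 2)"
      unfolding b_def by (simp add: algebra_simps)
    finally show "f \<tau> = bdry_eis k b \<tau>" by (simp add: bdry_eis_def)
  qed
  have binv: "b (act v g) = b v" if g: "g \<in> G" and v: "v \<in> prim" for g v
  proof -
    have gS: "g \<in> carrier SL2Z" using g G by blast
    let ?b = "\<lambda>v. b (act v (adj2 g))"
    have pb: "periodic N ?b" by (rule periodic_act[OF adj2_mult(3)[OF gS] per])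
    have "?b w - b w = 0" if "w \<in> prim" for w
    proof (rule bdry_eis_zero_imp[OF k N, of "\<lambda>w. ?b w - b w"])
      show "periodic N (\<lambda>w. ?b w - b w)"
        using periodic_add[OF pb periodic_cmult[OF per, of "- 1"]] by simp
      show "parity k (\<lambda>w. ?b w - b w)"
        using par prim_act[OF adj2_mult(3)[OF gS]] unfolding parity_def by (simp add: act_svec right_diff_distrib)
      show "bdry_eis k (\<lambda>w. ?b w - b w) \<tau> = 0" if "\<tau> \<in> upper_half_plane" for \<tau>
        using slash_bdry_eis[OF k N per gS that] inv[OF g that]
        by (simp add: bdry_eis_diff[OF k N pb per] f_b)
    qed (rule that)
    from this[of "act v g"] show ?thesis using v gS prim_act[OF gS] by simp
  qed
  have b2: "(\<Sum>r\<in>reps N. b r) = 0" if "k = 2"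
  proof -
    have "periodic_eis 2 (\<lambda>v. b v / 2) holomorphic_on upper_half_plane"
      using hol f_b that by (simp add: bdry_eis_def)
    then show ?thesis
      by (simp only: periodic_eis_2_holomorphic_iff[OF N periodic_half[OF per]] sum_half_reps)
  qed
  show ?thesis
    by (rule that[of b]) (use per par bR binv b2 f_b in \<open>auto simp: admissible_def\<close>)
qed

text \<open>An integer that encodes the residue class of \<open>v\<close>; comparing it at \<open>v\<close> and \<open>-v\<close> selects one
  class from each pair of opposite classes.\<close>
definition class_key :: "nat \<Rightarrow> int \<times> int \<Rightarrow> int" where
  "class_key N v = (fst v mod int N) * int N + snd v mod int N"

lemma class_key_eq_iff:
  assumes N: "N \<ge> 1"
  shows "class_key N v = class_key N w \<longleftrightarrow> v \<in> vclass N w"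
proof
  assume eq: "class_key N v = class_key N w"
  have d: "class_key N v div int N = fst v mod int N" "class_key N v mod int N = snd v mod int N" for v
    using N by (simp_all add: class_key_def div_add1_eq)
  show "v \<in> vclass N w"
    unfolding vclass_iff cong_def using eq d[of v] d[of w] by simp
qed (simp add: mem_Times_iff residue_class_def cong_def class_key_def)

text \<open>To stay inside \<open>R\<close> without dividing by 2, only one class from each pair of opposite
  classes is used: \<open>S\<close> equals \<open>b\<close> on the chosen half and 0 on the other, and its symmetrization
  is \<open>b\<close>. For \<open>N < 3\<close> every class is its own opposite, all classes are chosen, and \<open>eps_N = 1/2\<close>
  accounts for the double contribution.\<close>
lemma admissible_imp_Eis:
  assumes k: "k \<ge> 2" and N: "N \<ge> 1" and R: "subring R (ring_of_type_algebra :: complex ring)"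
    and G: "subgroup G SL2Z" and b: "admissible k N G R b"
  shows "bdry_eis k b \<in> Eis k N G R"
proof -
  have Gc: "G \<subseteq> carrier SL2Z" by (rule subgroup.subset[OF G])
  from b have per: "periodic N b" and par: "parity k b" and bR: "\<And>v. v \<in> prim \<Longrightarrow> b v \<in> R"
    and inv: "\<And>g v. g \<in> G \<Longrightarrow> v \<in> prim \<Longrightarrow> b (act v g) = b v" and b2: "k = 2 \<Longrightarrow> (\<Sum>r\<in>reps N. b r) = 0"
    by (auto simp: admissible_def)
  define P where "P = {r \<in> reps N. class_key N r \<le> class_key N (svec (- 1) r)}"
  define S where "S = (\<lambda>v. \<Sum>r\<in>P. b r * class_ind (vclass N r) v)"
  have finP: "finite P" unfolding P_def using finite_reps[OF N] by simp
  have perS: "periodic N S" unfolding S_def by (rule periodic_sum[OF periodic_class_ind])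
  have S_val: "S v = (if class_key N v \<le> class_key N (svec (- 1) v) then b v else 0)" if v: "v \<in> prim" for v
  proof -
    have keys: "class_key N r = class_key N v" "class_key N (svec (- 1) r) = class_key N (svec (- 1) v)" if "v \<in> vclass N r" for r
    proof -
      show "class_key N r = class_key N v" by (rule iffD2[OF class_key_eq_iff[OF N] vclass_symD[OF that]])
      show "class_key N (svec (- 1) r) = class_key N (svec (- 1) v)"
        by (rule iffD2[OF class_key_eq_iff[OF N] svec_vclass[OF vclass_symD[OF that]]])
    qed
    have "S v = (\<Sum>r\<in>reps N. if class_key N r \<le> class_key N (svec (- 1) r) then b r * of_bool (v \<in> vclass N r) else 0)"
      unfolding S_def P_def class_ind_def by (rule sum.inter_filter[OF finite_reps[OF N]])
    also have "\<dots> = (\<Sum>r\<in>reps N. (if class_key N r \<le> class_key N (svec (- 1) r) then b r else 0) * of_bool (v \<in> vclass N r))"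
      by (rule sum.cong) (simp_all only: if_distribR if_distrib[of "\<lambda>x. x * _"] mult_zero_left)
    also have "\<dots> = (if class_key N v \<le> class_key N (svec (- 1) v) then b v else 0)"
    proof (rule sum_reps_of_bool[OF N v])
      fix r assume r: "r \<in> reps N" "v \<in> vclass N r"
      have "b v = b r" using r reps_prim v by (intro periodicD[OF per]) auto
      then show "(if class_key N r \<le> class_key N (svec (- 1) r) then b r else 0) = (if class_key N v \<le> class_key N (svec (- 1) v) then b v else 0)"
        using keys[OF r(2)] by simp
    qed
    finally show ?thesis .
  qed
  have combine: "(eps_N N * S v + (- 1) ^ k * (eps_N N * S (svec (- 1) v))) / 2 = b v / 2" if v: "v \<in> prim" for v
  proof -
    have bn: "(- 1) ^ k * b (svec (- 1) v) = b v" using par v by (simp add: parity_def)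
    have vn: "svec (- 1) v \<in> prim" using v by simp
    show ?thesis
    proof (cases "N \<ge> 3")
      case True
      have "class_key N (svec (- 1) v) \<noteq> class_key N v"
        unfolding class_key_eq_iff[OF N] by (rule vclass_neg_large[OF True v])
      then show ?thesis using S_val[OF v] S_val[OF vn] True bn by (auto simp: eps_N_def)
    next
      case False
      have "class_key N (svec (- 1) v) = class_key N v"
        unfolding class_key_eq_iff[OF N] by (rule vclass_neg_small) (use False N in auto)
      then show ?thesis using S_val[OF v] S_val[OF vn] False bn by (simp add: eps_N_def)
    qed
  qed
  have f_eq: "bdry_eis k b \<tau> = (\<Sum>r\<in>P. b r * eisenstein k N (vclass N r) \<tau>)" for \<tau>
  proof -
    have "bdry_eis k b = periodic_eis k (\<lambda>v. (eps_N N * S v + (- 1) ^ k * (eps_N N * S (svec (- 1) v))) / 2)"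
      unfolding bdry_eis_def by (rule periodic_eis_cong) (rule combine[symmetric])
    also have "\<dots> = periodic_eis k (\<lambda>v. eps_N N * S v)"
      by (rule periodic_eis_symmetrize[OF k N periodic_cmult[OF perS]])
    also have "(\<lambda>v. eps_N N * S v) = (\<lambda>v. \<Sum>r\<in>P. b r * (eps_N N * class_ind (vclass N r) v))"
      unfolding S_def sum_distrib_left by (simp add: mult.left_commute)
    finally have "bdry_eis k b \<tau> = periodic_eis k (\<lambda>v. \<Sum>r\<in>P. b r * (eps_N N * class_ind (vclass N r) v)) \<tau>"
      by (rule fun_cong)
    also have "\<dots> = (\<Sum>r\<in>P. b r * periodic_eis k (\<lambda>v. eps_N N * class_ind (vclass N r) v) \<tau>)"
      by (rule periodic_eis_sum[OF k N]) (intro periodic_cmult periodic_class_ind)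
    finally show ?thesis by (simp only: eisenstein_eq_periodic_eis)
  qed
  have inj: "inj_on (vclass N) P"
  proof (rule inj_onI)
    fix r r' assume r: "r \<in> P" "r' \<in> P" and eq: "vclass N r = vclass N r'"
    show "r = r'"
      by (rule reps_unique[OF _ _ iffD1[OF vclass_eq_iff eq]]) (use r in \<open>simp_all add: P_def\<close>)
  qed
  have star: "bdry_eis k b \<in> Eis_star_N k N R"
    unfolding Eis_star_N_def span_over_def mem_Collect_eq
  proof (intro exI conjI)
    let ?c = "\<lambda>L. b (the_inv_into P (vclass N) L)"
    show "bdry_eis k b = (\<lambda>\<tau>. \<Sum>L\<in>vclass N ` P. ?c L * eisenstein k N L \<tau>)"
      by (rule ext) (simp add: f_eq sum.reindex[OF inj] the_inv_into_f_f[OF inj])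
    show "finite (vclass N ` P)" using finP by simp
    show "vclass N ` P \<subseteq> Lambda_N N" 
    proof (intro image_subsetI Lambda_N_prim)
      fix r assume "r \<in> P" then show "r \<in> prim" using reps_prim unfolding P_def by blast
    qed
    show "\<forall>L\<in>vclass N ` P. ?c L \<in> R"
    proof
      fix L assume "L \<in> vclass N ` P"
      then obtain r where r: "r \<in> P" "L = vclass N r" by blast
      have "r \<in> prim" using r(1) reps_prim unfolding P_def by blast
      then show "?c L \<in> R" using bR r(2) the_inv_into_f_f[OF inj r(1)] by simp
    qed
  qed
  have "slash k g (bdry_eis k b) \<tau> = bdry_eis k b \<tau>" if g: "g \<in> G" and \<tau>: "\<tau> \<in> upper_half_plane" for g \<tau>
  proof -
    have gS: "g \<in> carrier SL2Z" using g Gc by blast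
    have "adj2 g \<in> G" using subgroup.m_inv_closed[OF G g] inv_SL2Z[OF gS] by simp
    then have "bdry_eis k (\<lambda>v. b (act v (adj2 g))) = bdry_eis k b"
      using inv by (intro bdry_eis_cong)
    then show ?thesis by (simp only: slash_bdry_eis[OF k N per gS \<tau>])
  qed
  moreover have "bdry_eis k b holomorphic_on upper_half_plane"
  proof (cases "k = 2")
    case True
    then show ?thesis
      using b2 periodic_eis_2_holomorphic_iff[OF N periodic_half[OF per]]
      by (simp add: bdry_eis_def sum_half_reps)
  next
    case False
    then show ?thesis
      using k unfolding bdry_eis_def by (intro periodic_eis_holomorphic[OF _ N periodic_half[OF per]]) simp
  qed
  ultimately show ?thesis using star by (simp add: Eis_def Eis_star_def)
qed

section \<open>Cusps as orbits of primitive vectors\<close>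

text \<open>The zero of the linear form \<open>c\<tau> + d\<close>. With this sign, the right action on row vectors
  corresponds to the inverse of the Moebius action on points (\<open>moebius_pt\<close>).\<close>
definition pt :: "int \<times> int \<Rightarrow> P1Q" where
  "pt v = (if fst v = 0 then Infty else Fin (- of_int (snd v) / of_int (fst v)))"

lemma prim_fst_0: "v \<in> prim \<Longrightarrow> fst v = 0 \<Longrightarrow> v = (0, 1) \<or> v = svec (- 1) (0, 1)"
  by (cases v) (auto simp: prim_def svec_def abs_if split: if_splits)

lemma pt_neg [simp]: "pt (svec (- 1) v) = pt v"
  by (simp add: pt_def svec_def)

lemma moebius_pt:
  assumes v: "v \<in> prim"
  shows "moebius_P1Q g (pt v) = pt (act v (adj2 g))"
proof -
  obtain p q where pq: "v = (p, q)" by force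
  have A: "act v (adj2 g) = (p * g $ 2 $ 2 - q * g $ 2 $ 1, q * g $ 1 $ 1 - p * g $ 1 $ 2)"
    by (simp add: act_def pq)
  show ?thesis
  proof (cases "p = 0")
    case True
    then have "q = 1 \<or> q = - 1" using prim_fst_0[OF v] by (auto simp: pq svec_def)
    then show ?thesis unfolding A by (auto simp: pt_def pq True)
  next
    case False
    let ?P = "of_int p :: rat" and ?Q = "of_int q :: rat"
    let ?a = "of_int (g $ 1 $ 1) :: rat" and ?b = "of_int (g $ 1 $ 2) :: rat" and ?c = "of_int (g $ 2 $ 1) :: rat" and ?d = "of_int (g $ 2 $ 2) :: rat"
    have P: "?P \<noteq> 0" using False by simp
    have x: "pt v = Fin (- ?Q / ?P)" using False by (simp add: pt_def pq)
    have den: "?c * (- ?Q / ?P) + ?d = (?P * ?d - ?Q * ?c) / ?P" and num: "?a * (- ?Q / ?P) + ?b = (?P * ?b - ?Q * ?a) / ?P"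
      using P by (simp_all add: field_simps)
    have i: "of_int (p * g $ 2 $ 2 - q * g $ 2 $ 1) = ?P * ?d - ?Q * ?c" "of_int (q * g $ 1 $ 1 - p * g $ 1 $ 2) = ?Q * ?a - ?P * ?b"
      by simp_all
    show ?thesis
    proof (cases "p * g $ 2 $ 2 - q * g $ 2 $ 1 = 0")
      case True
      then have "?P * ?d - ?Q * ?c = 0" using i(1) by simp
      then have "moebius_P1Q g (pt v) = Infty" unfolding x moebius_P1Q.simps den by simp
      then show ?thesis unfolding A using True by (simp add: pt_def)
    next
      case nz: False
      then have D: "?P * ?d - ?Q * ?c \<noteq> 0" using i(1) by (metis of_int_0_eq_iff)
      then have "moebius_P1Q g (pt v) = Fin ((?P * ?b - ?Q * ?a) / ?P / ((?P * ?d - ?Q * ?c) / ?P))"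
        unfolding x moebius_P1Q.simps den num using P by simp
      also have "(?P * ?b - ?Q * ?a) / ?P / ((?P * ?d - ?Q * ?c) / ?P) = (?P * ?b - ?Q * ?a) / (?P * ?d - ?Q * ?c)"
        using P by simp
      also have "\<dots> = - (?Q * ?a - ?P * ?b) / (?P * ?d - ?Q * ?c)" by simp
      finally show ?thesis unfolding A pt_def fst_conv snd_conv i using nz by simp
    qed
  qed
qed

lemma pt_01: "pt (0, 1) = Infty" by (simp add: pt_def)

text \<open>By transitivity it suffices to compare with \<open>(0, 1)\<close>, where \<open>pt\<close> is infinite.\<close>
lemma pt_eq_iff:
  assumes v: "v \<in> prim" and w: "w \<in> prim"
  shows "pt v = pt w \<longleftrightarrow> w = v \<or> w = svec (- 1) v"
proof
  assume eq: "pt v = pt w"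
  obtain g where g: "g \<in> carrier SL2Z" "act (0, 1) g = v" using prim_transitive[OF v] by blast
  have "pt (act w (adj2 g)) = pt (act v (adj2 g))"
    using moebius_pt[OF v, of g] moebius_pt[OF w, of g] eq by simp
  also have "act v (adj2 g) = (0, 1)" using g act_adj2(1)[OF g(1), of "(0, 1)"] by simp
  finally have "fst (act w (adj2 g)) = 0" by (simp add: pt_def split: if_splits)
  moreover have "act w (adj2 g) \<in> prim" using w prim_act[OF adj2_mult(3)[OF g(1)]] by simp
  ultimately have "act w (adj2 g) = (0, 1) \<or> act w (adj2 g) = svec (- 1) (0, 1)" by (intro prim_fst_0)
  then have "act (act w (adj2 g)) g = v \<or> act (act w (adj2 g)) g = svec (- 1) v"
    using g(2) by (auto simp: act_svec)
  then show "w = v \<or> w = svec (- 1) v" using act_adj2(2)[OF g(1)] by simp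
qed auto

lemma pt_surj: "\<exists>v\<in>prim. pt v = x"
proof (cases x)
  case Infty
  then show ?thesis using prim_01 pt_01 by blast
next
  case (Fin r)
  obtain a b where ab: "quotient_of r = (a, b)" by force
  have b: "b > 0" and cop: "coprime a b" and r: "r = of_int a / of_int b"
    using quotient_of_denom_pos[OF ab] quotient_of_coprime[OF ab] quotient_of_div[OF ab] by auto
  have "(b, - a) \<in> prim" using cop by (simp add: prim_def coprime_iff_gcd_eq_1 gcd.commute)
  moreover have "pt (b, - a) = x" using b by (simp add: pt_def Fin r)
  ultimately show ?thesis by blast
qed

text \<open>The orbit under the right action; by \<open>Gorbit_pt\<close> it maps onto the orbit of points, as \<open>G\<close>
  is closed under inverses.\<close>
definition orb :: "(int ^ 2 ^ 2) set \<Rightarrow> int \<times> int \<Rightarrow> (int \<times> int) set" where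
  "orb G v = act v ` G"

abbreviation Gorbit :: "(int ^ 2 ^ 2) set \<Rightarrow> P1Q \<Rightarrow> P1Q set" where
  "Gorbit G x \<equiv> Group_Action.orbit (SL2Z_sub G) moebius_P1Q x"

context
  fixes G assumes G: "subgroup G SL2Z"
begin

lemma G_SL2Z: "g \<in> G \<Longrightarrow> g \<in> carrier SL2Z"
  using subgroup.subset[OF G] by blast

lemma G_mult: "g \<in> G \<Longrightarrow> h \<in> G \<Longrightarrow> g ** h \<in> G"
  using subgroup.m_closed[OF G, of g h] by simp

lemma G_one: "mat 1 \<in> G"
  using subgroup.one_closed[OF G] by simp

lemma G_adj: "g \<in> G \<Longrightarrow> adj2 g \<in> G"
  using subgroup.m_inv_closed[OF G, of g] inv_SL2Z[OF G_SL2Z] by simp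

lemma orb_prim: "v \<in> prim \<Longrightarrow> w \<in> orb G v \<Longrightarrow> w \<in> prim"
  using prim_act G_SL2Z unfolding orb_def by blast

lemma orb_refl: "v \<in> orb G v"
  unfolding orb_def using G_one by (intro image_eqI[of _ _ "mat 1"]) simp_all

lemma orb_act: "w \<in> orb G v \<Longrightarrow> g \<in> G \<Longrightarrow> act w g \<in> orb G v"
  unfolding orb_def using G_mult by (auto simp flip: act_mult)

lemma orb_eq: "w \<in> orb G v \<Longrightarrow> orb G w = orb G v"
proof -
  assume "w \<in> orb G v"
  then obtain h where h: "h \<in> G" "w = act v h" unfolding orb_def by blast
  have "v = act w (adj2 h)" using h G_SL2Z by simp
  show ?thesis
  proof
    show "orb G w \<subseteq> orb G v" unfolding orb_def h(2) using G_mult[OF h(1)] by (auto simp flip: act_mult)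
    show "orb G v \<subseteq> orb G w"
      unfolding orb_def by (subst \<open>v = act w (adj2 h)\<close>) (use G_mult[OF G_adj[OF h(1)]] in \<open>auto simp flip: act_mult\<close>)
  qed
qed

lemma orb_act_iff: "g \<in> G \<Longrightarrow> act w g \<in> orb G v \<longleftrightarrow> w \<in> orb G v"
  using orb_act[of w v g] orb_act[of "act w g" v "adj2 g"] G_adj[of g] act_adj2(1)[OF G_SL2Z, of g w] by auto

lemma Gorbit_pt: "v \<in> prim \<Longrightarrow> Gorbit G (pt v) = pt ` orb G v"
proof -
  assume v: "v \<in> prim"
  have "Gorbit G (pt v) = (\<lambda>g. pt (act v (adj2 g))) ` G"
    unfolding orbit_def using moebius_pt[OF v] by auto
  also have "\<dots> = (\<lambda>g. pt (act v g)) ` (adj2 ` G)" by (simp add: image_image)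
  also have "adj2 ` G = G"
  proof -
    have "adj2 (adj2 g) = g" for g by (simp add: mat2_eq_iff)
    then show ?thesis using G_adj by (metis (no_types, lifting) image_eqI image_subsetI subsetI subset_antisym)
  qed
  finally show ?thesis by (simp add: orb_def image_image)
qed

lemma pt_in_Gorbit:
  assumes v: "v \<in> prim" and w: "w \<in> prim"
  shows "pt w \<in> Gorbit G (pt v) \<longleftrightarrow> w \<in> orb G v \<or> svec (- 1) w \<in> orb G v"
proof
  assume "pt w \<in> Gorbit G (pt v)"
  then obtain u where u: "u \<in> orb G v" "pt w = pt u" unfolding Gorbit_pt[OF v] by blast
  have "u = w \<or> u = svec (- 1) w" using pt_eq_iff[OF w orb_prim[OF v u(1)]] u(2) by simp
  then show "w \<in> orb G v \<or> svec (- 1) w \<in> orb G v" using u(1) by auto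
next
  assume "w \<in> orb G v \<or> svec (- 1) w \<in> orb G v"
  then show "pt w \<in> Gorbit G (pt v)"
    unfolding Gorbit_pt[OF v]
  proof
    assume "svec (- 1) w \<in> orb G v"
    then have "pt (svec (- 1) w) \<in> pt ` orb G v" by (rule imageI)
    then show "pt w \<in> pt ` orb G v" by simp
  qed (rule imageI)
qed

lemma Gorbit_eq: "y \<in> Gorbit G x \<Longrightarrow> Gorbit G y = Gorbit G x"
proof -
  assume y: "y \<in> Gorbit G x"
  obtain v where v: "v \<in> prim" "pt v = x" using pt_surj by blast
  obtain w where w: "w \<in> orb G v" "y = pt w" using y Gorbit_pt[OF v(1)] v(2) by blast
  show ?thesis using orb_eq[OF w(1)] Gorbit_pt[OF v(1)] Gorbit_pt[OF orb_prim[OF v(1) w(1)]] v(2) w(2) by simp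
qed

lemma Gorbit_refl: "x \<in> Gorbit G x"
  using pt_surj[of x] Gorbit_pt orb_refl by blast

lemma cusps_iff: "C \<in> cusps G \<longleftrightarrow> (\<exists>x. C = Gorbit G x)"
  by (auto simp: cusps_def orbits_def)

lemma cusp_eq_Gorbit: "C \<in> cusps G \<Longrightarrow> x \<in> C \<Longrightarrow> C = Gorbit G x"
  unfolding cusps_iff using Gorbit_eq by blast

end

text \<open>Any completion of \<open>w\<close> to a matrix in \<open>SL2Z\<close> is corrected by adding a multiple of the
  second row to the first, which makes the upper right entry divisible by \<open>N\<close>; the determinant
  forces the upper left entry to be 1 modulo \<open>N\<close>.\<close>
lemma principal_transitive_01:
  assumes w: "w \<in> prim" "w \<in> vclass N (0, 1)"
  obtains g where "g \<in> principal_congruence_subgroup N" "act (0, 1) g = w"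
proof -
  obtain c d where cd: "w = (c, d)" by force
  have c0: "[c = 0] (mod int N)" and d1: "[d = 1] (mod int N)" using w(2) by (auto simp: cd residue_class_def)
  obtain g0 where g0: "g0 \<in> carrier SL2Z" "act (0, 1) g0 = w" using prim_transitive[OF w(1)] by blast
  define a0 b0 where "a0 = g0 $ 1 $ 1" and "b0 = g0 $ 1 $ 2"
  have g0e: "g0 $ 2 $ 1 = c" "g0 $ 2 $ 2 = d" using g0(2) by (auto simp: act_def cd)
  have det: "a0 * d - b0 * c = 1" using g0(1) by (simp add: carrier_SL2Z g0e a0_def b0_def)
  define g :: "int ^ 2 ^ 2" where "g = vector [vector [a0 - b0 * c, b0 - b0 * d], vector [c, d]]"
  have ge: "g $ 1 $ 1 = a0 - b0 * c" "g $ 1 $ 2 = b0 - b0 * d" "g $ 2 $ 1 = c" "g $ 2 $ 2 = d"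
    by (simp_all add: g_def)
  have "(a0 - b0 * c) * d - (b0 - b0 * d) * c = a0 * d - b0 * c" by (simp add: algebra_simps)
  then have gS: "g \<in> carrier SL2Z" using det by (simp add: carrier_SL2Z ge)
  have cd0: "int N dvd c" "int N dvd d - 1" using c0 d1 by (simp_all add: cong_0_iff cong_iff_dvd_diff)
  have "a0 - b0 * c - 1 = b0 * c - b0 * c - a0 * (d - 1)" using det by (simp add: algebra_simps)
  then have 11: "[g $ 1 $ 1 = 1] (mod int N)" using cd0 by (simp add: cong_iff_dvd_diff ge)
  have "b0 - b0 * d = - b0 * (d - 1)" by (simp add: algebra_simps)
  then have 12: "[g $ 1 $ 2 = 0] (mod int N)" using cd0 by (simp only: cong_0_iff ge) simp
  have "g \<in> principal_congruence_subgroup N"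
    unfolding principal_congruence_subgroup_def mem_Collect_eq forall_2
    using gS 11 12 c0 d1 by (simp add: ge(3,4))
  moreover have "act (0, 1) g = w" by (simp add: act_def ge cd)
  ultimately show ?thesis by (rule that)
qed

lemma principal_iff:
  "g \<in> principal_congruence_subgroup N \<longleftrightarrow> g \<in> carrier SL2Z \<and> [g $ 1 $ 1 = 1] (mod int N) \<and> [g $ 1 $ 2 = 0] (mod int N)
     \<and> [g $ 2 $ 1 = 0] (mod int N) \<and> [g $ 2 $ 2 = 1] (mod int N)"
  unfolding principal_congruence_subgroup_def mem_Collect_eq forall_2 by simp

definition mcong :: "nat \<Rightarrow> int ^ 2 ^ 2 \<Rightarrow> int ^ 2 ^ 2 \<Rightarrow> bool" where
  "mcong N A B \<longleftrightarrow> [A $ 1 $ 1 = B $ 1 $ 1] (mod int N) \<and> [A $ 1 $ 2 = B $ 1 $ 2] (mod int N) \<and>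
     [A $ 2 $ 1 = B $ 2 $ 1] (mod int N) \<and> [A $ 2 $ 2 = B $ 2 $ 2] (mod int N)"

lemma mcong_mult: "mcong N A A' \<Longrightarrow> mcong N B B' \<Longrightarrow> mcong N (A ** B) (A' ** B')"
  unfolding mcong_def mat2_mult_nth by (auto intro!: cong_add cong_mult)

lemma mcong_refl [simp]: "mcong N A A" by (simp add: mcong_def)

lemma mcong_sym: "mcong N A B \<Longrightarrow> mcong N B A"
  unfolding mcong_def by (simp add: cong_sym)

lemma mcong_trans: "mcong N A B \<Longrightarrow> mcong N B C \<Longrightarrow> mcong N A C"
  unfolding mcong_def by (blast intro: cong_trans)

lemma principal_iff_mcong: "g \<in> principal_congruence_subgroup N \<longleftrightarrow> g \<in> carrier SL2Z \<and> mcong N g (mat 1)"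
  by (simp add: principal_iff mcong_def)

lemma principal_conj:
  assumes h: "h \<in> carrier SL2Z" and g: "g \<in> principal_congruence_subgroup N"
  shows "adj2 h ** g ** h \<in> principal_congruence_subgroup N" "h ** g ** adj2 h \<in> principal_congruence_subgroup N"
proof -
  have g': "g \<in> carrier SL2Z" "mcong N g (mat 1)" using g by (auto simp: principal_iff_mcong)
  have "mcong N (adj2 h ** g ** h) (adj2 h ** mat 1 ** h)" "mcong N (h ** g ** adj2 h) (h ** mat 1 ** adj2 h)"
    by (intro mcong_mult mcong_refl g')+
  then show "adj2 h ** g ** h \<in> principal_congruence_subgroup N" "h ** g ** adj2 h \<in> principal_congruence_subgroup N"
    using h g' adj2_mult[OF h] by (simp_all add: principal_iff_mcong mult_closed_SL2Z)
qed

text \<open>\<open>\<Gamma>(N)\<close> is normal, so the claim for \<open>(0, 1)\<close> can be transported by conjugation.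
  Consequently the orbits of \<open>\<Gamma>(N)\<close> on primitive vectors are exactly the residue classes.\<close>
lemma principal_transitive:
  assumes v: "v \<in> prim" and w: "w \<in> prim" and wv: "w \<in> vclass N v"
  obtains g where "g \<in> principal_congruence_subgroup N" "act v g = w"
proof -
  obtain h where h: "h \<in> carrier SL2Z" "act (0, 1) h = v" using prim_transitive[OF v] by blast
  have hv: "act v (adj2 h) = (0, 1)" using h act_adj2(1)[OF h(1), of "(0, 1)"] by simp
  have "act w (adj2 h) \<in> vclass N (act v (adj2 h))" by (rule act_vclass[OF wv])
  then have c: "act w (adj2 h) \<in> vclass N (0, 1)" unfolding hv .
  have p: "act w (adj2 h) \<in> prim" using w prim_act[OF adj2_mult(3)[OF h(1)]] by simp
  obtain g where g: "g \<in> principal_congruence_subgroup N" "act (0, 1) g = act w (adj2 h)"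
    by (rule principal_transitive_01[OF p c])
  have "act v (adj2 h ** g ** h) = w" using hv g(2) h(1) by (simp add: act_mult)
  then show ?thesis using that principal_conj(1)[OF h(1) g(1)] by blast
qed

lemma act_principal: "g \<in> principal_congruence_subgroup N \<Longrightarrow> act v g \<in> vclass N v"
proof -
  assume g: "g \<in> principal_congruence_subgroup N"
  have "[fst v * g $ 1 $ 1 + snd v * g $ 2 $ 1 = fst v * 1 + snd v * 0] (mod int N)"
    using g unfolding principal_iff by (intro cong_add cong_mult cong_refl) simp_all
  moreover have "[fst v * g $ 1 $ 2 + snd v * g $ 2 $ 2 = fst v * 0 + snd v * 1] (mod int N)"
    using g unfolding principal_iff by (intro cong_add cong_mult cong_refl) simp_all
  ultimately show ?thesis by (simp add: act_def residue_class_def mem_Times_iff)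
qed

text \<open>The data of the theorem that do not involve the weight and the coefficient ring.\<close>
locale cusp_setup =
  fixes N :: nat and G :: "(int ^ 2 ^ 2) set" and rep :: "P1Q set \<Rightarrow> P1Q" and \<sigma> :: "P1Q set \<Rightarrow> int ^ 2 ^ 2"
  assumes N: "N \<ge> 1" and G: "subgroup G SL2Z" and principal: "principal_congruence_subgroup N \<subseteq> G"
    and rep: "\<And>C. C \<in> cusps G \<Longrightarrow> rep C \<in> C"
    and \<sigma>: "\<And>C. C \<in> cusps G \<Longrightarrow> \<sigma> C \<in> carrier SL2Z" "\<And>C. C \<in> cusps G \<Longrightarrow> moebius_P1Q (\<sigma> C) Infty = rep C"
begin

lemmas GS = G_SL2Z[OF G] and Gm = G_mult[OF G] and Ga = G_adj[OF G] and G1 = G_one[OF G]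

text \<open>The bottom row of the inverse scaling matrix. It represents the chosen point of the cusp,
  and its sign depends on \<open>\<sigma>\<close>.\<close>
definition base :: "P1Q set \<Rightarrow> int \<times> int" where
  "base C = act (0, 1) (adj2 (\<sigma> C))"

lemma base_prim: "C \<in> cusps G \<Longrightarrow> base C \<in> prim"
  unfolding base_def using prim_act[OF adj2_mult(3)[OF \<sigma>(1)]] prim_01 by simp

lemma pt_base: "C \<in> cusps G \<Longrightarrow> pt (base C) = rep C"
  unfolding base_def using moebius_pt[OF prim_01, of "\<sigma> C"] \<sigma>(2) by (simp add: pt_01)

lemma cusp_eq: "C \<in> cusps G \<Longrightarrow> C = Gorbit G (rep C)"
  by (rule cusp_eq_Gorbit[OF G _ rep])

lemma pt_in_cusp:
  assumes C: "C \<in> cusps G" and w: "w \<in> prim"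
  shows "pt w \<in> C \<longleftrightarrow> w \<in> orb G (base C) \<or> svec (- 1) w \<in> orb G (base C)"
  using pt_in_Gorbit[OF G base_prim[OF C] w] cusp_eq[OF C] pt_base[OF C] by simp

lemma orb_periodic:
  assumes v: "v \<in> prim" and u: "u \<in> prim" and w: "w \<in> orb G v" and c: "u \<in> vclass N w"
  shows "u \<in> orb G v"
proof -
  obtain g where g: "g \<in> principal_congruence_subgroup N" "act w g = u"
    by (rule principal_transitive[OF orb_prim[OF G v w] u c])
  then show ?thesis using orb_act[OF G w, of g] principal by blast
qed

text \<open>The boundary function of \<open>E_{k,x}\<close>: it is \<open>\<plusminus>1\<close> on the vectors representing points of the
  cusp. For odd \<open>k\<close> it satisfies \<open>parity\<close> only if the orbits of \<open>base C\<close> and its negative are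
  disjoint.\<close>
definition beta :: "nat \<Rightarrow> P1Q set \<Rightarrow> int \<times> int \<Rightarrow> complex" where
  "beta k C w = (if w \<in> orb G (base C) then 1 else if svec (- 1) w \<in> orb G (base C) then (- 1) ^ k else 0)"

text \<open>The orbits of \<open>v\<close> and \<open>-v\<close> are disjoint. If \<open>-1\<close> is not in the group, this is regularity
  of the cusp.\<close>
definition separated :: "P1Q set \<Rightarrow> bool" where
  "separated C \<longleftrightarrow> (\<forall>w\<in>orb G (base C). svec (- 1) w \<notin> orb G (base C))"

lemma beta_periodic:
  assumes C: "C \<in> cusps G"
  shows "periodic N (beta k C)"
  unfolding periodic_def
proof (intro ballI impI)
  fix v w assume v: "v \<in> prim" and w: "w \<in> prim" and c: "v \<in> vclass N w"
  have iff: "x \<in> orb G (base C) \<longleftrightarrow> y \<in> orb G (base C)" if "x \<in> prim" "y \<in> prim" "x \<in> vclass N y" for x y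
    using orb_periodic[OF base_prim[OF C] that(1) _ that(3)] orb_periodic[OF base_prim[OF C] that(2) _ vclass_symD[OF that(3)]]
    by (rule iffI[rotated])
  have "v \<in> orb G (base C) \<longleftrightarrow> w \<in> orb G (base C)" by (rule iff[OF v w c])
  moreover have "svec (- 1) v \<in> orb G (base C) \<longleftrightarrow> svec (- 1) w \<in> orb G (base C)"
    by (rule iff[OF _ _ svec_vclass[OF c]]) (use v w in simp_all)
  ultimately show "beta k C v = beta k C w" by (simp add: beta_def)
qed

lemma beta_parity:
  assumes "even k \<or> separated C"
  shows "parity k (beta k C)"
  unfolding parity_def beta_def using assms unfolding separated_def by auto

lemma beta_invariant:
  assumes "g \<in> G"
  shows "beta k C (act v g) = beta k C v"
  unfolding beta_def using orb_act_iff[OF G assms] by (simp flip: act_svec)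

lemma beta_base: 
  assumes C: "C \<in> cusps G" and D: "D \<in> cusps G"
  shows "beta k C (base D) = (if C = D then 1 else 0)"
proof (cases "C = D")
  case True
  then show ?thesis using orb_refl[OF G] by (simp add: beta_def)
next
  case False
  have "pt (base D) \<notin> C"
  proof
    assume "pt (base D) \<in> C"
    then have "C = Gorbit G (rep D)" using cusp_eq_Gorbit[OF G C] pt_base[OF D] by simp
    then show False using cusp_eq[OF D] False by simp
  qed
  then show ?thesis using pt_in_cusp[OF C base_prim[OF D]] False by (simp add: beta_def)
qed

lemma stabilizer_iff:
  assumes C: "C \<in> cusps G" and g: "g \<in> carrier SL2Z"
  shows "moebius_P1Q g (rep C) = rep C \<longleftrightarrow> act (base C) g = base C \<or> act (base C) g = svec (- 1) (base C)"
proof -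
  let ?b = "base C"
  have b: "?b \<in> prim" by (rule base_prim[OF C])
  have "moebius_P1Q g (rep C) = rep C \<longleftrightarrow> pt ?b = pt (act ?b (adj2 g))"
    using moebius_pt[OF b, of g] pt_base[OF C] by auto
  also have "\<dots> \<longleftrightarrow> act ?b (adj2 g) = ?b \<or> act ?b (adj2 g) = svec (- 1) ?b"
    by (rule pt_eq_iff[OF b]) (use b prim_act[OF adj2_mult(3)[OF g]] in simp)
  also have "\<dots> \<longleftrightarrow> act ?b g = ?b \<or> act ?b g = svec (- 1) ?b"
  proof -
    have "act ?b (adj2 g) = svec e ?b \<longleftrightarrow> ?b = svec e (act ?b g)" for e
      using act_adj2[OF g] by (metis act_svec)
    from this[of 1] this[of "- 1"] show ?thesis by (metis svec_neg_svec svec_def mult_1 prod.collapse)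
  qed
  finally show ?thesis .
qed

text \<open>The stabilizer of the point fixes \<open>base C\<close> up to sign, so a coset of it is determined by
  the image of \<open>base C\<close> up to sign.\<close>
lemma stab_coset:
  assumes C: "C \<in> cusps G" and a: "a \<in> G"
  shows "cusp_stabilizer G (rep C) #>\<^bsub>SL2Z_sub G\<^esub> a =
     {x \<in> G. act (base C) x = act (base C) a \<or> act (base C) x = svec (- 1) (act (base C) a)}"
proof -
  let ?b = "base C" and ?H = "cusp_stabilizer G (rep C)"
  have H: "g \<in> ?H \<longleftrightarrow> g \<in> G \<and> (act ?b g = ?b \<or> act ?b g = svec (- 1) ?b)" for g
    using stabilizer_iff[OF C GS] by (auto simp: cusp_stabilizer_def stabilizer_def)
  have "x \<in> ?H #>\<^bsub>SL2Z_sub G\<^esub> a \<longleftrightarrow> x \<in> G \<and> (act ?b x = act ?b a \<or> act ?b x = svec (- 1) (act ?b a))" for x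
  proof
    assume "x \<in> ?H #>\<^bsub>SL2Z_sub G\<^esub> a"
    then obtain g where g: "g \<in> ?H" "x = g ** a" by (auto simp: r_coset_def)
    then show "x \<in> G \<and> (act ?b x = act ?b a \<or> act ?b x = svec (- 1) (act ?b a))"
      using Gm[OF _ a] H by (auto simp: act_mult act_svec)
  next
    assume x: "x \<in> G \<and> (act ?b x = act ?b a \<or> act ?b x = svec (- 1) (act ?b a))"
    then have "x ** adj2 a \<in> ?H"
      unfolding H using Gm Ga[OF a] act_adj2(1)[OF GS[OF a], of ?b] by (auto simp: act_mult act_svec)
    moreover have "x = (x ** adj2 a) ** a"
      using adj2_mult[OF GS[OF a]] by (simp flip: matrix_mul_assoc)
    ultimately show "x \<in> ?H #>\<^bsub>SL2Z_sub G\<^esub> a" by (auto simp: r_coset_def)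
  qed
  then show ?thesis by blast
qed

section \<open>Spectral Eisenstein series as sums over primitive vectors\<close>

text \<open>The bottom row of the matrix \<open>\<sigma>\<^sup>-\<^sup>1 \<gamma>\<close> for the representative \<open>\<gamma>\<close> of the coset that the
  definition of the spectral series selects. Its sign is arbitrary if the stabilizer contains an
  element acting as \<open>-1\<close> on \<open>base C\<close>.\<close>
definition coset_vec :: "P1Q set \<Rightarrow> (int ^ 2 ^ 2) set \<Rightarrow> int \<times> int" where
  "coset_vec C K = act (base C) (SOME g. g \<in> K)"

abbreviation stab_cosets :: "P1Q set \<Rightarrow> (int ^ 2 ^ 2) set set" where
  "stab_cosets C \<equiv> rcosets\<^bsub>SL2Z_sub G\<^esub> cusp_stabilizer G (rep C)"

lemma stab_cosets_some:
  assumes C: "C \<in> cusps G" and K: "K \<in> stab_cosets C"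
  obtains a where "a \<in> G" "coset_vec C K = act (base C) a" "(SOME g. g \<in> K) = a"
    "K = {x \<in> G. act (base C) x = coset_vec C K \<or> act (base C) x = svec (- 1) (coset_vec C K)}"
proof -
  obtain a0 where a0: "a0 \<in> G" "K = cusp_stabilizer G (rep C) #>\<^bsub>SL2Z_sub G\<^esub> a0"
    using K by (auto simp: RCOSETS_def)
  have K_eq: "K = {x \<in> G. act (base C) x = act (base C) a0 \<or> act (base C) x = svec (- 1) (act (base C) a0)}"
    unfolding a0(2) by (rule stab_coset[OF C a0(1)])
  define a where "a = (SOME g. g \<in> K)"
  have "a0 \<in> K" using a0(1) by (simp add: K_eq)
  then have aK: "a \<in> K" unfolding a_def by (rule someI)
  then have aG: "a \<in> G" and ab: "act (base C) a = act (base C) a0 \<or> act (base C) a = svec (- 1) (act (base C) a0)"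
    by (auto simp: K_eq)
  have cv: "coset_vec C K = act (base C) a" by (simp add: coset_vec_def a_def)
  have "K = {x \<in> G. act (base C) x = coset_vec C K \<or> act (base C) x = svec (- 1) (coset_vec C K)}"
    unfolding cv using ab by (subst K_eq) auto
  then show ?thesis using that[OF aG cv] a_def by blast
qed

lemma coset_vec_inj: "C \<in> cusps G \<Longrightarrow> inj_on (coset_vec C) (stab_cosets C)"
proof (rule inj_onI)
  fix K K' assume C: "C \<in> cusps G" and K: "K \<in> stab_cosets C" "K' \<in> stab_cosets C" and eq: "coset_vec C K = coset_vec C K'"
  obtain a where 1: "K = {x \<in> G. act (base C) x = coset_vec C K \<or> act (base C) x = svec (- 1) (coset_vec C K)}"
    by (rule stab_cosets_some[OF C K(1)])
  obtain a where 2: "K' = {x \<in> G. act (base C) x = coset_vec C K' \<or> act (base C) x = svec (- 1) (coset_vec C K')}"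
    by (rule stab_cosets_some[OF C K(2)])
  show "K = K'" by (subst 1, subst 2) (simp add: eq)
qed

definition coset_vecs :: "P1Q set \<Rightarrow> (int \<times> int) set" where
  "coset_vecs C = coset_vec C ` stab_cosets C"

lemma coset_vecs_orb: "C \<in> cusps G \<Longrightarrow> coset_vecs C \<subseteq> orb G (base C)"
proof
  fix w assume C: "C \<in> cusps G" and "w \<in> coset_vecs C"
  then obtain K where K: "K \<in> stab_cosets C" "w = coset_vec C K" by (auto simp: coset_vecs_def)
  obtain a where "a \<in> G" "coset_vec C K = act (base C) a" by (rule stab_cosets_some[OF C K(1)])
  then show "w \<in> orb G (base C)" by (auto simp: K(2) orb_def)
qed

text \<open>Together with \<open>coset_vecs_cover\<close>: the coset vectors and their negatives partition the
  vectors that represent points of the cusp.\<close>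
lemma coset_vecs_disjoint: "C \<in> cusps G \<Longrightarrow> coset_vecs C \<inter> svec (- 1) ` coset_vecs C = {}"
proof (rule ccontr)
  assume C: "C \<in> cusps G" and "coset_vecs C \<inter> svec (- 1) ` coset_vecs C \<noteq> {}"
  then obtain w where w: "w \<in> coset_vecs C" "w \<in> svec (- 1) ` coset_vecs C" by blast
  from w(1) obtain K where K1: "K \<in> stab_cosets C" "w = coset_vec C K" unfolding coset_vecs_def by blast
  from w(2) obtain K' where K2: "K' \<in> stab_cosets C" "w = svec (- 1) (coset_vec C K')" unfolding coset_vecs_def by blast
  note K = K1(1) K2(1)
  have eq: "coset_vec C K = svec (- 1) (coset_vec C K')" using K1(2) K2(2) by simp
  obtain a where a: "a \<in> G" "coset_vec C K = act (base C) a" "(SOME g. g \<in> K) = a"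
    "K = {x \<in> G. act (base C) x = coset_vec C K \<or> act (base C) x = svec (- 1) (coset_vec C K)}"
    by (rule stab_cosets_some[OF C K(1)])
  obtain a' where a': "a' \<in> G" "coset_vec C K' = act (base C) a'" "(SOME g. g \<in> K') = a'"
    "K' = {x \<in> G. act (base C) x = coset_vec C K' \<or> act (base C) x = svec (- 1) (coset_vec C K')}"
    by (rule stab_cosets_some[OF C K(2)])
  have "K = K'" by (subst a(4), subst a'(4)) (auto simp: eq)
  then have self: "coset_vec C K' = svec (- 1) (coset_vec C K')" using eq by simp
  have "coset_vec C K' \<in> prim" unfolding a'(2) using prim_act[OF GS[OF a'(1)]] base_prim[OF C] by simp
  then show False using svec_neg_neq[of "coset_vec C K'"] self by simp
qed

lemma coset_vecs_cover:
  assumes C: "C \<in> cusps G" and w: "w \<in> prim"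
  shows "pt w \<in> C \<longleftrightarrow> w \<in> coset_vecs C \<union> svec (- 1) ` coset_vecs C"
proof
  assume "pt w \<in> C"
  then have "\<exists>g\<in>G. w = act (base C) g \<or> svec (- 1) w = act (base C) g"
    using pt_in_cusp[OF C w] by (auto simp: orb_def)
  then obtain g where g: "g \<in> G" "w = act (base C) g \<or> svec (- 1) w = act (base C) g" by blast
  define K where "K = cusp_stabilizer G (rep C) #>\<^bsub>SL2Z_sub G\<^esub> g"
  have K: "K \<in> stab_cosets C" using g(1) by (auto simp: RCOSETS_def K_def)
  have gK: "g \<in> K" unfolding K_def stab_coset[OF C g(1)] using g(1) by simp
  obtain a where a: "K = {x \<in> G. act (base C) x = coset_vec C K \<or> act (base C) x = svec (- 1) (coset_vec C K)}"
    by (rule stab_cosets_some[OF C K])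
  have "act (base C) g = coset_vec C K \<or> act (base C) g = svec (- 1) (coset_vec C K)" using gK a by blast
  moreover have "coset_vec C K \<in> coset_vecs C" using K by (auto simp: coset_vecs_def)
  moreover have "w = svec (- 1) (svec (- 1) w)" by simp
  ultimately show "w \<in> coset_vecs C \<union> svec (- 1) ` coset_vecs C"
    using g(2) by (metis Un_iff image_eqI svec_neg_svec)
next
  assume "w \<in> coset_vecs C \<union> svec (- 1) ` coset_vecs C"
  then have "w \<in> orb G (base C) \<or> svec (- 1) w \<in> orb G (base C)"
    using coset_vecs_orb[OF C] by auto
  then show "pt w \<in> C" using pt_in_cusp[OF C w] by simp
qed

text \<open>\<open>Im (\<delta> \<tau>) = Im \<tau> / |c\<tau> + d|\<^sup>2\<close> for \<open>\<delta>\<close> with bottom row \<open>(c, d)\<close>, so each term is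
  \<open>eis_term\<close> at that row.\<close>
lemma spectral_series_eq:
  assumes C: "C \<in> cusps G" and \<tau>: "Im \<tau> > 0"
  shows "spectral_series G k (rep C) (\<sigma> C) s \<tau> = (\<Sum>\<^sub>\<infinity>v\<in>coset_vecs C. eis_term k s \<tau> v)"
proof -
  have "(let \<delta> = inv\<^bsub>SL2Z\<^esub> (\<sigma> C) \<otimes>\<^bsub>SL2Z\<^esub> (SOME \<gamma>. \<gamma> \<in> K) in
      automorphy_factor \<delta> \<tau> powi (- int k) * of_real (Im (moebius \<delta> \<tau>)) powr s) = eis_term k s \<tau> (coset_vec C K)"
    if K: "K \<in> stab_cosets C" for K
  proof -
    obtain a where a: "a \<in> G" "coset_vec C K = act (base C) a" "(SOME g. g \<in> K) = a"
      by (rule stab_cosets_some[OF C K])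
    define \<delta> where "\<delta> = adj2 (\<sigma> C) ** a"
    have \<delta>S: "\<delta> \<in> carrier SL2Z" unfolding \<delta>_def by (intro mult_closed_SL2Z adj2_mult(3) \<sigma>(1)[OF C] GS a)
    have row: "act (0, 1) \<delta> = coset_vec C K" by (simp add: \<delta>_def act_mult a(2) base_def)
    have "automorphy_factor \<delta> \<tau> = lin \<tau> (act (0, 1) \<delta>)" by (simp add: automorphy_factor_def lin_def act_def)
    then have j: "automorphy_factor \<delta> \<tau> = lin \<tau> (coset_vec C K)" by (simp only: row)
    have nz: "lin \<tau> (coset_vec C K) \<noteq> 0" using automorphy_factor_nonzero[OF \<delta>S \<tau>] unfolding j .
    have "of_real (Im (moebius \<delta> \<tau>)) powr s = (of_real (Im \<tau>) powr s / of_real (cmod (lin \<tau> (coset_vec C K))) powr (2 * s) :: complex)"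
    proof -
      let ?x = "cmod (lin \<tau> (coset_vec C K))"
      have "of_real (Im \<tau> / ?x\<^sup>2) powr s = (of_real (Im \<tau>) powr s / of_real (?x\<^sup>2) powr s :: complex)"
        by (rule powr_quotient_of_real) (use \<tau> nz in auto)
      also have "of_real (?x\<^sup>2) powr s = (of_real ?x powr (2 * s) :: complex)"
        by (rule powr_square_of_real) (rule iffD2[OF zero_less_norm_iff nz])
      finally show ?thesis unfolding Im_moebius[OF \<delta>S \<tau>] j .
    qed
    then have "automorphy_factor \<delta> \<tau> powi (- int k) * of_real (Im (moebius \<delta> \<tau>)) powr s = eis_term k s \<tau> (coset_vec C K)"
      unfolding j eis_term_def by (simp add: power_int_minus field_simps)
    then show ?thesis by (simp add: inv_SL2Z[OF \<sigma>(1)[OF C]] a(3) \<delta>_def Let_def)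
  qed
  then have "spectral_series G k (rep C) (\<sigma> C) s \<tau> = (\<Sum>\<^sub>\<infinity>K\<in>stab_cosets C. eis_term k s \<tau> (coset_vec C K))"
    unfolding spectral_series_def by (intro infsum_cong)
  also have "\<dots> = (\<Sum>\<^sub>\<infinity>v\<in>coset_vecs C. eis_term k s \<tau> v)"
    unfolding coset_vecs_def by (subst infsum_reindex[OF coset_vec_inj[OF C]]) (simp add: o_def)
  finally show ?thesis .
qed

text \<open>Both \<open>v\<close> and \<open>-v\<close> contribute half of \<open>eis_term\<close> at the coset vector, by the parity of
  \<open>beta\<close>.\<close>
lemma spectral_eisenstein_eq:
  assumes k: "k \<ge> 2" and C: "C \<in> cusps G" and sep: "even k \<or> separated C"
  shows "spectral_eisenstein G k (rep C) (\<sigma> C) = bdry_eis k (beta k C)"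
proof
  fix \<tau>
  show "spectral_eisenstein G k (rep C) (\<sigma> C) \<tau> = bdry_eis k (beta k C) \<tau>"
  proof (cases "\<tau> \<in> upper_half_plane")
    case True
    then have \<tau>: "Im \<tau> > 0" by (simp add: upper_half_plane_def)
    let ?Y = "coset_vecs C" and ?B = "beta k C"
    have Yp: "?Y \<subseteq> prim" using coset_vecs_orb[OF C] orb_prim[OF G base_prim[OF C]] by blast
    have eq: "(\<Sum>\<^sub>\<infinity>v\<in>?Y. eis_term k s \<tau> v) = (\<Sum>\<^sub>\<infinity>v\<in>prim. ?B v / 2 * eis_term k s \<tau> v)"
      if s: "Re (of_nat k + 2 * s) > 2" for s
    proof -
      let ?f = "\<lambda>v. ?B v / 2 * eis_term k s \<tau> v"
      have inj: "inj_on (svec (- 1)) ?Y" by (auto simp: inj_on_def svec_def prod_eq_iff)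
      have fY: "?f v = 1 / 2 * eis_term k s \<tau> v" if "v \<in> ?Y" for v
        using that coset_vecs_orb[OF C] by (auto simp: beta_def)
      have fnY: "?f (svec (- 1) v) = 1 / 2 * eis_term k s \<tau> v" if v: "v \<in> ?Y" for v
      proof -
        have "?B (svec (- 1) v) = (- 1) ^ k * ?B v" using beta_parity[OF sep] Yp v by (auto simp: parity_def)
        then have "?f (svec (- 1) v) = ?f v" by (simp add: eis_term_neg)
        then show ?thesis using fY[OF v] by simp
      qed
      have smE: "(\<lambda>v. 1 / 2 * eis_term k s \<tau> v) summable_on ?Y"
        by (intro summable_on_cmult_right summable_on_eis_term \<tau> s)
      have sm1: "?f summable_on ?Y"
        by (rule summable_on_cong[THEN iffD2, OF fY smE])
      have sm2: "?f summable_on (svec (- 1) ` ?Y)"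
        unfolding summable_on_reindex[OF inj] o_def by (rule summable_on_cong[THEN iffD2, OF fnY smE])
      have "(\<Sum>\<^sub>\<infinity>v\<in>prim. ?f v) = (\<Sum>\<^sub>\<infinity>v\<in>?Y \<union> svec (- 1) ` ?Y. ?f v)"
      proof (rule infsum_cong_neutral)
        fix v assume v: "v \<in> prim - (?Y \<union> svec (- 1) ` ?Y)"
        then have "v \<notin> orb G (base C)" "svec (- 1) v \<notin> orb G (base C)"
          using coset_vecs_cover[OF C, of v] pt_in_cusp[OF C, of v] by auto
        then show "?f v = 0" by (simp add: beta_def)
      next
        fix v assume "v \<in> ?Y \<union> svec (- 1) ` ?Y - prim"
        then show "?f v = 0" using Yp by auto
      qed simp
      also have "\<dots> = infsum ?f ?Y + infsum ?f (svec (- 1) ` ?Y)"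
        by (rule infsum_Un_disjoint[OF sm1 sm2 coset_vecs_disjoint[OF C]])
      also have "infsum ?f ?Y = (\<Sum>\<^sub>\<infinity>v\<in>?Y. 1 / 2 * eis_term k s \<tau> v)" by (rule infsum_cong[OF fY])
      also have "infsum ?f (svec (- 1) ` ?Y) = (\<Sum>\<^sub>\<infinity>v\<in>?Y. 1 / 2 * eis_term k s \<tau> v)"
        unfolding infsum_reindex[OF inj] o_def by (rule infsum_cong[OF fnY])
      finally show ?thesis by (simp only: infsum_cmult_right') simp
    qed
    note per = periodic_half[OF beta_periodic[OF C, of k]]
    have cv: "continuation_value k (\<lambda>s. \<Sum>\<^sub>\<infinity>v\<in>prim. ?B v / 2 * eis_term k s \<tau> v) (bdry_eis k ?B \<tau>)"
      using continuation_value_periodic[OF k N per \<tau>] by (simp add: bdry_eis_def periodic_eis_eq[OF k N per \<tau>])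
    have "continuation_value k (\<lambda>s. spectral_series G k (rep C) (\<sigma> C) s \<tau>) (bdry_eis k ?B \<tau>)"
      by (rule continuation_value_cong[THEN iffD2, OF _ cv]) (simp add: spectral_series_eq[OF C \<tau>] eq)
    from continued_value_at_0_eqI[OF k this] show ?thesis using True by (simp add: spectral_eisenstein_def)
  next
    case False
    then show ?thesis by (simp add: spectral_eisenstein_def bdry_eis_def periodic_eis_outside)
  qed
qed

end

section \<open>Stabilizers of cusps\<close>

text \<open>For \<open>e = \<plusminus>1\<close> this is \<open>e\<close> times the \<open>n\<close>-th power of \<open>T_mat\<close>; these matrices are the
  stabilizer of infinity.\<close>
definition signed_T :: "int \<Rightarrow> int \<Rightarrow> int ^ 2 ^ 2" where
  "signed_T e n = vector [vector [e, e * n], vector [0, e]]"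

lemma signed_T_nth [simp]: "signed_T e n $ 1 $ 1 = e" "signed_T e n $ 1 $ 2 = e * n" "signed_T e n $ 2 $ 1 = 0" "signed_T e n $ 2 $ 2 = e"
  by (simp_all add: signed_T_def)

lemma signed_T_mult: "signed_T e m ** signed_T f n = signed_T (e * f) (m + n)"
  by (simp add: mat2_eq_iff mat2_mult_nth algebra_simps)

lemma signed_T_one: "signed_T 1 0 = mat 1" and signed_T_adj: "adj2 (signed_T e n) = signed_T e (- n)"
  by (simp_all add: mat2_eq_iff)

lemma signed_T_neg: "signed_T (- e) n = - signed_T e n"
  by (simp add: mat2_eq_iff)

lemma signed_T_SL2Z: "signed_T e n \<in> carrier SL2Z \<longleftrightarrow> e * e = 1"
  by (simp add: carrier_SL2Z)

lemma signed_T_eq_iff: "e \<noteq> 0 \<Longrightarrow> signed_T e m = signed_T f n \<longleftrightarrow> e = f \<and> m = n"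
  by (auto simp: mat2_eq_iff)

lemma sign_square: "e = 1 \<or> e = - 1 \<Longrightarrow> e * e = (1::int)" by auto

text \<open>The stabilizer of the line through \<open>(0, 1)\<close> consists of triangular matrices, and the
  determinant makes the diagonal entries equal.\<close>
lemma row_signed_T:
  assumes g: "g \<in> carrier SL2Z" and row: "act (0, 1) g = svec e (0, 1)" and e: "e = 1 \<or> e = - 1"
  obtains n where "g = signed_T e n"
proof -
  have b: "g $ 2 $ 1 = 0" "g $ 2 $ 2 = e" using row by (simp_all add: act_def svec_def)
  then have "g $ 1 $ 1 * e = 1" using g by (simp add: carrier_SL2Z)
  then have "g $ 1 $ 1 = e" using e by auto
  then have "g = signed_T e (e * g $ 1 $ 2)" using b e by (auto simp: mat2_eq_iff)
  then show ?thesis by (rule that)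
qed

lemma T_mat_signed_T: "T_mat = signed_T 1 1" by (simp add: T_mat_def signed_T_def)

lemma signed_T_pow_nat: "signed_T e n [^]\<^bsub>SL2Z\<^esub> (q::nat) = signed_T (e ^ q) (n * int q)"
proof (induction q)
  case 0
  then show ?case by (simp add: nat_pow_def signed_T_one)
next
  case (Suc q)
  have "signed_T e n [^]\<^bsub>SL2Z\<^esub> Suc q = signed_T (e ^ q) (n * int q) ** signed_T e n" using Suc by (simp add: nat_pow_def)
  then show ?case by (simp add: signed_T_mult algebra_simps)
qed

lemma neg_T_pow: "- (T_mat [^]\<^bsub>SL2Z\<^esub> (h::nat)) = signed_T (- 1) (int h)"
  by (simp add: T_mat_signed_T signed_T_pow_nat signed_T_neg)

lemma signed_T_pow_int: "signed_T (- 1) n [^]\<^bsub>SL2Z\<^esub> (q::int) = signed_T ((- 1) ^ nat \<bar>q\<bar>) (n * q)"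
proof (cases "q < 0")
  case False
  then have q: "nat \<bar>q\<bar> = nat q" "int (nat q) = q" by simp_all
  have "signed_T (- 1) n [^]\<^bsub>SL2Z\<^esub> q = signed_T (- 1) n [^]\<^bsub>SL2Z\<^esub> nat q" unfolding int_pow_def2 using False by (rule if_not_P)
  then show ?thesis by (simp only: signed_T_pow_nat q)
next
  case True
  then have q: "nat \<bar>q\<bar> = nat (- q)" "n * int (nat (- q)) = - (n * q)" by simp_all
  have sq: "((- 1) ^ m :: int) * (- 1) ^ m = 1" for m by (cases "even m") auto
  have "signed_T (- 1) n [^]\<^bsub>SL2Z\<^esub> q = inv\<^bsub>SL2Z\<^esub> (signed_T (- 1) n [^]\<^bsub>SL2Z\<^esub> nat (- q))"
    unfolding int_pow_def2 using True by (rule if_P)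
  also have "\<dots> = adj2 (signed_T ((- 1) ^ nat (- q)) (n * int (nat (- q))))"
    unfolding signed_T_pow_nat by (rule inv_SL2Z) (simp only: signed_T_SL2Z sq)
  also have "\<dots> = signed_T ((- 1) ^ nat \<bar>q\<bar>) (n * q)"
    by (simp only: signed_T_adj q minus_minus)
  finally show ?thesis .
qed

lemma int_subgroup_multiples:
  fixes J :: "int set"
  assumes add: "\<And>m n. m \<in> J \<Longrightarrow> n \<in> J \<Longrightarrow> m + n \<in> J" and neg: "\<And>n. n \<in> J \<Longrightarrow> - n \<in> J" and pos: "p \<in> J" "p > 0"
  obtains h :: nat where "h \<ge> 1" "\<And>n. n \<in> J \<longleftrightarrow> int h dvd n"
proof -
  define h where "h = (LEAST m::nat. m \<ge> 1 \<and> int m \<in> J)"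
  have "nat p \<ge> 1 \<and> int (nat p) \<in> J" using pos by simp
  then have h: "h \<ge> 1 \<and> int h \<in> J" unfolding h_def by (rule LeastI)
  have min: "m < h \<Longrightarrow> \<not> (m \<ge> 1 \<and> int m \<in> J)" for m unfolding h_def by (rule not_less_Least)
  have zero: "0 \<in> J" using add[OF pos(1) neg[OF pos(1)]] by simp
  have natmul: "int h * int q \<in> J" for q :: nat
  proof (induction q)
    case (Suc q)
    then have "int h * int q + int h \<in> J" using h add by blast
    then show ?case by (simp add: algebra_simps)
  qed (simp add: zero)
  have mul: "int h * q \<in> J" for q
  proof (cases "q \<ge> 0")
    case True then show ?thesis using natmul[of "nat q"] by simp
  next
    case False then show ?thesis using neg[OF natmul[of "nat (- q)"]] by simp
  qed
  have "n \<in> J \<longleftrightarrow> int h dvd n" for n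
  proof
    assume n: "n \<in> J"
    have "n + - (int h * (n div int h)) \<in> J" by (intro add n neg mul)
    then have r: "n mod int h \<in> J" by (simp add: minus_mult_div_eq_mod)
    have "n mod int h \<ge> 0" "n mod int h < int h" using h by simp_all
    then have "nat (n mod int h) < h" by linarith
    from min[OF this] r \<open>n mod int h \<ge> 0\<close> have "n mod int h = 0" by auto
    then show "int h dvd n" by auto
  next
    assume "int h dvd n"
    then show "n \<in> J" using mul by auto
  qed
  then show ?thesis using that h by blast
qed

lemma generate_SL2Z_single:
  assumes "a \<in> carrier SL2Z"
  shows "generate SL2Z {a} = {a [^]\<^bsub>SL2Z\<^esub> (q::int) | q. q \<in> UNIV}"
  by (rule group.generate_pow[OF group_SL2Z assms])

context cusp_setup
begin

text \<open>The elements of the full stabilizer of the cusp in \<open>SL2Z\<close>, parametrized by the sign \<open>e\<close>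
  and the translation \<open>n\<close>.\<close>
definition conj_T :: "P1Q set \<Rightarrow> int \<Rightarrow> int \<Rightarrow> int ^ 2 ^ 2" where
  "conj_T C e n = \<sigma> C ** signed_T e n ** adj2 (\<sigma> C)"

context
  fixes C assumes C: "C \<in> cusps G"
begin

lemma adj_\<sigma>_\<sigma>: "adj2 (\<sigma> C) ** \<sigma> C = mat 1" "\<sigma> C ** adj2 (\<sigma> C) = mat 1" "adj2 (\<sigma> C) \<in> carrier SL2Z"
  using adj2_mult[OF \<sigma>(1)[OF C]] by auto

lemma adj_\<sigma>_cancel: "adj2 (\<sigma> C) ** (\<sigma> C ** A) = A" "\<sigma> C ** (adj2 (\<sigma> C) ** A) = A"
  by (simp_all add: matrix_mul_assoc adj_\<sigma>_\<sigma>)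

lemma conj_T_mult: "conj_T C e m ** conj_T C f n = conj_T C (e * f) (m + n)"
proof -
  have "conj_T C e m ** conj_T C f n = \<sigma> C ** signed_T e m ** (adj2 (\<sigma> C) ** \<sigma> C) ** signed_T f n ** adj2 (\<sigma> C)"
    by (simp only: conj_T_def matrix_mul_assoc)
  also have "\<dots> = \<sigma> C ** (signed_T e m ** signed_T f n) ** adj2 (\<sigma> C)"
    unfolding adj_\<sigma>_\<sigma> matrix_mul_rid by (simp only: matrix_mul_assoc)
  finally show ?thesis by (simp only: signed_T_mult conj_T_def)
qed

lemma conj_T_one: "conj_T C 1 0 = mat 1"
  by (simp add: conj_T_def signed_T_one adj_\<sigma>_\<sigma>)

lemma conj_T_neg: "conj_T C (- e) n = - conj_T C e n"
  by (simp add: conj_T_def signed_T_neg mat2_eq_iff mat2_mult_nth algebra_simps)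

lemma conj_T_SL2Z: "e * e = 1 \<Longrightarrow> conj_T C e n \<in> carrier SL2Z"
  unfolding conj_T_def by (intro mult_closed_SL2Z \<sigma>(1)[OF C] adj_\<sigma>_\<sigma>(3)) (simp add: signed_T_SL2Z)

lemma conj_T_adj: "e * e = 1 \<Longrightarrow> adj2 (conj_T C e n) = conj_T C e (- n)"
proof -
  assume e: "e * e = 1"
  have "conj_T C e (- n) ** conj_T C e n = mat 1" by (simp add: conj_T_mult e conj_T_one)
  then have "adj2 (conj_T C e n) = conj_T C e (- n) ** conj_T C e n ** adj2 (conj_T C e n)" by simp
  also have "\<dots> = conj_T C e (- n)"
    using adj2_mult(2)[OF conj_T_SL2Z[OF e]] by (simp flip: matrix_mul_assoc)
  finally show ?thesis .
qed

lemma act_base_conj_T: "act (base C) (conj_T C e n) = svec e (base C)"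
proof -
  have "act (0, 1) (signed_T e n) = svec e (0, 1)" by (simp add: act_def svec_def)
  moreover have "act (base C) (\<sigma> C) = (0, 1)" unfolding base_def by (rule act_adj2(2)[OF \<sigma>(1)[OF C]])
  ultimately show ?thesis by (simp add: conj_T_def act_mult act_svec) (simp add: base_def)
qed

lemma conj_T_of_stab:
  assumes g: "g \<in> carrier SL2Z" and e: "e = 1 \<or> e = - 1" and stab: "act (base C) g = svec e (base C)"
  obtains n where "g = conj_T C e n"
proof -
  let ?m = "adj2 (\<sigma> C) ** g ** \<sigma> C"
  have "?m \<in> carrier SL2Z" by (intro mult_closed_SL2Z g \<sigma>(1)[OF C] adj_\<sigma>_\<sigma>(3))
  moreover have "act (0, 1) ?m = svec e (0, 1)"
  proof -
    have "act (0, 1) ?m = act (act (base C) g) (\<sigma> C)" by (simp add: act_mult base_def)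
    also have "\<dots> = svec e (act (base C) (\<sigma> C))" by (simp add: stab act_svec)
    also have "act (base C) (\<sigma> C) = (0, 1)" unfolding base_def by (rule act_adj2(2)[OF \<sigma>(1)[OF C]])
    finally show ?thesis .
  qed
  ultimately obtain n where n: "?m = signed_T e n" using row_signed_T[OF _ _ e] by blast
  have "conj_T C e n = g"
    unfolding conj_T_def n[symmetric] by (simp add: adj_\<sigma>_cancel adj_\<sigma>_\<sigma> flip: matrix_mul_assoc)
  then show ?thesis using that by blast
qed

lemma conj_T_eq_iff: "e \<noteq> 0 \<Longrightarrow> conj_T C e m = conj_T C f n \<longleftrightarrow> e = f \<and> m = n"
proof -
  assume e: "e \<noteq> 0"
  have "signed_T e m = adj2 (\<sigma> C) ** conj_T C e m ** \<sigma> C" for e m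
    by (simp add: conj_T_def adj_\<sigma>_cancel adj_\<sigma>_\<sigma> flip: matrix_mul_assoc)
  then show ?thesis using signed_T_eq_iff[OF e] by metis
qed

text \<open>Translations occurring in the stabilizer of the cusp in \<open>\<plusminus>G\<close>. They form a subgroup of the
  integers, whose positive generator is \<open>amp\<close> (\<open>amp_eq_width\<close>).\<close>
definition stab_shift :: "int \<Rightarrow> bool" where
  "stab_shift n \<longleftrightarrow> conj_T C 1 n \<in> G \<or> conj_T C (- 1) n \<in> G"

lemma conj_T_N: "conj_T C 1 (int N) \<in> G"
proof -
  have "signed_T 1 (int N) \<in> principal_congruence_subgroup N" by (simp add: principal_iff carrier_SL2Z cong_0_iff)
  from principal_conj(2)[OF \<sigma>(1)[OF C] this] show ?thesis using principal by (auto simp: conj_T_def)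
qed

lemma conj_T_G_mult: "conj_T C e m \<in> G \<Longrightarrow> conj_T C f n \<in> G \<Longrightarrow> conj_T C (e * f) (m + n) \<in> G"
  using Gm conj_T_mult by metis

lemma conj_T_G_neg: "e * e = 1 \<Longrightarrow> conj_T C e m \<in> G \<Longrightarrow> conj_T C e (- m) \<in> G"
  using Ga conj_T_adj by metis

lemma width_exists: "\<exists>h::nat. h \<ge> 1 \<and> (\<forall>n. stab_shift n \<longleftrightarrow> int h dvd n)"
proof (rule int_subgroup_multiples[of "{n. stab_shift n}" "int N"])
  show "m + n \<in> {n. stab_shift n}" if "m \<in> {n. stab_shift n}" "n \<in> {n. stab_shift n}" for m n
    using that conj_T_G_mult[of 1 m 1 n] conj_T_G_mult[of 1 m "- 1" n] conj_T_G_mult[of "- 1" m 1 n] conj_T_G_mult[of "- 1" m "- 1" n]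
    by (auto simp: stab_shift_def)
  show "- n \<in> {n. stab_shift n}" if "n \<in> {n. stab_shift n}" for n
    using that conj_T_G_neg[of 1 n] conj_T_G_neg[of "- 1" n] by (auto simp: stab_shift_def)
  show "int N \<in> {n. stab_shift n}" using conj_T_N by (simp add: stab_shift_def)
  show "int N > 0" using N by simp
next
  fix h :: nat assume "h \<ge> 1" "\<And>n. n \<in> {n. stab_shift n} \<longleftrightarrow> int h dvd n"
  then show "\<exists>h::nat. h \<ge> 1 \<and> (\<forall>n. stab_shift n \<longleftrightarrow> int h dvd n)" by auto
qed

lemma not_separated_iff: "\<not> separated C \<longleftrightarrow> (\<exists>n. conj_T C (- 1) n \<in> G)"
proof
  assume "\<not> separated C"
  then obtain w where w: "w \<in> orb G (base C)" "svec (- 1) w \<in> orb G (base C)" unfolding separated_def by blast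
  obtain g where g: "g \<in> G" "w = act (base C) g" using w(1) unfolding orb_def by blast
  obtain g' where g': "g' \<in> G" "svec (- 1) w = act (base C) g'" using w(2) unfolding orb_def by blast
  let ?x = "g' ** adj2 g"
  have x: "?x \<in> G" by (intro Gm Ga g g')
  have "act (base C) ?x = svec (- 1) (act w (adj2 g))" by (simp add: act_mult act_svec flip: g'(2))
  also have "act w (adj2 g) = base C" unfolding g(2) by (rule act_adj2(1)[OF GS[OF g(1)]])
  finally have st: "act (base C) ?x = svec (- 1) (base C)" .
  obtain n where "?x = conj_T C (- 1) n" by (rule conj_T_of_stab[OF GS[OF x] _ st]) simp
  then show "\<exists>n. conj_T C (- 1) n \<in> G" using x by metis
next
  assume "\<exists>n. conj_T C (- 1) n \<in> G"
  then obtain n where n: "conj_T C (- 1) n \<in> G" by blast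
  have "svec (- 1) (base C) \<in> orb G (base C)"
    unfolding orb_def using n act_base_conj_T[of "- 1" n] by (intro image_eqI[of _ _ "conj_T C (- 1) n"]) simp_all
  then show "\<not> separated C" using orb_refl[OF G, of "base C"] unfolding separated_def by blast
qed

lemma conj_stab_iff:
  assumes \<gamma>: "\<gamma> \<in> carrier SL2Z"
  shows "x \<in> inv\<^bsub>SL2Z\<^esub> \<gamma> <#\<^bsub>SL2Z\<^esub> H #>\<^bsub>SL2Z\<^esub> \<gamma> \<longleftrightarrow> (\<exists>g\<in>H. x = adj2 \<gamma> ** g ** \<gamma>)"
  unfolding inv_SL2Z[OF \<gamma>] by (auto simp: r_coset_def l_coset_def)

text \<open>If \<open>G\<close> contains some \<open>-T ^ j\<close> (after conjugation to infinity) but not \<open>-1\<close>, then for every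
  \<open>n\<close> at most one of \<open>T ^ n\<close> and \<open>-T ^ n\<close> lies in \<open>G\<close>. For the smallest positive \<open>h\<close> it must be
  \<open>-T ^ h\<close>, since otherwise all translations would come with the sign \<open>+\<close>; hence \<open>-T ^ h\<close>
  generates the stabilizer.\<close>
lemma irregular_iff_not_separated:
  assumes m1: "- mat 1 \<notin> G"
  shows "irregular G (rep C) \<longleftrightarrow> \<not> separated C"
proof
  assume "irregular G (rep C)"
  then obtain \<gamma> h where \<gamma>: "\<gamma> \<in> carrier SL2Z" "moebius_P1Q \<gamma> Infty = rep C"
    and K: "inv\<^bsub>SL2Z\<^esub> \<gamma> <#\<^bsub>SL2Z\<^esub> cusp_stabilizer G (rep C) #>\<^bsub>SL2Z\<^esub> \<gamma> = generate SL2Z {- (T_mat [^]\<^bsub>SL2Z\<^esub> (h::nat))}"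
    unfolding irregular_def by blast
  have "signed_T (- 1) (int h) \<in> generate SL2Z {- (T_mat [^]\<^bsub>SL2Z\<^esub> h)}"
    unfolding neg_T_pow by (rule generate.incl) simp
  then obtain g where g: "g \<in> cusp_stabilizer G (rep C)" "signed_T (- 1) (int h) = adj2 \<gamma> ** g ** \<gamma>"
    using conj_stab_iff[OF \<gamma>(1)] K by metis
  have gG: "g \<in> G" using g(1) by (auto simp: cusp_stabilizer_def stabilizer_def)
  let ?w = "act (0, 1) (adj2 \<gamma>)"
  have wp: "?w \<in> prim" using prim_act[OF adj2_mult(3)[OF \<gamma>(1)]] prim_01 by simp
  have "pt ?w = rep C" using moebius_pt[OF prim_01, of \<gamma>] \<gamma>(2) by (simp add: pt_01)
  then have wb: "?w = base C \<or> ?w = svec (- 1) (base C)"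
    using pt_eq_iff[OF base_prim[OF C] wp] pt_base[OF C] by simp
  have "act (act ?w g) \<gamma> = act (0, 1) (signed_T (- 1) (int h))" unfolding g(2) by (simp only: act_mult)
  also have "\<dots> = svec (- 1) (0, 1)" by (simp add: act_def svec_def)
  finally have "act (act (act ?w g) \<gamma>) (adj2 \<gamma>) = svec (- 1) ?w" by (simp only: act_svec)
  then have "act ?w g = svec (- 1) ?w" using act_adj2(1)[OF \<gamma>(1)] by simp
  then have st: "act (base C) g = svec (- 1) (base C)"
    using wb by (auto simp: act_svec) (metis svec_neg_svec)
  obtain n where "g = conj_T C (- 1) n" by (rule conj_T_of_stab[OF GS[OF gG] _ st]) simp
  then show "\<not> separated C" using not_separated_iff gG by metis
next
  assume "\<not> separated C"
  then obtain j where j: "conj_T C (- 1) j \<in> G" using not_separated_iff by blast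
  have no: "conj_T C (- 1) 0 \<notin> G" using m1 conj_T_neg[of 1 0] conj_T_one by simp
  obtain h where h: "h \<ge> 1" "\<And>n. stab_shift n \<longleftrightarrow> int h dvd n" using width_exists by metis
  have uniq: "e = f" if "conj_T C e n \<in> G" "conj_T C f n \<in> G" "e = 1 \<or> e = - 1" "f = 1 \<or> f = - 1" for e f n
  proof (rule ccontr)
    assume "e \<noteq> f"
    then have ef: "e * f = - 1" using that by auto
    have "f * f = 1" using that by auto
    then have "conj_T C f (- n) \<in> G" using conj_T_G_neg that by blast
    then have "conj_T C (e * f) (n + - n) \<in> G" using conj_T_G_mult that by blast
    then show False using no ef by simp
  qed
  \<comment> \<open>If \<open>T ^ h\<close> were in \<open>G\<close>, then so would be \<open>T ^ j\<close>, as \<open>h\<close> divides \<open>j\<close>.\<close>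
  have hm: "conj_T C (- 1) (int h) \<in> G"
  proof (rule ccontr)
    assume "conj_T C (- 1) (int h) \<notin> G"
    then have h1: "conj_T C 1 (int h) \<in> G" using h(2)[of "int h"] by (auto simp: stab_shift_def)
    have natm: "conj_T C 1 (int h * int q) \<in> G" for q :: nat
    proof (induction q)
      case 0
      then show ?case using G1 by (simp add: conj_T_one)
    next
      case (Suc q)
      then show ?case using conj_T_G_mult[OF Suc h1] by (simp add: algebra_simps)
    qed
    have mul: "conj_T C 1 (int h * q) \<in> G" for q
    proof (cases "q \<ge> 0")
      case True then show ?thesis using natm[of "nat q"] by simp
    next
      case False then show ?thesis using conj_T_G_neg[OF _ natm[of "nat (- q)"]] by simp
    qed
    have "stab_shift j" using j by (simp add: stab_shift_def)
    then obtain q where "j = int h * q" using h(2) by (auto simp: dvd_def)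
    then have "conj_T C 1 j \<in> G" using mul by simp
    then show False using uniq[OF j, of 1] by simp
  qed
  have emS: "signed_T (- 1) (int h) \<in> carrier SL2Z" by (simp add: signed_T_SL2Z)
  have natm: "conj_T C ((- 1) ^ q) (int h * int q) \<in> G" for q :: nat
  proof (induction q)
    case 0
    then show ?case using G1 by (simp add: conj_T_one)
  next
    case (Suc q)
    then show ?case using conj_T_G_mult[OF Suc hm] by (simp add: algebra_simps)
  qed
  have sg: "(- 1) ^ m = (1::int) \<or> (- 1) ^ m = (- 1::int)" for m by (cases "even m") auto
  have mul: "conj_T C ((- 1) ^ nat \<bar>q\<bar>) (int h * q) \<in> G" for q
  proof (cases "q \<ge> 0")
    case True then show ?thesis using natm[of "nat q"] by simp
  next
    case False
    then show ?thesis using conj_T_G_neg[OF sign_square[OF sg] natm[of "nat (- q)"]] by simp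
  qed
  have "x \<in> inv\<^bsub>SL2Z\<^esub> (\<sigma> C) <#\<^bsub>SL2Z\<^esub> cusp_stabilizer G (rep C) #>\<^bsub>SL2Z\<^esub> (\<sigma> C) \<longleftrightarrow> x \<in> generate SL2Z {- (T_mat [^]\<^bsub>SL2Z\<^esub> h)}" for x
  proof
    assume "x \<in> inv\<^bsub>SL2Z\<^esub> (\<sigma> C) <#\<^bsub>SL2Z\<^esub> cusp_stabilizer G (rep C) #>\<^bsub>SL2Z\<^esub> (\<sigma> C)"
    then obtain g where g: "g \<in> cusp_stabilizer G (rep C)" "x = adj2 (\<sigma> C) ** g ** \<sigma> C"
      using conj_stab_iff[OF \<sigma>(1)[OF C]] by blast
    have gG: "g \<in> G" "moebius_P1Q g (rep C) = rep C" using g(1) by (auto simp: cusp_stabilizer_def stabilizer_def)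
    then have "act (base C) g = svec 1 (base C) \<or> act (base C) g = svec (- 1) (base C)"
      using stabilizer_iff[OF C GS[OF gG(1)]] by (auto simp: svec_def)
    then obtain e where e: "e = 1 \<or> e = - 1" "act (base C) g = svec e (base C)" by blast
    obtain n where n: "g = conj_T C e n" by (rule conj_T_of_stab[OF GS[OF gG(1)] e])
    have "stab_shift n" using gG(1) n e(1) by (auto simp: stab_shift_def)
    then obtain q where q: "n = int h * q" using h(2) by (auto simp: dvd_def)
    have "e = (- 1) ^ nat \<bar>q\<bar>" by (rule uniq[of _ n]) (use gG(1) n q mul e sg in auto)
    then have "x = signed_T (- 1) (int h) [^]\<^bsub>SL2Z\<^esub> q"
      unfolding signed_T_pow_int g(2) n by (simp add: conj_T_def q adj_\<sigma>_cancel adj_\<sigma>_\<sigma> flip: matrix_mul_assoc)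
    then show "x \<in> generate SL2Z {- (T_mat [^]\<^bsub>SL2Z\<^esub> h)}"
      unfolding neg_T_pow generate_SL2Z_single[OF emS] by blast
  next
    assume "x \<in> generate SL2Z {- (T_mat [^]\<^bsub>SL2Z\<^esub> h)}"
    then obtain q where q: "x = signed_T ((- 1) ^ nat \<bar>q\<bar>) (int h * q)"
      unfolding neg_T_pow generate_SL2Z_single[OF emS] signed_T_pow_int by blast
    let ?g = "conj_T C ((- 1) ^ nat \<bar>q\<bar>) (int h * q)"
    have "moebius_P1Q ?g (rep C) = rep C"
      using stabilizer_iff[OF C GS[OF mul]] act_base_conj_T sg[of "nat \<bar>q\<bar>"] by (auto simp: svec_def)
    then have "?g \<in> cusp_stabilizer G (rep C)" using mul by (simp add: cusp_stabilizer_def stabilizer_def)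
    moreover have "x = adj2 (\<sigma> C) ** ?g ** \<sigma> C"
      by (simp add: q conj_T_def adj_\<sigma>_cancel adj_\<sigma>_\<sigma> flip: matrix_mul_assoc)
    ultimately show "x \<in> inv\<^bsub>SL2Z\<^esub> (\<sigma> C) <#\<^bsub>SL2Z\<^esub> cusp_stabilizer G (rep C) #>\<^bsub>SL2Z\<^esub> (\<sigma> C)"
      using conj_stab_iff[OF \<sigma>(1)[OF C]] by blast
  qed
  then have "inv\<^bsub>SL2Z\<^esub> (\<sigma> C) <#\<^bsub>SL2Z\<^esub> cusp_stabilizer G (rep C) #>\<^bsub>SL2Z\<^esub> (\<sigma> C) = generate SL2Z {- (T_mat [^]\<^bsub>SL2Z\<^esub> h)}"
    by blast
  then show "irregular G (rep C)"
    unfolding irregular_def using \<sigma>[OF C] h(1) by blast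
qed

lemma stab_conj_T: "g \<in> carrier SL2Z \<Longrightarrow> moebius_P1Q g (rep C) = rep C \<longleftrightarrow> (\<exists>e n. (e = 1 \<or> e = - 1) \<and> g = conj_T C e n)"
proof
  assume g: "g \<in> carrier SL2Z" and "moebius_P1Q g (rep C) = rep C"
  then have "act (base C) g = svec 1 (base C) \<or> act (base C) g = svec (- 1) (base C)"
    using stabilizer_iff[OF C g] by (auto simp: svec_def)
  then obtain e where e: "e = 1 \<or> e = - 1" "act (base C) g = svec e (base C)" by blast
  obtain n where n: "g = conj_T C e n" by (rule conj_T_of_stab[OF g e])
  then show "\<exists>e n. (e = 1 \<or> e = - 1) \<and> g = conj_T C e n" using e(1) by blast
next
  assume g: "g \<in> carrier SL2Z" and "\<exists>e n. (e = 1 \<or> e = - 1) \<and> g = conj_T C e n"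
  then obtain e n where e: "e = 1 \<or> e = - 1" "g = conj_T C e n" by blast
  then have "act (base C) g = base C \<or> act (base C) g = svec (- 1) (base C)"
    using act_base_conj_T[of e n] by (auto simp: svec_def)
  then show "moebius_P1Q g (rep C) = rep C" using stabilizer_iff[OF C g] by simp
qed

text \<open>The full stabilizer consists of all \<open>\<plusminus>T ^ n\<close>, and the subgroup generated by that of \<open>G\<close>
  and \<open>-1\<close> of those with \<open>n\<close> divisible by \<open>h\<close>; the cosets are the residues of \<open>n\<close> modulo \<open>h\<close>.\<close>
lemma amp_eq_width:
  assumes h: "h \<ge> 1" "\<And>n. stab_shift n \<longleftrightarrow> int h dvd n"
  shows "amp (rep C) G = h"
proof -
  let ?\<Gamma>x = "cusp_stabilizer (carrier SL2Z) (rep C)" and ?Gx = "cusp_stabilizer G (rep C)"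
  let ?E = "{1, - 1} :: int set"
  define H where "H = {conj_T C e n | e n. e \<in> ?E \<and> int h dvd n}"
  have \<Gamma>x: "?\<Gamma>x = {conj_T C e n | e n. e \<in> ?E}"
  proof -
    have "g \<in> ?\<Gamma>x \<longleftrightarrow> g \<in> {conj_T C e n | e n. e \<in> ?E}" for g
    proof -
      have "g \<in> ?\<Gamma>x \<longleftrightarrow> g \<in> carrier SL2Z \<and> moebius_P1Q g (rep C) = rep C"
        by (simp add: cusp_stabilizer_def stabilizer_def)
      also have "\<dots> \<longleftrightarrow> g \<in> {conj_T C e n | e n. e \<in> ?E}"
        using stab_conj_T[of g] conj_T_SL2Z[OF sign_square] by blast
      finally show ?thesis .
    qed
    then show ?thesis by blast
  qed
  have Hgen: "generate SL2Z (?Gx \<union> {- mat 1}) = H"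
  proof
    have sub: "subgroup H SL2Z"
    proof (rule group.subgroupI[OF group_SL2Z])
      show "H \<subseteq> carrier SL2Z" unfolding H_def using conj_T_SL2Z by auto
      have "conj_T C 1 0 \<in> H" unfolding H_def by blast
      then show "H \<noteq> {}" by blast
      fix a assume a: "a \<in> H"
      then obtain e n where en: "a = conj_T C e n" "e \<in> ?E" "int h dvd n" unfolding H_def by blast
      have e2: "e * e = 1" using en(2) by auto
      have "inv\<^bsub>SL2Z\<^esub> a = conj_T C e (- n)" unfolding en(1) using inv_SL2Z[OF conj_T_SL2Z[OF e2]] conj_T_adj[OF e2] by simp
      then show "inv\<^bsub>SL2Z\<^esub> a \<in> H" unfolding H_def using en(2) dvd_minus_iff[THEN iffD2, OF en(3)] by blast
      fix b assume "b \<in> H"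
      then obtain f m where fm: "b = conj_T C f m" "f \<in> ?E" "int h dvd m" unfolding H_def by blast
      have "a \<otimes>\<^bsub>SL2Z\<^esub> b = conj_T C (e * f) (n + m)" by (simp add: en(1) fm(1) conj_T_mult)
      moreover have "e * f \<in> ?E" using en(2) fm(2) by auto
      moreover have "int h dvd n + m" using en(3) fm(3) by simp
      ultimately show "a \<otimes>\<^bsub>SL2Z\<^esub> b \<in> H" unfolding H_def by blast
    qed
    have "?Gx \<union> {- mat 1} \<subseteq> H"
    proof
      fix g assume "g \<in> ?Gx \<union> {- mat 1}"
      then show "g \<in> H"
      proof
        assume "g \<in> ?Gx"
        then have g: "g \<in> G" "moebius_P1Q g (rep C) = rep C" by (auto simp: cusp_stabilizer_def stabilizer_def)
        then obtain e n where en: "e = 1 \<or> e = - 1" "g = conj_T C e n" using stab_conj_T[OF GS[OF g(1)]] by blast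
        have "stab_shift n" using g(1) en by (auto simp: stab_shift_def)
        then show "g \<in> H" unfolding H_def using en h(2) by blast
      next
        assume "g \<in> {- mat 1}"
        then have "g = conj_T C (- 1) 0" using conj_T_neg[of 1 0] conj_T_one by simp
        then show "g \<in> H" unfolding H_def by auto
      qed
    qed
    then show "generate SL2Z (?Gx \<union> {- mat 1}) \<subseteq> H"
      by (rule group.generate_subgroup_incl[OF group_SL2Z _ sub])
    show "H \<subseteq> generate SL2Z (?Gx \<union> {- mat 1})"
    proof
      fix g assume "g \<in> H"
      then obtain e n where en: "g = conj_T C e n" "e \<in> ?E" "int h dvd n" unfolding H_def by blast
      then have "stab_shift n" using h(2) by blast
      then obtain f where f: "f \<in> ?E" "conj_T C f n \<in> G" unfolding stab_shift_def by blast
      have f2: "f * f = 1" using f(1) by auto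
      have "moebius_P1Q (conj_T C f n) (rep C) = rep C" using stab_conj_T[OF conj_T_SL2Z[OF f2]] f(1) by blast
      then have fx: "conj_T C f n \<in> ?Gx" using f(2) by (simp add: cusp_stabilizer_def stabilizer_def)
      show "g \<in> generate SL2Z (?Gx \<union> {- mat 1})"
      proof (cases "e = f")
        case True
        then show ?thesis using fx en(1) by (auto intro: generate.incl)
      next
        case False
        then have "e = - f" using en(2) f(1) by auto
        then have "g = conj_T C (- 1) 0 ** conj_T C f n" by (simp add: en(1) conj_T_mult)
        also have "conj_T C (- 1) 0 = - mat 1" using conj_T_neg[of 1 0] conj_T_one by simp
        finally have geq: "g = (- mat 1) \<otimes>\<^bsub>SL2Z\<^esub> conj_T C f n" by simp
        show ?thesis unfolding geq using fx by (intro generate.eng generate.incl) simp_all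
      qed
    qed
  qed
  define S where "S = (\<lambda>n. {conj_T C f m | f m. f \<in> ?E \<and> int h dvd m - n})"
  have coset: "H #>\<^bsub>SL2Z_sub ?\<Gamma>x\<^esub> conj_T C e n = S n" if e: "e \<in> ?E" for e n
  proof -
    have "x \<in> H #>\<^bsub>SL2Z_sub ?\<Gamma>x\<^esub> conj_T C e n \<longleftrightarrow> x \<in> S n" for x
    proof
      assume "x \<in> H #>\<^bsub>SL2Z_sub ?\<Gamma>x\<^esub> conj_T C e n"
      then obtain f m where fm: "f \<in> ?E" "int h dvd m" "x = conj_T C f m ** conj_T C e n"
        by (auto simp: r_coset_def H_def)
      then have "x = conj_T C (f * e) (m + n)" by (simp add: conj_T_mult)
      moreover have "f * e \<in> ?E" using fm(1) e by auto
      moreover have "int h dvd (m + n) - n" using fm(2) by simp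
      ultimately show "x \<in> S n" unfolding S_def by blast
    next
      assume "x \<in> S n"
      then obtain f m where fm: "f \<in> ?E" "int h dvd m - n" "x = conj_T C f m" unfolding S_def by blast
      have "f * e * e = f" using e by auto
      then have "x = conj_T C (f * e) (m - n) ** conj_T C e n" by (simp only: conj_T_mult fm(3) diff_add_cancel)
      moreover have "f * e \<in> ?E" using fm(1) e by auto
      then have "conj_T C (f * e) (m - n) \<in> H" unfolding H_def using fm(2) by blast
      ultimately show "x \<in> H #>\<^bsub>SL2Z_sub ?\<Gamma>x\<^esub> conj_T C e n" by (auto simp: r_coset_def)
    qed
    then show ?thesis by blast
  qed
  have S_eq: "S m = S n \<longleftrightarrow> int h dvd m - n" for m n
  proof
    assume "S m = S n"
    moreover have "conj_T C 1 m \<in> S m"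
      unfolding S_def mem_Collect_eq by (intro exI[of _ 1] exI[of _ m]) simp
    ultimately have "conj_T C 1 m \<in> S n" by blast
    then obtain f m' where "conj_T C 1 m = conj_T C f m'" "int h dvd m' - n" unfolding S_def by blast
    then show "int h dvd m - n" using conj_T_eq_iff[of 1 m f m'] by simp
  next
    assume d: "int h dvd m - n"
    have "int h dvd l - m \<longleftrightarrow> int h dvd l - n" for l
    proof -
      have "l - n = (l - m) + (m - n)" by simp
      then show ?thesis using d by (simp only: dvd_add_left_iff)
    qed
    then show "S m = S n" unfolding S_def by simp
  qed
  have "rcosets\<^bsub>SL2Z_sub ?\<Gamma>x\<^esub> H = range S"
  proof
    show "rcosets\<^bsub>SL2Z_sub ?\<Gamma>x\<^esub> H \<subseteq> range S"
    proof
      fix K assume "K \<in> rcosets\<^bsub>SL2Z_sub ?\<Gamma>x\<^esub> H"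
      then obtain a where a: "a \<in> ?\<Gamma>x" "K = H #>\<^bsub>SL2Z_sub ?\<Gamma>x\<^esub> a" by (auto simp: RCOSETS_def)
      then obtain e n where "a = conj_T C e n" "e \<in> ?E" unfolding \<Gamma>x by blast
      then show "K \<in> range S" using coset a(2) by simp
    qed
    show "range S \<subseteq> rcosets\<^bsub>SL2Z_sub ?\<Gamma>x\<^esub> H"
    proof
      fix K assume "K \<in> range S"
      then obtain n where "K = S n" by blast
      then have "K = H #>\<^bsub>SL2Z_sub ?\<Gamma>x\<^esub> conj_T C 1 n" using coset[of 1 n] by simp
      moreover have "conj_T C 1 n \<in> ?\<Gamma>x" unfolding \<Gamma>x by blast
      ultimately show "K \<in> rcosets\<^bsub>SL2Z_sub ?\<Gamma>x\<^esub> H" by (auto simp: RCOSETS_def)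
    qed
  qed
  also have "range S = S ` {0..<int h}"
  proof -
    have "S n \<in> S ` {0..<int h}" for n
    proof (rule image_eqI)
      show "S n = S (n mod int h)" unfolding S_eq by (simp add: minus_mod_eq_mult_div)
      show "n mod int h \<in> {0..<int h}" using h(1) by simp
    qed
    then show ?thesis by blast
  qed
  also have "card (S ` {0..<int h}) = card {0..<int h}"
  proof (rule card_image, rule inj_onI)
    fix m n assume mn: "m \<in> {0..<int h}" "n \<in> {0..<int h}" "S m = S n"
    show "m = n"
    proof (rule ccontr)
      assume "m \<noteq> n"
      then have "\<bar>int h\<bar> \<le> \<bar>m - n\<bar>" using mn(3) S_eq by (intro dvd_imp_le_int) simp_all
      then show False using mn(1,2) by auto
    qed
  qed
  finally show ?thesis unfolding amp_def Hgen by simp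
qed

end

end

section \<open>Counting residue classes of vectors in a cusp\<close>

lemma card_constant_fibres:
  assumes "finite S" and fib: "\<And>x. x \<in> S \<Longrightarrow> card {y \<in> S. f y = f x} = m"
  shows "card S = card (f ` S) * m"
proof -
  have "card S = (\<Sum>x\<in>S. 1)" by simp
  also have "\<dots> = (\<Sum>z\<in>f ` S. \<Sum>x\<in>{x \<in> S. f x = z}. 1)" by (rule sum.image_gen[OF assms(1)])
  also have "\<dots> = (\<Sum>z\<in>f ` S. m)" using fib by (intro sum.cong) auto
  finally show ?thesis by simp
qed

lemma subgroup_principal: "subgroup (principal_congruence_subgroup N) SL2Z"
proof (rule group.subgroupI[OF group_SL2Z])
  show "principal_congruence_subgroup N \<subseteq> carrier SL2Z" by (auto simp: principal_iff_mcong)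
  have "mat 1 \<in> principal_congruence_subgroup N" by (simp add: principal_iff carrier_SL2Z)
  then show "principal_congruence_subgroup N \<noteq> {}" by blast
  fix a assume a: "a \<in> principal_congruence_subgroup N"
  then have aS: "a \<in> carrier SL2Z" by (simp add: principal_iff)
  have "[- a $ 1 $ 2 = - 0] (mod int N)" "[- a $ 2 $ 1 = - 0] (mod int N)"
    using a unfolding principal_iff cong_minus_minus_iff by simp_all
  then show "inv\<^bsub>SL2Z\<^esub> a \<in> principal_congruence_subgroup N"
    unfolding inv_SL2Z[OF aS] using a adj2_mult(3)[OF aS] by (simp add: principal_iff)
  fix b assume b: "b \<in> principal_congruence_subgroup N"
  have "mcong N (a ** b) (mat 1 ** mat 1)" using a b by (intro mcong_mult) (simp_all add: principal_iff_mcong)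
  then show "a \<otimes>\<^bsub>SL2Z\<^esub> b \<in> principal_congruence_subgroup N"
    using a b by (simp add: principal_iff_mcong mult_closed_SL2Z)
qed

lemma orb_principal:
  assumes v: "v \<in> prim" and w: "w \<in> prim"
  shows "w \<in> orb (principal_congruence_subgroup N) v \<longleftrightarrow> w \<in> vclass N v"
proof
  assume "w \<in> orb (principal_congruence_subgroup N) v"
  then obtain g where "g \<in> principal_congruence_subgroup N" "w = act v g" unfolding orb_def by blast
  then show "w \<in> vclass N v" using act_principal by blast
next
  assume "w \<in> vclass N v"
  then obtain g where "g \<in> principal_congruence_subgroup N" "act v g = w" by (rule principal_transitive[OF v w])
  then show "w \<in> orb (principal_congruence_subgroup N) v" unfolding orb_def by blast
qed

text \<open>Reduction modulo \<open>N\<close> with entries in \<open>{0..<N}\<close>, so that a reduced matrix still acts on row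
  vectors and \<open>red_act_redm\<close> makes sense.\<close>
definition redm :: "nat \<Rightarrow> int ^ 2 ^ 2 \<Rightarrow> int ^ 2 ^ 2" where
  "redm N A = (\<chi> i j. A $ i $ j mod int N)"

lemma redm_eq_iff: "redm N A = redm N B \<longleftrightarrow> mcong N A B"
  by (simp add: redm_def mcong_def mat2_eq_iff cong_def)

lemma red_act_redm: "red N (act v (redm N A)) = red N (act v A)"
proof -
  have "[x * (a mod int N) + y * (b mod int N) = x * a + y * b] (mod int N)" for x y a b
    by (intro cong_add cong_mult cong_refl) (simp_all add: cong_def)
  then show ?thesis by (simp add: red_def act_def redm_def cong_def)
qed

lemma finite_redm: "N \<ge> 1 \<Longrightarrow> finite (redm N ` S)"
proof -
  assume N: "N \<ge> 1"
  have "redm N ` S \<subseteq> (\<lambda>(a, b, c, d). vector [vector [a, b], vector [c, d]]) `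
    ({0..<int N} \<times> {0..<int N} \<times> {0..<int N} \<times> {0..<int N})" (is "_ \<subseteq> ?V ` ?I")
  proof
    fix A assume "A \<in> redm N ` S"
    then obtain B where A: "A = redm N B" by blast
    show "A \<in> ?V ` ?I"
      by (rule image_eqI[of _ _ "(A $ 1 $ 1, A $ 1 $ 2, A $ 2 $ 1, A $ 2 $ 2)"])
         (use N in \<open>simp_all add: mat2_eq_iff A redm_def\<close>)
  qed
  then show ?thesis by (rule finite_subset) simp
qed

context cusp_setup
begin

definition cusp_vecs :: "P1Q set \<Rightarrow> (int \<times> int) set" where
  "cusp_vecs C = {w \<in> prim. pt w \<in> C}"

definition cusp_count :: "P1Q set \<Rightarrow> nat" where
  "cusp_count C = card {r \<in> reps N. pt r \<in> C}"

lemma cusp_periodic: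
  assumes C: "C \<in> cusps G" and v: "v \<in> prim" and w: "w \<in> prim" and c: "v \<in> vclass N w" and ptw: "pt w \<in> C"
  shows "pt v \<in> C"
proof -
  have nv: "svec (- 1) v \<in> prim" using v by simp
  have "w \<in> orb G (base C) \<or> svec (- 1) w \<in> orb G (base C)" using pt_in_cusp[OF C w] ptw by simp
  then have "v \<in> orb G (base C) \<or> svec (- 1) v \<in> orb G (base C)"
    using orb_periodic[OF base_prim[OF C] v _ c] orb_periodic[OF base_prim[OF C] nv _ svec_vclass[OF c]] by (rule disj_forward)
  then show ?thesis using pt_in_cusp[OF C v] by simp
qed

lemma red_cusp_vecs:
  assumes C: "C \<in> cusps G"
  shows "red N ` cusp_vecs C = red N ` {r \<in> reps N. pt r \<in> C}"
proof
  show "red N ` cusp_vecs C \<subseteq> red N ` {r \<in> reps N. pt r \<in> C}"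
  proof
    fix q assume "q \<in> red N ` cusp_vecs C"
    then obtain w where w: "w \<in> prim" "pt w \<in> C" "q = red N w" unfolding cusp_vecs_def by blast
    obtain r where r: "r \<in> reps N" "w \<in> vclass N r" using reps_exists[OF w(1)] by blast
    have rp: "r \<in> prim" using r(1) reps_prim by blast
    have "pt r \<in> C" by (rule cusp_periodic[OF C rp w(1) vclass_symD[OF r(2)] w(2)])
    moreover have "q = red N r" using r(2) w(3) red_eq_iff by simp
    ultimately show "q \<in> red N ` {r \<in> reps N. pt r \<in> C}" using r(1) by blast
  qed
  show "red N ` {r \<in> reps N. pt r \<in> C} \<subseteq> red N ` cusp_vecs C"
    using reps_prim unfolding cusp_vecs_def by blast
qed

lemma cusp_count_eq:
  assumes C: "C \<in> cusps G"
  shows "cusp_count C = card (red N ` cusp_vecs C)"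
  unfolding red_cusp_vecs[OF C] cusp_count_def
proof (rule card_image[symmetric], rule inj_onI)
  fix r r' assume "r \<in> {r \<in> reps N. pt r \<in> C}" "r' \<in> {r \<in> reps N. pt r \<in> C}" "red N r = red N r'"
  then show "r = r'" by (intro reps_unique) (simp_all only: mem_Collect_eq red_eq_iff)
qed

lemma sum_reps_beta:
  assumes C: "C \<in> cusps G"
  shows "(\<Sum>r\<in>reps N. beta 2 C r) = of_nat (cusp_count C)"
proof -
  have "beta 2 C r = of_bool (pt r \<in> C)" if "r \<in> reps N" for r
    using pt_in_cusp[OF C, of r] that reps_prim by (auto simp: beta_def)
  then have "(\<Sum>r\<in>reps N. beta 2 C r) = (\<Sum>r\<in>reps N. of_bool (pt r \<in> C))" by (intro sum.cong) auto
  also have "\<dots> = of_nat (card ({r. pt r \<in> C} \<inter> reps N))"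
    using finite_reps[OF N] by (simp add: sum.If_cases of_bool_def Int_commute)
  also have "{r. pt r \<in> C} \<inter> reps N = {r \<in> reps N. pt r \<in> C}" by blast
  finally show ?thesis unfolding cusp_count_def .
qed

lemma or_set_eq:
  assumes C: "C \<in> cusps G"
  shows "or_set G N (rep C) = (\<lambda>r. Gorbit (principal_congruence_subgroup N) (pt r)) ` {r \<in> reps N. pt r \<in> C}"
proof -
  let ?P = "principal_congruence_subgroup N"
  have eq: "Gorbit ?P (pt v) = Gorbit ?P (pt w)" if "v \<in> prim" "w \<in> prim" "v \<in> vclass N w" for v w
  proof (rule Gorbit_eq[OF subgroup_principal])
    show "pt v \<in> Gorbit ?P (pt w)"
      unfolding pt_in_Gorbit[OF subgroup_principal that(2,1)] using orb_principal[OF that(2,1)] that(3) by simp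
  qed
  show ?thesis
  proof
    show "or_set G N (rep C) \<subseteq> (\<lambda>r. Gorbit ?P (pt r)) ` {r \<in> reps N. pt r \<in> C}"
    proof
      fix D assume "D \<in> or_set G N (rep C)"
      then have D: "D \<in> cusps ?P" "D \<subseteq> C" using cusp_eq[OF C] by (auto simp: or_set_def)
      obtain x where x: "D = Gorbit ?P x" using D(1) cusps_iff[OF subgroup_principal] by blast
      obtain w where w: "w \<in> prim" "pt w = x" using pt_surj by blast
      obtain r where r: "r \<in> reps N" "w \<in> vclass N r" using reps_exists[OF w(1)] by blast
      have rp: "r \<in> prim" using r(1) reps_prim by blast
      have "pt w \<in> C" using Gorbit_refl[OF subgroup_principal, of x] x D(2) w(2) by blast
      then have "pt r \<in> C" by (rule cusp_periodic[OF C rp w(1) vclass_symD[OF r(2)]])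
      moreover have "D = Gorbit ?P (pt r)" using eq[OF w(1) rp r(2)] x w(2) by simp
      ultimately show "D \<in> (\<lambda>r. Gorbit ?P (pt r)) ` {r \<in> reps N. pt r \<in> C}" using r(1) by blast
    qed
    show "(\<lambda>r. Gorbit ?P (pt r)) ` {r \<in> reps N. pt r \<in> C} \<subseteq> or_set G N (rep C)"
    proof
      fix D assume "D \<in> (\<lambda>r. Gorbit ?P (pt r)) ` {r \<in> reps N. pt r \<in> C}"
      then obtain r where r: "r \<in> prim" "pt r \<in> C" "D = Gorbit ?P (pt r)" using reps_prim by blast
      have "orb ?P r \<subseteq> orb G r" unfolding orb_def using principal by blast
      then have "D \<subseteq> Gorbit G (pt r)"
        unfolding r(3) Gorbit_pt[OF subgroup_principal r(1)] Gorbit_pt[OF G r(1)] by blast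
      also have "Gorbit G (pt r) = C" using cusp_eq_Gorbit[OF G C r(2)] by simp
      finally have "D \<subseteq> Gorbit G (rep C)" using cusp_eq[OF C] by simp
      then show "D \<in> or_set G N (rep C)"
        unfolding or_set_def using r(3) cusps_iff[OF subgroup_principal] by blast
    qed
  qed
qed

text \<open>A cusp of \<open>\<Gamma>(N)\<close> is a pair of opposite residue classes; the two classes coincide precisely
  if \<open>N < 3\<close>.\<close>
lemma cusp_count_or_set:
  assumes C: "C \<in> cusps G"
  shows "cusp_count C = card (or_set G N (rep C)) * (if N \<ge> 3 then 2 else 1)"
  unfolding or_set_eq[OF C] cusp_count_def
proof (rule card_constant_fibres)
  let ?P = "principal_congruence_subgroup N"
  show "finite {r \<in> reps N. pt r \<in> C}" using finite_reps[OF N] by simp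
  fix r assume "r \<in> {r \<in> reps N. pt r \<in> C}"
  then have r: "r \<in> reps N" "pt r \<in> C" by simp_all
  have rp: "r \<in> prim" using r(1) reps_prim by blast
  then have nrp: "svec (- 1) r \<in> prim" by simp
  obtain r' where r': "r' \<in> reps N" "svec (- 1) r \<in> vclass N r'" using reps_exists[OF nrp, of N] by (elim bexE) (rule that)
  have r'p: "r' \<in> prim" using r'(1) reps_prim by blast
  have r'C: "pt r' \<in> C"
    by (rule cusp_periodic[OF C r'p nrp vclass_symD[OF r'(2)]]) (use r(2) in simp)
  have fibre: "Gorbit ?P (pt s) = Gorbit ?P (pt r) \<longleftrightarrow> s = r \<or> s = r'" if s: "s \<in> reps N" for s
  proof -
    have sp: "s \<in> prim" using s reps_prim by blast
    then have nsp: "svec (- 1) s \<in> prim" by simp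
    have "Gorbit ?P (pt s) = Gorbit ?P (pt r) \<longleftrightarrow> pt s \<in> Gorbit ?P (pt r)"
      using Gorbit_eq[OF subgroup_principal] Gorbit_refl[OF subgroup_principal] by metis
    also have "\<dots> \<longleftrightarrow> s \<in> vclass N r \<or> svec (- 1) s \<in> vclass N r"
      using pt_in_Gorbit[OF subgroup_principal rp sp] orb_principal[OF rp sp] orb_principal[OF rp nsp] by simp
    also have "s \<in> vclass N r \<longleftrightarrow> s = r" using reps_unique[OF s r(1)] by auto
    also have "svec (- 1) s \<in> vclass N r \<longleftrightarrow> s = r'"
    proof
      assume "svec (- 1) s \<in> vclass N r"
      then have "svec (- 1) (svec (- 1) s) \<in> vclass N (svec (- 1) r)" by (rule svec_vclass)
      then have "s \<in> vclass N (svec (- 1) r)" by (simp only: svec_neg_svec)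
      then have "s \<in> vclass N r'" by (rule vclass_trans[OF _ r'(2)])
      then show "s = r'" by (rule reps_unique[OF s r'(1)])
    next
      assume "s = r'"
      have "svec (- 1) r' \<in> vclass N (svec (- 1) (svec (- 1) r))" by (rule svec_vclass[OF vclass_symD[OF r'(2)]])
      then show "svec (- 1) s \<in> vclass N r" by (simp only: svec_neg_svec \<open>s = r'\<close>)
    qed
    finally show ?thesis .
  qed
  have "{s \<in> {r \<in> reps N. pt r \<in> C}. Gorbit ?P (pt s) = Gorbit ?P (pt r)} = {r, r'}"
    using fibre r r' r'C by auto
  moreover have "card {r, r'} = (if N \<ge> 3 then 2 else 1)"
  proof (cases "N \<ge> 3")
    case True
    then have "svec (- 1) r \<notin> vclass N r" using rp by (rule vclass_neg_large)
    then have "r \<noteq> r'" using r'(2) by blast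
    then show ?thesis using True by simp
  next
    case False
    then have "svec (- 1) r \<in> vclass N r" using N by (intro vclass_neg_small) auto
    then have "r \<in> vclass N r'" by (rule vclass_trans[OF vclass_symD r'(2)])
    then have "r = r'" by (rule reps_unique[OF r(1) r'(1)])
    then show ?thesis using False by simp
  qed
  ultimately show "card {s \<in> {r \<in> reps N. pt r \<in> C}. Gorbit ?P (pt s) = Gorbit ?P (pt r)} = (if N \<ge> 3 then 2 else 1)"
    by simp
qed

text \<open>The group generated by \<open>G\<close> and \<open>-1\<close>. Its orbit of \<open>base C\<close> consists of all vectors that
  represent points of the cusp.\<close>
definition Gpm :: "(int ^ 2 ^ 2) set" where
  "Gpm = {g \<in> carrier SL2Z. g \<in> G \<or> - g \<in> G}"

lemma act_neg: "act v (- g) = svec (- 1) (act v g)"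
  by (simp add: act_def svec_def)

lemma act_base_Gpm:
  assumes C: "C \<in> cusps G"
  shows "act (base C) ` Gpm = cusp_vecs C"
proof
  have neg: "- g \<in> carrier SL2Z" if "g \<in> carrier SL2Z" for g :: "int ^ 2 ^ 2" using that by (simp add: carrier_SL2Z)
  show "act (base C) ` Gpm \<subseteq> cusp_vecs C"
  proof
    fix w assume "w \<in> act (base C) ` Gpm"
    then obtain g where g: "g \<in> carrier SL2Z" "g \<in> G \<or> - g \<in> G" "w = act (base C) g" unfolding Gpm_def by blast
    have wp: "w \<in> prim" using g(1,3) base_prim[OF C] prim_act by simp
    have "svec (- 1) w = act (base C) (- g)" by (simp add: g(3) act_neg)
    then have "w \<in> orb G (base C) \<or> svec (- 1) w \<in> orb G (base C)" using g(2,3) unfolding orb_def by blast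
    then show "w \<in> cusp_vecs C" using pt_in_cusp[OF C wp] wp by (simp add: cusp_vecs_def)
  qed
  show "cusp_vecs C \<subseteq> act (base C) ` Gpm"
  proof
    fix w assume "w \<in> cusp_vecs C"
    then have w: "w \<in> prim" "pt w \<in> C" by (simp_all add: cusp_vecs_def)
    from pt_in_cusp[OF C w(1)] w(2) consider "w \<in> orb G (base C)" | "svec (- 1) w \<in> orb G (base C)" by blast
    then show "w \<in> act (base C) ` Gpm"
    proof cases
      case 1
      then obtain g where "g \<in> G" "w = act (base C) g" unfolding orb_def by blast
      then show ?thesis using GS unfolding Gpm_def by blast
    next
      case 2
      then obtain g where g: "g \<in> G" "svec (- 1) w = act (base C) g" unfolding orb_def by blast
      then have "w = act (base C) (- g)" by (metis act_neg svec_neg_svec)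
      moreover have "- g \<in> Gpm" unfolding Gpm_def using g(1) neg[OF GS[OF g(1)]] by simp
      ultimately show ?thesis by blast
    qed
  qed
qed

lemma Gpm_mult: "g \<in> Gpm \<Longrightarrow> h \<in> Gpm \<Longrightarrow> g ** h \<in> Gpm"
proof -
  have n1: "- g ** h = - (g ** h)" "g ** - h = - (g ** h)" "- g ** - h = g ** h"
    by (simp_all add: mat2_eq_iff mat2_mult_nth)
  assume "g \<in> Gpm" "h \<in> Gpm"
  then have gh: "g \<in> carrier SL2Z" "h \<in> carrier SL2Z" "g \<in> G \<or> - g \<in> G" "h \<in> G \<or> - h \<in> G" by (auto simp: Gpm_def)
  then have "g ** h \<in> G \<or> - (g ** h) \<in> G"
    using Gm[of g h] Gm[of "- g" h] Gm[of g "- h"] Gm[of "- g" "- h"] by (auto simp: n1)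
  then show "g ** h \<in> Gpm" using gh by (simp add: Gpm_def mult_closed_SL2Z)
qed

lemma Gpm_adj: "g \<in> Gpm \<Longrightarrow> adj2 g \<in> Gpm"
proof -
  assume g: "g \<in> Gpm"
  have "adj2 (- g) = - adj2 g" by (simp add: mat2_eq_iff)
  then show ?thesis using g Ga[of g] Ga[of "- g"] adj2_mult(3)[of g] by (auto simp: Gpm_def)
qed

lemma conj_T_Gpm: "C \<in> cusps G \<Longrightarrow> conj_T C 1 n \<in> Gpm \<longleftrightarrow> stab_shift C n"
  using conj_T_SL2Z[of C 1 n] conj_T_neg[of C 1 n] by (simp add: Gpm_def stab_shift_def)

lemma mcong_conj_T:
  assumes C: "C \<in> cusps G"
  shows "mcong N (conj_T C 1 m) (conj_T C 1 n) \<longleftrightarrow> int N dvd m - n"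
proof
  assume "mcong N (conj_T C 1 m) (conj_T C 1 n)"
  then have "mcong N (adj2 (\<sigma> C) ** conj_T C 1 m ** \<sigma> C) (adj2 (\<sigma> C) ** conj_T C 1 n ** \<sigma> C)"
    by (intro mcong_mult mcong_refl)
  moreover have "adj2 (\<sigma> C) ** conj_T C 1 m ** \<sigma> C = signed_T 1 m" for m
    by (simp add: conj_T_def adj_\<sigma>_cancel[OF C] adj_\<sigma>_\<sigma>[OF C] flip: matrix_mul_assoc)
  ultimately show "int N dvd m - n" by (simp add: mcong_def cong_iff_dvd_diff)
next
  assume "int N dvd m - n"
  then have "mcong N (signed_T 1 m) (signed_T 1 n)" by (simp add: mcong_def cong_iff_dvd_diff)
  then show "mcong N (conj_T C 1 m) (conj_T C 1 n)" unfolding conj_T_def by (intro mcong_mult mcong_refl)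
qed

text \<open>Orbit counting: the reductions modulo \<open>N\<close> of \<open>\<plusminus>G\<close> map onto the residue classes of vectors
  of the cusp by their action on \<open>base C\<close>. Two elements have the same image iff they differ,
  modulo \<open>\<Gamma>(N)\<close>, by a translation \<open>T ^ n\<close> (conjugated to the cusp) in \<open>\<plusminus>G\<close>, that is \<open>h dvd n\<close>;
  modulo \<open>N\<close> there are \<open>N / h\<close> of these. The left-hand side does not involve the cusp.\<close>
lemma card_Gpm_mod:
  assumes C: "C \<in> cusps G" and h: "h \<ge> 1" "\<And>n. stab_shift C n \<longleftrightarrow> int h dvd n"
  shows "card (redm N ` Gpm) = cusp_count C * (N div h)"
proof -
  let ?\<phi> = "\<lambda>A. red N (act (base C) A)"
  have "stab_shift C (int N)" using conj_T_N[OF C] by (simp add: stab_shift_def[OF C])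
  then have hN: "h dvd N" using h(2) by simp
  then have Nh: "int h * int (N div h) = int N" by (simp flip: of_nat_mult)
  have img: "?\<phi> ` redm N ` Gpm = red N ` cusp_vecs C"
    by (simp add: image_image red_act_redm flip: act_base_Gpm[OF C])
  have "card (redm N ` Gpm) = card (?\<phi> ` redm N ` Gpm) * (N div h)"
  proof (rule card_constant_fibres)
    show "finite (redm N ` Gpm)" by (rule finite_redm[OF N])
    fix A assume "A \<in> redm N ` Gpm"
    then obtain g0 where g0: "g0 \<in> Gpm" "A = redm N g0" by blast
    have g0S: "g0 \<in> carrier SL2Z" using g0(1) by (simp add: Gpm_def)
    let ?F = "\<lambda>i. redm N (conj_T C 1 (int h * i) ** g0)"
    have inj: "inj_on ?F {0..<int (N div h)}"
    proof (rule inj_onI)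
      fix i j assume ij: "i \<in> {0..<int (N div h)}" "j \<in> {0..<int (N div h)}" "?F i = ?F j"
      then have "mcong N (conj_T C 1 (int h * i) ** g0) (conj_T C 1 (int h * j) ** g0)" by (simp add: redm_eq_iff)
      then have "mcong N (conj_T C 1 (int h * i) ** g0 ** adj2 g0) (conj_T C 1 (int h * j) ** g0 ** adj2 g0)"
        by (rule mcong_mult[OF _ mcong_refl])
      then have "mcong N (conj_T C 1 (int h * i)) (conj_T C 1 (int h * j))"
        using adj2_mult[OF g0S] by (simp flip: matrix_mul_assoc)
      then have "int h * int (N div h) dvd int h * (i - j)"
        by (simp add: mcong_conj_T[OF C] Nh right_diff_distrib)
      then have d: "int (N div h) dvd i - j" using h(1) by simp
      show "i = j"
      proof (rule ccontr)
        assume "i \<noteq> j"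
        then have "\<bar>int (N div h)\<bar> \<le> \<bar>i - j\<bar>" using d by (intro dvd_imp_le_int) simp_all
        then show False using ij(1,2) by auto
      qed
    qed
    have fibre: "{B \<in> redm N ` Gpm. ?\<phi> B = ?\<phi> A} = ?F ` {0..<int (N div h)}"
    proof
      show "?F ` {0..<int (N div h)} \<subseteq> {B \<in> redm N ` Gpm. ?\<phi> B = ?\<phi> A}"
      proof
        fix B assume "B \<in> ?F ` {0..<int (N div h)}"
        then obtain i where B: "B = ?F i" by blast
        have "conj_T C 1 (int h * i) ** g0 \<in> Gpm"
          by (rule Gpm_mult[OF _ g0(1)]) (simp add: conj_T_Gpm[OF C] h(2))
        moreover have "?\<phi> B = ?\<phi> A"
          by (simp add: B g0(2) red_act_redm act_mult act_base_conj_T[OF C] svec_def)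
        ultimately show "B \<in> {B \<in> redm N ` Gpm. ?\<phi> B = ?\<phi> A}" using B by blast
      qed
      show "{B \<in> redm N ` Gpm. ?\<phi> B = ?\<phi> A} \<subseteq> ?F ` {0..<int (N div h)}"
      proof
        fix B assume "B \<in> {B \<in> redm N ` Gpm. ?\<phi> B = ?\<phi> A}"
        then obtain g where g: "g \<in> Gpm" "B = redm N g" "?\<phi> B = ?\<phi> A" by blast
        have gS: "g \<in> carrier SL2Z" using g(1) by (simp add: Gpm_def)
        have "red N (act (base C) g0) = red N (act (base C) g)"
          using g(2,3) g0(2) by (simp add: red_act_redm)
        then have c: "act (base C) g0 \<in> vclass N (act (base C) g)" by (simp only: red_eq_iff)
        \<comment> \<open>Correcting \<open>g\<close> by an element of \<open>\<Gamma>(N)\<close> turns the congruence of the two vectors into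
          an equality.\<close>
        obtain p where p: "p \<in> principal_congruence_subgroup N" "act (act (base C) g) p = act (base C) g0"
          by (rule principal_transitive[OF _ _ c]) (use base_prim[OF C] prim_act[OF gS] prim_act[OF g0S] in simp_all)
        have pS: "p \<in> carrier SL2Z" "mcong N p (mat 1)" using p(1) by (simp_all add: principal_iff_mcong)
        have pG: "p \<in> Gpm" using p(1) principal pS(1) by (auto simp: Gpm_def)
        let ?x = "g ** p ** adj2 g0"
        have xG: "?x \<in> Gpm" by (intro Gpm_mult Gpm_adj g(1) pG g0(1))
        have xS: "?x \<in> carrier SL2Z" using xG by (simp add: Gpm_def)
        have st: "act (base C) ?x = svec 1 (base C)"
          by (simp add: act_mult p(2) act_adj2(1)[OF g0S] svec_def)
        obtain n where n: "?x = conj_T C 1 n" by (rule conj_T_of_stab[OF C xS _ st]) simp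
        have hn: "int h dvd n" using xG conj_T_Gpm[OF C, of n] h(2) n by simp
        then obtain j where j: "n = int h * j" by (auto simp: dvd_def)
        have "mcong N (g ** mat 1) (g ** p)" by (rule mcong_mult[OF mcong_refl mcong_sym[OF pS(2)]])
        also have "g ** p = ?x ** g0" using adj2_mult[OF g0S] by (simp flip: matrix_mul_assoc)
        finally have m1: "mcong N g (conj_T C 1 n ** g0)" by (simp add: n)
        define i where "i = j mod int (N div h)"
        have "int h * (j - i) = int h * (int (N div h) * (j div int (N div h)))"
          by (simp add: i_def minus_mod_eq_mult_div)
        also have "\<dots> = int N * (j div int (N div h))" by (simp add: mult.assoc flip: Nh)
        finally have "int N dvd int h * j - int h * i" by (simp add: right_diff_distrib)
        then have "mcong N (conj_T C 1 n ** g0) (conj_T C 1 (int h * i) ** g0)"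
          by (intro mcong_mult mcong_refl) (simp add: mcong_conj_T[OF C] j)
        then have "B = ?F i" using mcong_trans[OF m1] by (simp add: g(2) redm_eq_iff)
        moreover have "N div h > 0" 
        proof (rule Nat.gr0I)
          assume "N div h = 0"
          then have "int N = 0" unfolding Nh[symmetric] by (simp only: of_nat_0 mult_zero_right)
          then show False using N by simp
        qed
        then have "i \<in> {0..<int (N div h)}" by (simp add: i_def)
        ultimately show "B \<in> ?F ` {0..<int (N div h)}" by blast
      qed
    qed
    show "card {B \<in> redm N ` Gpm. ?\<phi> B = ?\<phi> A} = N div h"
      unfolding fibre card_image[OF inj] by simp
  qed
  then show ?thesis by (simp add: img cusp_count_eq[OF C])
qed

lemma cusp_count_pos:
  assumes C: "C \<in> cusps G"
  shows "cusp_count C > 0"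
proof -
  have "base C \<in> cusp_vecs C" using base_prim[OF C] pt_base[OF C] rep[OF C] by (simp add: cusp_vecs_def)
  then show ?thesis unfolding cusp_count_eq[OF C] using finite_red_prim[OF N] card_gt_0_iff by blast
qed

text \<open>By \<open>card_Gpm_mod\<close> the quotient of \<open>cusp_count\<close> by the amplitude \<open>h\<close> does not depend on the
  cusp.\<close>
lemma cusp_count_dvd:
  assumes C0: "C0 \<in> cusps G" and C: "C \<in> cusps G" and d: "amp (rep C0) G dvd amp (rep C) G"
  shows "cusp_count C0 dvd cusp_count C"
proof -
  obtain h0 where h0: "h0 \<ge> 1" "\<And>n. stab_shift C0 n \<longleftrightarrow> int h0 dvd n" using width_exists[OF C0] by metis
  obtain h where h: "h \<ge> 1" "\<And>n. stab_shift C n \<longleftrightarrow> int h dvd n" using width_exists[OF C] by metis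
  have "h0 dvd h" using d amp_eq_width[OF C0 h0] amp_eq_width[OF C h] by simp
  then obtain q where q: "h = h0 * q" by (auto simp: dvd_def)
  have "stab_shift C (int N)" using conj_T_N[OF C] by (simp add: stab_shift_def[OF C])
  then have "h dvd N" using h(2) by simp
  then obtain m where m: "N = h * m" by (auto simp: dvd_def)
  have "N div h = m" "N div h0 = q * m" using h(1) h0(1) by (simp_all add: m q)
  then have "cusp_count C0 * q * m = cusp_count C * m"
    using card_Gpm_mod[OF C0 h0] card_Gpm_mod[OF C h] by (simp only: mult.assoc)
  moreover have "m > 0" using N m by (cases m) auto
  ultimately have "cusp_count C = cusp_count C0 * q" by simp
  then show ?thesis by simp
qed

lemma or_set_ratio:
  assumes C0: "C0 \<in> cusps G" and C: "C \<in> cusps G" and d: "amp (rep C0) G dvd amp (rep C) G"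
  obtains q :: nat where "cusp_count C = q * cusp_count C0"
    "(of_nat (card (or_set G N (rep C))) / of_nat (card (or_set G N (rep C0))) :: complex) = of_nat q"
proof -
  obtain q where q: "cusp_count C = q * cusp_count C0"
    using cusp_count_dvd[OF assms] by (auto simp: dvd_def mult.commute)
  have "card (or_set G N (rep C)) = q * card (or_set G N (rep C0))"
    using q cusp_count_or_set[OF C] cusp_count_or_set[OF C0] by (auto split: if_splits)
  moreover have "card (or_set G N (rep C0)) > 0"
    using cusp_count_pos[OF C0] cusp_count_or_set[OF C0] by (auto intro: Nat.gr0I)
  ultimately have "(of_nat (card (or_set G N (rep C))) / of_nat (card (or_set G N (rep C0))) :: complex) = of_nat q"
    by simp
  then show ?thesis using that q by blast
qed

end

section \<open>The basis\<close>

lemma admissible_sum: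
  assumes R: "subring R (ring_of_type_algebra :: complex ring)" and c: "\<And>i. i \<in> J \<Longrightarrow> c i \<in> R"
    and a: "\<And>i. i \<in> J \<Longrightarrow> admissible k N G R (\<beta> i)"
  shows "admissible k N G R (\<lambda>v. \<Sum>i\<in>J. c i * \<beta> i v)"
proof -
  have a': "periodic N (\<beta> i)" "parity k (\<beta> i)" "\<And>v. v \<in> prim \<Longrightarrow> \<beta> i v \<in> R"
    "\<And>g v. g \<in> G \<Longrightarrow> v \<in> prim \<Longrightarrow> \<beta> i (act v g) = \<beta> i v" "k = 2 \<Longrightarrow> (\<Sum>r\<in>reps N. \<beta> i r) = 0" if "i \<in> J" for i
    using a[OF that] by (auto simp: admissible_def)
  show ?thesis
    unfolding admissible_def
  proof (intro conjI ballI impI)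
    show "periodic N (\<lambda>v. \<Sum>i\<in>J. c i * \<beta> i v)"
      by (intro periodic_sum periodic_cmult a'(1))
    show "parity k (\<lambda>v. \<Sum>i\<in>J. c i * \<beta> i v)"
      unfolding parity_def sum_distrib_left
      using a'(2) by (intro ballI sum.cong) (auto simp: parity_def)
    show "(\<Sum>i\<in>J. c i * \<beta> i v) \<in> R" if "v \<in> prim" for v
      using that c a'(3) by (intro subring_complex_sum[OF R] subring_complex_closed(4)[OF R])
    show "(\<Sum>i\<in>J. c i * \<beta> i (act v g)) = (\<Sum>i\<in>J. c i * \<beta> i v)" if "g \<in> G" "v \<in> prim" for g v
      using that a'(4) by (intro sum.cong) auto
    show "(\<Sum>r\<in>reps N. \<Sum>i\<in>J. c i * \<beta> i r) = 0" if k2: "k = 2"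
    proof -
      have "(\<Sum>r\<in>reps N. \<Sum>i\<in>J. c i * \<beta> i r) = (\<Sum>i\<in>J. c i * (\<Sum>r\<in>reps N. \<beta> i r))"
        by (subst sum.swap) (simp add: sum_distrib_left)
      also have "\<dots> = 0" using a'(5)[OF _ k2] by (intro sum.neutral) auto
      finally show ?thesis .
    qed
  qed
qed

text \<open>If the boundary functions \<open>\<beta>\<close> are dual to the evaluations at the vectors \<open>u\<close> and every
  admissible function is the combination of them given by its values at the \<open>u\<close>, then the
  coefficients are determined by these values and lie in \<open>R\<close> exactly if the function is
  \<open>R\<close>-valued.\<close>
lemma basis_over_dual:
  assumes k: "k \<ge> 2" and N: "N \<ge> 1" and R: "subring R (ring_of_type_algebra :: complex ring)" and G: "subgroup G SL2Z"
    and fin: "finite I" and adm: "\<And>C. C \<in> I \<Longrightarrow> admissible k N G R (\<beta> C)"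
    and u: "\<And>C. C \<in> I \<Longrightarrow> u C \<in> prim"
    and dual: "\<And>C D. C \<in> I \<Longrightarrow> D \<in> I \<Longrightarrow> \<beta> C (u D) = (if C = D then 1 else 0)"
    and expand: "\<And>b v. admissible k N G R b \<Longrightarrow> v \<in> prim \<Longrightarrow> b v = (\<Sum>C\<in>I. b (u C) * \<beta> C v)"
    and B: "\<And>C. C \<in> I \<Longrightarrow> B C = bdry_eis k (\<beta> C)"
  shows "basis_over R I B (Eis k N G R)"
proof -
  have comb: "(\<lambda>\<tau>. \<Sum>i\<in>J. c i * B i \<tau>) = bdry_eis k (\<lambda>v. \<Sum>i\<in>J. c i * \<beta> i v)"
    if J: "J \<subseteq> I" for J and c :: "_ \<Rightarrow> complex"
  proof
    fix \<tau>
    have "bdry_eis k (\<lambda>v. \<Sum>i\<in>J. c i * \<beta> i v) \<tau> = (\<Sum>i\<in>J. c i * bdry_eis k (\<beta> i) \<tau>)"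
      by (rule bdry_eis_sum[OF k N]) (use adm J in \<open>auto simp: admissible_def\<close>)
    then show "(\<Sum>i\<in>J. c i * B i \<tau>) = bdry_eis k (\<lambda>v. \<Sum>i\<in>J. c i * \<beta> i v) \<tau>"
      using B J by (auto intro!: sum.cong)
  qed
  have comb_adm: "admissible k N G R (\<lambda>v. \<Sum>i\<in>J. c i * \<beta> i v)" if "J \<subseteq> I" "\<And>i. i \<in> J \<Longrightarrow> c i \<in> R" for J c
    using that adm by (intro admissible_sum[OF R]) auto
  show ?thesis
    unfolding basis_over_def
  proof
    show "independent_over R I B"
      unfolding independent_over_def
    proof (intro allI impI ballI)
      fix J c i
      assume J: "finite J \<and> J \<subseteq> I \<and> (\<forall>i\<in>J. c i \<in> R) \<and> (\<lambda>\<tau>. \<Sum>i\<in>J. c i * B i \<tau>) = (\<lambda>\<tau>. 0)" and i: "i \<in> J"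
      let ?b = "\<lambda>v. \<Sum>i\<in>J. c i * \<beta> i v"
      have adm_b: "admissible k N G R ?b" by (rule comb_adm) (use J in auto)
      have b: "periodic N ?b" "parity k ?b" using adm_b by (simp_all only: admissible_def)
      have ui: "u i \<in> prim" using u J i by blast
      have zero: "bdry_eis k ?b = (\<lambda>\<tau>. 0)" using comb[of J c] J by simp
      have "?b (u i) = 0" by (rule bdry_eis_zero_imp[OF k N b _ ui]) (simp only: zero)
      moreover have "?b (u i) = (\<Sum>j\<in>J. if j = i then c j else 0)"
      proof (rule sum.cong[OF refl])
        fix j assume "j \<in> J"
        then have "\<beta> j (u i) = (if j = i then 1 else 0)" using J i by (intro dual) blast+
        then show "c j * \<beta> j (u i) = (if j = i then c j else 0)" by simp
      qed
      ultimately show "c i = 0" using J i by simp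
    qed
    show "span_over R I B = Eis k N G R"
    proof
      show "span_over R I B \<subseteq> Eis k N G R"
      proof
        fix f assume "f \<in> span_over R I B"
        then obtain J c where J: "J \<subseteq> I" "\<forall>i\<in>J. c i \<in> R" and f: "f = (\<lambda>\<tau>. \<Sum>i\<in>J. c i * B i \<tau>)"
          unfolding span_over_def by blast
        show "f \<in> Eis k N G R"
          unfolding f comb[OF J(1)] using J by (intro admissible_imp_Eis[OF k N R G] comb_adm) auto
      qed
      show "Eis k N G R \<subseteq> span_over R I B"
      proof
        fix f assume "f \<in> Eis k N G R"
        then obtain b where b: "admissible k N G R b" "f = bdry_eis k b"
          by (rule Eis_imp_admissible[OF k N R subgroup.subset[OF G]])
        have "f = bdry_eis k (\<lambda>v. \<Sum>C\<in>I. b (u C) * \<beta> C v)"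
          unfolding b(2) by (rule bdry_eis_cong) (rule expand[OF b(1)])
        then have "f = (\<lambda>\<tau>. \<Sum>C\<in>I. b (u C) * B C \<tau>)" by (simp only: comb[OF order_refl])
        moreover have "\<forall>C\<in>I. b (u C) \<in> R" using b(1) u by (auto simp: admissible_def)
        ultimately show "f \<in> span_over R I B"
          unfolding span_over_def mem_Collect_eq using fin
          by (intro exI[of _ I] exI[of _ "\<lambda>C. b (u C)"] conjI order_refl)
      qed
    qed
  qed
qed

context cusp_setup
begin

lemma cusp_unique: "C \<in> cusps G \<Longrightarrow> D \<in> cusps G \<Longrightarrow> x \<in> C \<Longrightarrow> x \<in> D \<Longrightarrow> C = D"
  using cusp_eq_Gorbit[OF G] by metis

lemma finite_cusps: "finite (cusps G)"
proof -
  have "inj_on (\<lambda>C. red N (base C)) (cusps G)"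
  proof (rule inj_onI)
    fix C D assume C: "C \<in> cusps G" and D: "D \<in> cusps G" and eq: "red N (base C) = red N (base D)"
    have c: "base C \<in> vclass N (base D)" using eq by (simp only: red_eq_iff)
    have "pt (base D) \<in> D" using pt_base[OF D] rep[OF D] by simp
    then have "pt (base C) \<in> D" by (rule cusp_periodic[OF D base_prim[OF C] base_prim[OF D] c])
    then have "rep C \<in> D" using pt_base[OF C] by simp
    then show "C = D" by (rule cusp_unique[OF C D rep[OF C]])
  qed
  moreover have "finite (red N ` base ` cusps G)" by (rule finite_red_prim[OF N])
  then have "finite ((\<lambda>C. red N (base C)) ` cusps G)" by (simp only: image_image)
  ultimately show ?thesis by (rule finite_imageD[rotated])
qed

lemma beta_zero: "C \<in> cusps G \<Longrightarrow> v \<in> prim \<Longrightarrow> pt v \<notin> C \<Longrightarrow> beta k C v = 0"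
  using pt_in_cusp by (simp add: beta_def)

lemma invariant_on_orb:
  assumes b: "admissible k N G R b" and C: "C \<in> cusps G" and w: "w \<in> orb G (base C)"
  shows "b w = b (base C)"
proof -
  obtain g where "g \<in> G" "w = act (base C) g" using w unfolding orb_def by blast
  then show ?thesis using b base_prim[OF C] by (simp add: admissible_def)
qed

text \<open>Each primitive vector lies in exactly one cusp, and there \<open>b\<close> is determined by invariance
  and parity. For odd \<open>k\<close> and a cusp that is not separated both sides vanish, by
  \<open>boundary_value_zero\<close>.\<close>
lemma expand_all:
  assumes b: "admissible k N G R b" and v: "v \<in> prim"
  shows "b v = (\<Sum>C\<in>cusps G. b (base C) * beta k C v)"
proof -
  define C where "C = Gorbit G (pt v)"
  have C: "C \<in> cusps G" unfolding C_def cusps_iff[OF G] by blast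
  have vC: "pt v \<in> C" unfolding C_def by (rule Gorbit_refl[OF G])
  have zero: "b (base D) * beta k D v = 0" if "D \<in> cusps G - {C}" for D
    using beta_zero[of D v] cusp_unique[OF C, of D "pt v"] vC v that by auto
  have "b v = b (base C) * beta k C v"
  proof (cases "v \<in> orb G (base C)")
    case True
    then show ?thesis using invariant_on_orb[OF b C] by (simp add: beta_def)
  next
    case False
    then have nv: "svec (- 1) v \<in> orb G (base C)" using pt_in_cusp[OF C v] vC by simp
    have "b (svec (- 1) v) = (- 1) ^ k * b v" using b v by (simp add: admissible_def parity_def)
    then have "b (base C) = (- 1) ^ k * b v" using invariant_on_orb[OF b C nv] by simp
    then show ?thesis using False nv by (simp add: beta_def flip: power_mult_distrib)
  qed
  also have "\<dots> = (\<Sum>C\<in>cusps G. b (base C) * beta k C v)"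
    unfolding sum.remove[OF finite_cusps C] using zero by (simp add: sum.neutral)
  finally show ?thesis .
qed

text \<open>The orbit contains a vector \<open>w\<close> together with \<open>-w\<close>; invariance makes the values equal and
  parity makes them opposite.\<close>
lemma boundary_value_zero:
  assumes b: "admissible k N G R b" and C: "C \<in> cusps G" and ns: "odd k" "\<not> separated C"
  shows "b (base C) = 0"
proof -
  obtain w where w: "w \<in> orb G (base C)" "svec (- 1) w \<in> orb G (base C)" using ns(2) unfolding separated_def by blast
  have wp: "w \<in> prim" by (rule orb_prim[OF G base_prim[OF C] w(1)])
  have "b (svec (- 1) w) = (- 1) ^ k * b w" using b wp by (simp add: admissible_def parity_def)
  then show ?thesis using invariant_on_orb[OF b C w(1)] invariant_on_orb[OF b C w(2)] ns(1) by simp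
qed

lemma beta_in_R: "subring R (ring_of_type_algebra :: complex ring) \<Longrightarrow> beta k C v \<in> R"
  unfolding beta_def using subring_complex_closed(1,2) subring_complex_power_neg by auto

lemma spectral_basis:
  assumes k: "k \<ge> 3" and R: "subring R (ring_of_type_algebra :: complex ring)"
    and B: "\<And>C. B C = spectral_eisenstein G k (rep C) (\<sigma> C)"
  shows "basis_over R {C \<in> cusps G. even k \<or> separated C} B (Eis k N G R)"
proof (rule basis_over_dual[OF _ N R G, where \<beta> = "beta k" and u = base])
  let ?I = "{C \<in> cusps G. even k \<or> separated C}"
  show "k \<ge> 2" using k by simp
  show "finite ?I" using finite_cusps by simp
  fix C assume C: "C \<in> ?I"
  then show "admissible k N G R (beta k C)"
    unfolding admissible_def using k
    by (intro conjI ballI impI beta_periodic beta_parity beta_in_R[OF R] beta_invariant) simp_all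
  show "base C \<in> prim" using C base_prim by blast
  show "B C = bdry_eis k (beta k C)"
    unfolding B by (rule spectral_eisenstein_eq) (use C k in auto)
  fix D assume "D \<in> ?I"
  then show "beta k C (base D) = (if C = D then 1 else 0)" using C beta_base by simp
next
  fix b v assume b: "admissible k N G R b" and v: "v \<in> prim"
  have "b v = (\<Sum>C\<in>cusps G. b (base C) * beta k C v)" by (rule expand_all[OF b v])
  also have "\<dots> = (\<Sum>C\<in>{C \<in> cusps G. even k \<or> separated C}. b (base C) * beta k C v)"
    using boundary_value_zero[OF b] finite_cusps by (intro sum.mono_neutral_right) auto
  finally show "b v = (\<Sum>C\<in>{C \<in> cusps G. even k \<or> separated C}. b (base C) * beta k C v)" .
qed

text \<open>Since \<open>\<rho> C\<close> is the ratio of the sums of \<open>beta 2\<close> over the residue classes, the combination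
  \<open>\<beta> C\<close> has sum 0. Conversely the vanishing of the sum of \<open>b\<close> determines the value of \<open>b\<close> at the
  cusp \<open>C0\<close> from the others.\<close>
lemma weight_2_basis:
  assumes R: "subring R (ring_of_type_algebra :: complex ring)" and C0: "C0 \<in> cusps G"
    and d: "\<And>C. C \<in> cusps G \<Longrightarrow> amp (rep C0) G dvd amp (rep C) G"
    and B: "\<And>C \<tau>. B C \<tau> = spectral_eisenstein G 2 (rep C) (\<sigma> C) \<tau>
       - of_nat (card (or_set G N (rep C))) / of_nat (card (or_set G N (rep C0))) * spectral_eisenstein G 2 (rep C0) (\<sigma> C0) \<tau>"
  shows "basis_over R (cusps G - {C0}) B (Eis 2 N G R)"
proof -
  define \<rho> :: "P1Q set \<Rightarrow> complex" where
    "\<rho> C = of_nat (card (or_set G N (rep C))) / of_nat (card (or_set G N (rep C0)))" for C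
  have \<rho>: "\<rho> C \<in> R \<and> of_nat (cusp_count C) = \<rho> C * of_nat (cusp_count C0)" if C: "C \<in> cusps G" for C
  proof -
    obtain q where q: "cusp_count C = q * cusp_count C0" "\<rho> C = of_nat q"
      unfolding \<rho>_def by (rule or_set_ratio[OF C0 C d[OF C]])
    have "of_nat n \<in> R" for n
      by (induction n) (use subring_complex_closed(1,2,3)[OF R] in auto)
    then show ?thesis using q by simp
  qed
  define \<beta> where "\<beta> C v = beta 2 C v - \<rho> C * beta 2 C0 v" for C v
  have per: "periodic N (\<lambda>v. \<rho> C * beta 2 C0 v)" for C by (rule periodic_cmult[OF beta_periodic[OF C0]])
  show ?thesis
  proof (rule basis_over_dual[OF _ N R G, where \<beta> = \<beta> and u = base])
    show "finite (cusps G - {C0})" using finite_cusps by simp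
    fix C assume C': "C \<in> cusps G - {C0}"
    then have C: "C \<in> cusps G" by simp
    show "base C \<in> prim" by (rule base_prim[OF C])
    show "admissible 2 N G R (\<beta> C)"
      unfolding admissible_def
    proof (intro conjI ballI impI)
      have *: "beta 2 C v = beta 2 C w \<and> beta 2 C0 v = beta 2 C0 w" if "v \<in> prim" "w \<in> prim" "v \<in> vclass N w" for v w
        using periodicD[OF beta_periodic[OF C] that] periodicD[OF beta_periodic[OF C0] that] by blast
      show "periodic N (\<beta> C)"
        unfolding periodic_def
      proof (intro ballI impI)
        fix v w assume "v \<in> prim" "w \<in> prim" "v \<in> vclass N w"
        from *[OF this] show "\<beta> C v = \<beta> C w" by (simp only: \<beta>_def)
      qed
      show "parity 2 (\<beta> C)"
        using beta_parity[of 2 C] beta_parity[of 2 C0] unfolding parity_def \<beta>_def by simp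
      show "(\<Sum>r\<in>reps N. \<beta> C r) = 0"
        unfolding \<beta>_def sum_subtractf using \<rho>[OF C]
        by (simp add: sum_reps_beta[OF C] sum_reps_beta[OF C0] flip: sum_distrib_left)
    next
      fix v
      have "beta 2 C v + - (\<rho> C * beta 2 C0 v) \<in> R"
        using \<rho>[OF C] by (intro subring_complex_closed(3,4,5)[OF R] beta_in_R[OF R]) simp
      then show "\<beta> C v \<in> R" by (simp add: \<beta>_def)
    next
      fix g v assume "g \<in> G"
      then show "\<beta> C (act v g) = \<beta> C v" by (simp add: \<beta>_def beta_invariant)
    qed
    show "B C = bdry_eis 2 (\<beta> C)"
    proof
      fix \<tau>
      have "bdry_eis 2 (\<beta> C) \<tau> = bdry_eis 2 (beta 2 C) \<tau> - bdry_eis 2 (\<lambda>v. \<rho> C * beta 2 C0 v) \<tau>"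
        unfolding \<beta>_def by (rule bdry_eis_diff[OF _ N beta_periodic[OF C] per]) simp
      also have "bdry_eis 2 (\<lambda>v. \<rho> C * beta 2 C0 v) \<tau> = \<rho> C * bdry_eis 2 (beta 2 C0) \<tau>"
        using bdry_eis_sum[of 2 N "{C0}" "beta 2" "\<lambda>_. \<rho> C" \<tau>] N beta_periodic[OF C0] by simp
      finally show "B C \<tau> = bdry_eis 2 (\<beta> C) \<tau>"
        by (simp add: B \<rho>_def spectral_eisenstein_eq[of 2, OF _ C] spectral_eisenstein_eq[of 2, OF _ C0])
    qed
    fix D assume D: "D \<in> cusps G - {C0}"
    then show "\<beta> C (base D) = (if C = D then 1 else 0)"
      using beta_base[OF C, of D 2] beta_base[OF C0, of D 2] by (auto simp: \<beta>_def)
  next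
    fix b v assume b: "admissible 2 N G R b" and v: "v \<in> prim"
    let ?S = "\<Sum>C\<in>cusps G - {C0}. b (base C) * \<rho> C"
    have "0 = (\<Sum>r\<in>reps N. b r)" using b by (simp add: admissible_def)
    also have "\<dots> = (\<Sum>r\<in>reps N. \<Sum>C\<in>cusps G. b (base C) * beta 2 C r)"
      using reps_prim by (intro sum.cong refl expand_all[OF b]) blast
    also have "\<dots> = (\<Sum>C\<in>cusps G. b (base C) * (\<Sum>r\<in>reps N. beta 2 C r))"
      by (subst sum.swap) (simp add: sum_distrib_left)
    also have "\<dots> = (\<Sum>C\<in>cusps G. b (base C) * (\<rho> C * of_nat (cusp_count C0)))"
      using \<rho> by (intro sum.cong) (auto simp: sum_reps_beta)
    also have "\<dots> = (\<Sum>C\<in>cusps G. b (base C) * \<rho> C) * of_nat (cusp_count C0)"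
      by (simp add: sum_distrib_right mult.assoc)
    finally have "(\<Sum>C\<in>cusps G. b (base C) * \<rho> C) = 0" using cusp_count_pos[OF C0] by simp
    moreover have "\<rho> C0 = 1" using \<rho>[OF C0] cusp_count_pos[OF C0] by simp
    ultimately have S: "b (base C0) = - ?S"
      unfolding sum.remove[OF finite_cusps C0] by (simp add: add_eq_0_iff2)
    have "b v = b (base C0) * beta 2 C0 v + (\<Sum>C\<in>cusps G - {C0}. b (base C) * beta 2 C v)"
      using expand_all[OF b v] unfolding sum.remove[OF finite_cusps C0] .
    also have "\<dots> = (\<Sum>C\<in>cusps G - {C0}. b (base C) * \<beta> C v)"
      unfolding S \<beta>_def by (simp add: algebra_simps sum_subtractf sum_distrib_left sum_distrib_right)
    finally show "b v = (\<Sum>C\<in>cusps G - {C0}. b (base C) * \<beta> C v)" .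
  qed simp
qed

end

theorem theorem4p5:
  fixes k N :: nat
    and \<G> :: "(int ^ 2 ^ 2) set"
    and R :: "complex set"
    and rep :: "P1Q set \<Rightarrow> P1Q"
    and \<sigma> :: "P1Q set \<Rightarrow> int ^ 2 ^ 2"
    and C0 :: "P1Q set"
  assumes "k \<ge> 2" and "N \<ge> 1"
    and "congruence_subgroup \<G>" and "principal_congruence_subgroup N \<subseteq> \<G>"
    and "subring R (ring_of_type_algebra :: complex ring)"
    and "\<And>C. C \<in> cusps \<G> \<Longrightarrow> rep C \<in> C"
    and "\<And>C. C \<in> cusps \<G> \<Longrightarrow> \<sigma> C \<in> carrier SL2Z \<and> moebius_P1Q (\<sigma> C) Infty = rep C"
    and "C0 \<in> cusps \<G>"
    and "\<And>C. C \<in> cusps \<G> \<Longrightarrow> amp (rep C0) \<G> dvd amp (rep C) \<G>"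
  shows "basis_over R (B_index \<G> k rep C0) (B_family \<G> N k rep \<sigma> C0) (Eis k N \<G> R)"
proof -
  have G: "subgroup \<G> SL2Z" using assms(3) by (simp add: congruence_subgroup_def)
  interpret cusp_setup N \<G> rep \<sigma>
    by (rule cusp_setup.intro[OF assms(2) G assms(4,6)]) (use assms(7) in blast)+
  show ?thesis
  proof (cases "k = 2")
    case True
    have "basis_over R (cusps \<G> - {C0}) (B_family \<G> N k rep \<sigma> C0) (Eis 2 N \<G> R)"
      by (rule weight_2_basis[OF assms(5,8,9)]) (simp_all add: B_family_def True)
    then show ?thesis by (simp add: B_index_def True)
  next
    case False
    then have k: "k \<ge> 3" using assms(1) by simp
    have basis: "basis_over R {C \<in> cusps \<G>. even k \<or> separated C} (B_family \<G> N k rep \<sigma> C0) (Eis k N \<G> R)"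
      by (rule spectral_basis[OF k assms(5)]) (simp add: B_family_def False)
    have "B_index \<G> k rep C0 = {C \<in> cusps \<G>. even k \<or> separated C}"
    proof (cases "even k")
      case True
      then have "k \<ge> 4" using k by (cases "k = 3") auto
      then show ?thesis using True by (simp add: B_index_def)
    next
      case odd: False
      show ?thesis
      proof (cases "- mat 1 \<in> \<G>")
        case True
        have "\<not> separated C" if "C \<in> cusps \<G>" for C
        proof -
          have "act (base C) (- mat 1) \<in> orb \<G> (base C)" by (rule orb_act[OF G orb_refl[OF G] True])
          then have "svec (- 1) (base C) \<in> orb \<G> (base C)" by (simp add: act_neg)
          then show ?thesis using orb_refl[OF G] unfolding separated_def by blast
        qed
        then show ?thesis using True odd False by (auto simp: B_index_def)
      next
        case False
        then show ?thesis using odd irregular_iff_not_separated by (auto simp: B_index_def)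
      qed
    qed
    then show ?thesis using basis by simp
  qed
qed

end
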